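(* Let $\mathcal G$ and $\mathcal H$ be groupoids, let $\mathcal R\subseteq\mathcal G^0$ be open and $\mathcal G$-invariant, and let $\mathcal X\colon\mathcal G\leftarrow\mathcal G$ be a groupoid correspondence that is regular on $\mathcal R$. Let $\mathcal M$ be the groupoid model of $(\mathcal G,\mathcal X,\mathcal R)$. An actor $\mathcal M\to\mathcal H$ is equivalent to a map $\vartheta\colon\mathcal B(\mathcal G)\sqcup\mathcal B(\mathcal X)\to\mathcal B(\mathcal H)$, $W\mapsto\vartheta_W$, such that (1) $\vartheta_V\vartheta_W=\vartheta_{VW}$ if $V$ and $W$ are bisections in $\mathcal G$ or $\mathcal X$ and at most one of them is a bisection in $\mathcal X$; (2) $\vartheta_V^*\vartheta_W=\vartheta_{\langle V\mid W\rangle}$ if $V$ and $W$ are bisections in $\mathcal X$; (3) $\vartheta_{\mathcal G^0}=\mathcal H^0$; (4) the restriction of $\vartheta$ to open subsets of $\mathcal G^0$ commutes with arbitrary unions; (5) the union of the open sets $r(\vartheta_{\mathcal U})\subseteq\mathcal H^0$ for $\mathcal U\in\mathcal B(\mathcal X)$ contains $r(\vartheta_{\mathcal R})$; (6) if $\mathcal U\in\mathcal B(\mathcal X)$ is precompact in $\mathcal X$, then the closure of $r(\vartheta_{\mathcal U})$ in $\mathcal H^0$ is contained in the union of the sets $r(\vartheta_W)$ for $W\in\mathcal B(\mathcal X)$. The actor is proper if and only if the associated anchor map $\varrho\colon\mathcal H^0\to\mathcal G^0$ is a proper map. In that case, condition (6) is redundant.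
   Context: Groupoids are étale and locally compact with Hausdorff object space (the arrow space may be non-Hausdorff). $\mathcal H^0$ is the object space, $r,s$ are range and source. Anchor maps of left actions are denoted $r$, of right actions $s$; products $x\cdot y$ are defined if $s(x)=r(y)$. Groupoid correspondence $\mathcal X\colon\mathcal G\leftarrow\mathcal G$: a topological space $\mathcal X$ with commuting actions of $\mathcal G$ on the left and on the right such that the right action is free and proper and the right anchor map $s\colon\mathcal X\to\mathcal G^0$ is a local homeomorphism. The left anchor map induces $r_*\colon\mathcal X/\mathcal G\to\mathcal G^0$ on the orbit space of the right action; $[x]$ is the class of $x$. It is regular on $\mathcal R$ if $r_*^{-1}(\mathcal R)\to\mathcal R$ is proper and surjective. Bisections: a bisection of a groupoid is an open subset on which $r$ and $s$ are injective; a bisection of $\mathcal X$ is an open subset on which $s\colon\mathcal X\to\mathcal G^0$ and the orbit map $\mathcal X\to\mathcal X/\mathcal G$ are injective. $\mathcal B(\cdot)$ denotes the set of bisections. $VW=\{v\cdot w: v\in V,\ w\in W,\ s(v)=r(w)\}$; for bisections of $\mathcal H$, $V^*=V^{-1}$; for $V,W\in\mathcal B(\mathcal X)$, $\langle V\mid W\rangle=\{g\in\mathcal G:\ w=v\cdot g\text{ for some }v\in V,\ w\in W\}\in\mathcal B(\mathcal G)$. Arbitrary unions in (4) include the empty union, so $\vartheta_\emptyset=\emptyset$. Action of $(\mathcal G,\mathcal X,\mathcal R)$ on a topological space $Y$: a groupoid action of $\mathcal G$ on $Y$ (anchor map $r\colon Y\to\mathcal G^0$) and a continuous open map $\mathcal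 X\times_{s,\mathcal G^0,r}Y\to Y$, $(x,y)\mapsto x\cdot y$, such that (i) $r(x\cdot y)=r(x)$ and $g\cdot(x\cdot y)=(g\cdot x)\cdot y$ whenever $s(g)=r(x)$, $s(x)=r(y)$; (ii) if $s(x)=r(y)$, $s(x')=r(y')$, then $x\cdot y=x'\cdot y'$ if and only if there is $g\in\mathcal G$ with $x'=x\cdot g$ and $y=g\cdot y'$; (iii) $r^{-1}(\mathcal R)\subseteq Y$ is contained in $\mathcal X\cdot Y:=\{x\cdot y\}$; (iv) if $K\subseteq\mathcal X/\mathcal G$ is compact, then the set of all $x\cdot y$ with $[x]\in K$, $s(x)=r(y)$ is closed in $Y$. A continuous map $\varphi\colon Y_1\to Y_2$ is $(\mathcal G,\mathcal X)$-equivariant if it is $\mathcal G$-equivariant, $\varphi(x\cdot y)=x\cdot\varphi(y)$ whenever $s(x)=r(y)$, and $\varphi^{-1}(\mathcal X\cdot Y_2)=\mathcal X\cdot Y_1$. Groupoid model of $(\mathcal G,\mathcal X,\mathcal R)$: an étale groupoid $\mathcal M$ with, for every topological space $Y$, a bijection between $(\mathcal G,\mathcal X,\mathcal R)$-actions and $\mathcal M$-actions on $Y$, natural in the sense that a continuous map is $(\mathcal G,\mathcal X)$-equivariant if and only if it is $\mathcal M$-equivariant. It is known to exist and to be unique up to canonical isomorphism. Actor $\mathcal M\to\mathcal H$: an action of $\mathcal M$ on the arrow space of $\mathcal H$ commuting with the right translation action of $\mathcal H$. It is proper if the induced map $\mathcal H/\mathcal H\cong\mathcal H^0\to\mathcal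 M^0$ is proper. Meaning of "equivalent": an actor corresponds to a $(\mathcal G,\mathcal X,\mathcal R)$-action on $\mathcal H$, whose anchor map is $\varrho\circ r$ for a continuous map $\varrho\colon\mathcal H^0\to\mathcal G^0$; the map sending it to $\vartheta_W=\{w\cdot 1_\omega: w\in W,\ \omega\in\mathcal H^0,\ s(w)=\varrho(\omega)\}$ for $W\in\mathcal B(\mathcal G)\sqcup\mathcal B(\mathcal X)$ is a bijection from actors onto the maps $\vartheta$ satisfying the conditions. In particular $\vartheta_U=\varrho^{-1}(U)$ for open $U\subseteq\mathcal G^0$. *)

theory Defs
  imports "HOL-Analysis.Analysis" "HOL-Library.FuncSet"
begin

section \<open>Topological preliminaries\<close>

definition local_homeomorphism :: "'a topology \<Rightarrow> 'b topology \<Rightarrow> ('a \<Rightarrow> 'b) \<Rightarrow> bool" where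
  "local_homeomorphism X Y f \<longleftrightarrow>
     (\<forall>x\<in>topspace X. \<exists>U. openin X U \<and> x \<in> U \<and> openin Y (f ` U) \<and>
        homeomorphic_map (subtopology X U) (subtopology Y (f ` U)) f)"

definition quotient_topology :: "'a topology \<Rightarrow> ('a \<Rightarrow> 'b) \<Rightarrow> 'b topology" where
  "quotient_topology X q =
     topology (\<lambda>U. U \<subseteq> q ` topspace X \<and> openin X {x \<in> topspace X. q x \<in> U})"

lemma openin_quotient_topology:
  "openin (quotient_topology X q) U \<longleftrightarrow>
     U \<subseteq> q ` topspace X \<and> openin X {x \<in> topspace X. q x \<in> U}"
proof -
  have "istopology (\<lambda>U. U \<subseteq> q ` topspace X \<and> openin X {x \<in> topspace X. q x \<in> U})"
    unfolding istopology_def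
  proof (intro conjI allI impI)
    fix S T
    assume S: "S \<subseteq> q ` topspace X \<and> openin X {x \<in> topspace X. q x \<in> S}"
      and T: "T \<subseteq> q ` topspace X \<and> openin X {x \<in> topspace X. q x \<in> T}"
    show "S \<inter> T \<subseteq> q ` topspace X" using S by blast
    have "{x \<in> topspace X. q x \<in> S \<inter> T} =
            {x \<in> topspace X. q x \<in> S} \<inter> {x \<in> topspace X. q x \<in> T}" by blast
    then show "openin X {x \<in> topspace X. q x \<in> S \<inter> T}" using S T by auto
  next
    fix K
    assume K: "\<forall>S\<in>K. S \<subseteq> q ` topspace X \<and> openin X {x \<in> topspace X. q x \<in> S}"
    show "\<Union>K \<subseteq> q ` topspace X" using K by blast
    have "{x \<in> topspace X. q x \<in> \<Union>K} = \<Union>((\<lambda>S. {x \<in> topspace X. q x \<in> S}) ` K)" by blast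
    moreover have "openin X (\<Union>((\<lambda>S. {x \<in> topspace X. q x \<in> S}) ` K))"
      using K by (intro openin_Union) blast
    ultimately show "openin X {x \<in> topspace X. q x \<in> \<Union>K}" by simp
  qed
  then show ?thesis
    unfolding quotient_topology_def by (simp add: topology_inverse')
qed

lemma topspace_quotient_topology [simp]:
  "topspace (quotient_topology X q) = q ` topspace X"
proof -
  have "{x \<in> topspace X. q x \<in> q ` topspace X} = topspace X" by blast
  then have "openin (quotient_topology X q) (q ` topspace X)"
    by (simp add: openin_quotient_topology)
  then show ?thesis
    using openin_quotient_topology [of X q "topspace (quotient_topology X q)"]
    by (simp add: openin_subset subset_antisym)
qed

lemma quotient_map_quotient_topology: "quotient_map X (quotient_topology X q) q"
  by (auto simp: quotient_map_def openin_quotient_topology)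


section \<open>Groupoids\<close>

text \<open>An object is identified with its unit arrow, so the object space is a subspace of the
  arrow space. This loses nothing: for a topological groupoid the unit map is an embedding.
  All sets and operations are only meaningful on the carrier, the topspace of the arrow
  topology. The product of \<open>g\<close> and \<open>h\<close> is defined if \<open>src g = rng h\<close>.\<close>

record 'a groupoid =
  arr :: "'a topology"
  rng :: "'a \<Rightarrow> 'a"
  src :: "'a \<Rightarrow> 'a"
  mult :: "'a \<Rightarrow> 'a \<Rightarrow> 'a"
  invs :: "'a \<Rightarrow> 'a"

definition units :: "'a groupoid \<Rightarrow> 'a set" where
  "units G = src G ` topspace (arr G)"

definition obj :: "'a groupoid \<Rightarrow> 'a topology" where
  "obj G = subtopology (arr G) (units G)"

locale etale_groupoid =
  fixes G :: "'a groupoid"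
  assumes src_closed: "g \<in> topspace (arr G) \<Longrightarrow> src G g \<in> topspace (arr G)"
    and rng_units: "g \<in> topspace (arr G) \<Longrightarrow> rng G g \<in> units G"
    and src_unit: "u \<in> units G \<Longrightarrow> src G u = u"
    and rng_unit: "u \<in> units G \<Longrightarrow> rng G u = u"
    and mult_closed:
      "\<lbrakk>g \<in> topspace (arr G); h \<in> topspace (arr G); src G g = rng G h\<rbrakk>
        \<Longrightarrow> mult G g h \<in> topspace (arr G)"
    and src_mult:
      "\<lbrakk>g \<in> topspace (arr G); h \<in> topspace (arr G); src G g = rng G h\<rbrakk>
        \<Longrightarrow> src G (mult G g h) = src G h"
    and rng_mult:
      "\<lbrakk>g \<in> topspace (arr G); h \<in> topspace (arr G); src G g = rng G h\<rbrakk>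
        \<Longrightarrow> rng G (mult G g h) = rng G g"
    and mult_assoc:
      "\<lbrakk>g \<in> topspace (arr G); h \<in> topspace (arr G); k \<in> topspace (arr G);
        src G g = rng G h; src G h = rng G k\<rbrakk>
        \<Longrightarrow> mult G (mult G g h) k = mult G g (mult G h k)"
    and unit_left: "g \<in> topspace (arr G) \<Longrightarrow> mult G (rng G g) g = g"
    and unit_right: "g \<in> topspace (arr G) \<Longrightarrow> mult G g (src G g) = g"
    and inv_closed: "g \<in> topspace (arr G) \<Longrightarrow> invs G g \<in> topspace (arr G)"
    and src_inv: "g \<in> topspace (arr G) \<Longrightarrow> src G (invs G g) = rng G g"
    and rng_inv: "g \<in> topspace (arr G) \<Longrightarrow> rng G (invs G g) = src G g"
    and inv_left: "g \<in> topspace (arr G) \<Longrightarrow> mult G (invs G g) g = src G g"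
    and inv_right: "g \<in> topspace (arr G) \<Longrightarrow> mult G g (invs G g) = rng G g"
    and mult_continuous:
      "continuous_map
         (subtopology (prod_topology (arr G) (arr G)) {(g, h). src G g = rng G h})
         (arr G) (\<lambda>(g, h). mult G g h)"
    and inv_continuous: "continuous_map (arr G) (arr G) (invs G)"
    and rng_local_homeo: "local_homeomorphism (arr G) (obj G) (rng G)"
    and src_local_homeo: "local_homeomorphism (arr G) (obj G) (src G)"
    and Hausdorff_obj: "Hausdorff_space (obj G)"
    and locally_compact_obj: "locally_compact_space (obj G)"

definition bisections :: "'a groupoid \<Rightarrow> 'a set set" where
  "bisections G = {V. openin (arr G) V \<and> inj_on (rng G) V \<and> inj_on (src G) V}"

definition set_mult :: "'a groupoid \<Rightarrow> 'a set \<Rightarrow> 'a set \<Rightarrow> 'a set" where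
  "set_mult G V W = {mult G v w | v w. v \<in> V \<and> w \<in> W \<and> src G v = rng G w}"


section \<open>Groupoid actions\<close>

text \<open>Anchor and multiplication are required to be extensional, that is, fixed to the junk value
  \<open>undefined\<close> off their domains, so that two actions on a space coincide mathematically if and
  only if they are equal as HOL objects. This matters for the bijections between sets of
  actions below.\<close>

record ('g, 'y) action =
  anchor :: "'y \<Rightarrow> 'g"
  act :: "'g \<Rightarrow> 'y \<Rightarrow> 'y"

definition groupoid_action ::
  "'g groupoid \<Rightarrow> 'y topology \<Rightarrow> ('g, 'y, 'e) action_scheme \<Rightarrow> bool" where
  "groupoid_action G Y A \<longleftrightarrow>
     anchor A \<in> extensional (topspace Y) \<and>
     (\<lambda>(g, y). act A g y) \<in> extensional
        {(g, y). g \<in> topspace (arr G) \<and> y \<in> topspace Y \<and> src G g = anchor A y} \<and>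
     continuous_map Y (obj G) (anchor A) \<and>
     continuous_map
       (subtopology (prod_topology (arr G) Y) {(g, y). src G g = anchor A y})
       Y (\<lambda>(g, y). act A g y) \<and>
     (\<forall>y\<in>topspace Y. act A (anchor A y) y = y) \<and>
     (\<forall>g\<in>topspace (arr G). \<forall>y\<in>topspace Y. src G g = anchor A y \<longrightarrow>
        anchor A (act A g y) = rng G g) \<and>
     (\<forall>g\<in>topspace (arr G). \<forall>h\<in>topspace (arr G). \<forall>y\<in>topspace Y.
        src G g = rng G h \<longrightarrow> src G h = anchor A y \<longrightarrow>
        act A (mult G g h) y = act A g (act A h y))"

definition equivariant ::
  "'g groupoid \<Rightarrow> 'y topology \<Rightarrow> ('g, 'y, 'e) action_scheme \<Rightarrow>
     ('g, 'z, 'f) action_scheme \<Rightarrow> ('y \<Rightarrow> 'z) \<Rightarrow> bool" where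
  "equivariant G Y A B f \<longleftrightarrow>
     (\<forall>y\<in>topspace Y. anchor B (f y) = anchor A y) \<and>
     (\<forall>g\<in>topspace (arr G). \<forall>y\<in>topspace Y. src G g = anchor A y \<longrightarrow>
        f (act A g y) = act B g (f y))"


section \<open>Groupoid correspondences\<close>

record ('g, 'x) correspondence =
  spc :: "'x topology"
  lanchor :: "'x \<Rightarrow> 'g"
  ranchor :: "'x \<Rightarrow> 'g"
  lact :: "'g \<Rightarrow> 'x \<Rightarrow> 'x"
  ract :: "'x \<Rightarrow> 'g \<Rightarrow> 'x"

definition orbit :: "'g groupoid \<Rightarrow> ('g, 'x) correspondence \<Rightarrow> 'x \<Rightarrow> 'x set" where
  "orbit G X x = {ract X x g | g. g \<in> topspace (arr G) \<and> ranchor X x = rng G g}"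

definition orbit_space :: "'g groupoid \<Rightarrow> ('g, 'x) correspondence \<Rightarrow> 'x set topology" where
  "orbit_space G X = quotient_topology (spc X) (orbit G X)"

locale groupoid_correspondence =
  fixes G :: "'g groupoid" and X :: "('g, 'x) correspondence"
  assumes lanchor_continuous: "continuous_map (spc X) (obj G) (lanchor X)"
    and lact_continuous:
      "continuous_map
         (subtopology (prod_topology (arr G) (spc X)) {(g, x). src G g = lanchor X x})
         (spc X) (\<lambda>(g, x). lact X g x)"
    and lanchor_lact:
      "\<lbrakk>g \<in> topspace (arr G); x \<in> topspace (spc X); src G g = lanchor X x\<rbrakk>
        \<Longrightarrow> lanchor X (lact X g x) = rng G g"
    and lact_unit: "x \<in> topspace (spc X) \<Longrightarrow> lact X (lanchor X x) x = x"
    and lact_mult: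
      "\<lbrakk>g \<in> topspace (arr G); h \<in> topspace (arr G); x \<in> topspace (spc X);
        src G g = rng G h; src G h = lanchor X x\<rbrakk>
        \<Longrightarrow> lact X (mult G g h) x = lact X g (lact X h x)"
    and ract_continuous:
      "continuous_map
         (subtopology (prod_topology (spc X) (arr G)) {(x, g). ranchor X x = rng G g})
         (spc X) (\<lambda>(x, g). ract X x g)"
    and ranchor_ract:
      "\<lbrakk>x \<in> topspace (spc X); g \<in> topspace (arr G); ranchor X x = rng G g\<rbrakk>
        \<Longrightarrow> ranchor X (ract X x g) = src G g"
    and ract_unit: "x \<in> topspace (spc X) \<Longrightarrow> ract X x (ranchor X x) = x"
    and ract_mult:
      "\<lbrakk>x \<in> topspace (spc X); g \<in> topspace (arr G); h \<in> topspace (arr G);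
        ranchor X x = rng G g; src G g = rng G h\<rbrakk>
        \<Longrightarrow> ract X x (mult G g h) = ract X (ract X x g) h"
    and lanchor_ract:
      "\<lbrakk>x \<in> topspace (spc X); g \<in> topspace (arr G); ranchor X x = rng G g\<rbrakk>
        \<Longrightarrow> lanchor X (ract X x g) = lanchor X x"
    and ranchor_lact:
      "\<lbrakk>g \<in> topspace (arr G); x \<in> topspace (spc X); src G g = lanchor X x\<rbrakk>
        \<Longrightarrow> ranchor X (lact X g x) = ranchor X x"
    and actions_commute:
      "\<lbrakk>g \<in> topspace (arr G); x \<in> topspace (spc X); h \<in> topspace (arr G);
        src G g = lanchor X x; ranchor X x = rng G h\<rbrakk>
        \<Longrightarrow> ract X (lact X g x) h = lact X g (ract X x h)"
    and ract_free:
      "\<lbrakk>x \<in> topspace (spc X); g \<in> topspace (arr G); ranchor X x = rng G g; ract X x g = x\<rbrakk>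
        \<Longrightarrow> g \<in> units G"
    and ract_proper:
      "proper_map
         (subtopology (prod_topology (spc X) (arr G)) {(x, g). ranchor X x = rng G g})
         (prod_topology (spc X) (spc X)) (\<lambda>(x, g). (x, ract X x g))"
    and ranchor_local_homeo: "local_homeomorphism (spc X) (obj G) (ranchor X)"

text \<open>The map induced on orbits by the left anchor map, which is constant on orbits.\<close>

definition orbit_anchor :: "('g, 'x) correspondence \<Rightarrow> 'x set \<Rightarrow> 'g" where
  "orbit_anchor X C = the_elem (lanchor X ` C)"

definition regular_on :: "'g groupoid \<Rightarrow> ('g, 'x) correspondence \<Rightarrow> 'g set \<Rightarrow> bool" where
  "regular_on G X R \<longleftrightarrow>
     (let P = {C \<in> topspace (orbit_space G X). orbit_anchor X C \<in> R} in
        proper_map (subtopology (orbit_space G X) P) (subtopology (obj G) R) (orbit_anchor X) \<and>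
        orbit_anchor X ` P = R)"

definition invariant :: "'g groupoid \<Rightarrow> 'g set \<Rightarrow> bool" where
  "invariant G R \<longleftrightarrow> (\<forall>g\<in>topspace (arr G). src G g \<in> R \<longleftrightarrow> rng G g \<in> R)"

definition corr_bisections :: "'g groupoid \<Rightarrow> ('g, 'x) correspondence \<Rightarrow> 'x set set" where
  "corr_bisections G X =
     {V. openin (spc X) V \<and> inj_on (ranchor X) V \<and> inj_on (orbit G X) V}"

definition set_lact ::
  "'g groupoid \<Rightarrow> ('g, 'x) correspondence \<Rightarrow> 'g set \<Rightarrow> 'x set \<Rightarrow> 'x set" where
  "set_lact G X V W = {lact X v w | v w. v \<in> V \<and> w \<in> W \<and> src G v = lanchor X w}"

definition set_ract ::
  "'g groupoid \<Rightarrow> ('g, 'x) correspondence \<Rightarrow> 'x set \<Rightarrow> 'g set \<Rightarrow> 'x set" where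
  "set_ract G X V W = {ract X v w | v w. v \<in> V \<and> w \<in> W \<and> ranchor X v = rng G w}"

definition bracket ::
  "'g groupoid \<Rightarrow> ('g, 'x) correspondence \<Rightarrow> 'x set \<Rightarrow> 'x set \<Rightarrow> 'g set" where
  "bracket G X V W =
     {g \<in> topspace (arr G). \<exists>v\<in>V. \<exists>w\<in>W. ranchor X v = rng G g \<and> w = ract X v g}"


section \<open>Actions of a groupoid correspondence\<close>

record ('g, 'x, 'y) corr_action = "('g, 'y) action" +
  xact :: "'x \<Rightarrow> 'y \<Rightarrow> 'y"

definition xact_image ::
  "('g, 'x) correspondence \<Rightarrow> 'y topology \<Rightarrow> ('g, 'x, 'y) corr_action \<Rightarrow> 'y set" where
  "xact_image X Y A =
     {xact A x y | x y. x \<in> topspace (spc X) \<and> y \<in> topspace Y \<and> ranchor X x = anchor A y}"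

definition correspondence_action ::
  "'g groupoid \<Rightarrow> ('g, 'x) correspondence \<Rightarrow> 'g set \<Rightarrow> 'y topology \<Rightarrow>
     ('g, 'x, 'y) corr_action \<Rightarrow> bool" where
  "correspondence_action G X R Y A \<longleftrightarrow>
     groupoid_action G Y A \<and>
     (\<lambda>(x, y). xact A x y) \<in> extensional
        {(x, y). x \<in> topspace (spc X) \<and> y \<in> topspace Y \<and> ranchor X x = anchor A y} \<and>
     continuous_map
       (subtopology (prod_topology (spc X) Y) {(x, y). ranchor X x = anchor A y})
       Y (\<lambda>(x, y). xact A x y) \<and>
     open_map
       (subtopology (prod_topology (spc X) Y) {(x, y). ranchor X x = anchor A y})
       Y (\<lambda>(x, y). xact A x y) \<and>
     (\<forall>x\<in>topspace (spc X). \<forall>y\<in>topspace Y. ranchor X x = anchor A y \<longrightarrow>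
        anchor A (xact A x y) = lanchor X x) \<and>
     (\<forall>g\<in>topspace (arr G). \<forall>x\<in>topspace (spc X). \<forall>y\<in>topspace Y.
        src G g = lanchor X x \<longrightarrow> ranchor X x = anchor A y \<longrightarrow>
        act A g (xact A x y) = xact A (lact X g x) y) \<and>
     (\<forall>x\<in>topspace (spc X). \<forall>x'\<in>topspace (spc X). \<forall>y\<in>topspace Y. \<forall>y'\<in>topspace Y.
        ranchor X x = anchor A y \<longrightarrow> ranchor X x' = anchor A y' \<longrightarrow>
        (xact A x y = xact A x' y' \<longleftrightarrow>
          (\<exists>g\<in>topspace (arr G). ranchor X x = rng G g \<and> src G g = anchor A y' \<and>
             x' = ract X x g \<and> y = act A g y'))) \<and>
     {y \<in> topspace Y. anchor A y \<in> R} \<subseteq> xact_image X Y A \<and>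
     (\<forall>K. compactin (orbit_space G X) K \<longrightarrow>
        closedin Y {xact A x y | x y. x \<in> topspace (spc X) \<and> orbit G X x \<in> K \<and>
                      y \<in> topspace Y \<and> ranchor X x = anchor A y})"

definition corr_equivariant ::
  "'g groupoid \<Rightarrow> ('g, 'x) correspondence \<Rightarrow> 'y topology \<Rightarrow> 'z topology \<Rightarrow>
     ('g, 'x, 'y) corr_action \<Rightarrow> ('g, 'x, 'z) corr_action \<Rightarrow> ('y \<Rightarrow> 'z) \<Rightarrow> bool" where
  "corr_equivariant G X Y Z A B f \<longleftrightarrow>
     equivariant G Y A B f \<and>
     (\<forall>x\<in>topspace (spc X). \<forall>y\<in>topspace Y. ranchor X x = anchor A y \<longrightarrow>
        f (xact A x y) = xact B x (f y)) \<and>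
     {y \<in> topspace Y. f y \<in> xact_image X Z B} = xact_image X Y A"


section \<open>The groupoid model\<close>

definition model_bijection ::
  "'g groupoid \<Rightarrow> ('g, 'x) correspondence \<Rightarrow> 'g set \<Rightarrow> 'm groupoid \<Rightarrow>
     ('y topology \<Rightarrow> ('g, 'x, 'y) corr_action \<Rightarrow> ('m, 'y) action) \<Rightarrow> bool" where
  "model_bijection G X R M \<Phi> \<longleftrightarrow>
     (\<forall>Y. bij_betw (\<Phi> Y) {A. correspondence_action G X R Y A} {B. groupoid_action M Y B})"

definition model_natural ::
  "'g groupoid \<Rightarrow> ('g, 'x) correspondence \<Rightarrow> 'g set \<Rightarrow> 'm groupoid \<Rightarrow>
     ('y topology \<Rightarrow> ('g, 'x, 'y) corr_action \<Rightarrow> ('m, 'y) action) \<Rightarrow>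
     ('z topology \<Rightarrow> ('g, 'x, 'z) corr_action \<Rightarrow> ('m, 'z) action) \<Rightarrow> bool" where
  "model_natural G X R M \<Phi> \<Psi> \<longleftrightarrow>
     (\<forall>Y Z A B f. correspondence_action G X R Y A \<longrightarrow> correspondence_action G X R Z B \<longrightarrow>
        continuous_map Y Z f \<longrightarrow>
        (corr_equivariant G X Y Z A B f \<longleftrightarrow> equivariant M Y (\<Phi> Y A) (\<Psi> Z B) f))"

text \<open>The universal property of a groupoid model speaks about all topological spaces, but HOL
  cannot quantify over the type of their points. The family of bijections is therefore given
  at two point types: \<open>\<Phi>\<close> at an arbitrary type \<open>'y\<close>, and \<open>\<Psi>\<close> at the type \<open>universe\<close>, together
  with naturality within and between the two types. A family defined for all spaces
  restricts to these two types, so this hypothesis is implied by the full universal property.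
  The type \<open>universe\<close> has room for copies of the object space of \<open>M\<close> and of the universal
  action, whose points are represented by finite or infinite sequences of elements of the
  correspondence, or by objects of \<open>G\<close>. Hence the universal property at this type pins down the
  object space of \<open>M\<close> up to homeomorphism, however small \<open>'y\<close> is.\<close>

type_synonym ('g, 'x, 'm) universe = "(nat \<Rightarrow> 'g + 'x + 'm) set"

definition groupoid_model ::
  "'g groupoid \<Rightarrow> ('g, 'x) correspondence \<Rightarrow> 'g set \<Rightarrow> 'm groupoid \<Rightarrow>
     ('y topology \<Rightarrow> ('g, 'x, 'y) corr_action \<Rightarrow> ('m, 'y) action) \<Rightarrow>
     (('g, 'x, 'm) universe topology \<Rightarrow> ('g, 'x, ('g, 'x, 'm) universe) corr_action \<Rightarrow>
        ('m, ('g, 'x, 'm) universe) action) \<Rightarrow> bool" where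
  "groupoid_model G X R M \<Phi> \<Psi> \<longleftrightarrow>
     etale_groupoid M \<and>
     model_bijection G X R M \<Phi> \<and> model_bijection G X R M \<Psi> \<and>
     model_natural G X R M \<Phi> \<Phi> \<and> model_natural G X R M \<Phi> \<Psi> \<and>
     model_natural G X R M \<Psi> \<Phi> \<and> model_natural G X R M \<Psi> \<Psi>"


text \<open>The action of the correspondence on \<open>Y\<close> from which an action of the model comes.\<close>

definition corr_action_of ::
  "'g groupoid \<Rightarrow> ('g, 'x) correspondence \<Rightarrow> 'g set \<Rightarrow>
     ('y topology \<Rightarrow> ('g, 'x, 'y) corr_action \<Rightarrow> ('m, 'y) action) \<Rightarrow> 'y topology \<Rightarrow>
     ('m, 'y) action \<Rightarrow> ('g, 'x, 'y) corr_action" where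
  "corr_action_of G X R \<Phi> Y = the_inv_into {A. correspondence_action G X R Y A} (\<Phi> Y)"


section \<open>Actors\<close>

definition actors :: "'m groupoid \<Rightarrow> 'h groupoid \<Rightarrow> ('m, 'h) action set" where
  "actors M H =
     {B. groupoid_action M (arr H) B \<and>
         (\<forall>x\<in>topspace (arr H). \<forall>h\<in>topspace (arr H). src H x = rng H h \<longrightarrow>
            anchor B (mult H x h) = anchor B x) \<and>
         (\<forall>m\<in>topspace (arr M). \<forall>x\<in>topspace (arr H). src M m = anchor B x \<longrightarrow>
            src H (act B m x) = src H x) \<and>
         (\<forall>m\<in>topspace (arr M). \<forall>x\<in>topspace (arr H). \<forall>h\<in>topspace (arr H).
            src M m = anchor B x \<longrightarrow> src H x = rng H h \<longrightarrow>
            mult H (act B m x) h = act B m (mult H x h))}"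

text \<open>The range map identifies the orbit space of the right translation action with the object
  space of \<open>H\<close>; under this identification the induced map is the anchor map on units.\<close>

definition proper_actor :: "'m groupoid \<Rightarrow> 'h groupoid \<Rightarrow> ('m, 'h) action \<Rightarrow> bool" where
  "proper_actor M H B \<longleftrightarrow> proper_map (obj H) (obj M) (anchor B)"


section \<open>Maps on bisections\<close>

definition bisection_map_of ::
  "'g groupoid \<Rightarrow> ('g, 'x) correspondence \<Rightarrow> 'h groupoid \<Rightarrow> ('g, 'x, 'h) corr_action \<Rightarrow>
     ('g set + 'x set \<Rightarrow> 'h set)" where
  "bisection_map_of G X H A =
     (\<lambda>W \<in> bisections G <+> corr_bisections G X.
        case W of
          Inl V \<Rightarrow> {act A g \<omega> | g \<omega>. g \<in> V \<and> \<omega> \<in> units H \<and> src G g = anchor A \<omega>}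
        | Inr V \<Rightarrow> {xact A x \<omega> | x \<omega>. x \<in> V \<and> \<omega> \<in> units H \<and> ranchor X x = anchor A \<omega>})"

definition multiplicative ::
  "'g groupoid \<Rightarrow> ('g, 'x) correspondence \<Rightarrow> 'h groupoid \<Rightarrow>
     ('g set + 'x set \<Rightarrow> 'h set) \<Rightarrow> bool" where
  "multiplicative G X H \<theta> \<longleftrightarrow>
     (\<forall>V\<in>bisections G. \<forall>W\<in>bisections G.
        set_mult H (\<theta> (Inl V)) (\<theta> (Inl W)) = \<theta> (Inl (set_mult G V W))) \<and>
     (\<forall>V\<in>bisections G. \<forall>W\<in>corr_bisections G X.
        set_mult H (\<theta> (Inl V)) (\<theta> (Inr W)) = \<theta> (Inr (set_lact G X V W))) \<and>
     (\<forall>V\<in>corr_bisections G X. \<forall>W\<in>bisections G.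
        set_mult H (\<theta> (Inr V)) (\<theta> (Inl W)) = \<theta> (Inr (set_ract G X V W)))"

definition preserves_bracket ::
  "'g groupoid \<Rightarrow> ('g, 'x) correspondence \<Rightarrow> 'h groupoid \<Rightarrow>
     ('g set + 'x set \<Rightarrow> 'h set) \<Rightarrow> bool" where
  "preserves_bracket G X H \<theta> \<longleftrightarrow>
     (\<forall>V\<in>corr_bisections G X. \<forall>W\<in>corr_bisections G X.
        set_mult H (invs H ` \<theta> (Inr V)) (\<theta> (Inr W)) = \<theta> (Inl (bracket G X V W)))"

definition preserves_unions ::
  "'g groupoid \<Rightarrow> ('g set + 'x set \<Rightarrow> 'h set) \<Rightarrow> bool" where
  "preserves_unions G \<theta> \<longleftrightarrow>
     (\<forall>\<U>. (\<forall>U\<in>\<U>. openin (obj G) U) \<longrightarrow> \<theta> (Inl (\<Union>\<U>)) = (\<Union>U\<in>\<U>. \<theta> (Inl U)))"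

definition covers_range ::
  "'g groupoid \<Rightarrow> ('g, 'x) correspondence \<Rightarrow> 'g set \<Rightarrow> 'h groupoid \<Rightarrow>
     ('g set + 'x set \<Rightarrow> 'h set) \<Rightarrow> bool" where
  "covers_range G X R H \<theta> \<longleftrightarrow>
     rng H ` \<theta> (Inl R) \<subseteq> (\<Union>U\<in>corr_bisections G X. rng H ` \<theta> (Inr U))"

text \<open>The space of a correspondence need not be Hausdorff, so closures of relatively compact sets
  need not be compact. Precompact here means contained in a compact subset, which for
  Hausdorff spaces is the same as having compact closure.\<close>

definition precompact_in :: "'a topology \<Rightarrow> 'a set \<Rightarrow> bool" where
  "precompact_in X U \<longleftrightarrow> (\<exists>K. compactin X K \<and> U \<subseteq> K)"

definition closure_condition ::
  "'g groupoid \<Rightarrow> ('g, 'x) correspondence \<Rightarrow> 'h groupoid \<Rightarrow>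
     ('g set + 'x set \<Rightarrow> 'h set) \<Rightarrow> bool" where
  "closure_condition G X H \<theta> \<longleftrightarrow>
     (\<forall>U\<in>corr_bisections G X. precompact_in (spc X) U \<longrightarrow>
        (obj H) closure_of (rng H ` \<theta> (Inr U))
          \<subseteq> (\<Union>W\<in>corr_bisections G X. rng H ` \<theta> (Inr W)))"

text \<open>The extensional function space makes distinct maps on bisections distinct as HOL functions.\<close>

definition bisection_maps ::
  "'g groupoid \<Rightarrow> ('g, 'x) correspondence \<Rightarrow> 'g set \<Rightarrow> 'h groupoid \<Rightarrow>
     ('g set + 'x set \<Rightarrow> 'h set) set" where
  "bisection_maps G X R H =
     {\<theta> \<in> (bisections G <+> corr_bisections G X) \<rightarrow>\<^sub>E bisections H.
        multiplicative G X H \<theta> \<and>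
        preserves_bracket G X H \<theta> \<and>
        \<theta> (Inl (units G)) = units H \<and>
        preserves_unions G \<theta> \<and>
        covers_range G X R H \<theta>}"

definition induces_anchor ::
  "'g groupoid \<Rightarrow> 'h groupoid \<Rightarrow> ('g set + 'x set \<Rightarrow> 'h set) \<Rightarrow> ('h \<Rightarrow> 'g) \<Rightarrow> bool" where
  "induces_anchor G H \<theta> \<rho> \<longleftrightarrow>
     continuous_map (obj H) (obj G) \<rho> \<and>
     (\<forall>U. openin (obj G) U \<longrightarrow> \<theta> (Inl U) = {\<omega> \<in> units H. \<rho> \<omega> \<in> U})"

end

(* A right translation invariant action of the correspondence on the arrow space of H is determined
   by what the elements of bisections do to units, and these values are read off the bisections
   theta_W by their source. Naturality of the model for the inclusions of source-saturated open
   subsets and for right translations by bisections of H (all on spaces of arrows of H) shows that the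
   actions of M that commute with right translation are exactly those that come from such actions.

   For properness, what matters is that the map from the objects of M to those of G is proper. Every algebraic
   action of (G, X, R) becomes a topological one for the coarsest possible topology, generated by
   cylinder sets. Since the object space of M is terminal among actions, its topology is of this form; and since
   finite and infinite sequences of points of X form an action, it contains a limit for each such
   sequence. An ultrafilter over a point of G determines such a sequence letter by letter, and the
   limit of the sequence is then a limit of the ultrafilter. *)

theory Submission
  imports Defs
begin

section \<open>Topology\<close>

text \<open>The universal property of M is available only at the point types \<open>'h\<close> and
  \<open>universe\<close>. Composable pairs of arrows of H have another point type, so commutation
  is tested on open subspaces of H, by maps that multiply with the matching arrow of a bisection.
  For the same reason the universal action is not constructed as a limit: the object space of M is
  copied into \<open>universe\<close>, and streams serve only to show that it has enough points.
  Limits of ultrafilters have to exist there but not to be unique, so non-Hausdorff spaces cause no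
  trouble. Regularity enters at one point: an ultrafilter lying over a point of R contains the cone
  of a compact set of orbits and therefore has a first letter. Once the map q from the objects of M
  to those of G is proper, the rest is formal: \<rho> is q after the anchor map of the actor, and
  the object space of M is Hausdorff. Condition (6) is what makes cones of compact sets of orbits
  closed. Points that some r(\<open>\<theta>\<close> W) reaches are separated from a cone by their
  orbit; for the remaining points only (6) is available.\<close>

lemma continuous_map_pair_compose:
  assumes "continuous_map (subtopology (prod_topology A B) D) C (\<lambda>(a, b). f a b)"
    and "continuous_map Z A p" and "continuous_map Z B q"
    and "\<And>z. z \<in> topspace Z \<Longrightarrow> (p z, q z) \<in> D"
  shows "continuous_map Z C (\<lambda>z. f (p z) (q z))"
proof -
  have "continuous_map Z (subtopology (prod_topology A B) D) (\<lambda>z. (p z, q z))"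
    using assms(2-4) by (auto simp: continuous_map_in_subtopology continuous_map_paired)
  from continuous_map_compose[OF this assms(1)] show ?thesis
    by (simp add: o_def)
qed

lemma openin_subtopology_prodI:
  assumes "P \<subseteq> D"
    and "\<And>a b. (a, b) \<in> P \<Longrightarrow> \<exists>U V. openin A U \<and> openin B V \<and> a \<in> U \<and> b \<in> V \<and> U \<times> V \<inter> D \<subseteq> P"
  shows "openin (subtopology (prod_topology A B) D) P"
proof (subst openin_subopen, intro ballI)
  fix z assume z: "z \<in> P"
  obtain a b where ab: "z = (a, b)" by (cases z)
  then have "(a, b) \<in> P" using z by simp
  from assms(2)[OF this] obtain U V
    where UV: "openin A U" "openin B V" "a \<in> U" "b \<in> V" "U \<times> V \<inter> D \<subseteq> P"
    by blast
  have "openin (subtopology (prod_topology A B) D) (U \<times> V \<inter> D)"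
    unfolding openin_subtopology using UV by (auto simp: openin_prod_Times_iff intro!: exI[of _ "U \<times> V"])
  with UV ab z assms(1) show "\<exists>T. openin (subtopology (prod_topology A B) D) T \<and> z \<in> T \<and> T \<subseteq> P"
    by (intro exI[of _ "U \<times> V \<inter> D"]) auto
qed

text \<open>Images commute with unions, so openness needs to be tested only on traces of open
  rectangles.\<close>

lemma open_map_subtopology_prodI:
  assumes "\<And>U V. openin A U \<Longrightarrow> openin B V \<Longrightarrow> openin C (f ` (U \<times> V \<inter> D))"
  shows "open_map (subtopology (prod_topology A B) D) C f"
  unfolding open_map_def
proof (intro allI impI)
  fix O' assume "openin (subtopology (prod_topology A B) D) O'"
  then obtain P where P: "openin (prod_topology A B) P" "O' = P \<inter> D"
    by (auto simp: openin_subtopology)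
  show "openin C (f ` O')"
  proof (subst openin_subopen, intro ballI)
    fix c assume "c \<in> f ` O'"
    then obtain a b where ab: "(a, b) \<in> P" "(a, b) \<in> D" "c = f (a, b)" using P by auto
    obtain U V where UV: "openin A U" "openin B V" "a \<in> U" "b \<in> V" "U \<times> V \<subseteq> P"
      using P(1)[unfolded openin_prod_topology_alt, rule_format, OF ab(1)] by blast
    have "f ` (U \<times> V \<inter> D) \<subseteq> f ` O'" "c \<in> f ` (U \<times> V \<inter> D)"
      using UV ab P(2) by auto
    with assms[OF UV(1,2)] show "\<exists>T. openin C T \<and> c \<in> T \<and> T \<subseteq> f ` O'"
      by blast
  qed
qed

lemma openin_preimage_subtopology:
  assumes "continuous_map (subtopology X E) Z f" "openin X E" "openin Z V"
  shows "openin X {x \<in> E. f x \<in> V}"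
proof -
  have "openin (subtopology X E) {x \<in> topspace (subtopology X E). f x \<in> V}"
    using assms(1,3) by (rule openin_continuous_map_preimage)
  moreover have "{x \<in> topspace (subtopology X E). f x \<in> V} = {x \<in> E. f x \<in> V}"
    using openin_subset[OF assms(2)] by auto
  ultimately show ?thesis using assms(2) openin_trans_full by fastforce
qed

lemma continuous_map_locallyI:
  assumes "\<And>x. x \<in> topspace X \<Longrightarrow> f x \<in> topspace Z"
    and "\<And>x. x \<in> topspace X \<Longrightarrow> \<exists>E. openin X E \<and> x \<in> E \<and> continuous_map (subtopology X E) Z f"
  shows "continuous_map X Z f"
  unfolding continuous_map
proof (intro conjI allI impI)
  show "f ` topspace X \<subseteq> topspace Z" using assms(1) by blast
  fix V assume V: "openin Z V"
  show "openin X {x \<in> topspace X. f x \<in> V}"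
  proof (subst openin_subopen, intro ballI)
    fix x assume x: "x \<in> {x \<in> topspace X. f x \<in> V}"
    then obtain E where E: "openin X E" "x \<in> E" "continuous_map (subtopology X E) Z f"
      using assms(2) by blast
    with openin_preimage_subtopology[OF E(3,1) V] x openin_subset[OF E(1)]
    show "\<exists>T. openin X T \<and> x \<in> T \<and> T \<subseteq> {x \<in> topspace X. f x \<in> V}"
      by (intro exI[of _ "{x \<in> E. f x \<in> V}"]) auto
  qed
qed

lemma local_homeomorphism_continuous_map:
  assumes "local_homeomorphism X Y f" shows "continuous_map X Y f"
proof (rule continuous_map_locallyI)
  fix x assume "x \<in> topspace X"
  then obtain U where U: "openin X U" "x \<in> U" "openin Y (f ` U)"
    "homeomorphic_map (subtopology X U) (subtopology Y (f ` U)) f"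
    using assms unfolding local_homeomorphism_def by blast
  show "f x \<in> topspace Y" using U(2) openin_subset[OF U(3)] by blast
  show "\<exists>E. openin X E \<and> x \<in> E \<and> continuous_map (subtopology X E) Y f"
    using U(1,2) continuous_map_into_fulltopology[OF homeomorphic_imp_continuous_map[OF U(4)]]
    by blast
qed

lemma local_homeomorphism_open_map:
  assumes "local_homeomorphism X Y f" shows "open_map X Y f"
  unfolding open_map_def
proof (intro allI impI, subst openin_subopen, intro ballI)
  fix V y assume V: "openin X V" and "y \<in> f ` V"
  then obtain x where x: "x \<in> V" "y = f x" by blast
  then have "x \<in> topspace X" using V openin_subset by blast
  then obtain U where U: "openin X U" "x \<in> U" "openin Y (f ` U)"
    "homeomorphic_map (subtopology X U) (subtopology Y (f ` U)) f"
    using assms unfolding local_homeomorphism_def by blast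
  have "openin (subtopology X U) (U \<inter> V)"
    using V openin_subtopology_Int2 by blast
  then have "openin (subtopology Y (f ` U)) (f ` (U \<inter> V))"
    using U(4) homeomorphic_imp_open_map open_map_def by blast
  then have "openin Y (f ` (U \<inter> V))" using U(3) openin_trans_full by blast
  then show "\<exists>T. openin Y T \<and> y \<in> T \<and> T \<subseteq> f ` V"
    using x U by (intro exI[of _ "f ` (U \<inter> V)"]) auto
qed

lemma local_homeomorphism_inj_on:
  assumes "local_homeomorphism X Y f" "x \<in> topspace X"
  obtains U where "openin X U" "x \<in> U" "inj_on f U"
proof -
  obtain U where U: "openin X U" "x \<in> U"
    "homeomorphic_map (subtopology X U) (subtopology Y (f ` U)) f"
    using assms unfolding local_homeomorphism_def by blast
  then have "inj_on f (topspace (subtopology X U))"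
    using homeomorphic_imp_injective_map by blast
  then show thesis using that U openin_subset[OF U(1)] by (simp add: inf.absorb2)
qed

text \<open>An open continuous injection is a homeomorphism onto its image. All local sections
  below, \<open>ssec\<close>, \<open>rsec\<close> and \<open>xsec\<close>, get their continuity from
  this form of the fact.\<close>

lemma continuous_map_inv_into:
  assumes "open_map X Y f" "openin X U" "inj_on f U"
    and "continuous_map Z Y h" "\<And>z. z \<in> topspace Z \<Longrightarrow> h z \<in> f ` U"
  shows "continuous_map Z X (\<lambda>z. inv_into U f (h z))"
  unfolding continuous_map
proof (intro conjI allI impI)
  show "(\<lambda>z. inv_into U f (h z)) ` topspace Z \<subseteq> topspace X"
    using inv_into_into[OF assms(5)] openin_subset[OF assms(2)] by blast
  fix V assume V: "openin X V"
  have "openin Y (f ` (U \<inter> V))" using assms(1,2) V unfolding open_map_def by blast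
  then have "openin Z {z \<in> topspace Z. h z \<in> f ` (U \<inter> V)}"
    using assms(4) by (simp add: continuous_map)
  moreover have "{z \<in> topspace Z. h z \<in> f ` (U \<inter> V)} = {z \<in> topspace Z. inv_into U f (h z) \<in> V}"
    using assms(3,5) by (auto simp: f_inv_into_f inv_into_into inv_into_f_f
        intro!: image_eqI[of _ f "inv_into U f _"])
  ultimately show "openin Z {z \<in> topspace Z. inv_into U f (h z) \<in> V}" by simp
qed

text \<open>Compactness is transported along the local inverse of f, because only the base Y is
  Hausdorff and locally compact. The space X may be non-Hausdorff, so K is not claimed to be
  closed.\<close>

lemma locally_compact_space_nbhd:
  assumes lc: "locally_compact_space Y" and f: "open_map X Y f" "continuous_map X Y f"
    and U: "openin X U" "inj_on f U" "x \<in> U"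
    and hd: "Hausdorff_space Y"
  obtains V K where "openin X V" "x \<in> V" "V \<subseteq> K" "K \<subseteq> U" "compactin X K"
proof -
  have fU: "openin Y (f ` U)" using f U unfolding open_map_def by blast
  have "neighbourhood_base_of (compactin Y) Y"
    using lc hd locally_compact_space_neighbourhood_base by blast
  then obtain N C where NC: "openin Y N" "compactin Y C" "f x \<in> N" "N \<subseteq> C" "C \<subseteq> f ` U"
    using fU U(3) unfolding neighbourhood_base_of by (metis imageI)
  define g where "g = inv_into U f"
  have "continuous_map (subtopology Y (f ` U)) X (\<lambda>z. inv_into U f (id z))"
    by (rule continuous_map_inv_into[OF f(1) U(1,2)]) auto
  then have g: "continuous_map (subtopology Y (f ` U)) X g" by (simp add: g_def id_def)
  have C: "compactin (subtopology Y (f ` U)) C" using NC by (simp add: compactin_subtopology)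
  have K: "compactin X (g ` C)" using image_compactin[OF C g] .
  show thesis
  proof
    show "openin X {x \<in> U. f x \<in> N}"
      by (rule openin_preimage_subtopology[OF _ U(1) NC(1)]) (use f(2) continuous_map_from_subtopology in blast)
    show "{x \<in> U. f x \<in> N} \<subseteq> g ` C"
    proof
      fix z assume z: "z \<in> {x \<in> U. f x \<in> N}"
      then have "g (f z) = z" using U(2) by (simp add: g_def)
      then show "z \<in> g ` C" using z NC by (metis (mono_tags, lifting) image_eqI mem_Collect_eq subsetD)
    qed
    show "g ` C \<subseteq> U" using NC(5) by (auto simp: g_def inv_into_into subset_iff)
  qed (use K U NC in auto)
qed

lemma compactin_Int_closedin: "compactin X K \<Longrightarrow> closedin X C \<Longrightarrow> compactin X (K \<inter> C)"
  by (metis closed_Int_compactin inf_commute)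

section \<open>Etale groupoids\<close>

context etale_groupoid
begin

abbreviation ssec where "ssec V \<equiv> inv_into V (src G)"
abbreviation rsec where "rsec V \<equiv> inv_into V (rng G)"

lemma units_subset: "units G \<subseteq> topspace (arr G)"
  by (auto simp: units_def src_closed)

lemma unit_closed: "u \<in> units G \<Longrightarrow> u \<in> topspace (arr G)"
  using units_subset by blast

lemma src_units: "g \<in> topspace (arr G) \<Longrightarrow> src G g \<in> units G"
  by (auto simp: units_def)

lemma rng_closed: "g \<in> topspace (arr G) \<Longrightarrow> rng G g \<in> topspace (arr G)"
  using rng_units units_subset by blast

lemma topspace_obj [simp]: "topspace (obj G) = units G"
  using units_subset by (auto simp: obj_def)

lemma continuous_src: "continuous_map (arr G) (obj G) (src G)"
  and continuous_rng: "continuous_map (arr G) (obj G) (rng G)"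
  and open_src: "open_map (arr G) (obj G) (src G)"
  and open_rng: "open_map (arr G) (obj G) (rng G)"
  using src_local_homeo rng_local_homeo
  by (auto intro: local_homeomorphism_continuous_map local_homeomorphism_open_map)

lemma continuous_obj_arr: "continuous_map Z (obj G) f \<Longrightarrow> continuous_map Z (arr G) f"
  unfolding obj_def using continuous_map_into_fulltopology by blast

lemma cont_src: "continuous_map Z (arr G) f \<Longrightarrow> continuous_map Z (obj G) (\<lambda>z. src G (f z))"
  using continuous_map_compose[OF _ continuous_src] by (simp add: o_def)

lemma cont_rng: "continuous_map Z (arr G) f \<Longrightarrow> continuous_map Z (obj G) (\<lambda>z. rng G (f z))"
  using continuous_map_compose[OF _ continuous_rng] by (simp add: o_def)

lemma cont_inv: "continuous_map Z (arr G) f \<Longrightarrow> continuous_map Z (arr G) (\<lambda>z. invs G (f z))"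
  using continuous_map_compose[OF _ inv_continuous] by (simp add: o_def)

lemma cont_mult:
  assumes "continuous_map Z (arr G) f" "continuous_map Z (arr G) h"
    and "\<And>z. z \<in> topspace Z \<Longrightarrow> src G (f z) = rng G (h z)"
  shows "continuous_map Z (arr G) (\<lambda>z. mult G (f z) (h z))"
  by (rule continuous_map_pair_compose[OF mult_continuous assms(1,2)]) (use assms in auto)

text \<open>If r is injective on a neighbourhood U of a unit and both g and r(g) lie in U, then
  r(r(g)) = r(g) forces g = r(g). So arrows close to a unit are units.\<close>

lemma openin_units: "openin (arr G) (units G)"
proof (subst openin_subopen, intro ballI)
  fix u assume u: "u \<in> units G"
  then have ut: "u \<in> topspace (arr G)" using units_subset by blast
  obtain U where U: "openin (arr G) U" "u \<in> U" "inj_on (rng G) U"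
    using local_homeomorphism_inj_on[OF rng_local_homeo ut] .
  define T where "T = {g \<in> topspace (arr G). rng G g \<in> U} \<inter> U"
  have "continuous_map (arr G) (arr G) (rng G)" using continuous_obj_arr continuous_rng by blast
  then have "openin (arr G) T"
    unfolding T_def using U openin_continuous_map_preimage by blast
  moreover have "u \<in> T" using u ut U by (simp add: T_def rng_unit)
  moreover have "T \<subseteq> units G"
  proof
    fix g assume g: "g \<in> T"
    then have "rng G (rng G g) = rng G g" by (simp add: T_def rng_unit rng_units)
    then have "rng G g = g" using g U(3) by (auto simp: T_def dest: inj_onD)
    then show "g \<in> units G" using g rng_units[of g] by (simp add: T_def)
  qed
  ultimately show "\<exists>T. openin (arr G) T \<and> u \<in> T \<and> T \<subseteq> units G" by blast
qed

lemma openin_obj_iff: "openin (obj G) U \<longleftrightarrow> openin (arr G) U \<and> U \<subseteq> units G"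
  unfolding obj_def using openin_open_subtopology[OF openin_units] by blast

lemma openin_src_preimage: "openin (obj G) U \<Longrightarrow> openin (arr G) {g \<in> topspace (arr G). src G g \<in> U}"
  using continuous_src openin_continuous_map_preimage by blast

lemma openin_rng_preimage: "openin (obj G) U \<Longrightarrow> openin (arr G) {g \<in> topspace (arr G). rng G g \<in> U}"
  using continuous_rng openin_continuous_map_preimage by blast

lemma bisectionD:
  assumes "V \<in> bisections G"
  shows "openin (arr G) V" "inj_on (rng G) V" "inj_on (src G) V" "V \<subseteq> topspace (arr G)"
    "openin (obj G) (src G ` V)" "openin (obj G) (rng G ` V)"
  using assms open_src open_rng
  by (auto simp: bisections_def open_map_def dest: openin_subset)

lemma bisection_in: "V \<in> bisections G \<Longrightarrow> g \<in> V \<Longrightarrow> g \<in> topspace (arr G)"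
  using bisectionD(4) by blast

lemma bisection_rng_eq: "\<lbrakk>V \<in> bisections G; g \<in> V; h \<in> V; rng G g = rng G h\<rbrakk> \<Longrightarrow> g = h"
  and bisection_src_eq: "\<lbrakk>V \<in> bisections G; g \<in> V; h \<in> V; src G g = src G h\<rbrakk> \<Longrightarrow> g = h"
  by (auto simp: bisections_def dest: inj_onD)

lemma bisection_subset: "\<lbrakk>V \<in> bisections G; openin (arr G) U; U \<subseteq> V\<rbrakk> \<Longrightarrow> U \<in> bisections G"
  by (auto simp: bisections_def intro: inj_on_subset)

lemma bisection_Int: "\<lbrakk>V \<in> bisections G; openin (arr G) U\<rbrakk> \<Longrightarrow> V \<inter> U \<in> bisections G"
  by (rule bisection_subset) (auto dest: bisectionD)

lemma open_obj_bisection: "openin (obj G) U \<Longrightarrow> U \<in> bisections G"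
  by (auto simp: bisections_def openin_obj_iff inj_on_def src_unit rng_unit subset_iff)

lemma bisection_exists:
  assumes "openin (arr G) U" "g \<in> U"
  obtains V where "V \<in> bisections G" "g \<in> V" "V \<subseteq> U"
proof -
  have g: "g \<in> topspace (arr G)" using assms openin_subset by blast
  obtain V where V: "openin (arr G) V" "g \<in> V" "inj_on (rng G) V"
    using local_homeomorphism_inj_on[OF rng_local_homeo g] .
  obtain W where W: "openin (arr G) W" "g \<in> W" "inj_on (src G) W"
    using local_homeomorphism_inj_on[OF src_local_homeo g] .
  have "V \<inter> W \<inter> U \<in> bisections G"
    using V W assms unfolding bisections_def by (auto intro: inj_on_subset)
  then show thesis using that V W assms by blast
qed

lemma ssec: "V \<in> bisections G \<Longrightarrow> u \<in> src G ` V \<Longrightarrow> ssec V u \<in> V \<and> src G (ssec V u) = u"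
  by (simp add: f_inv_into_f inv_into_into)

lemma rsec: "V \<in> bisections G \<Longrightarrow> u \<in> rng G ` V \<Longrightarrow> rsec V u \<in> V \<and> rng G (rsec V u) = u"
  by (simp add: f_inv_into_f inv_into_into)

lemma ssec_eq: "V \<in> bisections G \<Longrightarrow> g \<in> V \<Longrightarrow> src G g = u \<Longrightarrow> ssec V u = g"
  using bisectionD(3) inv_into_f_f by metis

lemma rsec_eq: "V \<in> bisections G \<Longrightarrow> g \<in> V \<Longrightarrow> rng G g = u \<Longrightarrow> rsec V u = g"
  using bisectionD(2) inv_into_f_f by metis

lemma cont_ssec:
  assumes "V \<in> bisections G" "continuous_map Z (obj G) f" "\<And>z. z \<in> topspace Z \<Longrightarrow> f z \<in> src G ` V"
  shows "continuous_map Z (arr G) (\<lambda>z. ssec V (f z))"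
  by (rule continuous_map_inv_into[OF open_src]) (use assms bisectionD in auto)

lemma cont_rsec:
  assumes "V \<in> bisections G" "continuous_map Z (obj G) f" "\<And>z. z \<in> topspace Z \<Longrightarrow> f z \<in> rng G ` V"
  shows "continuous_map Z (arr G) (\<lambda>z. rsec V (f z))"
  by (rule continuous_map_inv_into[OF open_rng]) (use assms bisectionD in auto)

section \<open>Cancellation in a groupoid and products of bisections\<close>

lemma mult_inv_cancel_left:
  "\<lbrakk>g \<in> topspace (arr G); h \<in> topspace (arr G); src G g = rng G h\<rbrakk> \<Longrightarrow>
    mult G (invs G g) (mult G g h) = h"
  by (metis inv_closed inv_left mult_assoc src_inv unit_left)

lemma mult_inv_cancel_left':
  "\<lbrakk>g \<in> topspace (arr G); h \<in> topspace (arr G); rng G g = rng G h\<rbrakk> \<Longrightarrow>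
    mult G g (mult G (invs G g) h) = h"
  by (metis inv_closed inv_right mult_assoc rng_inv src_inv unit_left)

lemma mult_inv_cancel_right:
  "\<lbrakk>g \<in> topspace (arr G); h \<in> topspace (arr G); src G g = rng G h\<rbrakk> \<Longrightarrow>
    mult G (mult G g h) (invs G h) = g"
  by (metis inv_closed inv_right mult_assoc rng_inv unit_right)

lemma mult_inv_cancel_right':
  "\<lbrakk>g \<in> topspace (arr G); h \<in> topspace (arr G); src G g = src G h\<rbrakk> \<Longrightarrow>
    mult G (mult G g (invs G h)) h = g"
  by (metis inv_closed inv_left mult_assoc rng_inv src_inv unit_right)

lemma inv_inv: "g \<in> topspace (arr G) \<Longrightarrow> invs G (invs G g) = g"
  by (metis inv_closed inv_left mult_inv_cancel_left src_inv rng_inv unit_right)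

lemma inv_mult_unit_eq:
  "\<lbrakk>g \<in> topspace (arr G); h \<in> topspace (arr G); rng G g = rng G h; mult G (invs G g) h \<in> units G\<rbrakk>
    \<Longrightarrow> g = h"
  by (metis inv_closed mult_inv_cancel_left' src_inv src_mult src_unit rng_inv rng_mult rng_unit unit_right)

lemma idempotent_unit:
  "\<lbrakk>g \<in> topspace (arr G); src G g = rng G g; mult G g g = g\<rbrakk> \<Longrightarrow> g \<in> units G"
  by (metis inv_left mult_inv_cancel_left src_units)

lemma bisection_inv: "V \<in> bisections G \<Longrightarrow> invs G ` V \<in> bisections G"
proof -
  assume V: "V \<in> bisections G"
  have "invs G ` V = {g \<in> topspace (arr G). invs G g \<in> V}"
    using bisection_in[OF V] by (auto simp: inv_inv inv_closed image_iff) (metis inv_inv)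
  moreover have "openin (arr G) {g \<in> topspace (arr G). invs G g \<in> V}"
    using bisectionD(1)[OF V] inv_continuous openin_continuous_map_preimage by blast
  moreover have "inj_on (rng G) (invs G ` V)" "inj_on (src G) (invs G ` V)"
    using V bisection_in[OF V] bisection_rng_eq[OF V] bisection_src_eq[OF V]
    by (auto simp: inj_on_def src_inv rng_inv intro!: arg_cong[of _ _ "invs G"])
  ultimately show ?thesis by (simp add: bisections_def)
qed

text \<open>A factorisation x = v w with v in V has only one candidate for v, the arrow of V with
  range r(x). So x lies in VW if and only if inverse(v) x lies in W, and VW is the preimage of W
  under a continuous map on an open set. The same device reappears for products with bisections of X
  and for actions on units.\<close>

lemma openin_set_mult_bisection:
  assumes V: "V \<in> bisections G" and W: "openin (arr G) W"
  shows "openin (arr G) (set_mult G V W)"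
proof -
  define E where "E = {x \<in> topspace (arr G). rng G x \<in> rng G ` V}"
  have E: "openin (arr G) E" unfolding E_def
    using openin_rng_preimage bisectionD(6)[OF V] by blast
  have "set_mult G V W = {x \<in> E. mult G (invs G (rsec V (rng G x))) x \<in> W}"
  proof (intro set_eqI iffI)
    fix x assume "x \<in> set_mult G V W"
    then obtain v w where vw: "v \<in> V" "w \<in> W" "src G v = rng G w" "x = mult G v w"
      by (auto simp: set_mult_def)
    have t: "v \<in> topspace (arr G)" "w \<in> topspace (arr G)"
      using vw bisection_in[OF V] openin_subset[OF W] by auto
    have "rng G x = rng G v" using vw t by (simp add: rng_mult)
    then have "rsec V (rng G x) = v" using rsec_eq[OF V] vw by metis
    then show "x \<in> {x \<in> E. mult G (invs G (rsec V (rng G x))) x \<in> W}"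
      using vw t by (auto simp: E_def mult_closed rng_mult mult_inv_cancel_left)
  next
    fix x assume "x \<in> {x \<in> E. mult G (invs G (rsec V (rng G x))) x \<in> W}"
    then have x: "x \<in> topspace (arr G)" "rng G x \<in> rng G ` V"
      "mult G (invs G (rsec V (rng G x))) x \<in> W" by (auto simp: E_def)
    define v where "v = rsec V (rng G x)"
    have v: "v \<in> V" "rng G v = rng G x" using rsec[OF V x(2)] by (auto simp: v_def)
    have vt: "v \<in> topspace (arr G)" using bisection_in[OF V v(1)] .
    have "x = mult G v (mult G (invs G v) x)" using mult_inv_cancel_left' vt x v by simp
    moreover have "src G v = rng G (mult G (invs G v) x)"
      using vt x v by (simp add: rng_mult inv_closed src_inv rng_inv)
    ultimately show "x \<in> set_mult G V W"
      unfolding set_mult_def using v x(3) by (auto simp: v_def)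
  qed
  moreover have "openin (arr G) {x \<in> E. mult G (invs G (rsec V (rng G x))) x \<in> W}"
  proof (rule openin_preimage_subtopology[OF _ E W])
    have *: "continuous_map (subtopology (arr G) E) (arr G) (\<lambda>x. x)"
      by (simp add: continuous_map_from_subtopology)
    show "continuous_map (subtopology (arr G) E) (arr G)
       (\<lambda>x. mult G (invs G (rsec V (rng G x))) x)"
      by (intro cont_mult cont_inv cont_rsec cont_rng * V)
        (use rsec[OF V] bisection_in[OF V] in \<open>auto simp: E_def src_inv\<close>)
  qed
  ultimately show ?thesis by simp
qed

lemma openin_set_mult:
  assumes V: "openin (arr G) V" and W: "openin (arr G) W"
  shows "openin (arr G) (set_mult G V W)"
proof (subst openin_subopen, intro ballI)
  fix x assume "x \<in> set_mult G V W"
  then obtain v w where vw: "v \<in> V" "w \<in> W" "src G v = rng G w" "x = mult G v w"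
    by (auto simp: set_mult_def)
  obtain V' where "V' \<in> bisections G" "v \<in> V'" "V' \<subseteq> V" using bisection_exists[OF V vw(1)] .
  then show "\<exists>T. openin (arr G) T \<and> x \<in> T \<and> T \<subseteq> set_mult G V W"
    using openin_set_mult_bisection[OF _ W, of V'] vw
    by (intro exI[of _ "set_mult G V' W"]) (auto simp: set_mult_def)
qed

lemma bisection_set_mult:
  assumes V: "V \<in> bisections G" and W: "W \<in> bisections G"
  shows "set_mult G V W \<in> bisections G"
proof -
  have "inj_on (rng G) (set_mult G V W)"
  proof (rule inj_onI)
    fix x y assume "x \<in> set_mult G V W" "y \<in> set_mult G V W" and e: "rng G x = rng G y"
    then obtain v w v' w' where *: "v \<in> V" "w \<in> W" "src G v = rng G w" "x = mult G v w"
      "v' \<in> V" "w' \<in> W" "src G v' = rng G w'" "y = mult G v' w'" by (auto simp: set_mult_def)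
    then have "v = v'" using e bisection_rng_eq[OF V] by (metis rng_mult bisection_in V W)
    moreover from this have "w = w'" using * bisection_rng_eq[OF W] by metis
    ultimately show "x = y" using * by simp
  qed
  moreover have "inj_on (src G) (set_mult G V W)"
  proof (rule inj_onI)
    fix x y assume "x \<in> set_mult G V W" "y \<in> set_mult G V W" and e: "src G x = src G y"
    then obtain v w v' w' where *: "v \<in> V" "w \<in> W" "src G v = rng G w" "x = mult G v w"
      "v' \<in> V" "w' \<in> W" "src G v' = rng G w'" "y = mult G v' w'" by (auto simp: set_mult_def)
    then have "w = w'" using e bisection_src_eq[OF W] by (metis src_mult bisection_in V W)
    moreover from this have "v = v'" using * bisection_src_eq[OF V] by metis
    ultimately show "x = y" using * by simp
  qed
  ultimately show ?thesis
    using openin_set_mult_bisection[OF V bisectionD(1)[OF W]] by (simp add: bisections_def)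
qed

lemma obj_separate:
  assumes "u \<in> units G" "v \<in> units G" "u \<noteq> v"
  obtains N N' where "openin (obj G) N" "openin (obj G) N'" "u \<in> N" "v \<in> N'" "N \<inter> N' = {}"
  using Hausdorff_obj assms unfolding Hausdorff_space_def disjnt_def
  by (metis topspace_obj)

text \<open>One inclusion of neighbourhood filters suffices in a Hausdorff space. Equations between
  objects are proved in this way whenever only open sets of objects are under control.\<close>

lemma obj_eqI:
  assumes "u \<in> units G" "v \<in> units G" "\<And>N. openin (obj G) N \<Longrightarrow> u \<in> N \<Longrightarrow> v \<in> N"
  shows "u = v"
  using obj_separate[OF assms(1,2)] assms(3) by (metis IntI empty_iff)

lemma arr_compact_nbhd:
  assumes "openin (arr G) U" "g \<in> U"
  obtains V C where "V \<in> bisections G" "g \<in> V" "V \<subseteq> C" "C \<subseteq> U" "compactin (arr G) C"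
proof -
  obtain B where B: "B \<in> bisections G" "g \<in> B" "B \<subseteq> U" using bisection_exists[OF assms] .
  obtain V C where "openin (arr G) V" "g \<in> V" "V \<subseteq> C" "C \<subseteq> B" "compactin (arr G) C"
    using locally_compact_space_nbhd[OF locally_compact_obj open_src continuous_src
        bisectionD(1)[OF B(1)] bisectionD(3)[OF B(1)] B(2) Hausdorff_obj] .
  then show thesis using that B bisection_subset[OF B(1)] by (meson order_trans)
qed

end

section \<open>Groupoid correspondences\<close>

locale correspondence_setting = etale_groupoid G + groupoid_correspondence G X
  for G :: "'g groupoid" and X :: "('g, 'x) correspondence"
begin

abbreviation arrs where "arrs \<equiv> topspace (arr G)"
abbreviation pts where "pts \<equiv> topspace (spc X)"
abbreviation xsec where "xsec U \<equiv> inv_into U (ranchor X)"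

lemma continuous_ranchor: "continuous_map (spc X) (obj G) (ranchor X)"
  and open_ranchor: "open_map (spc X) (obj G) (ranchor X)"
  using ranchor_local_homeo
  by (auto intro: local_homeomorphism_continuous_map local_homeomorphism_open_map)

lemma lanchor_units: "x \<in> pts \<Longrightarrow> lanchor X x \<in> units G"
  using continuous_map_image_subset_topspace[OF lanchor_continuous] by auto

lemma ranchor_units: "x \<in> pts \<Longrightarrow> ranchor X x \<in> units G"
  using continuous_map_image_subset_topspace[OF continuous_ranchor] by auto

lemma lact_closed: "\<lbrakk>g \<in> arrs; x \<in> pts; src G g = lanchor X x\<rbrakk> \<Longrightarrow> lact X g x \<in> pts"
  using continuous_map_image_subset_topspace[OF lact_continuous] by auto

lemma ract_closed: "\<lbrakk>x \<in> pts; g \<in> arrs; ranchor X x = rng G g\<rbrakk> \<Longrightarrow> ract X x g \<in> pts"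
  using continuous_map_image_subset_topspace[OF ract_continuous] by auto

lemma cont_lanchor: "continuous_map Z (spc X) f \<Longrightarrow> continuous_map Z (obj G) (\<lambda>z. lanchor X (f z))"
  using continuous_map_compose[OF _ lanchor_continuous] by (simp add: o_def)

lemma cont_ranchor: "continuous_map Z (spc X) f \<Longrightarrow> continuous_map Z (obj G) (\<lambda>z. ranchor X (f z))"
  using continuous_map_compose[OF _ continuous_ranchor] by (simp add: o_def)

lemma cont_lact:
  assumes "continuous_map Z (arr G) f" "continuous_map Z (spc X) h"
    and "\<And>z. z \<in> topspace Z \<Longrightarrow> src G (f z) = lanchor X (h z)"
  shows "continuous_map Z (spc X) (\<lambda>z. lact X (f z) (h z))"
  by (rule continuous_map_pair_compose[OF lact_continuous assms(1,2)]) (use assms in auto)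

lemma cont_ract:
  assumes "continuous_map Z (spc X) f" "continuous_map Z (arr G) h"
    and "\<And>z. z \<in> topspace Z \<Longrightarrow> ranchor X (f z) = rng G (h z)"
  shows "continuous_map Z (spc X) (\<lambda>z. ract X (f z) (h z))"
  by (rule continuous_map_pair_compose[OF ract_continuous assms(1,2)]) (use assms in auto)

lemma openin_lanchor_preimage: "openin (obj G) U \<Longrightarrow> openin (spc X) {x \<in> pts. lanchor X x \<in> U}"
  using lanchor_continuous openin_continuous_map_preimage by blast

lemma openin_ranchor_preimage: "openin (obj G) U \<Longrightarrow> openin (spc X) {x \<in> pts. ranchor X x \<in> U}"
  using continuous_ranchor openin_continuous_map_preimage by blast

lemma lact_inv_cancel:
  "\<lbrakk>g \<in> arrs; x \<in> pts; src G g = lanchor X x\<rbrakk> \<Longrightarrow> lact X (invs G g) (lact X g x) = x"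
  by (metis inv_closed inv_left lact_mult lact_unit src_inv)

lemma lact_inv_cancel':
  "\<lbrakk>g \<in> arrs; x \<in> pts; rng G g = lanchor X x\<rbrakk> \<Longrightarrow> lact X g (lact X (invs G g) x) = x"
  by (metis inv_closed inv_right lact_mult lact_unit src_inv rng_inv)

lemma ract_inv_cancel:
  "\<lbrakk>x \<in> pts; g \<in> arrs; ranchor X x = rng G g\<rbrakk> \<Longrightarrow> ract X (ract X x g) (invs G g) = x"
  by (metis inv_closed inv_right ract_mult ract_unit src_inv rng_inv)

lemma ract_inv_cancel':
  "\<lbrakk>x \<in> pts; g \<in> arrs; ranchor X x = src G g\<rbrakk> \<Longrightarrow> ract X (ract X x (invs G g)) g = x"
  by (metis inv_closed inv_left ract_mult ract_unit src_inv rng_inv)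

text \<open>Two arrows with the same effect on x have a quotient g inverse(h) that fixes x, and
  freeness makes this a unit.\<close>

lemma ract_free_eq:
  assumes "x \<in> pts" "g \<in> arrs" "h \<in> arrs" "ranchor X x = rng G g" "ranchor X x = rng G h"
    "ract X x g = ract X x h"
  shows "g = h"
proof -
  have s: "src G g = src G h" using assms by (metis ranchor_ract)
  have "ract X x (mult G g (invs G h)) = x"
    using assms s by (metis inv_closed ract_mult ract_inv_cancel rng_inv)
  then have u: "mult G g (invs G h) \<in> units G"
    using assms s by (intro ract_free) (auto simp: mult_closed inv_closed rng_inv rng_mult)
  then have "mult G g (invs G h) = rng G g"
    using assms s by (metis inv_closed rng_inv rng_mult rng_unit)
  then show ?thesis using assms s by (metis mult_inv_cancel_right' unit_left)
qed

subsection \<open>The orbit space\<close>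

abbreviation orb where "orb \<equiv> orbit G X"
abbreviation XG where "XG \<equiv> orbit_space G X"

lemma orbit_self: "x \<in> pts \<Longrightarrow> x \<in> orb x"
  unfolding orbit_def using ract_unit[of x] ranchor_units[of x] unit_closed rng_unit by (auto intro!: exI[of _ "ranchor X x"])

lemma orbit_ract:
  assumes "x \<in> pts" "g \<in> arrs" "ranchor X x = rng G g"
  shows "orb (ract X x g) = orb x"
proof (intro equalityI subsetI)
  fix z assume "z \<in> orb (ract X x g)"
  then obtain h where h: "h \<in> arrs" "src G g = rng G h" "z = ract X (ract X x g) h"
    using assms by (auto simp: orbit_def ranchor_ract)
  then have "z = ract X x (mult G g h)" using assms ract_mult by metis
  then show "z \<in> orb x" using h(1,2) assms mult_closed[of g h] rng_mult[of g h]
    unfolding orbit_def by (auto intro!: exI[of _ "mult G g h"])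
next
  fix z assume "z \<in> orb x"
  then obtain h where h: "h \<in> arrs" "ranchor X x = rng G h" "z = ract X x h" by (auto simp: orbit_def)
  have k: "mult G (invs G g) h \<in> arrs" "rng G (mult G (invs G g) h) = src G g"
    using h assms by (auto simp: mult_closed inv_closed src_inv rng_mult rng_inv)
  have "z = ract X x (mult G g (mult G (invs G g) h))" using h assms by (simp add: mult_inv_cancel_left')
  also have "\<dots> = ract X (ract X x g) (mult G (invs G g) h)" using assms k by (simp add: ract_mult)
  finally show "z \<in> orb (ract X x g)" using k assms unfolding orbit_def by (auto simp: ranchor_ract)
qed

lemma orbit_eqD:
  assumes "x \<in> pts" "y \<in> pts" "orb x = orb y"
  obtains g where "g \<in> arrs" "ranchor X x = rng G g" "y = ract X x g"
  using orbit_self[OF assms(2)] assms(3)[symmetric] that unfolding orbit_def by auto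

lemma topspace_XG [simp]: "topspace XG = orb ` pts"
  by (simp add: orbit_space_def)

lemma continuous_orbit: "continuous_map (spc X) XG orb"
  unfolding orbit_space_def using quotient_map_quotient_topology quotient_imp_continuous_map by blast

text \<open>If y = x g lies in U, a bisection through g extends g to a continuous choice of arrows
  near x. Multiplication by these arrows moves a neighbourhood of x into U without leaving orbits,
  so the saturation of U is open.\<close>

lemma open_orbit: "open_map (spc X) XG orb"
  unfolding open_map_def
proof (intro allI impI)
  fix U assume U: "openin (spc X) U"
  then have Us: "U \<subseteq> pts" by (rule openin_subset)
  have "openin (spc X) {x \<in> pts. orb x \<in> orb ` U}"
  proof (subst openin_subopen, intro ballI)
    fix x assume "x \<in> {x \<in> pts. orb x \<in> orb ` U}"
    then obtain y where y: "x \<in> pts" "y \<in> U" "orb x = orb y" by auto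
    then obtain g where g: "g \<in> arrs" "ranchor X x = rng G g" "y = ract X x g"
      using orbit_eqD[of x y] Us by blast
    obtain V where V: "V \<in> bisections G" "g \<in> V" using bisection_exists[of "arrs" g] g by auto
    define E where "E = {x \<in> pts. ranchor X x \<in> rng G ` V}"
    have E: "openin (spc X) E" unfolding E_def
      using openin_ranchor_preimage bisectionD(6)[OF V(1)] by blast
    define T where "T = {z \<in> E. ract X z (rsec V (ranchor X z)) \<in> U}"
    have *: "continuous_map (subtopology (spc X) E) (spc X) (\<lambda>x. x)"
      by (simp add: continuous_map_from_subtopology)
    have "openin (spc X) T" unfolding T_def
      by (rule openin_preimage_subtopology[OF _ E U], intro cont_ract cont_rsec cont_ranchor * V)
        (use rsec[OF V(1)] in \<open>auto simp: E_def\<close>)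
    moreover have "x \<in> T" using rsec_eq[OF V(1,2)] g y V by (auto simp: T_def E_def)
    moreover have "T \<subseteq> {x \<in> pts. orb x \<in> orb ` U}"
    proof
      fix z assume z: "z \<in> T"
      define h where "h = rsec V (ranchor X z)"
      have h: "h \<in> V" "rng G h = ranchor X z" using z rsec[OF V(1)] by (auto simp: T_def E_def h_def)
      then have "orb (ract X z h) = orb z" using z bisection_in[OF V(1)] by (intro orbit_ract) (auto simp: T_def E_def)
      then show "z \<in> {x \<in> pts. orb x \<in> orb ` U}"
        using z unfolding T_def E_def h_def by (smt (verit, best) image_eqI mem_Collect_eq)
    qed
    ultimately show "\<exists>T. openin (spc X) T \<and> x \<in> T \<and> T \<subseteq> {x \<in> pts. orb x \<in> orb ` U}" by blast
  qed
  then show "openin XG (orb ` U)"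
    unfolding orbit_space_def openin_quotient_topology using Us by auto
qed

text \<open>Proper maps are closed. Taking all arrows for C gives a closed orbit relation and a
  Hausdorff orbit space; taking the non-units gives local injectivity of the orbit map.\<close>

lemma closed_orbit_relation:
  assumes "C \<subseteq> arrs" "closedin (arr G) C"
  shows "closedin (prod_topology (spc X) (spc X))
    {(x, ract X x g) | x g. x \<in> pts \<and> g \<in> C \<and> ranchor X x = rng G g}"
proof -
  let ?D = "subtopology (prod_topology (spc X) (arr G)) {(x, g). ranchor X x = rng G g}"
  have "continuous_map ?D (arr G) snd"
    by (simp add: continuous_map_from_subtopology continuous_map_snd)
  then have "closedin ?D {z \<in> topspace ?D. snd z \<in> C}"
    using assms(2) closedin_continuous_map_preimage by blast
  then have "closedin (prod_topology (spc X) (spc X))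
     ((\<lambda>(x, g). (x, ract X x g)) ` {z \<in> topspace ?D. snd z \<in> C})"
    using ract_proper unfolding proper_map_def closed_map_def by blast
  also have "(\<lambda>(x, g). (x, ract X x g)) ` {z \<in> topspace ?D. snd z \<in> C} =
    {(x, ract X x g) | x g. x \<in> pts \<and> g \<in> C \<and> ranchor X x = rng G g}"
    using assms(1) by (auto simp: image_iff)
  finally show ?thesis .
qed

lemma closed_relation_separate:
  assumes "closedin (prod_topology Y Y) D" "x \<in> topspace Y" "y \<in> topspace Y" "(x, y) \<notin> D"
  obtains U V where "openin Y U" "openin Y V" "x \<in> U" "y \<in> V" "U \<times> V \<inter> D = {}"
proof -
  have "openin (prod_topology Y Y) (topspace (prod_topology Y Y) - D)" using assms(1) by blast
  moreover have "(x, y) \<in> topspace (prod_topology Y Y) - D" using assms(2-4) by simp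
  ultimately obtain U V where "openin Y U" "openin Y V" "x \<in> U" "y \<in> V"
      "U \<times> V \<subseteq> topspace (prod_topology Y Y) - D"
    unfolding openin_prod_topology_alt by meson
  then show thesis using that[of U V] by blast
qed

text \<open>The orbit relation is closed and the orbit map is open, so a rectangle that avoids the
  relation projects to disjoint open sets.\<close>

lemma Hausdorff_XG: "Hausdorff_space XG"
  unfolding Hausdorff_space_def
proof (intro allI impI)
  fix C C' assume "C \<in> topspace XG \<and> C' \<in> topspace XG \<and> C \<noteq> C'"
  then obtain x y where xy: "x \<in> pts" "y \<in> pts" "C = orb x" "C' = orb y" "orb x \<noteq> orb y" by auto
  let ?D = "{(x, ract X x g) | x g. x \<in> pts \<and> g \<in> arrs \<and> ranchor X x = rng G g}"
  have "(x, y) \<notin> ?D" using xy(5) orbit_ract by auto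
  moreover have "closedin (prod_topology (spc X) (spc X)) ?D"
    by (rule closed_orbit_relation) auto
  ultimately obtain U V where UV: "openin (spc X) U" "openin (spc X) V" "x \<in> U" "y \<in> V" "U \<times> V \<inter> ?D = {}"
    using closed_relation_separate[OF _ xy(1,2), of ?D] by blast
  have "disjnt (orb ` U) (orb ` V)"
  proof (rule ccontr)
    assume "\<not> disjnt (orb ` U) (orb ` V)"
    then obtain u v where uv: "u \<in> U" "v \<in> V" "orb u = orb v" unfolding disjnt_def by auto
    then have "u \<in> pts" "v \<in> pts" using UV openin_subset by blast+
    then obtain g where "g \<in> arrs" "ranchor X u = rng G g" "v = ract X u g"
      using orbit_eqD uv(3) by metis
    then have "(u, v) \<in> U \<times> V \<inter> ?D" using uv \<open>u \<in> pts\<close> by blast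
    then show False using UV(5) by blast
  qed
  moreover have "openin XG (orb ` U)" "openin XG (orb ` V)"
    using UV(1,2) open_orbit unfolding open_map_def by auto
  moreover have "C \<in> orb ` U" "C' \<in> orb ` V" using UV(3,4) xy(3,4) by auto
  ultimately show "\<exists>U V. openin XG U \<and> openin XG V \<and> C \<in> U \<and> C' \<in> V \<and> disjnt U V"
    by blast
qed

section \<open>Bisections of X and compact sets of orbits\<close>

lemma corr_bisectionD:
  assumes "U \<in> corr_bisections G X"
  shows "openin (spc X) U" "inj_on (ranchor X) U" "inj_on orb U" "U \<subseteq> pts"
    "openin (obj G) (ranchor X ` U)"
  using assms open_ranchor by (auto simp: corr_bisections_def open_map_def dest: openin_subset)

lemma corr_bisection_in: "U \<in> corr_bisections G X \<Longrightarrow> x \<in> U \<Longrightarrow> x \<in> pts"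
  using corr_bisectionD(4) by blast

lemma corr_bisection_orb_eq: "\<lbrakk>U \<in> corr_bisections G X; x \<in> U; y \<in> U; orb x = orb y\<rbrakk> \<Longrightarrow> x = y"
  and corr_bisection_ranchor_eq:
    "\<lbrakk>U \<in> corr_bisections G X; x \<in> U; y \<in> U; ranchor X x = ranchor X y\<rbrakk> \<Longrightarrow> x = y"
  by (auto simp: corr_bisections_def dest: inj_onD)

lemma corr_bisection_subset:
  "\<lbrakk>U \<in> corr_bisections G X; openin (spc X) V; V \<subseteq> U\<rbrakk> \<Longrightarrow> V \<in> corr_bisections G X"
  by (auto simp: corr_bisections_def intro: inj_on_subset)

lemma corr_bisection_Int:
  "\<lbrakk>U \<in> corr_bisections G X; openin (spc X) V\<rbrakk> \<Longrightarrow> U \<inter> V \<in> corr_bisections G X"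
  by (rule corr_bisection_subset) (auto dest: corr_bisectionD)

text \<open>Local injectivity of the orbit map: the units are open and the right action is free and
  proper, so the pairs (y, yg) with non-unit g form a closed set that avoids the diagonal.\<close>

lemma corr_bisection_exists:
  assumes "openin (spc X) U" "x \<in> U"
  obtains V where "V \<in> corr_bisections G X" "x \<in> V" "V \<subseteq> U"
proof -
  have x: "x \<in> pts" using assms openin_subset by blast
  obtain A where A: "openin (spc X) A" "x \<in> A" "inj_on (ranchor X) A"
    using local_homeomorphism_inj_on[OF ranchor_local_homeo x] .
  let ?D = "{(x, ract X x g) | x g. x \<in> pts \<and> g \<in> arrs - units G \<and> ranchor X x = rng G g}"
  have "closedin (prod_topology (spc X) (spc X)) ?D"
    by (rule closed_orbit_relation) (use openin_units in auto)
  moreover have "(x, x) \<notin> ?D" using ract_free[OF x] by auto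
  ultimately obtain B C where BC: "openin (spc X) B" "openin (spc X) C" "x \<in> B" "x \<in> C" "B \<times> C \<inter> ?D = {}"
    using closed_relation_separate[OF _ x x, of ?D] by blast
  let ?V = "A \<inter> (B \<inter> C) \<inter> U"
  have o: "openin (spc X) ?V" using A BC assms by blast
  have "inj_on orb ?V"
  proof (rule inj_onI)
    fix y z assume yz: "y \<in> ?V" "z \<in> ?V" "orb y = orb z"
    then have p: "y \<in> pts" "z \<in> pts" using openin_subset[OF o] by blast+
    then obtain g where g: "g \<in> arrs" "ranchor X y = rng G g" "z = ract X y g"
      using orbit_eqD yz(3) by metis
    then have "g \<in> units G" using BC(5) yz p by blast
    then show "y = z" using g p by (metis ract_unit rng_unit)
  qed
  then have "?V \<in> corr_bisections G X"
    using o A(3) by (auto simp: corr_bisections_def intro: inj_on_subset)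
  then show thesis using that A BC assms by blast
qed

lemma corr_compact_nbhd:
  assumes "openin (spc X) U" "x \<in> U"
  obtains V C where "V \<in> corr_bisections G X" "x \<in> V" "V \<subseteq> C" "C \<subseteq> U" "compactin (spc X) C"
proof -
  obtain B where B: "B \<in> corr_bisections G X" "x \<in> B" "B \<subseteq> U" using corr_bisection_exists[OF assms] .
  obtain V C where "openin (spc X) V" "x \<in> V" "V \<subseteq> C" "C \<subseteq> B" "compactin (spc X) C"
    using locally_compact_space_nbhd[OF locally_compact_obj open_ranchor continuous_ranchor
        corr_bisectionD(1)[OF B(1)] corr_bisectionD(2)[OF B(1)] B(2) Hausdorff_obj] .
  then show thesis using that B corr_bisection_subset[OF B(1)] by (meson order_trans)
qed

lemma compactin_orbit_image: "compactin (spc X) K \<Longrightarrow> compactin XG (orb ` K)"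
  using continuous_orbit image_compactin by blast

text \<open>Precompact bisections have open images that cover the orbit space. This reduces
  statements about a compact set of orbits to finitely many of the bisections that condition (6)
  speaks about.\<close>

lemma compactin_XG_cover:
  assumes "compactin XG K"
  obtains F where "finite F" "F \<subseteq> {U \<in> corr_bisections G X. precompact_in (spc X) U}" "K \<subseteq> orb ` \<Union>F"
proof -
  let ?F = "{U \<in> corr_bisections G X. precompact_in (spc X) U}"
  have "\<forall>U\<in>(`) orb ` ?F. openin XG U"
    using open_orbit corr_bisectionD(1) unfolding open_map_def by auto
  moreover have "K \<subseteq> \<Union>((`) orb ` ?F)"
  proof
    fix k assume "k \<in> K"
    then obtain x where x: "x \<in> pts" "k = orb x"
      using compactin_subset_topspace[OF assms] by auto
    obtain V C where "V \<in> corr_bisections G X" "x \<in> V" "V \<subseteq> C" "compactin (spc X) C"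
      using corr_compact_nbhd[OF openin_topspace x(1)] by metis
    then show "k \<in> \<Union>((`) orb ` ?F)" using x unfolding precompact_in_def by blast
  qed
  ultimately obtain FF where FF: "finite FF" "FF \<subseteq> (`) orb ` ?F" "K \<subseteq> \<Union>FF"
    using compactinD[OF assms] by meson
  obtain F where "F \<subseteq> ?F" "finite F" "FF = (`) orb ` F" using finite_subset_image[OF FF(1,2)] by metis
  then show thesis using that[of F] FF by (auto simp: image_Union)
qed

text \<open>The compact sets that contain the finitely many bisections of a cover are united. This
  yields a compact set of representatives although X may be non-Hausdorff.\<close>

lemma compactin_XG_lift:
  assumes "compactin XG K"
  obtains C where "compactin (spc X) C" "K \<subseteq> orb ` C"
proof -
  obtain F where F: "finite F" "F \<subseteq> {U \<in> corr_bisections G X. precompact_in (spc X) U}" "K \<subseteq> orb ` \<Union>F"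
    using compactin_XG_cover[OF assms] .
  then have "\<forall>U\<in>F. \<exists>C. compactin (spc X) C \<and> U \<subseteq> C" unfolding precompact_in_def by auto
  then obtain c where c: "\<And>U. U \<in> F \<Longrightarrow> compactin (spc X) (c U) \<and> U \<subseteq> c U" by metis
  then have "compactin (spc X) (\<Union>(c ` F))" using F(1) by (intro compactin_Union) auto
  moreover have "K \<subseteq> orb ` \<Union>(c ` F)" using F(3) c by blast
  ultimately show thesis using that by blast
qed

lemma orbit_anchor_orb: "x \<in> pts \<Longrightarrow> orbit_anchor X (orb x) = lanchor X x"
proof -
  assume x: "x \<in> pts"
  have "lanchor X ` orb x = {lanchor X x}"
    using x orbit_self[OF x] by (auto simp: orbit_def lanchor_ract)
  then show ?thesis by (simp add: orbit_anchor_def)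
qed

subsection \<open>Products of bisections\<close>

lemma openin_set_lact:
  assumes V: "V \<in> bisections G" and W: "openin (spc X) W"
  shows "openin (spc X) (set_lact G X V W)"
proof -
  define E where "E = {x \<in> pts. lanchor X x \<in> rng G ` V}"
  have E: "openin (spc X) E" unfolding E_def
    using openin_lanchor_preimage bisectionD(6)[OF V] by blast
  have "set_lact G X V W = {x \<in> E. lact X (invs G (rsec V (lanchor X x))) x \<in> W}"
  proof (intro set_eqI iffI)
    fix x assume "x \<in> set_lact G X V W"
    then obtain v w where vw: "v \<in> V" "w \<in> W" "src G v = lanchor X w" "x = lact X v w"
      by (auto simp: set_lact_def)
    have t: "v \<in> arrs" "w \<in> pts" using vw bisection_in[OF V] openin_subset[OF W] by auto
    have "lanchor X x = rng G v" using vw t by (simp add: lanchor_lact)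
    then have "rsec V (lanchor X x) = v" using rsec_eq[OF V] vw by metis
    then show "x \<in> {x \<in> E. lact X (invs G (rsec V (lanchor X x))) x \<in> W}"
      using vw t by (auto simp: E_def lact_closed lanchor_lact lact_inv_cancel)
  next
    fix x assume "x \<in> {x \<in> E. lact X (invs G (rsec V (lanchor X x))) x \<in> W}"
    then have x: "x \<in> pts" "lanchor X x \<in> rng G ` V" "lact X (invs G (rsec V (lanchor X x))) x \<in> W"
      by (auto simp: E_def)
    define v where "v = rsec V (lanchor X x)"
    have v: "v \<in> V" "rng G v = lanchor X x" using rsec[OF V x(2)] by (auto simp: v_def)
    have vt: "v \<in> arrs" using bisection_in[OF V v(1)] .
    have "x = lact X v (lact X (invs G v) x)" using lact_inv_cancel' vt x v by simp
    moreover have "src G v = lanchor X (lact X (invs G v) x)"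
      using vt x v by (simp add: lanchor_lact inv_closed src_inv rng_inv)
    ultimately show "x \<in> set_lact G X V W"
      unfolding set_lact_def using v x(3) by (auto simp: v_def)
  qed
  moreover have "openin (spc X) {x \<in> E. lact X (invs G (rsec V (lanchor X x))) x \<in> W}"
  proof (rule openin_preimage_subtopology[OF _ E W])
    have *: "continuous_map (subtopology (spc X) E) (spc X) (\<lambda>x. x)"
      by (simp add: continuous_map_from_subtopology)
    show "continuous_map (subtopology (spc X) E) (spc X)
       (\<lambda>x. lact X (invs G (rsec V (lanchor X x))) x)"
      by (intro cont_lact cont_inv cont_rsec cont_lanchor * V)
        (use rsec[OF V] bisection_in[OF V] in \<open>auto simp: E_def src_inv\<close>)
  qed
  ultimately show ?thesis by simp
qed

lemma orbit_lact:
  "\<lbrakk>g \<in> arrs; x \<in> pts; y \<in> pts; src G g = lanchor X x; src G g = lanchor X y; orb x = orb y\<rbrakk>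
    \<Longrightarrow> orb (lact X g x) = orb (lact X g y)"
  by (metis actions_commute lact_closed orbit_eqD orbit_ract ranchor_lact)

lemma orbit_lact_cancel:
  assumes "g \<in> arrs" "x \<in> pts" "y \<in> pts" "src G g = lanchor X x" "src G g = lanchor X y"
    "orb (lact X g x) = orb (lact X g y)"
  shows "orb x = orb y"
proof -
  have "orb (lact X (invs G g) (lact X g x)) = orb (lact X (invs G g) (lact X g y))"
    by (rule orbit_lact) (use assms in \<open>auto simp: inv_closed lact_closed src_inv lanchor_lact\<close>)
  then show ?thesis using assms by (simp add: lact_inv_cancel)
qed

lemma orbit_lanchor: "\<lbrakk>x \<in> pts; y \<in> pts; orb x = orb y\<rbrakk> \<Longrightarrow> lanchor X x = lanchor X y"
  by (metis lanchor_ract orbit_eqD)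

lemma corr_bisection_set_lact:
  assumes V: "V \<in> bisections G" and W: "W \<in> corr_bisections G X"
  shows "set_lact G X V W \<in> corr_bisections G X"
proof -
  have "inj_on (ranchor X) (set_lact G X V W)"
  proof (rule inj_onI)
    fix x y assume "x \<in> set_lact G X V W" "y \<in> set_lact G X V W" and e: "ranchor X x = ranchor X y"
    then obtain v w v' w' where *: "v \<in> V" "w \<in> W" "src G v = lanchor X w" "x = lact X v w"
      "v' \<in> V" "w' \<in> W" "src G v' = lanchor X w'" "y = lact X v' w'" by (auto simp: set_lact_def)
    then have "ranchor X w = ranchor X w'" using e by (metis ranchor_lact bisection_in V corr_bisection_in W)
    then have "w = w'" using corr_bisection_ranchor_eq[OF W] * by metis
    moreover from this have "v = v'" using * bisection_src_eq[OF V] by metis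
    ultimately show "x = y" using * by simp
  qed
  moreover have "inj_on orb (set_lact G X V W)"
  proof (rule inj_onI)
    fix x y assume "x \<in> set_lact G X V W" "y \<in> set_lact G X V W" and e: "orb x = orb y"
    then obtain v w v' w' where *: "v \<in> V" "w \<in> W" "src G v = lanchor X w" "x = lact X v w"
      "v' \<in> V" "w' \<in> W" "src G v' = lanchor X w'" "y = lact X v' w'" by (auto simp: set_lact_def)
    have t: "v \<in> arrs" "v' \<in> arrs" "w \<in> pts" "w' \<in> pts"
      using * bisection_in[OF V] corr_bisection_in[OF W] by auto
    have "rng G v = rng G v'" using orbit_lanchor[OF _ _ e] * t by (simp add: lanchor_lact lact_closed)
    then have v: "v = v'" using bisection_rng_eq[OF V] * by metis
    have "orb w = orb w'" by (rule orbit_lact_cancel[of v]) (use * v t e in auto)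
    then show "x = y" using * v corr_bisection_orb_eq[OF W] by metis
  qed
  ultimately show ?thesis
    using openin_set_lact[OF V corr_bisectionD(1)[OF W]] by (simp add: corr_bisections_def)
qed

lemma openin_set_ract:
  assumes W: "openin (spc X) W" and V: "V \<in> bisections G"
  shows "openin (spc X) (set_ract G X W V)"
proof -
  define E where "E = {x \<in> pts. ranchor X x \<in> src G ` V}"
  have E: "openin (spc X) E" unfolding E_def
    using openin_ranchor_preimage bisectionD(5)[OF V] by blast
  have "set_ract G X W V = {x \<in> E. ract X x (invs G (ssec V (ranchor X x))) \<in> W}"
  proof (intro set_eqI iffI)
    fix x assume "x \<in> set_ract G X W V"
    then obtain w v where vw: "v \<in> V" "w \<in> W" "ranchor X w = rng G v" "x = ract X w v"
      by (auto simp: set_ract_def)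
    have t: "v \<in> arrs" "w \<in> pts" using vw bisection_in[OF V] openin_subset[OF W] by auto
    have "ranchor X x = src G v" using vw t by (simp add: ranchor_ract)
    then have "ssec V (ranchor X x) = v" using ssec_eq[OF V] vw by metis
    then show "x \<in> {x \<in> E. ract X x (invs G (ssec V (ranchor X x))) \<in> W}"
      using vw t by (auto simp: E_def ract_closed ranchor_ract ract_inv_cancel)
  next
    fix x assume "x \<in> {x \<in> E. ract X x (invs G (ssec V (ranchor X x))) \<in> W}"
    then have x: "x \<in> pts" "ranchor X x \<in> src G ` V" "ract X x (invs G (ssec V (ranchor X x))) \<in> W"
      by (auto simp: E_def)
    define v where "v = ssec V (ranchor X x)"
    have v: "v \<in> V" "src G v = ranchor X x" using ssec[OF V x(2)] by (auto simp: v_def)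
    have vt: "v \<in> arrs" using bisection_in[OF V v(1)] .
    have "x = ract X (ract X x (invs G v)) v" using ract_inv_cancel' vt x v by simp
    moreover have "rng G v = ranchor X (ract X x (invs G v))"
      using vt x v by (simp add: ranchor_ract inv_closed src_inv rng_inv)
    ultimately show "x \<in> set_ract G X W V"
      unfolding set_ract_def using v x(3) unfolding v_def by (smt (verit, best) mem_Collect_eq)
  qed
  moreover have "openin (spc X) {x \<in> E. ract X x (invs G (ssec V (ranchor X x))) \<in> W}"
  proof (rule openin_preimage_subtopology[OF _ E W])
    have *: "continuous_map (subtopology (spc X) E) (spc X) (\<lambda>x. x)"
      by (simp add: continuous_map_from_subtopology)
    show "continuous_map (subtopology (spc X) E) (spc X)
       (\<lambda>x. ract X x (invs G (ssec V (ranchor X x))))"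
      by (intro cont_ract cont_inv cont_ssec cont_ranchor * V)
        (use ssec[OF V] bisection_in[OF V] in \<open>auto simp: E_def rng_inv\<close>)
  qed
  ultimately show ?thesis by simp
qed

lemma corr_bisection_set_ract:
  assumes W: "W \<in> corr_bisections G X" and V: "V \<in> bisections G"
  shows "set_ract G X W V \<in> corr_bisections G X"
proof -
  have "inj_on (ranchor X) (set_ract G X W V)"
  proof (rule inj_onI)
    fix x y assume "x \<in> set_ract G X W V" "y \<in> set_ract G X W V" and e: "ranchor X x = ranchor X y"
    then obtain v w v' w' where *: "v \<in> V" "w \<in> W" "ranchor X w = rng G v" "x = ract X w v"
      "v' \<in> V" "w' \<in> W" "ranchor X w' = rng G v'" "y = ract X w' v'" by (auto simp: set_ract_def)
    then have "src G v = src G v'" using e by (metis ranchor_ract bisection_in V corr_bisection_in W)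
    then have "v = v'" using * bisection_src_eq[OF V] by metis
    moreover from this have "w = w'" using corr_bisection_ranchor_eq[OF W] * by metis
    ultimately show "x = y" using * by simp
  qed
  moreover have "inj_on orb (set_ract G X W V)"
  proof (rule inj_onI)
    fix x y assume "x \<in> set_ract G X W V" "y \<in> set_ract G X W V" and e: "orb x = orb y"
    then obtain v w v' w' where *: "v \<in> V" "w \<in> W" "ranchor X w = rng G v" "x = ract X w v"
      "v' \<in> V" "w' \<in> W" "ranchor X w' = rng G v'" "y = ract X w' v'" by (auto simp: set_ract_def)
    then have "orb w = orb w'" using e by (metis orbit_ract bisection_in V corr_bisection_in W)
    then have "w = w'" using corr_bisection_orb_eq[OF W] * by metis
    moreover from this have "v = v'" using * bisection_rng_eq[OF V] by metis
    ultimately show "x = y" using * by simp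
  qed
  ultimately show ?thesis
    using openin_set_ract[OF corr_bisectionD(1)[OF W] V] by (simp add: corr_bisections_def)
qed

lemma xsec: "U \<in> corr_bisections G X \<Longrightarrow> u \<in> ranchor X ` U \<Longrightarrow> xsec U u \<in> U \<and> ranchor X (xsec U u) = u"
  by (simp add: f_inv_into_f inv_into_into)

lemma xsec_eq: "U \<in> corr_bisections G X \<Longrightarrow> x \<in> U \<Longrightarrow> ranchor X x = u \<Longrightarrow> xsec U u = x"
  using corr_bisectionD(2) inv_into_f_f by metis

lemma cont_xsec:
  assumes "U \<in> corr_bisections G X" "continuous_map Z (obj G) f" "\<And>z. z \<in> topspace Z \<Longrightarrow> f z \<in> ranchor X ` U"
  shows "continuous_map Z (spc X) (\<lambda>z. xsec U (f z))"
  by (rule continuous_map_inv_into[OF open_ranchor]) (use assms corr_bisectionD in auto)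

text \<open>For g in the bracket, w = v g with v in V and w in W. Either anchor of g determines one
  of v and w, hence their common orbit, hence the other one; then freeness recovers g. For openness,
  v is a continuous function of r(g).\<close>

lemma bisection_bracket:
  assumes V: "V \<in> corr_bisections G X" and W: "W \<in> corr_bisections G X"
  shows "bracket G X V W \<in> bisections G"
proof -
  define E where "E = {g \<in> arrs. rng G g \<in> ranchor X ` V}"
  have E: "openin (arr G) E" unfolding E_def
    using openin_rng_preimage corr_bisectionD(5)[OF V] by blast
  have "bracket G X V W = {g \<in> E. ract X (xsec V (rng G g)) g \<in> W}"
    using xsec[OF V] xsec_eq[OF V] unfolding bracket_def E_def by force
  moreover have "openin (arr G) {g \<in> E. ract X (xsec V (rng G g)) g \<in> W}"
  proof (rule openin_preimage_subtopology[OF _ E corr_bisectionD(1)[OF W]])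
    have *: "continuous_map (subtopology (arr G) E) (arr G) (\<lambda>x. x)"
      by (simp add: continuous_map_from_subtopology)
    show "continuous_map (subtopology (arr G) E) (spc X) (\<lambda>g. ract X (xsec V (rng G g)) g)"
      by (intro cont_ract cont_xsec cont_rng * V) (use xsec[OF V] in \<open>auto simp: E_def\<close>)
  qed
  moreover have "inj_on (rng G) (bracket G X V W)"
  proof (rule inj_onI)
    fix g h assume "g \<in> bracket G X V W" "h \<in> bracket G X V W" and e: "rng G g = rng G h"
    then obtain v v' where *: "g \<in> arrs" "v \<in> V" "ranchor X v = rng G g" "ract X v g \<in> W"
      "h \<in> arrs" "v' \<in> V" "ranchor X v' = rng G h" "ract X v' h \<in> W" by (auto simp: bracket_def)
    then have v: "v = v'" using e corr_bisection_ranchor_eq[OF V] by metis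
    have "orb (ract X v g) = orb (ract X v h)"
      using * v by (metis orbit_ract corr_bisection_in V)
    then have "ract X v g = ract X v h" using corr_bisection_orb_eq[OF W] * v by metis
    then show "g = h" using * v by (metis ract_free_eq corr_bisection_in V)
  qed
  moreover have "inj_on (src G) (bracket G X V W)"
  proof (rule inj_onI)
    fix g h assume "g \<in> bracket G X V W" "h \<in> bracket G X V W" and e: "src G g = src G h"
    then obtain v v' where *: "g \<in> arrs" "v \<in> V" "ranchor X v = rng G g" "ract X v g \<in> W"
      "h \<in> arrs" "v' \<in> V" "ranchor X v' = rng G h" "ract X v' h \<in> W" by (auto simp: bracket_def)
    then have "ranchor X (ract X v g) = ranchor X (ract X v' h)"
      using e by (metis ranchor_ract corr_bisection_in V)
    then have w: "ract X v g = ract X v' h" using corr_bisection_ranchor_eq[OF W] * by metis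
    then have "orb v = orb v'" using * by (metis orbit_ract corr_bisection_in V)
    then have "v = v'" using corr_bisection_orb_eq[OF V] * by metis
    then show "g = h" using * w by (metis ract_free_eq corr_bisection_in V)
  qed
  ultimately show ?thesis by (simp add: bisections_def)
qed

end

section \<open>Actions of a correspondence\<close>

text \<open>Actions without their topology: they can be topologised later, which is the source of all
  test objects for the universal property.\<close>

locale algebraic_action = correspondence_setting G X
  for G :: "'g groupoid" and X :: "('g, 'x) correspondence" +
  fixes R :: "'g set" and S :: "'y set" and A :: "('g, 'x, 'y) corr_action"
  assumes anchor_ext: "anchor A \<in> extensional S"
    and act_ext: "(\<lambda>(g, y). act A g y) \<in> extensional {(g, y). g \<in> arrs \<and> y \<in> S \<and> src G g = anchor A y}"
    and xact_ext: "(\<lambda>(x, y). xact A x y) \<in> extensional {(x, y). x \<in> pts \<and> y \<in> S \<and> ranchor X x = anchor A y}"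
    and anchor_units: "y \<in> S \<Longrightarrow> anchor A y \<in> units G"
    and act_closed: "\<lbrakk>g \<in> arrs; y \<in> S; src G g = anchor A y\<rbrakk> \<Longrightarrow> act A g y \<in> S"
    and act_unit: "y \<in> S \<Longrightarrow> act A (anchor A y) y = y"
    and anchor_act: "\<lbrakk>g \<in> arrs; y \<in> S; src G g = anchor A y\<rbrakk> \<Longrightarrow> anchor A (act A g y) = rng G g"
    and act_mult: "\<lbrakk>g \<in> arrs; h \<in> arrs; y \<in> S; src G g = rng G h; src G h = anchor A y\<rbrakk>
      \<Longrightarrow> act A (mult G g h) y = act A g (act A h y)"
    and xact_closed: "\<lbrakk>x \<in> pts; y \<in> S; ranchor X x = anchor A y\<rbrakk> \<Longrightarrow> xact A x y \<in> S"
    and anchor_xact: "\<lbrakk>x \<in> pts; y \<in> S; ranchor X x = anchor A y\<rbrakk> \<Longrightarrow> anchor A (xact A x y) = lanchor X x"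
    and act_xact: "\<lbrakk>g \<in> arrs; x \<in> pts; y \<in> S; src G g = lanchor X x; ranchor X x = anchor A y\<rbrakk>
      \<Longrightarrow> act A g (xact A x y) = xact A (lact X g x) y"
    and xact_eq_iff: "\<lbrakk>x \<in> pts; x' \<in> pts; y \<in> S; y' \<in> S; ranchor X x = anchor A y; ranchor X x' = anchor A y'\<rbrakk>
      \<Longrightarrow> xact A x y = xact A x' y' \<longleftrightarrow>
        (\<exists>g\<in>arrs. ranchor X x = rng G g \<and> src G g = anchor A y' \<and> x' = ract X x g \<and> y = act A g y')"
    and covered: "\<lbrakk>y \<in> S; anchor A y \<in> R\<rbrakk>
      \<Longrightarrow> \<exists>x\<in>pts. \<exists>z\<in>S. ranchor X x = anchor A z \<and> y = xact A x z"
begin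

definition gact where "gact V B = {act A g y | g y. g \<in> V \<and> y \<in> B \<and> src G g = anchor A y}"
definition sact where "sact W B = {xact A x y | x y. x \<in> W \<and> y \<in> B \<and> ranchor X x = anchor A y}"
text \<open>These are the sets that axiom (iv) requires to be closed when K is compact.\<close>

definition orbit_cone where
  "orbit_cone K = {xact A x y | x y. x \<in> pts \<and> orb x \<in> K \<and> y \<in> S \<and> ranchor X x = anchor A y}"

text \<open>The balancing relation (x g) y = x (g y) is not an axiom by itself; it is the easy
  direction of axiom (ii) with g as the witness.\<close>

lemma xact_ract:
  assumes "x \<in> pts" "g \<in> arrs" "y \<in> S" "ranchor X x = rng G g" "src G g = anchor A y"
  shows "xact A (ract X x g) y = xact A x (act A g y)"
  using assms xact_eq_iff[of x "ract X x g" "act A g y" y]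
  by (auto simp: ract_closed act_closed anchor_act ranchor_ract)

lemma act_inv_cancel:
  "\<lbrakk>g \<in> arrs; y \<in> S; src G g = anchor A y\<rbrakk> \<Longrightarrow> act A (invs G g) (act A g y) = y"
  by (metis act_mult act_unit inv_closed inv_left src_inv)

lemma act_inv_cancel':
  "\<lbrakk>g \<in> arrs; y \<in> S; rng G g = anchor A y\<rbrakk> \<Longrightarrow> act A g (act A (invs G g) y) = y"
  by (metis act_mult act_unit inv_closed inv_right src_inv rng_inv)

lemma xact_eq_orbit:
  assumes "x \<in> pts" "x' \<in> pts" "y \<in> S" "y' \<in> S" "ranchor X x = anchor A y" "ranchor X x' = anchor A y'"
    "xact A x y = xact A x' y'"
  shows "orb x = orb x'"
  using assms xact_eq_iff[of x x' y y'] orbit_ract by auto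

text \<open>Axiom (ii) relates y and y' by an arrow that fixes x, and freeness of the right action
  makes this arrow a unit.\<close>

lemma xact_cancel:
  assumes "x \<in> pts" "y \<in> S" "y' \<in> S" "ranchor X x = anchor A y" "ranchor X x = anchor A y'"
    "xact A x y = xact A x y'"
  shows "y = y'"
proof -
  obtain g where g: "g \<in> arrs" "ranchor X x = rng G g" "src G g = anchor A y'" "x = ract X x g" "y = act A g y'"
    using assms xact_eq_iff[of x x y y'] by auto
  then have "g \<in> units G" using ract_free[of x g] assms by simp
  then show ?thesis using g act_unit[OF assms(3)] src_unit by simp
qed

text \<open>By balancing, the first factor of a product x y may be replaced by any other
  representative of its orbit. This makes finite covers of compact sets of orbits usable.\<close>

lemma xact_change:
  assumes "x \<in> pts" "x' \<in> pts" "y \<in> S" "ranchor X x = anchor A y" "orb x = orb x'"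
  obtains g where "g \<in> arrs" "rng G g = ranchor X x'" "src G g = ranchor X x" "x = ract X x' g"
    "act A g y \<in> S" "ranchor X x' = anchor A (act A g y)" "xact A x y = xact A x' (act A g y)"
proof -
  obtain g where g: "g \<in> arrs" "ranchor X x' = rng G g" "x = ract X x' g"
    using orbit_eqD[OF assms(2,1)] assms(5) by metis
  then have "src G g = ranchor X x" using assms by (simp add: ranchor_ract)
  then show thesis using that[of g] g assms xact_ract[of x' g y] by (simp add: act_closed anchor_act)
qed

lemma mem_orbit_coneI: "\<lbrakk>x \<in> pts; orb x \<in> K; y \<in> S; ranchor X x = anchor A y\<rbrakk> \<Longrightarrow> xact A x y \<in> orbit_cone K"
  unfolding orbit_cone_def by blast

lemma xact_mem_orbit_cone_iff:
  "\<lbrakk>x \<in> pts; y \<in> S; ranchor X x = anchor A y\<rbrakk> \<Longrightarrow> xact A x y \<in> orbit_cone K \<longleftrightarrow> orb x \<in> K"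
proof
  assume a: "x \<in> pts" "y \<in> S" "ranchor X x = anchor A y" "xact A x y \<in> orbit_cone K"
  then obtain x' y' where "x' \<in> pts" "orb x' \<in> K" "y' \<in> S" "ranchor X x' = anchor A y'"
    "xact A x y = xact A x' y'"
    unfolding orbit_cone_def by blast
  then show "orb x \<in> K" using xact_eq_orbit[of x x' y y'] a by simp
qed (rule mem_orbit_coneI)

lemma sact_subset: "\<lbrakk>W \<subseteq> pts; B \<subseteq> S\<rbrakk> \<Longrightarrow> sact W B \<subseteq> S"
  unfolding sact_def using xact_closed by blast

lemma orbit_cone_subset: "orbit_cone K \<subseteq> S"
  unfolding orbit_cone_def using xact_closed by blast

lemma sact_mono: "\<lbrakk>W \<subseteq> W'; B \<subseteq> B'\<rbrakk> \<Longrightarrow> sact W B \<subseteq> sact W' B'"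
  unfolding sact_def by blast

text \<open>The value x y determines the orbit of x, and a bisection contains at most one point of
  each orbit.\<close>

lemma xact_bisection_cancel:
  assumes "U \<in> corr_bisections G X" "x \<in> U" "x' \<in> U" "y \<in> S" "y' \<in> S"
    "ranchor X x = anchor A y" "ranchor X x' = anchor A y'" "xact A x y = xact A x' y'"
  shows "x = x' \<and> y = y'"
proof -
  have p: "x \<in> pts" "x' \<in> pts" using assms corr_bisection_in by blast+
  have "orb x = orb x'" using xact_eq_orbit p assms by blast
  then have "x = x'" using assms corr_bisection_orb_eq by blast
  then show ?thesis using xact_cancel p assms by blast
qed

text \<open>Separates the algebra, fixed by the locale, from the choice of topology: the same
  algebraic data are given several topologies later. Openness is asked only for rectangles.\<close>

lemma correspondence_actionI:
  assumes Y: "topspace Y = S" and "continuous_map Y (obj G) (anchor A)"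
    and "continuous_map (subtopology (prod_topology (arr G) Y) {(g, y). src G g = anchor A y}) Y
      (\<lambda>(g, y). act A g y)"
    and "continuous_map (subtopology (prod_topology (spc X) Y) {(x, y). ranchor X x = anchor A y}) Y
      (\<lambda>(x, y). xact A x y)"
    and op: "\<And>W B. \<lbrakk>openin (spc X) W; openin Y B\<rbrakk> \<Longrightarrow> openin Y (sact W B)"
    and cl: "\<And>K. compactin XG K \<Longrightarrow> closedin Y (orbit_cone K)"
  shows "correspondence_action G X R Y A"
proof -
  have o: "open_map (subtopology (prod_topology (spc X) Y) {(x, y). ranchor X x = anchor A y}) Y
      (\<lambda>(x, y). xact A x y)"
  proof (rule open_map_subtopology_prodI)
    fix U V assume "openin (spc X) U" "openin Y V"
    then have "openin Y (sact U V)" by (rule op)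
    also have "sact U V = (\<lambda>(x, y). xact A x y) ` (U \<times> V \<inter> {(x, y). ranchor X x = anchor A y})"
      unfolding sact_def by auto
    finally show "openin Y \<dots>" .
  qed
  have c: "{y \<in> S. anchor A y \<in> R} \<subseteq> xact_image X Y A"
    using covered unfolding xact_image_def Y by fastforce
  show ?thesis
    unfolding correspondence_action_def groupoid_action_def Y
    by (intro conjI ballI allI impI anchor_ext act_ext xact_ext act_unit anchor_act act_mult
        anchor_xact act_xact xact_eq_iff assms o c cl[unfolded orbit_cone_def]) assumption+
qed

end

locale topological_action = correspondence_setting G X
  for G :: "'g groupoid" and X :: "('g, 'x) correspondence" +
  fixes R :: "'g set" and Y :: "'y topology" and A :: "('g, 'x, 'y) corr_action"
  assumes action: "correspondence_action G X R Y A"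
begin

lemma action_parts:
  "anchor A \<in> extensional (topspace Y)"
  "(\<lambda>(g, y). act A g y) \<in> extensional {(g, y). g \<in> arrs \<and> y \<in> topspace Y \<and> src G g = anchor A y}"
  "(\<lambda>(x, y). xact A x y) \<in> extensional {(x, y). x \<in> pts \<and> y \<in> topspace Y \<and> ranchor X x = anchor A y}"
  "continuous_map Y (obj G) (anchor A)"
  "continuous_map (subtopology (prod_topology (arr G) Y) {(g, y). src G g = anchor A y}) Y
      (\<lambda>(g, y). act A g y)"
  "continuous_map (subtopology (prod_topology (spc X) Y) {(x, y). ranchor X x = anchor A y}) Y
      (\<lambda>(x, y). xact A x y)"
  "open_map (subtopology (prod_topology (spc X) Y) {(x, y). ranchor X x = anchor A y}) Y
      (\<lambda>(x, y). xact A x y)"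
  "\<And>K. compactin XG K \<Longrightarrow> closedin Y {xact A x y | x y. x \<in> pts \<and> orb x \<in> K \<and>
                      y \<in> topspace Y \<and> ranchor X x = anchor A y}"
  "{y \<in> topspace Y. anchor A y \<in> R} \<subseteq> xact_image X Y A"
  using action unfolding correspondence_action_def groupoid_action_def by simp_all

sublocale algebraic_action G X R "topspace Y" A
proof (unfold_locales)
  show "anchor A y \<in> units G" if "y \<in> topspace Y" for y
    using continuous_map_image_subset_topspace[OF action_parts(4)] that by auto
  show "act A g y \<in> topspace Y" if "g \<in> arrs" "y \<in> topspace Y" "src G g = anchor A y" for g y
    using continuous_map_image_subset_topspace[OF action_parts(5)] that by auto
  show "xact A x y \<in> topspace Y" if "x \<in> pts" "y \<in> topspace Y" "ranchor X x = anchor A y" for x y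
    using continuous_map_image_subset_topspace[OF action_parts(6)] that by auto
  show "\<exists>x\<in>pts. \<exists>z\<in>topspace Y. ranchor X x = anchor A z \<and> y = xact A x z"
    if "y \<in> topspace Y" "anchor A y \<in> R" for y
    using action_parts(9) that unfolding xact_image_def by fast
qed (use action action_parts(1-3) in \<open>simp_all add: correspondence_action_def groupoid_action_def\<close>)

lemma cont_anchor: "continuous_map Z Y f \<Longrightarrow> continuous_map Z (obj G) (\<lambda>z. anchor A (f z))"
  using continuous_map_compose[OF _ action_parts(4)] by (simp add: o_def)

lemma cont_act:
  assumes "continuous_map Z (arr G) f" "continuous_map Z Y h"
    and "\<And>z. z \<in> topspace Z \<Longrightarrow> src G (f z) = anchor A (h z)"
  shows "continuous_map Z Y (\<lambda>z. act A (f z) (h z))"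
  by (rule continuous_map_pair_compose[OF action_parts(5) assms(1,2)]) (use assms in auto)

lemma cont_xact:
  assumes "continuous_map Z (spc X) f" "continuous_map Z Y h"
    and "\<And>z. z \<in> topspace Z \<Longrightarrow> ranchor X (f z) = anchor A (h z)"
  shows "continuous_map Z Y (\<lambda>z. xact A (f z) (h z))"
  by (rule continuous_map_pair_compose[OF action_parts(6) assms(1,2)]) (use assms in auto)

lemma openin_anchor_preimage: "openin (obj G) U \<Longrightarrow> openin Y {y \<in> topspace Y. anchor A y \<in> U}"
  using action_parts(4) openin_continuous_map_preimage by blast

lemma openin_sact:
  assumes "openin (spc X) W" "openin Y B"
  shows "openin Y (sact W B)"
proof -
  let ?P = "subtopology (prod_topology (spc X) Y) {(x, y). ranchor X x = anchor A y}"
  have "openin ?P (W \<times> B \<inter> {(x, y). ranchor X x = anchor A y})"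
    unfolding openin_subtopology using assms by (auto simp: openin_prod_Times_iff intro!: exI[of _ "W \<times> B"])
  then have "openin Y ((\<lambda>(x, y). xact A x y) ` (W \<times> B \<inter> {(x, y). ranchor X x = anchor A y}))"
    using action_parts(7) unfolding open_map_def by blast
  also have "(\<lambda>(x, y). xact A x y) ` (W \<times> B \<inter> {(x, y). ranchor X x = anchor A y}) = sact W B"
    unfolding sact_def by auto
  finally show ?thesis .
qed

lemma closedin_orbit_cone: "compactin XG K \<Longrightarrow> closedin Y (orbit_cone K)"
  using action_parts(8) unfolding orbit_cone_def .

lemma xact_image_eq: "xact_image X Y A = sact pts (topspace Y)"
  unfolding xact_image_def sact_def by auto

end

section \<open>From actions to maps on bisections\<close>

locale bisection_setting = correspondence_setting G X + H: etale_groupoid H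
  for G :: "'g groupoid" and X :: "('g, 'x) correspondence" and H :: "'h groupoid"
begin

abbreviation harrs where "harrs \<equiv> topspace (arr H)"

definition commuting :: "('g, 'x, 'h) corr_action \<Rightarrow> bool" where
  "commuting A \<longleftrightarrow>
    (\<forall>y\<in>harrs. \<forall>h\<in>harrs. src H y = rng H h \<longrightarrow> anchor A (mult H y h) = anchor A y) \<and>
    (\<forall>g\<in>arrs. \<forall>y\<in>harrs. src G g = anchor A y \<longrightarrow> src H (act A g y) = src H y \<and>
      (\<forall>h\<in>harrs. src H y = rng H h \<longrightarrow> mult H (act A g y) h = act A g (mult H y h))) \<and>
    (\<forall>x\<in>pts. \<forall>y\<in>harrs. ranchor X x = anchor A y \<longrightarrow> src H (xact A x y) = src H y \<and>
      (\<forall>h\<in>harrs. src H y = rng H h \<longrightarrow> mult H (xact A x y) h = xact A x (mult H y h)))"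

end

locale commuting_action = bisection_setting G X H + topological_action G X R "arr H" A
  for G :: "'g groupoid" and X :: "('g, 'x) correspondence" and H :: "'h groupoid"
    and R :: "'g set" and A :: "('g, 'x, 'h) corr_action" +
  assumes comm: "commuting A"
begin

section \<open>Right invariant actions are determined on units\<close>

lemma anchor_mult: "\<lbrakk>y \<in> harrs; h \<in> harrs; src H y = rng H h\<rbrakk> \<Longrightarrow> anchor A (mult H y h) = anchor A y"
  and src_act: "\<lbrakk>g \<in> arrs; y \<in> harrs; src G g = anchor A y\<rbrakk> \<Longrightarrow> src H (act A g y) = src H y"
  and mult_act: "\<lbrakk>g \<in> arrs; y \<in> harrs; src G g = anchor A y; h \<in> harrs; src H y = rng H h\<rbrakk>
    \<Longrightarrow> mult H (act A g y) h = act A g (mult H y h)"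
  and src_xact: "\<lbrakk>x \<in> pts; y \<in> harrs; ranchor X x = anchor A y\<rbrakk> \<Longrightarrow> src H (xact A x y) = src H y"
  and mult_xact: "\<lbrakk>x \<in> pts; y \<in> harrs; ranchor X x = anchor A y; h \<in> harrs; src H y = rng H h\<rbrakk>
    \<Longrightarrow> mult H (xact A x y) h = xact A x (mult H y h)"
  using comm unfolding commuting_def by blast+

text \<open>Since h = r(h) h, right invariance makes the anchor map factor through the range. Its
  values on units form the map \<rho> of the theorem.\<close>

lemma anchor_rng: "h \<in> harrs \<Longrightarrow> anchor A (rng H h) = anchor A h"
  using anchor_mult[of "rng H h" h] H.rng_closed[of h] H.rng_units[of h] H.src_unit H.unit_left
  by metis

text \<open>Writing b = r(b) b and pulling b out on the right reduces every value to a value on a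
  unit.\<close>

lemma act_eq_mult:
  assumes "g \<in> arrs" "b \<in> harrs" "src G g = anchor A b"
  shows "act A g b = mult H (act A g (rng H b)) b" "src H (act A g (rng H b)) = rng H b"
    "act A g (rng H b) \<in> harrs"
proof -
  have *: "rng H b \<in> harrs" "src H (rng H b) = rng H b" "src G g = anchor A (rng H b)"
    using assms by (auto simp: H.rng_closed H.src_unit H.rng_units anchor_rng)
  then show "act A g b = mult H (act A g (rng H b)) b"
    using mult_act[OF assms(1) *(1,3) assms(2)] H.unit_left[OF assms(2)] by simp
  show "src H (act A g (rng H b)) = rng H b" using src_act assms * by simp
  show "act A g (rng H b) \<in> harrs" using act_closed assms * by blast
qed

lemma xact_eq_mult:
  assumes "x \<in> pts" "b \<in> harrs" "ranchor X x = anchor A b"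
  shows "xact A x b = mult H (xact A x (rng H b)) b" "src H (xact A x (rng H b)) = rng H b"
    "xact A x (rng H b) \<in> harrs"
proof -
  have *: "rng H b \<in> harrs" "src H (rng H b) = rng H b" "ranchor X x = anchor A (rng H b)"
    using assms by (auto simp: H.rng_closed H.src_unit H.rng_units anchor_rng)
  then show "xact A x b = mult H (xact A x (rng H b)) b"
    using mult_xact[OF assms(1) *(1,3) assms(2)] H.unit_left[OF assms(2)] by simp
  show "src H (xact A x (rng H b)) = rng H b" using src_xact assms * by simp
  show "xact A x (rng H b) \<in> harrs" using xact_closed assms * by blast
qed

lemma act_unit_mult:
  assumes "g \<in> arrs" "w \<in> units H" "src G g = anchor A w" "b \<in> harrs" "src H (act A g w) = rng H b"
  shows "mult H (act A g w) b = act A g b" "src G g = anchor A b" "rng H b = w"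
proof -
  have w: "w \<in> harrs" "src H w = w" using assms H.units_subset H.src_unit by auto
  show e: "rng H b = w" using assms w src_act by metis
  show "src G g = anchor A b" using assms e anchor_rng by metis
  show "mult H (act A g w) b = act A g b" using mult_act[of g w b] assms w e H.unit_left by metis
qed

lemma xact_unit_mult:
  assumes "x \<in> pts" "w \<in> units H" "ranchor X x = anchor A w" "b \<in> harrs" "src H (xact A x w) = rng H b"
  shows "mult H (xact A x w) b = xact A x b" "ranchor X x = anchor A b" "rng H b = w"
proof -
  have w: "w \<in> harrs" "src H w = w" using assms H.units_subset H.src_unit by auto
  show e: "rng H b = w" using assms w src_xact by metis
  show "ranchor X x = anchor A b" using assms e anchor_rng by metis
  show "mult H (xact A x w) b = xact A x b" using mult_xact[of x w b] assms w e H.unit_left by metis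
qed

text \<open>The anchor of k = g \<omega> determines g in V, and then k has this form if and only if
  inverse(g) k is a unit. The units are open in H.\<close>

lemma openin_gact_units:
  assumes V: "V \<in> bisections G" shows "openin (arr H) (gact V (units H))"
proof -
  define E where "E = {k \<in> harrs. anchor A k \<in> rng G ` V}"
  have E: "openin (arr H) E" unfolding E_def
    using openin_anchor_preimage bisectionD(6)[OF V] by blast
  have "gact V (units H) = {k \<in> E. act A (invs G (rsec V (anchor A k))) k \<in> units H}"
  proof (intro set_eqI iffI)
    fix k assume "k \<in> gact V (units H)"
    then obtain g w where gw: "g \<in> V" "w \<in> units H" "src G g = anchor A w" "k = act A g w"
      unfolding gact_def by blast
    have t: "g \<in> arrs" "w \<in> harrs" using gw bisection_in[OF V] H.units_subset by auto
    have "anchor A k = rng G g" using gw t by (simp add: anchor_act)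
    then show "k \<in> {k \<in> E. act A (invs G (rsec V (anchor A k))) k \<in> units H}"
      using gw t rsec_eq[OF V, of g] by (auto simp: E_def act_closed act_inv_cancel)
  next
    fix k assume "k \<in> {k \<in> E. act A (invs G (rsec V (anchor A k))) k \<in> units H}"
    then have k: "k \<in> harrs" "anchor A k \<in> rng G ` V" "act A (invs G (rsec V (anchor A k))) k \<in> units H"
      by (auto simp: E_def)
    define g where "g = rsec V (anchor A k)"
    have g: "g \<in> V" "rng G g = anchor A k" using rsec[OF V k(2)] by (auto simp: g_def)
    have gt: "g \<in> arrs" using bisection_in[OF V g(1)] .
    have "k = act A g (act A (invs G g) k)" using act_inv_cancel' gt k g by simp
    moreover have "src G g = anchor A (act A (invs G g) k)"
      using gt k g by (simp add: anchor_act inv_closed src_inv rng_inv)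
    ultimately show "k \<in> gact V (units H)"
      unfolding gact_def using g k(3) unfolding g_def by blast
  qed
  moreover have "openin (arr H) {k \<in> E. act A (invs G (rsec V (anchor A k))) k \<in> units H}"
  proof (rule openin_preimage_subtopology[OF _ E H.openin_units])
    have *: "continuous_map (subtopology (arr H) E) (arr H) (\<lambda>x. x)"
      by (simp add: continuous_map_from_subtopology)
    show "continuous_map (subtopology (arr H) E) (arr H)
       (\<lambda>k. act A (invs G (rsec V (anchor A k))) k)"
      by (intro cont_act cont_inv cont_rsec cont_anchor * V)
        (use rsec[OF V] bisection_in[OF V] in \<open>auto simp: E_def src_inv\<close>)
  qed
  ultimately show ?thesis by simp
qed

lemma bisection_gact_units:
  assumes V: "V \<in> bisections G" shows "gact V (units H) \<in> bisections H"
proof -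
  have "inj_on (src H) (gact V (units H))"
  proof (rule inj_onI)
    fix k k' assume "k \<in> gact V (units H)" "k' \<in> gact V (units H)" and e: "src H k = src H k'"
    then obtain g w g' w' where *: "g \<in> V" "w \<in> units H" "src G g = anchor A w" "k = act A g w"
      "g' \<in> V" "w' \<in> units H" "src G g' = anchor A w'" "k' = act A g' w'" unfolding gact_def by blast
    then have "w = w'" using e src_act H.src_unit H.unit_closed bisection_in[OF V] by metis
    moreover from this have "g = g'" using * bisection_src_eq[OF V] by metis
    ultimately show "k = k'" using * by simp
  qed
  moreover have "inj_on (rng H) (gact V (units H))"
  proof (rule inj_onI)
    fix k k' assume "k \<in> gact V (units H)" "k' \<in> gact V (units H)" and e: "rng H k = rng H k'"
    then obtain g w g' w' where *: "g \<in> V" "w \<in> units H" "src G g = anchor A w" "k = act A g w"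
      "g' \<in> V" "w' \<in> units H" "src G g' = anchor A w'" "k' = act A g' w'" unfolding gact_def by blast
    have t: "g \<in> arrs" "g' \<in> arrs" "w \<in> harrs" "w' \<in> harrs"
      using * bisection_in[OF V] H.unit_closed by auto
    have kk: "k \<in> harrs" "k' \<in> harrs" using * t by (auto simp: act_closed)
    have "rng G g = rng G g'" using e anchor_rng[OF kk(1)] anchor_rng[OF kk(2)] * t by (simp add: anchor_act)
    then have g: "g = g'" using bisection_rng_eq[OF V] * by metis
    \<comment> \<open>Injectivity of the range map amounts to this quotient being a unit. Since k' m
      = g m and k = g w for the same g, cancelling g gives m = w.\<close>
    define m where "m = mult H (invs H k') k"
    have m: "m \<in> harrs" "rng H m = src H k'" "mult H k' m = k"
      using kk e by (auto simp: m_def H.mult_closed H.inv_closed H.src_inv H.rng_mult H.rng_inv H.mult_inv_cancel_left')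
    have "act A g m = act A g w" "src G g = anchor A m"
      using act_unit_mult[of g' w' m] * t m g by auto
    then have "m = w" using act_inv_cancel * t m by metis
    then show "k = k'" using H.inv_mult_unit_eq[OF kk(2,1)] e * by (simp add: m_def)
  qed
  ultimately show ?thesis using openin_gact_units[OF V] by (simp add: bisections_def)
qed

text \<open>Openness is now part of the axioms of an action. For the range map the quotient m of two
  values satisfies x' m = x w, and products with first factor in a bisection can be
  cancelled.\<close>

lemma bisection_sact_units:
  assumes U: "U \<in> corr_bisections G X" shows "sact U (units H) \<in> bisections H"
proof -
  have "inj_on (src H) (sact U (units H))"
  proof (rule inj_onI)
    fix k k' assume "k \<in> sact U (units H)" "k' \<in> sact U (units H)" and e: "src H k = src H k'"
    then obtain x w x' w' where *: "x \<in> U" "w \<in> units H" "ranchor X x = anchor A w" "k = xact A x w"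
      "x' \<in> U" "w' \<in> units H" "ranchor X x' = anchor A w'" "k' = xact A x' w'" unfolding sact_def by blast
    then have "w = w'" using e src_xact H.src_unit H.unit_closed corr_bisection_in[OF U] by metis
    moreover from this have "x = x'" using * corr_bisection_ranchor_eq[OF U] by metis
    ultimately show "k = k'" using * by simp
  qed
  moreover have "inj_on (rng H) (sact U (units H))"
  proof (rule inj_onI)
    fix k k' assume "k \<in> sact U (units H)" "k' \<in> sact U (units H)" and e: "rng H k = rng H k'"
    then obtain x w x' w' where *: "x \<in> U" "w \<in> units H" "ranchor X x = anchor A w" "k = xact A x w"
      "x' \<in> U" "w' \<in> units H" "ranchor X x' = anchor A w'" "k' = xact A x' w'" unfolding sact_def by blast
    have t: "x \<in> pts" "x' \<in> pts" "w \<in> harrs" "w' \<in> harrs"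
      using * corr_bisection_in[OF U] H.unit_closed by auto
    have kk: "k \<in> harrs" "k' \<in> harrs" using * t by (auto simp: xact_closed)
    define m where "m = mult H (invs H k') k"
    have m: "m \<in> harrs" "rng H m = src H k'" "mult H k' m = k"
      using kk e by (auto simp: m_def H.mult_closed H.inv_closed H.src_inv H.rng_mult H.rng_inv H.mult_inv_cancel_left')
    have "xact A x' m = xact A x w" "ranchor X x' = anchor A m"
      using xact_unit_mult[of x' w' m] * t m by auto
    then have "m = w" using xact_bisection_cancel[OF U, of x' x m w] * t m by blast
    then show "k = k'" using H.inv_mult_unit_eq[OF kk(2,1)] e * by (simp add: m_def)
  qed
  moreover have "openin (arr H) (sact U (units H))"
    using openin_sact H.openin_units corr_bisectionD(1)[OF U] by blast
  ultimately show ?thesis by (simp add: bisections_def)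
qed

text \<open>The source of v w is w, so multiplying v w on the right by an arrow b with range w gives
  v b. A product of two values thus collapses to an iterated action on a unit. The two mixed
  products follow the same pattern.\<close>

lemma set_mult_gact_gact:
  assumes V: "V \<subseteq> arrs" and W: "W \<subseteq> arrs"
  shows "set_mult H (gact V (units H)) (gact W (units H)) = gact (set_mult G V W) (units H)"
proof (intro equalityI subsetI)
  fix k assume "k \<in> set_mult H (gact V (units H)) (gact W (units H))"
  then obtain v w g w' where *: "v \<in> V" "w \<in> units H" "src G v = anchor A w"
    "g \<in> W" "w' \<in> units H" "src G g = anchor A w'" "src H (act A v w) = rng H (act A g w')"
    "k = mult H (act A v w) (act A g w')"
    unfolding set_mult_def gact_def by blast
  have t: "v \<in> arrs" "g \<in> arrs" "w' \<in> harrs" using * V W H.unit_closed by auto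
  have "k = act A v (act A g w')" "src G v = rng G g"
    using act_unit_mult[of v w "act A g w'"] * t by (auto simp: act_closed anchor_act)
  moreover from this have "k = act A (mult G v g) w'" using act_mult * t by metis
  ultimately show "k \<in> gact (set_mult G V W) (units H)"
    unfolding gact_def set_mult_def using * t src_mult[of v g] by (smt (verit, best) mem_Collect_eq)
next
  fix k assume "k \<in> gact (set_mult G V W) (units H)"
  then obtain v g w where *: "v \<in> V" "g \<in> W" "src G v = rng G g" "w \<in> units H"
    "src G (mult G v g) = anchor A w" "k = act A (mult G v g) w"
    unfolding set_mult_def gact_def by blast
  have t0: "v \<in> arrs" "g \<in> arrs" "w \<in> harrs"
    using * V W H.unit_closed by auto
  have t1: "src G g = anchor A w" using * t0 src_mult[of v g] by simp
  note t = t0 t1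
  \<comment> \<open>For the converse, v b is split again as (v r(b)) b, which exhibits it as a
    product of two values on units.\<close>
  define b where "b = act A g w"
  have b: "b \<in> harrs" "anchor A b = rng G g" "b \<in> gact W (units H)"
    using * t by (auto simp: b_def act_closed anchor_act gact_def)
  have "k = act A v b" using * t act_mult by (simp add: b_def)
  with act_eq_mult[of v b] have "k = mult H (act A v (rng H b)) b" "src H (act A v (rng H b)) = rng H b"
    using * t b by auto
  moreover have "act A v (rng H b) \<in> gact V (units H)"
    unfolding gact_def using * b H.rng_units anchor_rng[of b] by force
  ultimately show "k \<in> set_mult H (gact V (units H)) (gact W (units H))"
    unfolding set_mult_def using b by blast
qed

lemma set_mult_gact_sact:
  assumes V: "V \<subseteq> arrs" and W: "W \<subseteq> pts"
  shows "set_mult H (gact V (units H)) (sact W (units H)) = sact (set_lact G X V W) (units H)"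
proof (intro equalityI subsetI)
  fix k assume "k \<in> set_mult H (gact V (units H)) (sact W (units H))"
  then obtain v w x w' where *: "v \<in> V" "w \<in> units H" "src G v = anchor A w"
    "x \<in> W" "w' \<in> units H" "ranchor X x = anchor A w'" "src H (act A v w) = rng H (xact A x w')"
    "k = mult H (act A v w) (xact A x w')"
    unfolding set_mult_def gact_def sact_def by blast
  have t: "v \<in> arrs" "x \<in> pts" "w' \<in> harrs" using * V W H.unit_closed by auto
  have "k = act A v (xact A x w')" "src G v = lanchor X x"
    using act_unit_mult[of v w "xact A x w'"] * t by (auto simp: xact_closed anchor_xact)
  moreover from this have "k = xact A (lact X v x) w'" using act_xact * t by metis
  ultimately show "k \<in> sact (set_lact G X V W) (units H)"
    unfolding sact_def set_lact_def using * t ranchor_lact[of v x] by (smt (verit, best) mem_Collect_eq)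
next
  fix k assume "k \<in> sact (set_lact G X V W) (units H)"
  then obtain v x w where *: "v \<in> V" "x \<in> W" "src G v = lanchor X x" "w \<in> units H"
    "ranchor X (lact X v x) = anchor A w" "k = xact A (lact X v x) w"
    unfolding set_lact_def sact_def by blast
  have t0: "v \<in> arrs" "x \<in> pts" "w \<in> harrs"
    using * V W H.unit_closed by auto
  have t1: "ranchor X x = anchor A w" using * t0 ranchor_lact[of v x] by simp
  note t = t0 t1
  define b where "b = xact A x w"
  have b: "b \<in> harrs" "anchor A b = lanchor X x" "b \<in> sact W (units H)"
    using * t by (auto simp: b_def xact_closed anchor_xact sact_def)
  have "k = act A v b" using * t act_xact by (simp add: b_def)
  with act_eq_mult[of v b] have "k = mult H (act A v (rng H b)) b" "src H (act A v (rng H b)) = rng H b"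
    using * t b by auto
  moreover have "act A v (rng H b) \<in> gact V (units H)"
    unfolding gact_def using * b H.rng_units anchor_rng[of b] by force
  ultimately show "k \<in> set_mult H (gact V (units H)) (sact W (units H))"
    unfolding set_mult_def using b by blast
qed

lemma set_mult_sact_gact:
  assumes V: "V \<subseteq> pts" and W: "W \<subseteq> arrs"
  shows "set_mult H (sact V (units H)) (gact W (units H)) = sact (set_ract G X V W) (units H)"
proof (intro equalityI subsetI)
  fix k assume "k \<in> set_mult H (sact V (units H)) (gact W (units H))"
  then obtain x w g w' where *: "x \<in> V" "w \<in> units H" "ranchor X x = anchor A w"
    "g \<in> W" "w' \<in> units H" "src G g = anchor A w'" "src H (xact A x w) = rng H (act A g w')"
    "k = mult H (xact A x w) (act A g w')"
    unfolding set_mult_def gact_def sact_def by blast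
  have t: "x \<in> pts" "g \<in> arrs" "w' \<in> harrs" using * V W H.unit_closed by auto
  have "k = xact A x (act A g w')" "ranchor X x = rng G g"
    using xact_unit_mult[of x w "act A g w'"] * t by (auto simp: act_closed anchor_act)
  moreover from this have "k = xact A (ract X x g) w'" using xact_ract * t by metis
  ultimately show "k \<in> sact (set_ract G X V W) (units H)"
    unfolding sact_def set_ract_def using * t ranchor_ract[of x g] by (smt (verit, best) mem_Collect_eq)
next
  fix k assume "k \<in> sact (set_ract G X V W) (units H)"
  then obtain x g w where *: "x \<in> V" "g \<in> W" "ranchor X x = rng G g" "w \<in> units H"
    "ranchor X (ract X x g) = anchor A w" "k = xact A (ract X x g) w"
    unfolding set_ract_def sact_def by blast
  have t0: "x \<in> pts" "g \<in> arrs" "w \<in> harrs"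
    using * V W H.unit_closed by auto
  have t1: "src G g = anchor A w" using * t0 ranchor_ract[of x g] by simp
  note t = t0 t1
  define b where "b = act A g w"
  have b: "b \<in> harrs" "anchor A b = rng G g" "b \<in> gact W (units H)"
    using * t by (auto simp: b_def act_closed anchor_act gact_def)
  have "k = xact A x b" using * t xact_ract by (simp add: b_def)
  with xact_eq_mult[of x b] have "k = mult H (xact A x (rng H b)) b" "src H (xact A x (rng H b)) = rng H b"
    using * t b by auto
  moreover have "xact A x (rng H b) \<in> sact V (units H)"
    unfolding sact_def using * b H.rng_units anchor_rng[of b] by force
  ultimately show "k \<in> set_mult H (sact V (units H)) (gact W (units H))"
    unfolding set_mult_def using b by blast
qed

text \<open>If a = x w, b = x' w' and k = inverse(a) b, then x k = a k = x' w'. Axiom (ii) turns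
  this equation into an arrow g with x' = x g and k = g w', which is an element of the bracket
  applied to a unit.\<close>

lemma set_mult_inv_sact_sact:
  assumes V: "V \<subseteq> pts" and W: "W \<subseteq> pts"
  shows "set_mult H (invs H ` sact V (units H)) (sact W (units H)) = gact (bracket G X V W) (units H)"
proof (intro equalityI subsetI)
  fix k assume "k \<in> set_mult H (invs H ` sact V (units H)) (sact W (units H))"
  then obtain x w x' w' where *: "x \<in> V" "w \<in> units H" "ranchor X x = anchor A w"
    "x' \<in> W" "w' \<in> units H" "ranchor X x' = anchor A w'"
    "src H (invs H (xact A x w)) = rng H (xact A x' w')"
    "k = mult H (invs H (xact A x w)) (xact A x' w')"
    unfolding set_mult_def sact_def by blast
  have t: "x \<in> pts" "x' \<in> pts" "w \<in> harrs" "w' \<in> harrs" using * V W H.unit_closed by auto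
  define a b where "a = xact A x w" and "b = xact A x' w'"
  have ab: "a \<in> harrs" "b \<in> harrs" "rng H a = rng H b" "k = mult H (invs H a) b"
    using * t by (auto simp: a_def b_def xact_closed H.src_inv)
  have k: "k \<in> harrs" "rng H k = src H a" "mult H a k = b"
    using ab by (auto simp: H.mult_closed H.inv_closed H.src_inv H.rng_mult H.rng_inv H.mult_inv_cancel_left')
  have "xact A x k = xact A x' w'" "ranchor X x = anchor A k"
    using xact_unit_mult[of x w k] * t k by (auto simp: a_def b_def)
  then obtain g where g: "g \<in> arrs" "ranchor X x = rng G g" "src G g = anchor A w'" "x' = ract X x g" "k = act A g w'"
    using xact_eq_iff[of x x' k w'] t k * by auto
  then have "g \<in> bracket G X V W" unfolding bracket_def using * by blast
  then show "k \<in> gact (bracket G X V W) (units H)" unfolding gact_def using g * by blast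
next
  fix k assume "k \<in> gact (bracket G X V W) (units H)"
  then obtain g w x where *: "g \<in> arrs" "x \<in> V" "ract X x g \<in> W" "ranchor X x = rng G g" "w \<in> units H"
    "src G g = anchor A w" "k = act A g w"
    unfolding gact_def bracket_def by blast
  have t: "x \<in> pts" "w \<in> harrs" "k \<in> harrs" "anchor A k = rng G g"
    using * V H.unit_closed by (auto simp: act_closed anchor_act)
  define a where "a = xact A x (rng H k)"
  define b where "b = xact A (ract X x g) w"
  have b: "b = xact A x k" using * t xact_ract by (simp add: b_def)
  have a: "b = mult H a k" "src H a = rng H k" "a \<in> harrs"
    using xact_eq_mult[of x k] * t b by (auto simp: a_def)
  have "k = mult H (invs H a) b" "src H (invs H a) = rng H b"
    using a t by (auto simp: H.mult_inv_cancel_left H.src_inv H.rng_mult)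
  moreover have "a \<in> sact V (units H)"
    unfolding sact_def a_def using * t H.rng_units anchor_rng[of k] by force
  moreover have "b \<in> sact W (units H)"
    unfolding sact_def b_def using * t ranchor_ract[of x g] by force
  ultimately show "k \<in> set_mult H (invs H ` sact V (units H)) (sact W (units H))"
    unfolding set_mult_def by blast
qed

lemma gact_open_units:
  assumes "U \<subseteq> units G" shows "gact U (units H) = {w \<in> units H. anchor A w \<in> U}"
proof (intro equalityI subsetI)
  fix k assume "k \<in> gact U (units H)"
  then obtain u w where *: "u \<in> U" "w \<in> units H" "src G u = anchor A w" "k = act A u w"
    unfolding gact_def by blast
  then have "u = anchor A w" using assms src_unit[of u] by auto
  then show "k \<in> {w \<in> units H. anchor A w \<in> U}" using * act_unit[of w] H.unit_closed by simp
next
  fix w assume "w \<in> {w \<in> units H. anchor A w \<in> U}"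
  then have w: "w \<in> units H" "anchor A w \<in> U" by auto
  moreover have "src G (anchor A w) = anchor A w" "w = act A (anchor A w) w"
    using w assms src_unit[of "anchor A w"] act_unit[of w] H.unit_closed by auto
  ultimately show "w \<in> gact U (units H)" unfolding gact_def by blast
qed

section \<open>The map on bisections that belongs to an action\<close>

abbreviation th where "th \<equiv> bisection_map_of G X H A"

lemma th_Inl: "V \<in> bisections G \<Longrightarrow> th (Inl V) = gact V (units H)"
  and th_Inr: "U \<in> corr_bisections G X \<Longrightarrow> th (Inr U) = sact U (units H)"
  by (auto simp: bisection_map_of_def gact_def sact_def)

lemma induces_anchor_th: "induces_anchor G H th (anchor A)"
proof -
  have "continuous_map (obj H) (obj G) (anchor A)"
    unfolding obj_def[of H] using continuous_map_from_subtopology action_parts(4) by blast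
  moreover have "th (Inl U) = {w \<in> units H. anchor A w \<in> U}" if "openin (obj G) U" for U
    using that th_Inl[OF open_obj_bisection[OF that]] gact_open_units by (auto simp: openin_obj_iff)
  ultimately show ?thesis by (simp add: induces_anchor_def)
qed

lemma rng_covered:
  assumes "x \<in> pts" "h \<in> harrs" "ranchor X x = anchor A h"
  shows "rng H (xact A x h) \<in> (\<Union>U\<in>corr_bisections G X. rng H ` th (Inr U))"
proof -
  obtain U where U: "U \<in> corr_bisections G X" "x \<in> U" using corr_bisection_exists[OF openin_topspace assms(1)] .
  have "rng H (xact A x h) = rng H (xact A x (rng H h))"
    using xact_eq_mult[OF assms] assms by (simp add: H.rng_mult)
  moreover have "xact A x (rng H h) \<in> th (Inr U)"
    unfolding th_Inr[OF U(1)] sact_def using assms U H.rng_units anchor_rng[of h] by force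
  ultimately show ?thesis using U by blast
qed

lemma th_bisection_maps:
  assumes R: "openin (obj G) R"
  shows "th \<in> bisection_maps G X R H"
proof -
  have ext: "th \<in> (bisections G <+> corr_bisections G X) \<rightarrow>\<^sub>E bisections H"
    using bisection_gact_units bisection_sact_units th_Inl th_Inr
    by (auto simp: bisection_map_of_def gact_def sact_def)
  have mul: "multiplicative G X H th"
    unfolding multiplicative_def
    using bisectionD(4) corr_bisectionD(4)
    by (auto simp: th_Inl th_Inr bisection_set_mult corr_bisection_set_lact corr_bisection_set_ract
        set_mult_gact_gact set_mult_gact_sact set_mult_sact_gact)
  have br: "preserves_bracket G X H th"
    unfolding preserves_bracket_def using corr_bisectionD(4)
    by (auto simp: th_Inl th_Inr bisection_bracket set_mult_inv_sact_sact)
  have obj: "th (Inl U) = {w \<in> units H. anchor A w \<in> U}" if "openin (obj G) U" for U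
    using induces_anchor_th that by (simp add: induces_anchor_def)
  have un: "th (Inl (units G)) = units H"
    using obj[of "units G"] openin_topspace[of "obj G"] anchor_units H.unit_closed by auto
  have pu: "preserves_unions G th"
    unfolding preserves_unions_def using obj openin_Union by auto
  have "covers_range G X R H th"
    unfolding covers_range_def
  proof
    fix k assume "k \<in> rng H ` th (Inl R)"
    then have k: "k \<in> units H" "anchor A k \<in> R" using obj[OF R] H.rng_unit by auto
    then obtain x h where "x \<in> pts" "h \<in> harrs" "ranchor X x = anchor A h" "k = xact A x h"
      using covered[of k] H.unit_closed by auto
    then show "k \<in> (\<Union>U\<in>corr_bisections G X. rng H ` th (Inr U))"
      using rng_covered[of x h] H.rng_unit[OF k(1)] by simp
  qed
  with ext mul br un pu show ?thesis unfolding bisection_maps_def by blast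
qed

text \<open>For a = x w the range is r(a) = a inverse(a) = x inverse(a). So if U lies in a compact
  set, the ranges lie in the cone of a compact set of orbits, which is closed by axiom (iv) and
  whose units are ranges of values of bisections.\<close>

lemma th_closure_condition: "closure_condition G X H th"
  unfolding closure_condition_def
proof (intro ballI impI)
  fix U assume U: "U \<in> corr_bisections G X" and "precompact_in (spc X) U"
  then obtain K where K: "compactin (spc X) K" "U \<subseteq> K" unfolding precompact_in_def by blast
  have "closedin (arr H) (orbit_cone (orb ` K))" using closedin_orbit_cone compactin_orbit_image[OF K(1)] by blast
  then have "closedin (obj H) (orbit_cone (orb ` K) \<inter> units H)"
    unfolding obj_def by (simp add: closedin_subtopology_Int_closed inf_commute)
  moreover have "rng H ` th (Inr U) \<subseteq> orbit_cone (orb ` K) \<inter> units H"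
  proof
    fix k assume "k \<in> rng H ` th (Inr U)"
    then obtain x w where *: "x \<in> U" "w \<in> units H" "ranchor X x = anchor A w" "k = rng H (xact A x w)"
      unfolding th_Inr[OF U] sact_def by blast
    have t: "x \<in> pts" "w \<in> harrs" using * corr_bisection_in[OF U] H.unit_closed by auto
    define a where "a = xact A x w"
    have a: "a \<in> harrs" "src H a = w" using * t src_xact[of x w] H.src_unit by (auto simp: a_def xact_closed)
    have "mult H a (invs H a) = xact A x (invs H a)" "ranchor X x = anchor A (invs H a)"
      using xact_unit_mult[of x w "invs H a"] * t a by (auto simp: a_def H.inv_closed H.rng_inv)
    moreover have "k = mult H a (invs H a)" using * a by (simp add: a_def H.inv_right)
    ultimately have "k \<in> orbit_cone (orb ` K)"
      using mem_orbit_coneI[of x "orb ` K" "invs H a"] * t K(2) a by (auto simp: H.inv_closed)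
    then show "k \<in> orbit_cone (orb ` K) \<inter> units H" using * a by (auto simp: a_def H.rng_units)
  qed
  ultimately have "obj H closure_of (rng H ` th (Inr U)) \<subseteq> orbit_cone (orb ` K) \<inter> units H"
    by (rule closure_of_minimal[rotated])
  also have "\<dots> \<subseteq> (\<Union>W\<in>corr_bisections G X. rng H ` th (Inr W))"
  proof
    fix k assume k: "k \<in> orbit_cone (orb ` K) \<inter> units H"
    then obtain x h where "x \<in> pts" "h \<in> harrs" "ranchor X x = anchor A h" "k = xact A x h"
      unfolding orbit_cone_def by blast
    then show "k \<in> (\<Union>U\<in>corr_bisections G X. rng H ` th (Inr U))"
      using rng_covered[of x h] H.rng_unit[of k] k by simp
  qed
  finally show "obj H closure_of (rng H ` th (Inr U)) \<subseteq> (\<Union>W\<in>corr_bisections G X. rng H ` th (Inr W))" .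
qed

end



section \<open>Injectivity of the passage to maps on bisections\<close>

lemma commuting_action_eqI:
  assumes "commuting_action G X H R A" "commuting_action G X H R A'"
    and e: "bisection_map_of G X H A = bisection_map_of G X H A'"
  shows "A = A'"
proof -
  interpret A: commuting_action G X H R A by fact
  interpret B: commuting_action G X H R A' by fact
  \<comment> \<open>The anchors come first: the domains of the two actions can be compared only
    after the anchors agree.\<close>
  have an: "anchor A w = anchor A' w" if w: "w \<in> units H" for w
  proof (rule A.obj_eqI)
    show "anchor A w \<in> units G" "anchor A' w \<in> units G"
      using w A.anchor_units B.anchor_units A.H.unit_closed by auto
    fix N assume "openin (obj G) N" "anchor A w \<in> N"
    then have "w \<in> bisection_map_of G X H A' (Inl N)"
      using A.induces_anchor_th w e unfolding induces_anchor_def by simp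
    then show "anchor A' w \<in> N"
      using B.induces_anchor_th \<open>openin (obj G) N\<close> unfolding induces_anchor_def by simp
  qed
  have anH: "anchor A h = anchor A' h" for h
  proof (cases "h \<in> A.harrs")
    case True
    then show ?thesis using an[of "rng H h"] A.anchor_rng B.anchor_rng A.H.rng_units by metis
  qed (use A.anchor_ext B.anchor_ext in \<open>auto simp: extensional_def\<close>)
  have act0: "act A g w = act A' g w" if g: "g \<in> A.arrs" "w \<in> units H" "src G g = anchor A w" for g w
  proof -
    obtain V where V: "V \<in> bisections G" "g \<in> V" using A.bisection_exists[OF openin_topspace g(1)] .
    have "act A g w \<in> bisection_map_of G X H A (Inl V)"
      unfolding A.th_Inl[OF V(1)] A.gact_def using V g by blast
    moreover have "act A' g w \<in> bisection_map_of G X H A (Inl V)"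
      unfolding e B.th_Inl[OF V(1)] B.gact_def using V g anH by auto
    moreover have "bisection_map_of G X H A (Inl V) \<in> bisections H"
      using A.bisection_gact_units A.th_Inl V by simp
    moreover have "src H (act A g w) = src H (act A' g w)"
      using A.src_act[of g w] B.src_act[of g w] g anH A.H.unit_closed by simp
    ultimately show ?thesis using A.H.bisection_src_eq by blast
  qed
  have xact0: "xact A x w = xact A' x w" if x: "x \<in> A.pts" "w \<in> units H" "ranchor X x = anchor A w" for x w
  proof -
    obtain V where V: "V \<in> corr_bisections G X" "x \<in> V" using A.corr_bisection_exists[OF openin_topspace x(1)] .
    have "xact A x w \<in> bisection_map_of G X H A (Inr V)"
      unfolding A.th_Inr[OF V(1)] A.sact_def using V x by blast
    moreover have "xact A' x w \<in> bisection_map_of G X H A (Inr V)"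
      unfolding e B.th_Inr[OF V(1)] B.sact_def using V x anH by auto
    moreover have "bisection_map_of G X H A (Inr V) \<in> bisections H"
      using A.bisection_sact_units A.th_Inr V by simp
    moreover have "src H (xact A x w) = src H (xact A' x w)"
      using A.src_xact[of x w] B.src_xact[of x w] x anH A.H.unit_closed by simp
    ultimately show ?thesis using A.H.bisection_src_eq by blast
  qed
  have "act A g h = act A' g h" for g h
  proof (cases "g \<in> A.arrs \<and> h \<in> A.harrs \<and> src G g = anchor A h")
    case True
    then have "act A g (rng H h) = act A' g (rng H h)"
      by (intro act0) (auto simp: A.H.rng_units A.anchor_rng)
    then show ?thesis using True A.act_eq_mult(1)[of g h] B.act_eq_mult(1)[of g h] anH by simp
  next
    case False
    \<comment> \<open>Off the common domain both operations take the default value, so agreement on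
      the domain becomes equality of functions.\<close>
    then have "(\<lambda>(g, y). act A g y) (g, h) = undefined" "(\<lambda>(g, y). act A' g y) (g, h) = undefined"
      by (rule_tac extensional_arb[OF A.act_ext], simp, rule_tac extensional_arb[OF B.act_ext], simp add: anH)
    then show ?thesis by simp
  qed
  moreover have "xact A x h = xact A' x h" for x h
  proof (cases "x \<in> A.pts \<and> h \<in> A.harrs \<and> ranchor X x = anchor A h")
    case True
    then have "xact A x (rng H h) = xact A' x (rng H h)"
      by (intro xact0) (auto simp: A.H.rng_units A.anchor_rng)
    then show ?thesis using True A.xact_eq_mult(1)[of x h] B.xact_eq_mult(1)[of x h] anH by simp
  next
    case False
    then have "(\<lambda>(g, y). xact A g y) (x, h) = undefined" "(\<lambda>(g, y). xact A' g y) (x, h) = undefined"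
      by (rule_tac extensional_arb[OF A.xact_ext], simp, rule_tac extensional_arb[OF B.xact_ext], simp add: anH)
    then show ?thesis by simp
  qed
  ultimately have "anchor A = anchor A'" "act A = act A'" "xact A = xact A'"
    using anH by (auto intro!: ext)
  then show ?thesis by simp
qed

section \<open>From maps on bisections to actions\<close>

context etale_groupoid
begin

lemma set_mult_units:
  assumes "U \<subseteq> units G" "V \<subseteq> topspace (arr G)"
  shows "set_mult G U V = {v \<in> V. rng G v \<in> U}"
proof (intro equalityI subsetI)
  fix k assume "k \<in> set_mult G U V"
  then obtain u v where *: "u \<in> U" "v \<in> V" "src G u = rng G v" "k = mult G u v"
    by (auto simp: set_mult_def)
  then have "u = rng G v" using assms src_unit[of u] by auto
  then show "k \<in> {v \<in> V. rng G v \<in> U}" using * assms unit_left[of v] by auto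
next
  fix v assume v: "v \<in> {v \<in> V. rng G v \<in> U}"
  then have "v = mult G (rng G v) v" "src G (rng G v) = rng G v"
    using assms unit_left[of v] src_unit[of "rng G v"] by auto
  then show "v \<in> set_mult G U V" using v unfolding set_mult_def by blast
qed

lemma set_mult_units_right:
  assumes "U \<subseteq> units G" "V \<subseteq> topspace (arr G)"
  shows "set_mult G V U = {v \<in> V. src G v \<in> U}"
proof (intro equalityI subsetI)
  fix k assume "k \<in> set_mult G V U"
  then obtain u v where *: "u \<in> U" "v \<in> V" "src G v = rng G u" "k = mult G v u"
    by (auto simp: set_mult_def)
  then have "u = src G v" using assms rng_unit[of u] by auto
  then show "k \<in> {v \<in> V. src G v \<in> U}" using * assms unit_right[of v] by auto
next
  fix v assume v: "v \<in> {v \<in> V. src G v \<in> U}"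
  then have "v = mult G v (src G v)" "rng G (src G v) = src G v"
    using assms unit_right[of v] rng_unit[of "src G v"] by auto
  then show "v \<in> set_mult G V U" using v unfolding set_mult_def by (smt (verit) mem_Collect_eq)
qed

lemma set_mult_inv_self:
  assumes V: "V \<in> bisections G" shows "set_mult G (invs G ` V) V = src G ` V"
proof (intro equalityI subsetI)
  fix k assume "k \<in> set_mult G (invs G ` V) V"
  then obtain v w where *: "v \<in> V" "w \<in> V" "src G (invs G v) = rng G w" "k = mult G (invs G v) w"
    by (auto simp: set_mult_def)
  then have "v = w" using bisection_rng_eq[OF V] bisection_in[OF V] src_inv by metis
  then show "k \<in> src G ` V" using * bisection_in[OF V] by (simp add: inv_left)
next
  fix k assume "k \<in> src G ` V"
  then obtain v where v: "v \<in> V" "k = src G v" by blast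
  then have "src G (invs G v) = rng G v" "k = mult G (invs G v) v"
    using bisection_in[OF V] by (auto simp: src_inv inv_left)
  then show "k \<in> set_mult G (invs G ` V) V" using v unfolding set_mult_def by blast
qed

text \<open>If g = a b with a and b in V, injectivity of r gives a = g and injectivity of s gives b
  = g. So g is idempotent. Applied to the value of an open set of objects, this places that value
  inside the units of H.\<close>

lemma idempotent_bisection_units:
  assumes V: "V \<in> bisections G" and "set_mult G V V = V"
  shows "V \<subseteq> units G"
proof
  fix g assume g: "g \<in> V"
  then have "g \<in> set_mult G V V" using assms(2) by simp
  then obtain a b where ab: "a \<in> V" "b \<in> V" "src G a = rng G b" "g = mult G a b"
    unfolding set_mult_def by blast
  have t: "a \<in> topspace (arr G)" "b \<in> topspace (arr G)" using ab bisection_in[OF V] by auto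
  have "a = g" using bisection_rng_eq[OF V ab(1) g] ab t by (simp add: rng_mult)
  moreover have "b = g" using bisection_src_eq[OF V ab(2) g] ab t by (simp add: src_mult)
  ultimately show "g \<in> units G" using idempotent_unit[of g] ab(3,4) t by metis
qed

end

context correspondence_setting
begin

lemma set_lact_units:
  assumes "U \<subseteq> units G" "V \<subseteq> pts"
  shows "set_lact G X U V = {v \<in> V. lanchor X v \<in> U}"
proof (intro equalityI subsetI)
  fix k assume "k \<in> set_lact G X U V"
  then obtain u v where *: "u \<in> U" "v \<in> V" "src G u = lanchor X v" "k = lact X u v"
    by (auto simp: set_lact_def)
  then have "u = lanchor X v" using assms src_unit[of u] by auto
  then show "k \<in> {v \<in> V. lanchor X v \<in> U}" using * assms lact_unit[of v] by auto
next
  fix v assume v: "v \<in> {v \<in> V. lanchor X v \<in> U}"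
  then have "v = lact X (lanchor X v) v" "src G (lanchor X v) = lanchor X v"
    using assms lact_unit[of v] src_unit[of "lanchor X v"] by auto
  then show "v \<in> set_lact G X U V" using v unfolding set_lact_def by blast
qed

lemma set_ract_units:
  assumes "U \<subseteq> units G" "V \<subseteq> pts"
  shows "set_ract G X V U = {v \<in> V. ranchor X v \<in> U}"
proof (intro equalityI subsetI)
  fix k assume "k \<in> set_ract G X V U"
  then obtain u v where *: "u \<in> U" "v \<in> V" "ranchor X v = rng G u" "k = ract X v u"
    by (auto simp: set_ract_def)
  then have "u = ranchor X v" using assms rng_unit[of u] by auto
  then show "k \<in> {v \<in> V. ranchor X v \<in> U}" using * assms ract_unit[of v] by auto
next
  fix v assume v: "v \<in> {v \<in> V. ranchor X v \<in> U}"
  then have "v = ract X v (ranchor X v)" "rng G (ranchor X v) = ranchor X v"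
    using assms ract_unit[of v] rng_unit[of "ranchor X v"] by auto
  then show "v \<in> set_ract G X V U" using v unfolding set_ract_def by (smt (verit) mem_Collect_eq)
qed

text \<open>If v and v g both lie in U, they share an orbit and hence agree, and freeness makes g a
  unit. With condition (2) this computes the sources of \<open>\<theta>\<close> on bisections of
  X.\<close>

lemma bracket_self:
  assumes U: "U \<in> corr_bisections G X" shows "bracket G X U U = ranchor X ` U"
proof (intro equalityI subsetI)
  fix g assume "g \<in> bracket G X U U"
  then obtain v where *: "g \<in> arrs" "v \<in> U" "ract X v g \<in> U" "ranchor X v = rng G g"
    by (auto simp: bracket_def)
  then have "orb (ract X v g) = orb v" using orbit_ract corr_bisection_in[OF U] by blast
  then have "ract X v g = v" using corr_bisection_orb_eq[OF U] * by blast
  then have "g \<in> units G" using ract_free * corr_bisection_in[OF U] by blast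
  then show "g \<in> ranchor X ` U" using * rng_unit[of g] by auto
next
  fix g assume "g \<in> ranchor X ` U"
  then obtain v where v: "v \<in> U" "g = ranchor X v" by blast
  then have "g \<in> units G" "ract X v g = v" using ranchor_units ract_unit corr_bisection_in[OF U] by auto
  then show "g \<in> bracket G X U U" unfolding bracket_def using v unit_closed rng_unit by force
qed

end

section \<open>The frame homomorphism of a map on bisections and the map \<rho>\<close>

locale bisection_map = bisection_setting G X H
  for G :: "'g groupoid" and X :: "('g, 'x) correspondence" and H :: "'h groupoid" +
  fixes R :: "'g set" and \<theta> :: "'g set + 'x set \<Rightarrow> 'h set"
  assumes R: "openin (obj G) R" and theta: "\<theta> \<in> bisection_maps G X R H"
begin

abbreviation tG where "tG V \<equiv> \<theta> (Inl V)"
abbreviation tX where "tX U \<equiv> \<theta> (Inr U)"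

lemma theta_parts:
  "\<theta> \<in> (bisections G <+> corr_bisections G X) \<rightarrow>\<^sub>E bisections H"
  "multiplicative G X H \<theta>" "preserves_bracket G X H \<theta>" "tG (units G) = units H"
  "preserves_unions G \<theta>" "covers_range G X R H \<theta>"
  using theta unfolding bisection_maps_def by auto

lemma tG: "V \<in> bisections G \<Longrightarrow> tG V \<in> bisections H"
  and tX: "U \<in> corr_bisections G X \<Longrightarrow> tX U \<in> bisections H"
  using PiE_mem[OF theta_parts(1), of "Inl V"] PiE_mem[OF theta_parts(1), of "Inr U"] by auto

lemma tGG: "\<lbrakk>V \<in> bisections G; W \<in> bisections G\<rbrakk> \<Longrightarrow> set_mult H (tG V) (tG W) = tG (set_mult G V W)"
  and tGX: "\<lbrakk>V \<in> bisections G; U \<in> corr_bisections G X\<rbrakk> \<Longrightarrow> set_mult H (tG V) (tX U) = tX (set_lact G X V U)"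
  and tXG: "\<lbrakk>U \<in> corr_bisections G X; V \<in> bisections G\<rbrakk> \<Longrightarrow> set_mult H (tX U) (tG V) = tX (set_ract G X U V)"
  using theta_parts(2) unfolding multiplicative_def by auto

lemma tXX: "\<lbrakk>U \<in> corr_bisections G X; W \<in> corr_bisections G X\<rbrakk>
    \<Longrightarrow> set_mult H (invs H ` tX U) (tX W) = tG (bracket G X U W)"
  using theta_parts(3) unfolding preserves_bracket_def by auto

lemma tG_units:
  assumes "openin (obj G) U" shows "tG U \<subseteq> units H"
proof (rule H.idempotent_bisection_units)
  have U: "U \<in> bisections G" "U \<subseteq> units G" "U \<subseteq> arrs"
    using open_obj_bisection[OF assms] assms openin_subset[OF assms] units_subset by auto
  show "tG U \<in> bisections H" using tG U by blast
  have "set_mult G U U = U" using set_mult_units[OF U(2,3)] U rng_unit by (auto simp: subset_iff)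
  then show "set_mult H (tG U) (tG U) = tG U" using tGG[OF U(1,1)] by simp
qed

text \<open>For sets of units the product is the intersection, so condition (1) supplies the finite
  meets and condition (4) the joins of a frame homomorphism.\<close>

lemma tG_Int:
  assumes "openin (obj G) U" "openin (obj G) V" shows "tG (U \<inter> V) = tG U \<inter> tG V"
proof -
  have U: "U \<in> bisections G" "U \<subseteq> units G" "U \<subseteq> arrs" and V: "V \<in> bisections G" "V \<subseteq> units G" "V \<subseteq> arrs"
    using assms open_obj_bisection openin_subset[OF assms(1)] openin_subset[OF assms(2)] units_subset by auto
  have "set_mult G U V = U \<inter> V" using set_mult_units[OF U(2) V(3)] V rng_unit by auto
  then have "tG (U \<inter> V) = set_mult H (tG U) (tG V)" using tGG[OF U(1) V(1)] by simp
  also have "\<dots> = tG U \<inter> tG V"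
    using H.set_mult_units[OF tG_units[OF assms(1)], of "tG V"] tG_units[OF assms(2)] H.rng_unit H.units_subset
    by auto
  finally show ?thesis .
qed

lemma tG_Union: "(\<And>U. U \<in> \<U> \<Longrightarrow> openin (obj G) U) \<Longrightarrow> tG (\<Union>\<U>) = (\<Union>U\<in>\<U>. tG U)"
  using theta_parts(5) unfolding preserves_unions_def by blast

lemma tG_mono_obj:
  assumes "openin (obj G) U" "openin (obj G) V" "U \<subseteq> V" shows "tG U \<subseteq> tG V"
  using tG_Int[OF assms(1,2)] assms(3) by (metis Int_absorb2 inf_le2)

text \<open>The map on open sets is a frame homomorphism, so it comes from a continuous map because
  Hausdorff spaces are sober: the largest open set whose image avoids a unit has exactly one
  point in its complement.\<close>

lemma anchor_exists:
  assumes w: "w \<in> units H"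
  shows "\<exists>u\<in>units G. \<forall>U. openin (obj G) U \<longrightarrow> (w \<in> tG U \<longleftrightarrow> u \<in> U)"
proof -
  define U0 where "U0 = \<Union>{U. openin (obj G) U \<and> w \<notin> tG U}"
  have U0: "openin (obj G) U0" "w \<notin> tG U0"
    unfolding U0_def using tG_Union[of "{U. openin (obj G) U \<and> w \<notin> tG U}"] by auto
  have iff: "w \<notin> tG U \<longleftrightarrow> U \<subseteq> U0" if "openin (obj G) U" for U
    using tG_mono_obj[OF that U0(1)] U0(2) that by (auto simp: U0_def)
  have "\<not> units G \<subseteq> U0" using iff[of "units G"] theta_parts(4) w openin_topspace[of "obj G"] by auto
  then obtain u where u: "u \<in> units G" "u \<notin> U0" by blast
  have "v = u" if v: "v \<in> units G" "v \<notin> U0" for v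
  proof (rule ccontr)
    assume "v \<noteq> u"
    then obtain N N' where N: "openin (obj G) N" "openin (obj G) N'" "v \<in> N" "u \<in> N'" "N \<inter> N' = {}"
      using obj_separate[OF v(1) u(1)] by metis
    then have "w \<in> tG N \<inter> tG N'" using iff[OF N(1)] iff[OF N(2)] u v by blast
    then have "w \<in> tG {}" using tG_Int[OF N(1,2)] N(5) by simp
    moreover have "tG {} = {}" using tG_Union[of "{}"] by simp
    ultimately show False by simp
  qed
  note unique = this
  have "w \<in> tG U \<longleftrightarrow> u \<in> U" if U: "openin (obj G) U" for U
  proof -
    have "U \<subseteq> units G" using openin_subset[OF U] by simp
    then have "U \<subseteq> U0 \<longleftrightarrow> u \<notin> U" using u unique by (metis subsetD subsetI)
    then show ?thesis using iff[OF U] by blast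
  qed
  then show ?thesis using u by blast
qed

definition rho where
  "rho w = (SOME u. u \<in> units G \<and> (\<forall>U. openin (obj G) U \<longrightarrow> (w \<in> tG U \<longleftrightarrow> u \<in> U)))"

lemma rho: "w \<in> units H \<Longrightarrow> rho w \<in> units G \<and> (\<forall>U. openin (obj G) U \<longrightarrow> (w \<in> tG U \<longleftrightarrow> rho w \<in> U))"
  unfolding rho_def by (rule someI_ex) (use anchor_exists in blast)

lemma rho_units: "w \<in> units H \<Longrightarrow> rho w \<in> units G"
  using rho by blast

lemma mem_tG_iff: "openin (obj G) U \<Longrightarrow> w \<in> tG U \<longleftrightarrow> w \<in> units H \<and> rho w \<in> U"
  using rho tG_units by blast

lemma continuous_rho: "continuous_map (obj H) (obj G) rho"
  unfolding continuous_map
proof (intro conjI allI impI)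
  show "rho ` topspace (obj H) \<subseteq> topspace (obj G)" using rho_units by auto
  fix U assume U: "openin (obj G) U"
  have "{w \<in> topspace (obj H). rho w \<in> U} = tG U" using mem_tG_iff[OF U] by auto
  moreover have "openin (obj H) (tG U)"
    using tG[OF open_obj_bisection[OF U]] tG_units[OF U] H.bisectionD(1) by (simp add: H.openin_obj_iff)
  ultimately show "openin (obj H) {w \<in> topspace (obj H). rho w \<in> U}" by simp
qed

lemma induces_anchor_rho: "induces_anchor G H \<theta> rho"
  unfolding induces_anchor_def using continuous_rho mem_tG_iff by auto

text \<open>From V = V s(V) the sources lie in the value of s(V). Conversely s(V) is the product of
  the inverse of V with V, so every unit in the value of s(V) is the source of an arrow in the value
  of V.\<close>

lemma src_tG:
  assumes V: "V \<in> bisections G"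
  shows "src H ` tG V = {w \<in> units H. rho w \<in> src G ` V}"
proof (intro equalityI subsetI)
  have Vt: "V \<subseteq> arrs" using bisectionD(4)[OF V] .
  have s: "openin (obj G) (src G ` V)" using bisectionD(5)[OF V] .
  { fix w assume "w \<in> src H ` tG V"
    then obtain b where b: "b \<in> tG V" "w = src H b" by blast
    have "set_mult G V (src G ` V) = V"
      using set_mult_units_right[of "src G ` V" V] openin_subset[OF s] Vt by auto
    then have "b \<in> set_mult H (tG V) (tG (src G ` V))"
      using tGG[OF V open_obj_bisection[OF s]] b by simp
    then have "src H b \<in> tG (src G ` V)"
      using H.set_mult_units_right[OF tG_units[OF s] H.bisectionD(4)[OF tG[OF V]]] by blast
    then show "w \<in> {w \<in> units H. rho w \<in> src G ` V}" using mem_tG_iff[OF s] b by simp }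
  { fix w assume "w \<in> {w \<in> units H. rho w \<in> src G ` V}"
    then have w: "w \<in> units H" "w \<in> tG (src G ` V)" using mem_tG_iff[OF s] by auto
    then have "w \<in> set_mult H (tG (invs G ` V)) (tG V)"
      using tGG[OF bisection_inv[OF V] V] set_mult_inv_self[OF V] by simp
    then obtain a b where ab: "a \<in> tG (invs G ` V)" "b \<in> tG V" "src H a = rng H b" "w = mult H a b"
      by (auto simp: set_mult_def)
    then have "src H b = src H w"
      using H.src_mult[of a b] H.bisection_in[OF tG[OF V]] H.bisection_in[OF tG[OF bisection_inv[OF V]]] by auto
    then show "w \<in> src H ` tG V" using ab w H.src_unit by (metis image_eqI) }
qed

lemma src_tX:
  assumes U: "U \<in> corr_bisections G X"
  shows "src H ` tX U = {w \<in> units H. rho w \<in> ranchor X ` U}"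
proof -
  have "src H ` tX U = set_mult H (invs H ` tX U) (tX U)" using H.set_mult_inv_self[OF tX[OF U]] by simp
  also have "\<dots> = tG (ranchor X ` U)" using tXX[OF U U] bracket_self[OF U] by simp
  finally show ?thesis using mem_tG_iff[OF corr_bisectionD(5)[OF U]] by auto
qed

text \<open>Monotonicity is not among the conditions, but V = V' s(V) holds for bisections V inside
  V'. So the value of V is the restriction of the value of V' to certain sources.\<close>

lemma tG_subset:
  assumes V: "V \<in> bisections G" "V' \<in> bisections G" "V \<subseteq> V'" shows "tG V \<subseteq> tG V'"
proof -
  have s: "openin (obj G) (src G ` V)" using bisectionD(5)[OF V(1)] .
  have "{v \<in> V'. src G v \<in> src G ` V} = V" using bisection_src_eq[OF V(2)] V(3) by blast
  then have "V = set_mult G V' (src G ` V)"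
    using set_mult_units_right[OF _ bisectionD(4)[OF V(2)], of "src G ` V"] openin_subset[OF s]
    by simp
  then have "tG V = set_mult H (tG V') (tG (src G ` V))" using tGG[OF V(2) open_obj_bisection[OF s]] by simp
  then show ?thesis
    using H.set_mult_units_right[OF tG_units[OF s] H.bisectionD(4)[OF tG[OF V(2)]]] by auto
qed

lemma tX_subset:
  assumes V: "V \<in> corr_bisections G X" "V' \<in> corr_bisections G X" "V \<subseteq> V'" shows "tX V \<subseteq> tX V'"
proof -
  have s: "openin (obj G) (ranchor X ` V)" using corr_bisectionD(5)[OF V(1)] .
  have "{v \<in> V'. ranchor X v \<in> ranchor X ` V} = V" using corr_bisection_ranchor_eq[OF V(2)] V(3) by blast
  then have "V = set_ract G X V' (ranchor X ` V)"
    using set_ract_units[OF _ corr_bisectionD(4)[OF V(2)], of "ranchor X ` V"] openin_subset[OF s]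
    by simp
  then have "tX V = set_mult H (tX V') (tG (ranchor X ` V))" using tXG[OF V(2) open_obj_bisection[OF s]] by simp
  then show ?thesis
    using H.set_mult_units_right[OF tG_units[OF s] H.bisectionD(4)[OF tX[OF V(2)]]] by auto
qed

text \<open>The future value of g on the unit w, and below it that of x: the arrow with source w in
  the value of any bisection through g or x.\<close>

definition gu where "gu g w = (THE b. \<exists>V\<in>bisections G. g \<in> V \<and> b \<in> tG V \<and> src H b = w)"
definition xu where "xu x w = (THE b. \<exists>U\<in>corr_bisections G X. x \<in> U \<and> b \<in> tX U \<and> src H b = w)"

text \<open>The intersection of two bisections through g is a bisection whose value has an arrow
  with source w, and by monotonicity this arrow lies in both values.\<close>

lemma gu_unique:
  assumes "V \<in> bisections G" "V' \<in> bisections G" "g \<in> V" "g \<in> V'" "b \<in> tG V" "b' \<in> tG V'"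
    "src H b = w" "src H b' = w" "src G g = rho w" "w \<in> units H"
  shows "b = b'"
proof -
  have O: "V \<inter> V' \<in> bisections G" using bisection_Int[OF assms(1)] bisectionD(1)[OF assms(2)] by blast
  have "w \<in> src H ` tG (V \<inter> V')" unfolding src_tG[OF O] using assms by force
  then obtain c where c: "c \<in> tG (V \<inter> V')" "src H c = w" by blast
  then have "c \<in> tG V" "c \<in> tG V'" using tG_subset[OF O] assms by auto
  then show ?thesis using H.bisection_src_eq tG assms c by metis
qed

lemma xu_unique:
  assumes "V \<in> corr_bisections G X" "V' \<in> corr_bisections G X" "x \<in> V" "x \<in> V'" "b \<in> tX V" "b' \<in> tX V'"
    "src H b = w" "src H b' = w" "ranchor X x = rho w" "w \<in> units H"
  shows "b = b'"
proof -
  have O: "V \<inter> V' \<in> corr_bisections G X" using corr_bisection_Int[OF assms(1)] corr_bisectionD(1)[OF assms(2)] by blast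
  have "w \<in> src H ` tX (V \<inter> V')" unfolding src_tX[OF O] using assms by force
  then obtain c where c: "c \<in> tX (V \<inter> V')" "src H c = w" by blast
  then have "c \<in> tX V" "c \<in> tX V'" using tX_subset[OF O] assms by auto
  then show ?thesis using H.bisection_src_eq tX assms c by metis
qed

lemma gu_eqI:
  assumes "V \<in> bisections G" "g \<in> V" "b \<in> tG V" "src H b = w" "src G g = rho w" "w \<in> units H"
  shows "gu g w = b"
  unfolding gu_def by (rule the_equality) (use assms gu_unique in blast)+

lemma xu_eqI:
  assumes "V \<in> corr_bisections G X" "x \<in> V" "b \<in> tX V" "src H b = w" "ranchor X x = rho w" "w \<in> units H"
  shows "xu x w = b"
  unfolding xu_def by (rule the_equality) (use assms xu_unique in blast)+

lemma gu:
  assumes "V \<in> bisections G" "g \<in> V" "src G g = rho w" "w \<in> units H"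
  shows "gu g w \<in> tG V" "src H (gu g w) = w"
proof -
  have "w \<in> src H ` tG V" unfolding src_tG[OF assms(1)] using assms by force
  then obtain b where b: "b \<in> tG V" "src H b = w" by blast
  then show "gu g w \<in> tG V" "src H (gu g w) = w" using gu_eqI[OF assms(1,2) b] assms by auto
qed

lemma xu:
  assumes "V \<in> corr_bisections G X" "x \<in> V" "ranchor X x = rho w" "w \<in> units H"
  shows "xu x w \<in> tX V" "src H (xu x w) = w"
proof -
  have "w \<in> src H ` tX V" unfolding src_tX[OF assms(1)] using assms by force
  then obtain b where b: "b \<in> tX V" "src H b = w" by blast
  then show "xu x w \<in> tX V" "src H (xu x w) = w" using xu_eqI[OF assms(1,2) b] assms by auto
qed

lemma gu_closed:
  assumes "g \<in> arrs" "src G g = rho w" "w \<in> units H"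
  shows "gu g w \<in> harrs" "src H (gu g w) = w"
proof -
  obtain V where "V \<in> bisections G" "g \<in> V" using bisection_exists[OF openin_topspace assms(1)] .
  then show "gu g w \<in> harrs" "src H (gu g w) = w" using gu assms H.bisection_in tG by blast+
qed

lemma xu_closed:
  assumes "x \<in> pts" "ranchor X x = rho w" "w \<in> units H"
  shows "xu x w \<in> harrs" "src H (xu x w) = w"
proof -
  obtain V where "V \<in> corr_bisections G X" "x \<in> V" using corr_bisection_exists[OF openin_topspace assms(1)] .
  then show "xu x w \<in> harrs" "src H (xu x w) = w" using xu assms H.bisection_in tX by blast+
qed

lemma mem_tG:
  assumes "V \<in> bisections G" "b \<in> tG V"
  obtains g where "g \<in> V" "src G g = rho (src H b)" "b = gu g (src H b)" "src H b \<in> units H"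
proof -
  have "src H b \<in> src H ` tG V" using assms by blast
  then obtain g where "g \<in> V" "src G g = rho (src H b)" "src H b \<in> units H"
    unfolding src_tG[OF assms(1)] by auto
  then show thesis using that gu_eqI[OF assms(1) _ assms(2)] by metis
qed

lemma mem_tX:
  assumes "V \<in> corr_bisections G X" "b \<in> tX V"
  obtains x where "x \<in> V" "ranchor X x = rho (src H b)" "b = xu x (src H b)" "src H b \<in> units H"
proof -
  have "src H b \<in> src H ` tX V" using assms by blast
  then obtain x where "x \<in> V" "ranchor X x = rho (src H b)" "src H b \<in> units H"
    unfolding src_tX[OF assms(1)] by auto
  then show thesis using that xu_eqI[OF assms(1) _ assms(2)] by metis
qed

text \<open>For a neighbourhood N of r(g), a bisection V through g with range in N satisfies N V =
  V. By condition (1) the ranges of the value of V then lie in the value of N.\<close>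

lemma rho_rng_gu:
  assumes g: "g \<in> arrs" "src G g = rho w" "w \<in> units H"
  shows "rho (rng H (gu g w)) = rng G g"
proof (rule obj_eqI[symmetric])
  show "rng G g \<in> units G" "rho (rng H (gu g w)) \<in> units G"
    using g gu_closed H.rng_units rho_units rng_units by auto
  fix N assume N: "openin (obj G) N" "rng G g \<in> N"
  obtain V where V: "V \<in> bisections G" "g \<in> V" "V \<subseteq> {g \<in> arrs. rng G g \<in> N}"
    using bisection_exists[OF openin_rng_preimage[OF N(1)], of g] g N by blast
  have "set_mult G N V = V"
    using set_mult_units[of N V] V bisectionD(4)[OF V(1)] openin_subset[OF N(1)] by auto
  then have "gu g w \<in> set_mult H (tG N) (tG V)"
    using tGG[OF open_obj_bisection[OF N(1)] V(1)] gu[OF V(1,2)] g by simp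
  then have "rng H (gu g w) \<in> tG N"
    using H.set_mult_units[OF tG_units[OF N(1)] H.bisectionD(4)[OF tG[OF V(1)]]] by auto
  then show "rho (rng H (gu g w)) \<in> N" using mem_tG_iff[OF N(1)] by simp
qed

lemma rho_rng_xu:
  assumes x: "x \<in> pts" "ranchor X x = rho w" "w \<in> units H"
  shows "rho (rng H (xu x w)) = lanchor X x"
proof (rule obj_eqI[symmetric])
  show "lanchor X x \<in> units G" "rho (rng H (xu x w)) \<in> units G"
    using x xu_closed H.rng_units rho_units lanchor_units by auto
  fix N assume N: "openin (obj G) N" "lanchor X x \<in> N"
  obtain V where V: "V \<in> corr_bisections G X" "x \<in> V" "V \<subseteq> {x \<in> pts. lanchor X x \<in> N}"
    using corr_bisection_exists[OF openin_lanchor_preimage[OF N(1)], of x] x N by blast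
  have "set_lact G X N V = V"
    using set_lact_units[of N V] V corr_bisectionD(4)[OF V(1)] openin_subset[OF N(1)] by auto
  then have "xu x w \<in> set_mult H (tG N) (tX V)"
    using tGX[OF open_obj_bisection[OF N(1)] V(1)] xu[OF V(1,2)] x by simp
  then have "rng H (xu x w) \<in> tG N"
    using H.set_mult_units[OF tG_units[OF N(1)] H.bisectionD(4)[OF tX[OF V(1)]]] by auto
  then show "rho (rng H (xu x w)) \<in> N" using mem_tG_iff[OF N(1)] by simp
qed

lemma gu_unit: "w \<in> units H \<Longrightarrow> gu (rho w) w = w"
  by (rule gu_eqI[of "units G"])
    (use open_obj_bisection[of "units G"] openin_topspace[of "obj G"] rho_units src_unit theta_parts(4) H.src_unit in auto)

text \<open>Condition (1) puts the product on the right into the value of VW. As its source is w, it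
  is the arrow that defines the left side. The two lemmas on points of X use the mixed cases of (1)
  in the same way.\<close>

lemma gu_mult:
  assumes "g \<in> arrs" "h \<in> arrs" "src G g = rng G h" "src G h = rho w" "w \<in> units H"
  shows "gu (mult G g h) w = mult H (gu g (rng H (gu h w))) (gu h w)"
proof -
  obtain V where V: "V \<in> bisections G" "g \<in> V" using bisection_exists[OF openin_topspace assms(1)] .
  obtain W where W: "W \<in> bisections G" "h \<in> W" using bisection_exists[OF openin_topspace assms(2)] .
  have h: "gu h w \<in> tG W" "src H (gu h w) = w" "gu h w \<in> harrs" "rng H (gu h w) \<in> units H"
    "src G g = rho (rng H (gu h w))"
    using gu[OF W assms(4,5)] gu_closed[OF assms(2,4,5)] rho_rng_gu[OF assms(2,4,5)] assms(3) H.rng_units by auto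
  have g: "gu g (rng H (gu h w)) \<in> tG V" "src H (gu g (rng H (gu h w))) = rng H (gu h w)"
    "gu g (rng H (gu h w)) \<in> harrs"
    using gu[OF V h(5,4)] gu_closed[OF assms(1) h(5,4)] by auto
  show ?thesis
  proof (rule gu_eqI[OF bisection_set_mult[OF V(1) W(1)]])
    show "mult G g h \<in> set_mult G V W" using V W assms by (auto simp: set_mult_def)
    show "mult H (gu g (rng H (gu h w))) (gu h w) \<in> tG (set_mult G V W)"
      unfolding tGG[OF V(1) W(1), symmetric] set_mult_def[of H] using g h by blast
  qed (use g h assms in \<open>auto simp: H.src_mult src_mult\<close>)
qed

lemma xu_lact:
  assumes "g \<in> arrs" "x \<in> pts" "src G g = lanchor X x" "ranchor X x = rho w" "w \<in> units H"
  shows "xu (lact X g x) w = mult H (gu g (rng H (xu x w))) (xu x w)"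
proof -
  obtain V where V: "V \<in> bisections G" "g \<in> V" using bisection_exists[OF openin_topspace assms(1)] .
  obtain W where W: "W \<in> corr_bisections G X" "x \<in> W" using corr_bisection_exists[OF openin_topspace assms(2)] .
  have h: "xu x w \<in> tX W" "src H (xu x w) = w" "xu x w \<in> harrs" "rng H (xu x w) \<in> units H"
    "src G g = rho (rng H (xu x w))"
    using xu[OF W assms(4,5)] xu_closed[OF assms(2,4,5)] rho_rng_xu[OF assms(2,4,5)] assms(3) H.rng_units by auto
  have g: "gu g (rng H (xu x w)) \<in> tG V" "src H (gu g (rng H (xu x w))) = rng H (xu x w)"
    "gu g (rng H (xu x w)) \<in> harrs"
    using gu[OF V h(5,4)] gu_closed[OF assms(1) h(5,4)] by auto
  show ?thesis
  proof (rule xu_eqI[OF corr_bisection_set_lact[OF V(1) W(1)]])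
    show "lact X g x \<in> set_lact G X V W" using V W assms by (auto simp: set_lact_def)
    show "mult H (gu g (rng H (xu x w))) (xu x w) \<in> tX (set_lact G X V W)"
      unfolding tGX[OF V(1) W(1), symmetric] set_mult_def using g h by blast
  qed (use g h assms in \<open>auto simp: H.src_mult ranchor_lact\<close>)
qed

lemma xu_ract:
  assumes "x \<in> pts" "g \<in> arrs" "ranchor X x = rng G g" "src G g = rho w" "w \<in> units H"
  shows "xu (ract X x g) w = mult H (xu x (rng H (gu g w))) (gu g w)"
proof -
  obtain V where V: "V \<in> corr_bisections G X" "x \<in> V" using corr_bisection_exists[OF openin_topspace assms(1)] .
  obtain W where W: "W \<in> bisections G" "g \<in> W" using bisection_exists[OF openin_topspace assms(2)] .
  have h: "gu g w \<in> tG W" "src H (gu g w) = w" "gu g w \<in> harrs" "rng H (gu g w) \<in> units H"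
    "ranchor X x = rho (rng H (gu g w))"
    using gu[OF W assms(4,5)] gu_closed[OF assms(2,4,5)] rho_rng_gu[OF assms(2,4,5)] assms(3) H.rng_units by auto
  have g: "xu x (rng H (gu g w)) \<in> tX V" "src H (xu x (rng H (gu g w))) = rng H (gu g w)"
    "xu x (rng H (gu g w)) \<in> harrs"
    using xu[OF V h(5,4)] xu_closed[OF assms(1) h(5,4)] by auto
  show ?thesis
  proof (rule xu_eqI[OF corr_bisection_set_ract[OF V(1) W(1)]])
    show "ract X x g \<in> set_ract G X V W" using V W assms by (auto simp: set_ract_def)
    show "mult H (xu x (rng H (gu g w))) (gu g w) \<in> tX (set_ract G X V W)"
      unfolding tXG[OF V(1) W(1), symmetric] set_mult_def using g h by blast
  qed (use g h assms in \<open>auto simp: H.src_mult ranchor_ract\<close>)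
qed

text \<open>The source of the harder half of axiom (ii). By condition (2) the quotient lies in the
  value of the bracket of V and W, hence comes from some g with v g in W. The sources identify v g
  with x', and the anchor of the quotient identifies v with x.\<close>

lemma xu_inv_xu:
  assumes "x \<in> pts" "ranchor X x = rho w" "w \<in> units H" "x' \<in> pts" "ranchor X x' = rho w'" "w' \<in> units H"
    and r: "rng H (xu x w) = rng H (xu x' w')"
  obtains g where "g \<in> arrs" "ranchor X x = rng G g" "src G g = rho w'" "x' = ract X x g"
    "mult H (invs H (xu x w)) (xu x' w') = gu g w'"
proof -
  obtain V where V: "V \<in> corr_bisections G X" "x \<in> V" using corr_bisection_exists[OF openin_topspace assms(1)] .
  obtain W where W: "W \<in> corr_bisections G X" "x' \<in> W" using corr_bisection_exists[OF openin_topspace assms(4)] .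
  define k where "k = mult H (invs H (xu x w)) (xu x' w')"
  have x: "xu x w \<in> tX V" "src H (xu x w) = w" "xu x w \<in> harrs"
    using xu[OF V assms(2,3)] xu_closed[OF assms(1-3)] by auto
  have x': "xu x' w' \<in> tX W" "src H (xu x' w') = w'" "xu x' w' \<in> harrs"
    using xu[OF W assms(5,6)] xu_closed[OF assms(4-6)] by auto
  have k: "k \<in> harrs" "src H k = w'" "rng H k = w"
    using x x' r by (auto simp: k_def H.mult_closed H.inv_closed H.src_inv H.src_mult H.rng_mult H.rng_inv)
  have "src H (invs H (xu x w)) = rng H (xu x' w')" using x r by (simp add: H.src_inv)
  then have "k \<in> tG (bracket G X V W)"
    unfolding tXX[OF V(1) W(1), symmetric] set_mult_def k_def using x(1) x'(1) by blast
  then obtain g where g: "g \<in> bracket G X V W" "src G g = rho w'" "k = gu g w'"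
    using mem_tG[OF bisection_bracket[OF V(1) W(1)], of k] k(2) by metis
  then obtain v where v: "g \<in> arrs" "v \<in> V" "ranchor X v = rng G g" "ract X v g \<in> W"
    unfolding bracket_def by blast
  have "ranchor X (ract X v g) = ranchor X x'"
    using v g assms corr_bisection_in[OF V(1)] by (simp add: ranchor_ract)
  then have e: "x' = ract X v g" using corr_bisection_ranchor_eq[OF W(1)] v W by metis
  have "ranchor X v = ranchor X x" using rho_rng_gu[OF v(1) g(2) assms(6)] g k v assms by simp
  then have "v = x" using corr_bisection_ranchor_eq[OF V(1)] v V by metis
  then show thesis using that[of g] v g e unfolding k_def by simp
qed

subsection \<open>The induced action\<close>

text \<open>Right invariance leaves no other choice: the value on h is the value on the unit r(h),
  multiplied by h. Values off the domain are fixed because actions are extensional.\<close>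

definition the_action :: "('g, 'x, 'h) corr_action" where
  "the_action = \<lparr>anchor = restrict (\<lambda>h. rho (rng H h)) harrs,
     act = (\<lambda>g h. if g \<in> arrs \<and> h \<in> harrs \<and> src G g = rho (rng H h) then mult H (gu g (rng H h)) h else undefined),
     xact = (\<lambda>x h. if x \<in> pts \<and> h \<in> harrs \<and> ranchor X x = rho (rng H h) then mult H (xu x (rng H h)) h else undefined)\<rparr>"

lemma the_anchor: "h \<in> harrs \<Longrightarrow> anchor the_action h = rho (rng H h)"
  and the_act: "\<lbrakk>g \<in> arrs; h \<in> harrs; src G g = rho (rng H h)\<rbrakk> \<Longrightarrow> act the_action g h = mult H (gu g (rng H h)) h"
  and the_xact: "\<lbrakk>x \<in> pts; h \<in> harrs; ranchor X x = rho (rng H h)\<rbrakk> \<Longrightarrow> xact the_action x h = mult H (xu x (rng H h)) h"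
  by (simp_all add: the_action_def)

lemma rng_the_act:
  "\<lbrakk>g \<in> arrs; h \<in> harrs; src G g = rho (rng H h)\<rbrakk> \<Longrightarrow> rng H (mult H (gu g (rng H h)) h) = rng H (gu g (rng H h))"
  "\<lbrakk>g \<in> arrs; h \<in> harrs; src G g = rho (rng H h)\<rbrakk> \<Longrightarrow> mult H (gu g (rng H h)) h \<in> harrs"
  "\<lbrakk>g \<in> arrs; h \<in> harrs; src G g = rho (rng H h)\<rbrakk> \<Longrightarrow> src H (mult H (gu g (rng H h)) h) = src H h"
  using gu_closed[of g "rng H h"] by (simp_all add: H.rng_mult H.src_mult H.mult_closed H.rng_units)

lemma rng_the_xact:
  "\<lbrakk>x \<in> pts; h \<in> harrs; ranchor X x = rho (rng H h)\<rbrakk> \<Longrightarrow> rng H (mult H (xu x (rng H h)) h) = rng H (xu x (rng H h))"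
  "\<lbrakk>x \<in> pts; h \<in> harrs; ranchor X x = rho (rng H h)\<rbrakk> \<Longrightarrow> mult H (xu x (rng H h)) h \<in> harrs"
  "\<lbrakk>x \<in> pts; h \<in> harrs; ranchor X x = rho (rng H h)\<rbrakk> \<Longrightarrow> src H (mult H (xu x (rng H h)) h) = src H h"
  using xu_closed[of x "rng H h"] by (simp_all add: H.rng_mult H.src_mult H.mult_closed H.rng_units)

lemma the_xact_eq_iff:
  assumes "x \<in> pts" "x' \<in> pts" "h \<in> harrs" "h' \<in> harrs"
    "ranchor X x = rho (rng H h)" "ranchor X x' = rho (rng H h')"
  shows "mult H (xu x (rng H h)) h = mult H (xu x' (rng H h')) h' \<longleftrightarrow>
    (\<exists>g\<in>arrs. ranchor X x = rng G g \<and> src G g = rho (rng H h') \<and> x' = ract X x g \<and> h = mult H (gu g (rng H h')) h')"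
    (is "?L \<longleftrightarrow> ?R")
proof -
  have u: "rng H h \<in> units H" "rng H h' \<in> units H" using assms H.rng_units by auto
  note x = xu_closed[OF assms(1,5) u(1)] and x' = xu_closed[OF assms(2,6) u(2)]
  show ?thesis
  proof
    assume L: ?L
    have r: "rng H (xu x (rng H h)) = rng H (xu x' (rng H h'))"
      using rng_the_xact(1)[OF assms(1,3,5)] rng_the_xact(1)[OF assms(2,4,6)] L by simp
    obtain g where g: "g \<in> arrs" "ranchor X x = rng G g" "src G g = rho (rng H h')" "x' = ract X x g"
      "mult H (invs H (xu x (rng H h))) (xu x' (rng H h')) = gu g (rng H h')"
      using xu_inv_xu[OF assms(1,5) u(1) assms(2,6) u(2) r] .
    \<comment> \<open>Both products have the same range, so the first factor can be moved to the
      other side; the remaining quotient is the one just identified with a value of g.\<close>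
    have "h = mult H (invs H (xu x (rng H h))) (mult H (xu x (rng H h)) h)"
      using H.mult_inv_cancel_left x assms by simp
    also have "\<dots> = mult H (mult H (invs H (xu x (rng H h))) (xu x' (rng H h'))) h'"
      unfolding L using x x' r assms H.mult_assoc[of "invs H (xu x (rng H h))" "xu x' (rng H h')" h']
      by (simp add: H.inv_closed H.src_inv)
    finally have "h = mult H (gu g (rng H h')) h'" using g(5) by simp
    with g show ?R by blast
  next
    assume ?R
    then obtain g where g: "g \<in> arrs" "ranchor X x = rng G g" "src G g = rho (rng H h')" "x' = ract X x g"
      "h = mult H (gu g (rng H h')) h'" by blast
    have c: "gu g (rng H h') \<in> harrs" "src H (gu g (rng H h')) = rng H h'" using gu_closed[OF g(1,3) u(2)] by auto
    have rh: "rng H h = rng H (gu g (rng H h'))" using rng_the_act(1)[OF g(1) assms(4) g(3)] g(5) by simp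
    have "xu x' (rng H h') = mult H (xu x (rng H h)) (gu g (rng H h'))"
      using xu_ract[OF assms(1) g(1,2,3) u(2)] g(4) rh by simp
    then have "mult H (xu x' (rng H h')) h' = mult H (xu x (rng H h)) (mult H (gu g (rng H h')) h')"
      using H.mult_assoc[of "xu x (rng H h)" "gu g (rng H h')" h'] x c rh assms by simp
    then show ?L using g(5) by simp
  qed
qed

sublocale TA: algebraic_action G X R harrs the_action
proof (unfold_locales, goal_cases)
  case (13 y)
  then have y: "y \<in> harrs" "rng H y \<in> units H" "rho (rng H y) \<in> R" by (auto simp: the_anchor H.rng_units)
  then have "rng H y \<in> rng H ` tG R" using mem_tG_iff[OF R, of "rng H y"] H.rng_unit by (metis image_eqI)
  then obtain U b where U: "U \<in> corr_bisections G X" "b \<in> tX U" "rng H y = rng H b"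
    using theta_parts(6) unfolding covers_range_def by auto
  obtain x where x: "x \<in> U" "ranchor X x = rho (src H b)" "b = xu x (src H b)" using mem_tX[OF U(1,2)] by metis
  have b: "b \<in> harrs" using H.bisection_in[OF tX[OF U(1)] U(2)] .
  \<comment> \<open>Condition (5) gives only an arrow b with the same range as y. The factorisation
    y = b z corrects this by right translation.\<close>
  define z where "z = mult H (invs H b) y"
  have z: "z \<in> harrs" "rng H z = src H b" "y = mult H b z"
    using b y U(3) by (auto simp: z_def H.mult_closed H.inv_closed H.src_inv H.rng_mult H.rng_inv H.mult_inv_cancel_left')
  have "x \<in> pts" using corr_bisection_in[OF U(1) x(1)] .
  moreover have "ranchor X x = anchor the_action z" using x z by (simp add: the_anchor)
  moreover have "y = xact the_action x z" using the_xact[of x z] x z \<open>x \<in> pts\<close> by simp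
  ultimately show ?case using z(1) by blast
next
  case (12 x x' y y')
  then show ?case using the_xact_eq_iff[of x x' y y'] by (auto simp: the_anchor the_xact the_act)
next
  case 2 then show ?case by (auto simp: the_action_def extensional_def)
next
  case 3 then show ?case by (auto simp: the_action_def extensional_def)
next
  case (11 g x y)
  then have y: "y \<in> harrs" "rng H y \<in> units H" "ranchor X x = rho (rng H y)" by (auto simp: the_anchor H.rng_units)
  note xc = xu_closed[OF 11(2) y(3,2)] and rx = rho_rng_xu[OF 11(2) y(3,2)]
  have r: "rng H (xu x (rng H y)) \<in> units H" using xc H.rng_units by blast
  have gc: "gu g (rng H (xu x (rng H y))) \<in> harrs" "src H (gu g (rng H (xu x (rng H y)))) = rng H (xu x (rng H y))"
    using gu_closed[OF 11(1) _ r] rx 11 by auto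
  have "act the_action g (xact the_action x y) = mult H (gu g (rng H (xu x (rng H y)))) (mult H (xu x (rng H y)) y)"
    using 11 y rx rng_the_xact[OF 11(2) y(1,3)] by (simp add: the_xact the_act)
  also have "\<dots> = mult H (mult H (gu g (rng H (xu x (rng H y)))) (xu x (rng H y))) y"
    using H.mult_assoc gc xc y by simp
  also have "\<dots> = xact the_action (lact X g x) y"
    using xu_lact[OF 11(1,2) 11(4) y(3,2)] 11 y by (simp add: the_xact lact_closed ranchor_lact)
  finally show ?case .
next
  case (8 g h y)
  then have y: "y \<in> harrs" "rng H y \<in> units H" "src G h = rho (rng H y)" by (auto simp: the_anchor H.rng_units)
  note xc = gu_closed[OF 8(2) y(3,2)] and rx = rho_rng_gu[OF 8(2) y(3,2)]
  have r: "rng H (gu h (rng H y)) \<in> units H" using xc H.rng_units by blast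
  have gc: "gu g (rng H (gu h (rng H y))) \<in> harrs" "src H (gu g (rng H (gu h (rng H y)))) = rng H (gu h (rng H y))"
    using gu_closed[OF 8(1) _ r] rx 8 by auto
  have "act the_action g (act the_action h y) = mult H (gu g (rng H (gu h (rng H y)))) (mult H (gu h (rng H y)) y)"
    using 8 y rx rng_the_act[OF 8(2) y(1,3)] by (simp add: the_act)
  also have "\<dots> = mult H (mult H (gu g (rng H (gu h (rng H y)))) (gu h (rng H y))) y"
    using H.mult_assoc gc xc y by simp
  also have "\<dots> = act the_action (mult G g h) y"
    using gu_mult[OF 8(1,2) 8(4) y(3,2)] 8 y by (simp add: the_act mult_closed src_mult)
  finally show ?case by simp
next
  case (6 y)
  then show ?case using gu_unit[of "rng H y"] src_unit[of "rho (rng H y)"] rho_units[of "rng H y"]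
    by (simp add: the_anchor the_act H.rng_units unit_closed H.unit_left)
qed (use rng_the_act rng_the_xact in \<open>simp_all add: the_action_def[THEN arg_cong[of _ _ anchor]] the_anchor the_act the_xact
  rho_units H.rng_units rho_rng_gu rho_rng_xu\<close>)

end

section \<open>Topology of the induced action\<close>

context bisection_map
begin

lemma ssec_tG: "\<lbrakk>V \<in> bisections G; g \<in> V; src G g = rho w; w \<in> units H\<rbrakk> \<Longrightarrow> H.ssec (tG V) w = gu g w"
  using H.ssec_eq[OF tG, of V "gu g w" w] gu[of V g w] by simp

lemma ssec_tX: "\<lbrakk>U \<in> corr_bisections G X; x \<in> U; ranchor X x = rho w; w \<in> units H\<rbrakk> \<Longrightarrow> H.ssec (tX U) w = xu x w"
  using H.ssec_eq[OF tX, of U "xu x w" w] xu[of U x w] by simp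

lemma continuous_the_anchor: "continuous_map (arr H) (obj G) (anchor the_action)"
proof (rule continuous_map_eq)
  show "continuous_map (arr H) (obj G) (rho \<circ> rng H)"
    using continuous_map_compose[OF H.continuous_rng continuous_rho] .
qed (simp add: the_anchor)

text \<open>While g stays in a bisection V, the value on r(h) is the section of the source map of
  the value of V at r(h). This formula no longer mentions g, so it is continuous in h, and h depends
  continuously on the pair.\<close>

lemma continuous_the_act:
  "continuous_map (subtopology (prod_topology (arr G) (arr H)) {(g, y). src G g = anchor the_action y})
    (arr H) (\<lambda>(g, y). act the_action g y)" (is "continuous_map ?D _ _")
proof (rule continuous_map_locallyI)
  fix z assume z: "z \<in> topspace ?D"
  obtain g h where gh: "z = (g, h)" by (cases z)
  then have *: "g \<in> arrs" "h \<in> harrs" "src G g = anchor the_action h" using z by auto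
  show "(case z of (g, y) \<Rightarrow> act the_action g y) \<in> topspace (arr H)" using TA.act_closed[OF *] gh by simp
  obtain V where V: "V \<in> bisections G" "g \<in> V" using bisection_exists[OF openin_topspace *(1)] .
  define E where "E = {z \<in> topspace ?D. fst z \<in> V}"
  have c: "continuous_map ?D (arr G) fst" "continuous_map ?D (arr H) snd"
    by (simp_all add: continuous_map_from_subtopology continuous_map_fst continuous_map_snd)
  have "openin ?D E" unfolding E_def
    using c(1) bisectionD(1)[OF V(1)] openin_continuous_map_preimage by blast
  moreover have "z \<in> E" using z gh V by (simp add: E_def)
  moreover have "continuous_map (subtopology ?D E) (arr H) (\<lambda>(g, y). act the_action g y)"
  proof (rule continuous_map_eq)
    have s: "continuous_map (subtopology ?D E) (arr H) snd"
      using c(2) continuous_map_from_subtopology by blast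
    have e: "rng H h \<in> src H ` tG V \<and> H.ssec (tG V) (rng H h) = gu g (rng H h)"
      if "(g, h) \<in> topspace (subtopology ?D E)" for g h
    proof -
      have *: "g \<in> V" "h \<in> harrs" "src G g = rho (rng H h)" "rng H h \<in> units H"
        using that by (auto simp: E_def the_anchor H.rng_units)
      then show ?thesis using ssec_tG[OF V(1) *(1,3,4)] src_tG[OF V(1)] by force
    qed
    show "continuous_map (subtopology ?D E) (arr H) (\<lambda>z. mult H (H.ssec (tG V) (rng H (snd z))) (snd z))"
    proof (intro H.cont_mult H.cont_ssec H.cont_rng s tG V)
      fix z assume z: "z \<in> topspace (subtopology ?D E)"
      then have "(fst z, snd z) \<in> topspace (subtopology ?D E)" by simp
      from e[OF this] show "rng H (snd z) \<in> src H ` tG V"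
        and "src H (H.ssec (tG V) (rng H (snd z))) = rng H (snd z)"
        using H.ssec[OF tG[OF V(1)]] by blast+
    qed
    fix z assume z: "z \<in> topspace (subtopology ?D E)"
    then have z': "(fst z, snd z) \<in> topspace (subtopology ?D E)" by simp
    have "act the_action (fst z) (snd z) = mult H (gu (fst z) (rng H (snd z))) (snd z)"
      by (rule the_act) (use z in \<open>auto simp: the_anchor\<close>)
    then show "mult H (H.ssec (tG V) (rng H (snd z))) (snd z) = (case z of (g, y) \<Rightarrow> act the_action g y)"
      using e[OF z'] by (simp add: case_prod_beta)
  qed
  ultimately show "\<exists>E. openin ?D E \<and> z \<in> E \<and> continuous_map (subtopology ?D E) (arr H) (\<lambda>(g, y). act the_action g y)"
    by blast
qed

lemma continuous_the_xact:
  "continuous_map (subtopology (prod_topology (spc X) (arr H)) {(x, y). ranchor X x = anchor the_action y})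
    (arr H) (\<lambda>(x, y). xact the_action x y)" (is "continuous_map ?D _ _")
proof (rule continuous_map_locallyI)
  fix z assume z: "z \<in> topspace ?D"
  obtain g h where gh: "z = (g, h)" by (cases z)
  then have *: "g \<in> pts" "h \<in> harrs" "ranchor X g = anchor the_action h" using z by auto
  show "(case z of (g, y) \<Rightarrow> xact the_action g y) \<in> topspace (arr H)" using TA.xact_closed[OF *] gh by simp
  obtain V where V: "V \<in> corr_bisections G X" "g \<in> V" using corr_bisection_exists[OF openin_topspace *(1)] .
  define E where "E = {z \<in> topspace ?D. fst z \<in> V}"
  have c: "continuous_map ?D (spc X) fst" "continuous_map ?D (arr H) snd"
    by (simp_all add: continuous_map_from_subtopology continuous_map_fst continuous_map_snd)
  have "openin ?D E" unfolding E_def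
    using c(1) corr_bisectionD(1)[OF V(1)] openin_continuous_map_preimage by blast
  moreover have "z \<in> E" using z gh V by (simp add: E_def)
  moreover have "continuous_map (subtopology ?D E) (arr H) (\<lambda>(g, y). xact the_action g y)"
  proof (rule continuous_map_eq)
    have s: "continuous_map (subtopology ?D E) (arr H) snd"
      using c(2) continuous_map_from_subtopology by blast
    have e: "rng H h \<in> src H ` tX V \<and> H.ssec (tX V) (rng H h) = xu g (rng H h)"
      if "(g, h) \<in> topspace (subtopology ?D E)" for g h
    proof -
      have *: "g \<in> V" "h \<in> harrs" "ranchor X g = rho (rng H h)" "rng H h \<in> units H"
        using that by (auto simp: E_def the_anchor H.rng_units)
      then show ?thesis using ssec_tX[OF V(1) *(1,3,4)] src_tX[OF V(1)] by force
    qed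
    show "continuous_map (subtopology ?D E) (arr H) (\<lambda>z. mult H (H.ssec (tX V) (rng H (snd z))) (snd z))"
    proof (intro H.cont_mult H.cont_ssec H.cont_rng s tX V)
      fix z assume z: "z \<in> topspace (subtopology ?D E)"
      then have "(fst z, snd z) \<in> topspace (subtopology ?D E)" by simp
      from e[OF this] show "rng H (snd z) \<in> src H ` tX V"
        and "src H (H.ssec (tX V) (rng H (snd z))) = rng H (snd z)"
        using H.ssec[OF tX[OF V(1)]] by blast+
    qed
    fix z assume z: "z \<in> topspace (subtopology ?D E)"
    then have z': "(fst z, snd z) \<in> topspace (subtopology ?D E)" by simp
    have "xact the_action (fst z) (snd z) = mult H (xu (fst z) (rng H (snd z))) (snd z)"
      by (rule the_xact) (use z in \<open>auto simp: the_anchor\<close>)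
    then show "mult H (H.ssec (tX V) (rng H (snd z))) (snd z) = (case z of (g, y) \<Rightarrow> xact the_action g y)"
      using e[OF z'] by (simp add: case_prod_beta)
  qed
  ultimately show "\<exists>E. openin ?D E \<and> z \<in> E \<and> continuous_map (subtopology ?D E) (arr H) (\<lambda>(g, y). xact the_action g y)"
    by blast
qed

text \<open>Turns openness of the action of X into openness of products of open sets in H.\<close>

lemma sact_the_action:
  assumes U: "U \<in> corr_bisections G X" and B: "B \<subseteq> harrs"
  shows "TA.sact U B = set_mult H (tX U) B"
proof (intro equalityI subsetI)
  fix k assume "k \<in> TA.sact U B"
  then obtain x h where *: "x \<in> U" "h \<in> B" "ranchor X x = anchor the_action h" "k = xact the_action x h"
    unfolding TA.sact_def by blast
  then have t: "x \<in> pts" "h \<in> harrs" "ranchor X x = rho (rng H h)" "rng H h \<in> units H"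
    using B corr_bisection_in[OF U] by (auto simp: the_anchor H.rng_units subset_iff)
  have "k = mult H (xu x (rng H h)) h" using * the_xact[OF t(1-3)] by simp
  then show "k \<in> set_mult H (tX U) B"
    unfolding set_mult_def using xu[OF U *(1) t(3,4)] *(2) by blast
next
  fix k assume "k \<in> set_mult H (tX U) B"
  then obtain b h where *: "b \<in> tX U" "h \<in> B" "src H b = rng H h" "k = mult H b h"
    unfolding set_mult_def by blast
  obtain x where x: "x \<in> U" "ranchor X x = rho (rng H h)" "b = xu x (rng H h)"
    using mem_tX[OF U *(1)] *(3) by metis
  have h: "h \<in> harrs" using * B by blast
  have "k = xact the_action x h" using the_xact[OF corr_bisection_in[OF U x(1)] h x(2)] x(3) * by simp
  then show "k \<in> TA.sact U B" unfolding TA.sact_def using x *(2) the_anchor[OF h] by (smt (verit) mem_Collect_eq)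
qed

lemma gact_the_action:
  assumes V: "V \<in> bisections G"
  shows "TA.gact V (units H) = tG V"
proof (intro equalityI subsetI)
  fix k assume "k \<in> TA.gact V (units H)"
  then obtain g w where *: "g \<in> V" "w \<in> units H" "src G g = anchor the_action w" "k = act the_action g w"
    unfolding TA.gact_def by blast
  then have t: "g \<in> arrs" "w \<in> harrs" "src G g = rho w" "rng H w = w"
    using bisection_in[OF V] H.unit_closed H.rng_unit by (auto simp: the_anchor)
  have "k = mult H (gu g w) w" using the_act[of g w] t * by simp
  also have "\<dots> = gu g w"
    using H.unit_right[of "gu g w"] gu_closed[OF t(1,3) *(2)] by simp
  finally show "k \<in> tG V" using gu[OF V *(1) t(3) *(2)] by simp
next
  fix b assume b: "b \<in> tG V"
  obtain g where g: "g \<in> V" "src G g = rho (src H b)" "b = gu g (src H b)" "src H b \<in> units H"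
    using mem_tG[OF V b] by metis
  have s: "src H b \<in> harrs" "rng H (src H b) = src H b" using g H.unit_closed H.rng_unit by auto
  have bh: "b \<in> harrs" using H.bisection_in[OF tG[OF V] b] .
  have "act the_action g (src H b) = mult H b (src H b)"
    using the_act[OF bisection_in[OF V g(1)] s(1)] s g by simp
  then have "b = act the_action g (src H b)" using H.unit_right[OF bh] by simp
  moreover have "src G g = anchor the_action (src H b)" using g s by (simp add: the_anchor)
  ultimately show "b \<in> TA.gact V (units H)" unfolding TA.gact_def using g by blast
qed

lemma openin_the_sact:
  assumes W: "openin (spc X) W" and B: "openin (arr H) B"
  shows "openin (arr H) (TA.sact W B)"
proof (subst openin_subopen, intro ballI)
  fix k assume "k \<in> TA.sact W B"
  then obtain x h where *: "x \<in> W" "h \<in> B" "ranchor X x = anchor the_action h" "k = xact the_action x h"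
    unfolding TA.sact_def by blast
  obtain U where U: "U \<in> corr_bisections G X" "x \<in> U" "U \<subseteq> W" using corr_bisection_exists[OF W *(1)] .
  have "openin (arr H) (TA.sact U B)"
    unfolding sact_the_action[OF U(1) openin_subset[OF B]]
    by (rule H.openin_set_mult[OF H.bisectionD(1)[OF tX[OF U(1)]] B])
  moreover have "k \<in> TA.sact U B" unfolding TA.sact_def using * U by blast
  ultimately show "\<exists>T. openin (arr H) T \<and> k \<in> T \<and> T \<subseteq> TA.sact W B"
    using TA.sact_mono[OF U(3) order_refl] by blast
qed

text \<open>The cone of K is saturated under right translation, so it suffices to look at units. A
  unit outside it either has the form r(x w) with [x] outside the closed set K, or is not in the range
  of any bisection; then condition (6) and a finite cover of K separate it from the cone.\<close>

lemma closedin_the_cone: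
  assumes cc: "closure_condition G X H \<theta>" and K: "compactin XG K"
  shows "closedin (arr H) (TA.orbit_cone K)"
proof -
  define T where "T = (\<Union>W\<in>corr_bisections G X. rng H ` tX W)"
  have clK: "closedin XG K" using compactin_imp_closedin[OF Hausdorff_XG K] .
  have rng_xact: "rng H (xact the_action x h) = rng H (xu x (rng H h))"
    "xact the_action x h \<in> harrs" "rng H h \<in> units H" "ranchor X x = rho (rng H h)"
    if "x \<in> pts" "h \<in> harrs" "ranchor X x = anchor the_action h" for x h
    using that the_xact[of x h] rng_the_xact[of x h] by (simp_all add: the_anchor H.rng_units)
  have sep: "orb x = orb x'"
    if "x \<in> pts" "x' \<in> pts" "w \<in> units H" "w' \<in> units H" "ranchor X x = rho w" "ranchor X x' = rho w'"
      "rng H (xu x w) = rng H (xu x' w')" for x x' w w'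
    using xu_inv_xu[OF that(1,5,3,2,6,4,7)] orbit_ract[of x] that(1) by metis
  have cone_rng: "\<exists>x w. x \<in> pts \<and> orb x \<in> K \<and> w \<in> units H \<and> ranchor X x = rho w \<and> rng H h = rng H (xu x w)"
    if "h \<in> TA.orbit_cone K" for h
    using that rng_xact unfolding TA.orbit_cone_def by blast
  have "openin (arr H) (harrs - TA.orbit_cone K)"
  proof (subst openin_subopen, intro ballI)
    fix h assume h: "h \<in> harrs - TA.orbit_cone K"
    show "\<exists>N. openin (arr H) N \<and> h \<in> N \<and> N \<subseteq> harrs - TA.orbit_cone K"
    proof (cases "rng H h \<in> T")
      case True
      then obtain U b where U: "U \<in> corr_bisections G X" "b \<in> tX U" "rng H h = rng H b" unfolding T_def by auto
      obtain x where x: "x \<in> U" "ranchor X x = rho (src H b)" "b = xu x (src H b)" "src H b \<in> units H"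
        using mem_tX[OF U(1,2)] by metis
      have b: "b \<in> harrs" "x \<in> pts" using H.bisection_in[OF tX[OF U(1)] U(2)] corr_bisection_in[OF U(1) x(1)] by auto
      have "orb x \<notin> K"
      proof
        assume o: "orb x \<in> K"
        define z where "z = mult H (invs H b) h"
        have z: "z \<in> harrs" "rng H z = src H b" "h = mult H b z"
          using b h U(3) by (auto simp: z_def H.mult_closed H.inv_closed H.src_inv H.rng_mult H.rng_inv H.mult_inv_cancel_left')
        then have "h = xact the_action x z" using the_xact[of x z] x b by simp
        then have "h \<in> TA.orbit_cone K" using TA.mem_orbit_coneI[OF b(2) o z(1)] z x by (simp add: the_anchor)
        then show False using h by simp
      qed
      \<comment> \<open>Deleting the points with orbit in the closed set K keeps x. Any cone element
        whose range agrees with that of a value of U' would have its orbit both in K and outside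
        K.\<close>
      define U' where "U' = {x \<in> pts. orb x \<in> topspace XG - K} \<inter> U"
      have "openin XG (topspace XG - K)" using clK by blast
      then have "openin (spc X) {x \<in> pts. orb x \<in> topspace XG - K}"
        using continuous_orbit openin_continuous_map_preimage by blast
      then have U': "U' \<in> corr_bisections G X" "x \<in> U'"
        using corr_bisection_Int[OF U(1)] x b \<open>orb x \<notin> K\<close> unfolding U'_def Int_commute[of _ U] by auto
      define N where "N = {k \<in> harrs. rng H k \<in> rng H ` tX U'}"
      have "openin (arr H) N" unfolding N_def
        using H.openin_rng_preimage H.bisectionD(6)[OF tX[OF U'(1)]] by blast
      moreover have "h \<in> N"
      proof -
        have "b \<in> tX U'" using xu(1)[OF U' x(2,4)] x(3) by simp
        then show ?thesis using h U(3) by (auto simp: N_def)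
      qed
      moreover have "N \<inter> TA.orbit_cone K = {}"
      proof (rule ccontr)
        assume "N \<inter> TA.orbit_cone K \<noteq> {}"
        then obtain k where k: "k \<in> N" "k \<in> TA.orbit_cone K" by blast
        then obtain c where c: "c \<in> tX U'" "rng H k = rng H c" by (auto simp: N_def)
        obtain y where y: "y \<in> U'" "ranchor X y = rho (src H c)" "c = xu y (src H c)" "src H c \<in> units H"
          using mem_tX[OF U'(1) c(1)] by metis
        obtain x' w' where x': "x' \<in> pts" "orb x' \<in> K" "w' \<in> units H" "ranchor X x' = rho w'" "rng H k = rng H (xu x' w')"
          using cone_rng[OF k(2)] by blast
        have "orb y = orb x'"
          using sep[OF corr_bisection_in[OF U'(1) y(1)] x'(1) y(4) x'(3) y(2) x'(4)] y(3) c(2) x'(5) by simp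
        then show False using y(1) x'(2) by (simp add: U'_def)
      qed
      ultimately show ?thesis by (auto simp: N_def)
    next
      case False
      obtain F where F: "finite F" "F \<subseteq> {U \<in> corr_bisections G X. precompact_in (spc X) U}" "K \<subseteq> orb ` \<Union>F"
        using compactin_XG_cover[OF K] .
      \<comment> \<open>A closed set that contains the ranges of all elements of the cone. By (6) it
        stays inside the reachable units, so it misses r(h).\<close>
      define C where "C = (\<Union>U\<in>F. obj H closure_of (rng H ` tX U))"
      have C: "closedin (obj H) C" unfolding C_def by (rule closedin_Union) (use F in auto)
      have "C \<subseteq> T" using cc F(2) unfolding C_def closure_condition_def T_def by blast
      then have nC: "rng H h \<notin> C" using False by blast
      define N where "N = {k \<in> harrs. rng H k \<in> topspace (obj H) - C}"
      have "openin (obj H) (topspace (obj H) - C)" using C by blast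
      then have "openin (arr H) N" unfolding N_def using H.openin_rng_preimage by blast
      moreover have "h \<in> N" using h nC H.rng_units by (simp add: N_def)
      moreover have "N \<inter> TA.orbit_cone K = {}"
      proof (rule ccontr)
        assume "N \<inter> TA.orbit_cone K \<noteq> {}"
        then obtain k where k: "k \<in> N" "k \<in> TA.orbit_cone K" by blast
        obtain x w where x: "x \<in> pts" "orb x \<in> K" "w \<in> units H" "ranchor X x = rho w" "rng H k = rng H (xu x w)"
          using cone_rng[OF k(2)] by blast
        obtain U u where u: "U \<in> F" "u \<in> U" "orb x = orb u" using F(3) x(2) by blast
        have U: "U \<in> corr_bisections G X" using u F(2) by blast
        have up: "u \<in> pts" using corr_bisection_in[OF U u(2)] .
        obtain g where g: "g \<in> arrs" "ranchor X u = rng G g" "x = ract X u g" using orbit_eqD[OF up x(1)] u(3) by metis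
        have sg: "src G g = rho w" using g x up by (simp add: ranchor_ract)
        have gc: "gu g w \<in> harrs" "src H (gu g w) = w" "rho (rng H (gu g w)) = rng G g" "rng H (gu g w) \<in> units H"
          using gu_closed[OF g(1) sg x(3)] rho_rng_gu[OF g(1) sg x(3)] H.rng_units by auto
        have uc: "xu u (rng H (gu g w)) \<in> tX U" "src H (xu u (rng H (gu g w))) = rng H (gu g w)"
          using xu[OF U u(2) _ gc(4)] g gc by auto
        have "rng H (xu x w) = rng H (xu u (rng H (gu g w)))"
          using xu_ract[OF up g(1,2) sg x(3)] g(3) gc uc H.bisection_in[OF tX[OF U] uc(1)] by (simp add: H.rng_mult)
        then have "rng H k \<in> rng H ` tX U" using x(5) uc(1) by simp
        moreover have "rng H ` tX U \<subseteq> topspace (obj H)"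
          using H.rng_units H.bisection_in[OF tX[OF U]] by auto
        ultimately have "rng H k \<in> C" using closure_of_subset[of "rng H ` tX U" "obj H"] u(1) by (auto simp: C_def)
        then show False using k(1) by (simp add: N_def)
      qed
      ultimately show ?thesis by (auto simp: N_def)
    qed
  qed
  then show ?thesis unfolding closedin_def using TA.orbit_cone_subset by blast
qed

lemma the_action_action:
  assumes "closure_condition G X H \<theta>"
  shows "correspondence_action G X R (arr H) the_action"
  by (rule TA.correspondence_actionI[OF refl continuous_the_anchor continuous_the_act continuous_the_xact
        openin_the_sact closedin_the_cone[OF assms]])

lemma commuting_the_action: "commuting the_action"
  unfolding commuting_def
proof (intro conjI ballI impI)
  fix y h assume "y \<in> harrs" "h \<in> harrs" "src H y = rng H h"
  then show "anchor the_action (mult H y h) = anchor the_action y"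
    by (simp add: the_anchor H.mult_closed H.rng_mult)
next
  fix g y assume *: "g \<in> arrs" "y \<in> harrs" "src G g = anchor the_action y"
  then have r: "src G g = rho (rng H y)" by (simp add: the_anchor)
  show "src H (act the_action g y) = src H y"
    using the_act[OF *(1,2) r] rng_the_act[OF *(1,2) r] by simp
  fix h assume h: "h \<in> harrs" "src H y = rng H h"
  show "mult H (act the_action g y) h = act the_action g (mult H y h)"
    using the_act[OF *(1,2) r] the_act[of g "mult H y h"] * h r gu_closed[OF *(1) r H.rng_units[OF *(2)]]
      H.mult_assoc[of "gu g (rng H y)" y h] by (simp add: H.mult_closed H.rng_mult)
next
  fix x y assume *: "x \<in> pts" "y \<in> harrs" "ranchor X x = anchor the_action y"
  then have r: "ranchor X x = rho (rng H y)" by (simp add: the_anchor)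
  show "src H (xact the_action x y) = src H y"
    using the_xact[OF *(1,2) r] rng_the_xact[OF *(1,2) r] by simp
  fix h assume h: "h \<in> harrs" "src H y = rng H h"
  show "mult H (xact the_action x y) h = xact the_action x (mult H y h)"
    using the_xact[OF *(1,2) r] the_xact[of x "mult H y h"] * h r xu_closed[OF *(1) r H.rng_units[OF *(2)]]
      H.mult_assoc[of "xu x (rng H y)" y h] by (simp add: H.mult_closed H.rng_mult)
qed

lemma bisection_map_of_the_action: "bisection_map_of G X H the_action = \<theta>"
proof
  fix W
  have *: "TA.sact U (units H) = tX U" if U: "U \<in> corr_bisections G X" for U
  proof -
    have "set_mult H (tX U) (units H) = {v \<in> tX U. src H v \<in> units H}"
      by (rule H.set_mult_units_right) (use H.bisectionD(4)[OF tX[OF U]] in auto)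
    also have "\<dots> = tX U" using H.bisection_in[OF tX[OF U]] H.src_units by auto
    finally show ?thesis using sact_the_action[OF U H.units_subset] by simp
  qed
  show "bisection_map_of G X H the_action W = \<theta> W"
  proof (cases "W \<in> bisections G <+> corr_bisections G X")
    case True
    then show ?thesis
      using gact_the_action * by (auto simp: bisection_map_of_def TA.gact_def TA.sact_def)
  next
    case False
    then show ?thesis using PiE_arb[OF theta_parts(1) False] by (auto simp: bisection_map_of_def)
  qed
qed

section \<open>Properness of \<rho> and condition (6)\<close>

lemma induces_anchor_unique:
  assumes "induces_anchor G H \<theta> r" "w \<in> units H" shows "r w = rho w"
proof (rule obj_eqI)
  show "r w \<in> units G" "rho w \<in> units G"
    using continuous_map_image_subset_topspace[of "obj H" "obj G" r] assms rho_units
    unfolding induces_anchor_def by auto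
  fix N assume "openin (obj G) N" "r w \<in> N"
  then show "rho w \<in> N" using assms mem_tG_iff[of N w] unfolding induces_anchor_def by auto
qed

text \<open>If U lies in a compact K, properness makes the preimage P of s(K) under \<rho> compact.
  The fibre product of K and P is compact as well, being closed in their product because the object
  space of G is Hausdorff. Its image under (x, w) \<mapsto> r(x w) is compact, hence closed in the
  objects of H, contains the ranges for U, and consists of ranges of values of bisections.\<close>

lemma closure_condition_if_proper:
  assumes r: "induces_anchor G H \<theta> r" and p: "proper_map (obj H) (obj G) r"
  shows "closure_condition G X H \<theta>"
  unfolding closure_condition_def
proof (intro ballI impI)
  fix U assume U: "U \<in> corr_bisections G X" and "precompact_in (spc X) U"
  then obtain K where K: "compactin (spc X) K" "U \<subseteq> K" unfolding precompact_in_def by blast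
  define P where "P = {w \<in> topspace (obj H). r w \<in> ranchor X ` K}"
  have "compactin (obj H) P" unfolding P_def
    using compactin_proper_map_preimage[OF p] image_compactin[OF K(1) continuous_ranchor] by blast
  then have KP: "compactin (prod_topology (spc X) (obj H)) (K \<times> P)" using K(1) by (simp add: compactin_Times)
  let ?Z = "prod_topology (spc X) (obj H)"
  define D where "D = {z \<in> topspace ?Z. ranchor X (fst z) = rho (snd z)}"
  have "closedin ?Z D" unfolding D_def
  proof (rule closedin_continuous_maps_eq[OF Hausdorff_obj])
    show "continuous_map ?Z (obj G) (\<lambda>z. ranchor X (fst z))"
      by (intro cont_ranchor continuous_map_fst)
    show "continuous_map ?Z (obj G) (\<lambda>z. rho (snd z))"
      using continuous_map_compose[OF continuous_map_snd continuous_rho] by (simp add: o_def)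
  qed
  then have c: "compactin ?Z ((K \<times> P) \<inter> D)" using KP compactin_Int_closedin by blast
  then have c: "compactin (subtopology ?Z D) ((K \<times> P) \<inter> D)" by (simp add: compactin_subtopology)
  have f: "continuous_map (subtopology ?Z D) (obj H) (\<lambda>z. rng H (xact the_action (fst z) (snd z)))"
  proof (rule H.cont_rng, rule continuous_map_pair_compose[OF continuous_the_xact])
    show "continuous_map (subtopology ?Z D) (spc X) fst"
      by (simp add: continuous_map_from_subtopology continuous_map_fst)
    have "continuous_map (subtopology ?Z D) (obj H) snd"
      by (simp add: continuous_map_from_subtopology continuous_map_snd)
    then show "continuous_map (subtopology ?Z D) (arr H) snd" by (rule H.continuous_obj_arr)
    fix z assume "z \<in> topspace (subtopology ?Z D)"
    then have "snd z \<in> units H" "ranchor X (fst z) = rho (snd z)" by (auto simp: D_def)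
    then show "(fst z, snd z) \<in> {(x, y). ranchor X x = anchor the_action y}"
      using H.unit_closed H.rng_unit by (simp add: the_anchor case_prod_beta)
  qed
  let ?S = "(\<lambda>z. rng H (xact the_action (fst z) (snd z))) ` ((K \<times> P) \<inter> D)"
  have "closedin (obj H) ?S"
    using compactin_imp_closedin[OF H.Hausdorff_obj image_compactin[OF c f]] .
  moreover have "rng H ` tX U \<subseteq> ?S"
  proof
    fix k assume "k \<in> rng H ` tX U"
    then obtain b where b: "b \<in> tX U" "k = rng H b" by blast
    obtain x where x: "x \<in> U" "ranchor X x = rho (src H b)" "b = xu x (src H b)" "src H b \<in> units H"
      using mem_tX[OF U b(1)] by metis
    have s: "src H b \<in> harrs" "rng H (src H b) = src H b" "x \<in> pts"
      using x H.unit_closed H.rng_unit corr_bisection_in[OF U] by auto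
    have "k = rng H (xact the_action x (src H b))"
      using the_xact[of x "src H b"] rng_the_xact(1)[of x "src H b"] s x b by simp
    moreover have "(x, src H b) \<in> (K \<times> P) \<inter> D"
      using x K(2) s induces_anchor_unique[OF r x(4)] by (force simp: P_def D_def)
    ultimately show "k \<in> ?S" by force
  qed
  ultimately have "obj H closure_of (rng H ` tX U) \<subseteq> ?S" by (rule closure_of_minimal[rotated])
  also have "\<dots> \<subseteq> (\<Union>W\<in>corr_bisections G X. rng H ` tX W)"
  proof
    fix k assume "k \<in> ?S"
    then obtain x w where x: "x \<in> pts" "w \<in> units H" "ranchor X x = rho w" "k = rng H (xact the_action x w)"
      by (auto simp: D_def)
    have w: "w \<in> harrs" "rng H w = w" using x H.unit_closed H.rng_unit by auto
    obtain V where V: "V \<in> corr_bisections G X" "x \<in> V" using corr_bisection_exists[OF openin_topspace x(1)] .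
    have "k = rng H (xu x w)" using the_xact[of x w] rng_the_xact(1)[of x w] x w by simp
    then show "k \<in> (\<Union>W\<in>corr_bisections G X. rng H ` tX W)" using xu(1)[OF V x(3,2)] V(1) by blast
  qed
  finally show "obj H closure_of (rng H ` tX U) \<subseteq> (\<Union>W\<in>corr_bisections G X. rng H ` tX W)" .
qed

end

section \<open>Restriction to invariant open subsets\<close>

definition restrict_action :: "('g, 'y) action \<Rightarrow> 'y set \<Rightarrow> ('g, 'y) action" where
  "restrict_action B S =
    \<lparr>anchor = restrict (anchor B) S, act = (\<lambda>g y. if y \<in> S then act B g y else undefined)\<rparr>"

definition restrict_corr_action :: "('g, 'x, 'y) corr_action \<Rightarrow> 'y set \<Rightarrow> ('g, 'x, 'y) corr_action" where
  "restrict_corr_action A S =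
    \<lparr>anchor = restrict (anchor A) S, act = (\<lambda>g y. if y \<in> S then act A g y else undefined),
     xact = (\<lambda>x y. if y \<in> S then xact A x y else undefined)\<rparr>"

lemma restrict_action_simps [simp]:
  "y \<in> S \<Longrightarrow> anchor (restrict_action B S) y = anchor B y"
  "y \<in> S \<Longrightarrow> act (restrict_action B S) g y = act B g y"
  "y \<in> S \<Longrightarrow> anchor (restrict_corr_action A S) y = anchor A y"
  "y \<in> S \<Longrightarrow> act (restrict_corr_action A S) g y = act A g y"
  "y \<in> S \<Longrightarrow> xact (restrict_corr_action A S) x y = xact A x y"
  by (simp_all add: restrict_action_def restrict_corr_action_def)

lemma groupoid_action_closed:
  assumes "groupoid_action M Y B" "m \<in> topspace (arr M)" "y \<in> topspace Y" "src M m = anchor B y"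
  shows "act B m y \<in> topspace Y"
proof -
  have "continuous_map (subtopology (prod_topology (arr M) Y) {(g, y). src M g = anchor B y}) Y
      (\<lambda>(g, y). act B g y)"
    using assms(1) unfolding groupoid_action_def by blast
  from continuous_map_image_subset_topspace[OF this] show ?thesis using assms by auto
qed

lemma groupoid_action_restrict:
  assumes B: "groupoid_action M Y B" and S: "S \<subseteq> topspace Y"
    and inv: "\<And>m y. \<lbrakk>m \<in> topspace (arr M); y \<in> S; src M m = anchor B y\<rbrakk> \<Longrightarrow> act B m y \<in> S"
  shows "groupoid_action M (subtopology Y S) (restrict_action B S)"
proof -
  let ?C = "restrict_action B S"
  let ?D = "subtopology (prod_topology (arr M) (subtopology Y S)) {(g, y). src M g = anchor ?C y}"
  have ts: "topspace (subtopology Y S) = S" using S by auto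
  have a: "continuous_map (subtopology Y S) (obj M) (anchor ?C)"
  proof (rule continuous_map_eq)
    show "continuous_map (subtopology Y S) (obj M) (anchor B)"
      using B continuous_map_from_subtopology unfolding groupoid_action_def by blast
  qed simp
  have c: "continuous_map ?D Y (\<lambda>(g, y). act ?C g y)"
  proof (rule continuous_map_eq)
    have k: "continuous_map (subtopology (prod_topology (arr M) Y) {(g, y). src M g = anchor B y}) Y
      (\<lambda>(g, y). act B g y)"
      using B unfolding groupoid_action_def by blast
    have s: "continuous_map ?D (subtopology Y S) snd"
      by (simp add: continuous_map_from_subtopology continuous_map_snd)
    show "continuous_map ?D Y (\<lambda>z. act B (fst z) (snd z))"
      by (rule continuous_map_pair_compose[OF k])
        (use s in \<open>auto simp: continuous_map_from_subtopology continuous_map_fst continuous_map_in_subtopology ts\<close>)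
  qed (auto simp: ts)
  have c': "continuous_map ?D (subtopology Y S) (\<lambda>(g, y). act ?C g y)"
    unfolding continuous_map_in_subtopology using c inv by (auto simp: ts)
  have e: "(\<lambda>(g, y). act ?C g y) \<in> extensional
      {(g, y). g \<in> topspace (arr M) \<and> y \<in> S \<and> src M g = anchor ?C y}"
  proof -
    have "(\<lambda>(g, y). act B g y) \<in> extensional
      {(g, y). g \<in> topspace (arr M) \<and> y \<in> topspace Y \<and> src M g = anchor B y}"
      using B unfolding groupoid_action_def by blast
    then show ?thesis using S unfolding extensional_def
      by (auto simp: restrict_action_def subset_iff)
  qed
  show ?thesis
    unfolding groupoid_action_def ts
  proof (intro conjI a c' e)
    show "anchor ?C \<in> extensional S" by (simp add: restrict_action_def)
  qed (use B S inv in \<open>auto simp: groupoid_action_def subset_iff\<close>)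
qed

context topological_action
begin

text \<open>Both directions of invariance under X matter. The backward direction says that a point x
  y of S has y in S, so that coverage of the part over R survives and the cone of K in S is the
  trace of the cone in Y.\<close>

lemma restrict_corr_action:
  assumes S: "openin Y S"
    and ia: "\<And>g y. \<lbrakk>g \<in> arrs; y \<in> S; src G g = anchor A y\<rbrakk> \<Longrightarrow> act A g y \<in> S"
    and ix: "\<And>x y. \<lbrakk>x \<in> pts; y \<in> topspace Y; ranchor X x = anchor A y\<rbrakk> \<Longrightarrow> xact A x y \<in> S \<longleftrightarrow> y \<in> S"
  shows "correspondence_action G X R (subtopology Y S) (restrict_corr_action A S)"
proof -
  let ?C = "restrict_corr_action A S"
  have SY: "S \<subseteq> topspace Y" using openin_subset[OF S] .
  then have ts: "topspace (subtopology Y S) = S" by auto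
  have sY: "y \<in> topspace Y" if "y \<in> S" for y using SY that by blast
  interpret C: algebraic_action G X R S ?C
  proof (unfold_locales, goal_cases)
    case 1 then show ?case by (simp add: restrict_corr_action_def)
  next
    case 2 then show ?case using act_ext sY unfolding extensional_def restrict_corr_action_def by auto
  next
    case 3 then show ?case using xact_ext sY unfolding extensional_def restrict_corr_action_def by auto
  next
    case (12 x x' y y')
    then show ?case using xact_eq_iff[of x x' y y'] sY by simp
  next
    case (13 y)
    then obtain x z where "x \<in> pts" "z \<in> topspace Y" "ranchor X x = anchor A z" "y = xact A x z"
      using covered[of y] sY by auto
    then show ?case using ix 13(1) by (metis restrict_action_simps(3,5))
  qed (use sY ia ix in \<open>simp_all add: anchor_units act_unit anchor_act act_mult anchor_xact act_xact\<close>)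
  show ?thesis
  proof (rule C.correspondence_actionI[OF ts])
    show "continuous_map (subtopology Y S) (obj G) (anchor ?C)"
      by (rule continuous_map_eq[of _ _ "anchor A"])
        (use action_parts(4) continuous_map_from_subtopology ts in auto)
    let ?D = "subtopology (prod_topology (arr G) (subtopology Y S)) {(g, y). src G g = anchor ?C y}"
    have s: "continuous_map ?D (subtopology Y S) snd" "continuous_map ?D (arr G) fst"
      by (simp_all add: continuous_map_from_subtopology continuous_map_snd continuous_map_fst)
    then have sY: "continuous_map ?D Y snd" using continuous_map_into_fulltopology by blast
    have "continuous_map ?D Y (\<lambda>z. act A (fst z) (snd z))"
      by (rule cont_act[OF s(2) sY]) (auto simp: ts)
    then have "continuous_map ?D Y (\<lambda>(g, y). act ?C g y)"
      by (rule continuous_map_eq) (auto simp: ts)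
    then show "continuous_map ?D (subtopology Y S) (\<lambda>(g, y). act ?C g y)"
      unfolding continuous_map_in_subtopology using ia by (auto simp: ts)
    let ?D = "subtopology (prod_topology (spc X) (subtopology Y S)) {(g, y). ranchor X g = anchor ?C y}"
    have s: "continuous_map ?D (subtopology Y S) snd" "continuous_map ?D (spc X) fst"
      by (simp_all add: continuous_map_from_subtopology continuous_map_snd continuous_map_fst)
    then have sY: "continuous_map ?D Y snd" using continuous_map_into_fulltopology by blast
    have "continuous_map ?D Y (\<lambda>z. xact A (fst z) (snd z))"
      by (rule cont_xact[OF s(2) sY]) (auto simp: ts)
    then have "continuous_map ?D Y (\<lambda>(g, y). xact ?C g y)"
      by (rule continuous_map_eq) (auto simp: ts)
    then show "continuous_map ?D (subtopology Y S) (\<lambda>(g, y). xact ?C g y)"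
      unfolding continuous_map_in_subtopology using ix SY by (auto simp: ts subset_iff)
  next
    fix W B assume W: "openin (spc X) W" and "openin (subtopology Y S) B"
    then have B: "openin Y B" "B \<subseteq> S" using openin_open_subtopology[OF S] by auto
    have e: "C.sact W B = sact W B"
    proof -
      have "(y \<in> B \<and> ranchor X x = anchor ?C y) \<longleftrightarrow> (y \<in> B \<and> ranchor X x = anchor A y)" for x y
        using B(2) by auto
      moreover have "y \<in> B \<Longrightarrow> xact ?C x y = xact A x y" for x y using B(2) by auto
      ultimately show ?thesis unfolding C.sact_def sact_def by (metis (no_types, lifting))
    qed
    have "sact W B \<subseteq> S"
      unfolding sact_def using openin_subset[OF W] ix B(2) SY by blast
    then show "openin (subtopology Y S) (C.sact W B)"
      unfolding e openin_open_subtopology[OF S] using openin_sact[OF W B(1)] by blast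
  next
    fix K assume K: "compactin XG K"
    have "C.orbit_cone K = orbit_cone K \<inter> S"
    proof (intro equalityI subsetI)
      fix k assume "k \<in> C.orbit_cone K"
      then obtain x y where "x \<in> pts" "orb x \<in> K" "y \<in> S" "ranchor X x = anchor A y" "k = xact A x y"
        unfolding C.orbit_cone_def by auto
      then show "k \<in> orbit_cone K \<inter> S" unfolding orbit_cone_def using ix sY by blast
    next
      fix k assume "k \<in> orbit_cone K \<inter> S"
      then obtain x y where *: "x \<in> pts" "orb x \<in> K" "y \<in> topspace Y" "ranchor X x = anchor A y" "k = xact A x y" "k \<in> S"
        unfolding orbit_cone_def by auto
      then have "y \<in> S" using ix by blast
      then show "k \<in> C.orbit_cone K" using C.mem_orbit_coneI[of x K y] * by simp
    qed
    then show "closedin (subtopology Y S) (C.orbit_cone K)"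
      using closedin_subtopology_Int_closed[OF closedin_orbit_cone[OF K]] by (simp add: inf_commute)
  qed
qed

lemma corr_equivariant_restrict:
  assumes SY: "S \<subseteq> topspace Y"
    and ix: "\<And>x y. \<lbrakk>x \<in> pts; y \<in> topspace Y; ranchor X x = anchor A y\<rbrakk> \<Longrightarrow> xact A x y \<in> S \<longleftrightarrow> y \<in> S"
  shows "corr_equivariant G X (subtopology Y S) Y (restrict_corr_action A S) A (\<lambda>y. y)"
proof -
  have ts: "topspace (subtopology Y S) = S" using SY by auto
  have "{y \<in> S. y \<in> xact_image X Y A} = xact_image X (subtopology Y S) (restrict_corr_action A S)"
  proof (intro equalityI subsetI)
    fix k assume "k \<in> {y \<in> S. y \<in> xact_image X Y A}"
    then obtain x y where *: "x \<in> pts" "y \<in> topspace Y" "ranchor X x = anchor A y" "k = xact A x y" "k \<in> S"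
      unfolding xact_image_def by auto
    then have y: "y \<in> S" using ix by blast
    then have "k = xact (restrict_corr_action A S) x y" "ranchor X x = anchor (restrict_corr_action A S) y"
      using * by simp_all
    then show "k \<in> xact_image X (subtopology Y S) (restrict_corr_action A S)"
      unfolding xact_image_def ts using * y by blast
  next
    fix k assume "k \<in> xact_image X (subtopology Y S) (restrict_corr_action A S)"
    then obtain x y where *: "x \<in> pts" "y \<in> S" "ranchor X x = anchor A y" "k = xact A x y"
      unfolding xact_image_def ts by auto
    then show "k \<in> {y \<in> S. y \<in> xact_image X Y A}" unfolding xact_image_def using ix SY by blast
  qed
  then show ?thesis unfolding corr_equivariant_def equivariant_def ts by simp
qed

end

section \<open>Actors as actions of the correspondence\<close>

text \<open>Naturality for inclusions of source-saturated open subsets shows that the source map is invariant;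
  naturality for right translation by bisections then gives the commutation.\<close>

context etale_groupoid
begin

definition translate where "translate V y = mult G y (rsec V (src G y))"

definition saturated where "saturated U = {y \<in> topspace (arr G). src G y \<in> U}"

lemma openin_saturated: "openin (obj G) U \<Longrightarrow> openin (arr G) (saturated U)"
  unfolding saturated_def by (rule openin_src_preimage)

lemma translate:
  assumes V: "V \<in> bisections G" and y: "y \<in> saturated (rng G ` V)"
  shows "rsec V (src G y) \<in> V" "rsec V (src G y) \<in> topspace (arr G)" "rng G (rsec V (src G y)) = src G y"
    "translate V y \<in> topspace (arr G)" "rng G (translate V y) = rng G y"
    "src G (translate V y) = src G (rsec V (src G y))"
  using rsec[OF V, of "src G y"] y bisection_in[OF V]
  by (auto simp: translate_def saturated_def mult_closed rng_mult src_mult)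

lemma continuous_translate:
  assumes V: "V \<in> bisections G"
  shows "continuous_map (subtopology (arr G) (saturated (rng G ` V))) (arr G) (translate V)"
proof -
  have *: "continuous_map (subtopology (arr G) (saturated (rng G ` V))) (arr G) (\<lambda>x. x)"
    by (simp add: continuous_map_from_subtopology)
  show ?thesis unfolding translate_def
    by (intro cont_mult cont_rsec cont_src * V) (use translate(3)[OF V] in \<open>auto simp: saturated_def\<close>)
qed

end

locale model_setting = bisection_setting G X H
  for G :: "'g groupoid" and X :: "('g, 'x) correspondence" and H :: "'h groupoid" +
  fixes R :: "'g set" and M :: "'m groupoid"
    and \<Phi> :: "'h topology \<Rightarrow> ('g, 'x, 'h) corr_action \<Rightarrow> ('m, 'h) action"
  assumes bij: "model_bijection G X R M \<Phi>" and nat: "model_natural G X R M \<Phi> \<Phi>"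
begin

lemma \<Phi>_action: "correspondence_action G X R Y A \<Longrightarrow> groupoid_action M Y (\<Phi> Y A)"
  using bij unfolding model_bijection_def by (meson bij_betwE mem_Collect_eq)

lemma \<Phi>_surj:
  assumes "groupoid_action M Y B"
  obtains A where "correspondence_action G X R Y A" "\<Phi> Y A = B"
  using bij assms unfolding model_bijection_def bij_betw_def by (metis (no_types, lifting) imageE mem_Collect_eq)

lemma \<Phi>_natural:
  "\<lbrakk>correspondence_action G X R Y A; correspondence_action G X R Z B; continuous_map Y Z f\<rbrakk>
    \<Longrightarrow> corr_equivariant G X Y Z A B f \<longleftrightarrow> equivariant M Y (\<Phi> Y A) (\<Phi> Z B) f"
  using nat unfolding model_natural_def by blast

lemma commuting_imp_actor:
  assumes A: "correspondence_action G X R (arr H) A" and comm: "commuting A"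
  shows "\<Phi> (arr H) A \<in> actors M H"
proof -
  interpret A: commuting_action G X H R A by unfold_locales fact+
  let ?B = "\<Phi> (arr H) A"
  define Z where "Z U = subtopology (arr H) (H.saturated U)" for U
  define C where "C U = restrict_corr_action A (H.saturated U)" for U
  have ts: "topspace (Z U) = H.saturated U" for U
    by (auto simp: Z_def H.saturated_def)
  have ix: "xact A x y \<in> H.saturated U \<longleftrightarrow> y \<in> H.saturated U"
    if "x \<in> pts" "y \<in> topspace (arr H)" "ranchor X x = anchor A y" for U x y
    using that A.xact_closed[of x y] A.src_xact[of x y] by (auto simp: H.saturated_def)
  have C: "correspondence_action G X R (Z U) (C U)" if "openin (obj H) U" for U
    unfolding Z_def C_def
    by (rule A.restrict_corr_action[OF H.openin_saturated[OF that]])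
      (use ix A.act_closed A.src_act in \<open>auto simp: H.saturated_def\<close>)
  have B: "groupoid_action M (arr H) ?B" using \<Phi>_action[OF A] .
  have CB: "groupoid_action M (Z U) (\<Phi> (Z U) (C U))" if "openin (obj H) U" for U
    using \<Phi>_action[OF C[OF that]] .
  have inc: "equivariant M (Z U) (\<Phi> (Z U) (C U)) ?B (\<lambda>y. y)" if U: "openin (obj H) U" for U
  proof -
    have "corr_equivariant G X (Z U) (arr H) (C U) A (\<lambda>y. y)"
      unfolding Z_def C_def by (rule A.corr_equivariant_restrict) (use ix in \<open>auto simp: H.saturated_def\<close>)
    then show ?thesis using \<Phi>_natural[OF C[OF U] A, of "\<lambda>y. y"]
      by (simp add: Z_def continuous_map_from_subtopology)
  qed
  have pres: "act ?B m y \<in> H.saturated U" "act ?B m y = act (\<Phi> (Z U) (C U)) m y" "src M m = anchor (\<Phi> (Z U) (C U)) y"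
    if U: "openin (obj H) U" and m: "m \<in> topspace (arr M)" "y \<in> H.saturated U" "src M m = anchor ?B y" for U m y
  proof -
    show s: "src M m = anchor (\<Phi> (Z U) (C U)) y" using inc[OF U] m ts unfolding equivariant_def by simp
    show e: "act ?B m y = act (\<Phi> (Z U) (C U)) m y" using inc[OF U] m s ts unfolding equivariant_def by simp
    show "act ?B m y \<in> H.saturated U" using groupoid_action_closed[OF CB[OF U] m(1) _ s] e m ts by simp
  qed
  \<comment> \<open>The element m y stays in the saturated set of every neighbourhood of s(y), so
    its source cannot be separated from s(y).\<close>
  have src_B: "src H (act ?B m y) = src H y"
    if m: "m \<in> topspace (arr M)" "y \<in> harrs" "src M m = anchor ?B y" for m y
  proof (rule H.obj_eqI[symmetric])
    have "act ?B m y \<in> harrs" using groupoid_action_closed[OF B m] .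
    then show "src H y \<in> units H" "src H (act ?B m y) \<in> units H" using H.src_units m by auto
    fix N assume "openin (obj H) N" "src H y \<in> N"
    then show "src H (act ?B m y) \<in> N" using pres(1)[of N m y] m by (auto simp: H.saturated_def)
  qed
  have tr: "equivariant M (Z (rng H ` V)) (\<Phi> (Z (rng H ` V)) (C (rng H ` V))) ?B (H.translate V)"
    if V: "V \<in> bisections H" for V
  proof -
    let ?U = "rng H ` V"
    have U: "openin (obj H) ?U" using H.bisectionD(6)[OF V] .
    have c: "continuous_map (Z ?U) (arr H) (H.translate V)"
      unfolding Z_def using H.continuous_translate[OF V] .
    have an: "anchor A (H.translate V y) = anchor A y" if "y \<in> H.saturated ?U" for y
      unfolding H.translate_def using that H.translate(1-3)[OF V that] A.anchor_mult by (simp add: H.saturated_def)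
    have ga: "H.translate V (act A g y) = act A g (H.translate V y)"
      if "g \<in> arrs" "y \<in> H.saturated ?U" "src G g = anchor A y" for g y
      unfolding H.translate_def using that H.translate(1-3)[OF V that(2)] A.mult_act A.src_act
      by (simp add: H.saturated_def)
    have xa: "H.translate V (xact A x y) = xact A x (H.translate V y)"
      if "x \<in> pts" "y \<in> H.saturated ?U" "ranchor X x = anchor A y" for x y
      unfolding H.translate_def using that H.translate(1-3)[OF V that(2)] A.mult_xact A.src_xact
      by (simp add: H.saturated_def)
    have im: "{y \<in> H.saturated ?U. H.translate V y \<in> xact_image X (arr H) A} = xact_image X (Z ?U) (C ?U)"
    proof (intro equalityI subsetI)
      fix y assume y: "y \<in> {y \<in> H.saturated ?U. H.translate V y \<in> xact_image X (arr H) A}"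
      then obtain x z where *: "x \<in> pts" "z \<in> harrs" "ranchor X x = anchor A z" "H.translate V y = xact A x z"
        unfolding xact_image_def by auto
      have yy: "y \<in> H.saturated ?U" "y \<in> harrs" using y by (auto simp: H.saturated_def)
      define v where "v = H.rsec V (src H y)"
      note t = H.translate[OF V yy(1), folded v_def]
      have z: "src H z = src H v" using A.src_xact[OF *(1-3)] t *(4) by simp
      \<comment> \<open>The preimage clause of equivariance: from y v = x z right invariance gives y
        = x (z inverse(v)).\<close>
      define k where "k = mult H z (invs H v)"
      have kv: "invs H v \<in> harrs" "src H z = rng H (invs H v)" using z t by (auto simp: H.inv_closed H.rng_inv)
      have k: "k \<in> harrs" "src H k = src H y" "anchor A k = anchor A z"
        using *(2) kv t by (auto simp: k_def H.mult_closed H.src_mult H.src_inv A.anchor_mult)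
      have "xact A x k = mult H (xact A x z) (invs H v)" using A.mult_xact[OF *(1-3) kv] by (simp add: k_def)
      also have "\<dots> = mult H (mult H y v) (invs H v)" using *(4) by (simp add: H.translate_def v_def)
      also have "\<dots> = y" using H.mult_inv_cancel_right[of y v] t yy by simp
      finally have "y = xact A x k" by simp
      moreover have "k \<in> H.saturated ?U" using k yy by (auto simp: H.saturated_def)
      ultimately have "y = xact (C ?U) x k" "ranchor X x = anchor (C ?U) k" "k \<in> topspace (Z ?U)"
        using * k ts by (simp_all add: C_def)
      then show "y \<in> xact_image X (Z ?U) (C ?U)" unfolding xact_image_def using *(1) by blast
    next
      fix y assume "y \<in> xact_image X (Z ?U) (C ?U)"
      then obtain x z where *: "x \<in> pts" "z \<in> H.saturated ?U" "ranchor X x = anchor A z" "y = xact A x z"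
        unfolding xact_image_def by (auto simp: ts C_def)
      then have "y \<in> H.saturated ?U" using ix by (simp add: H.saturated_def)
      moreover have "H.translate V y = xact A x (H.translate V z)" using xa[OF *(1-3)] *(4) by simp
      moreover have "H.translate V z \<in> harrs" "ranchor X x = anchor A (H.translate V z)"
        using H.translate(4)[OF V *(2)] an[OF *(2)] *(3) by simp_all
      ultimately show "y \<in> {y \<in> H.saturated ?U. H.translate V y \<in> xact_image X (arr H) A}"
        unfolding xact_image_def using *(1) by blast
    qed
    have "corr_equivariant G X (Z ?U) (arr H) (C ?U) A (H.translate V)"
      unfolding corr_equivariant_def equivariant_def ts using an ga xa im by (simp add: C_def)
    then show ?thesis using \<Phi>_natural[OF C[OF U] A c] by simp
  qed
  have main: "anchor ?B (mult H x h) = anchor ?B x \<and> (\<forall>m\<in>topspace (arr M). src M m = anchor ?B x \<longrightarrow>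
      mult H (act ?B m x) h = act ?B m (mult H x h))"
    if x: "x \<in> harrs" "h \<in> harrs" "src H x = rng H h" for x h
  proof -
    \<comment> \<open>Translation by a bisection through h is multiplication by h on every arrow
      with source s(x), and the action of M preserves sources.\<close>
    obtain V where V: "V \<in> bisections H" "h \<in> V" using H.bisection_exists[OF openin_topspace x(2)] .
    let ?U = "rng H ` V"
    have U: "openin (obj H) ?U" using H.bisectionD(6)[OF V(1)] .
    have xs: "x \<in> H.saturated ?U" using x V by (simp add: H.saturated_def)
    have f: "H.translate V y = mult H y h" if "src H y = src H x" for y
      using that H.rsec_eq[OF V, of "src H x"] x by (simp add: H.translate_def)
    note e = tr[OF V(1), unfolded equivariant_def ts]
    have i: "anchor ?B x = anchor (\<Phi> (Z ?U) (C ?U)) x" using inc[OF U] xs ts unfolding equivariant_def by simp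
    have 1: "anchor ?B (mult H x h) = anchor ?B x" using e xs f[OF refl] i by auto
    have 2: "mult H (act ?B m x) h = act ?B m (mult H x h)"
      if m: "m \<in> topspace (arr M)" "src M m = anchor ?B x" for m
    proof -
      note p = pres[OF U m(1) xs m(2)]
      have "H.translate V (act (\<Phi> (Z ?U) (C ?U)) m x) = act ?B m (H.translate V x)"
        using e m(1) xs p(3) by blast
      then show ?thesis using p(2) f[OF refl] f[OF src_B[OF m(1) x(1) m(2)]] by simp
    qed
    show ?thesis using 1 2 by blast
  qed
  show ?thesis unfolding actors_def using B main src_B by blast
qed

text \<open>It is not yet known that the restriction of A to a saturated open set is an action. The
  restriction is therefore made on the side of M, where invariance is part of being an actor, and
  surjectivity of the bijection produces an action D of the correspondence there.\<close>

lemma actor_imp_commuting: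
  assumes A: "correspondence_action G X R (arr H) A" and act: "\<Phi> (arr H) A \<in> actors M H"
  shows "commuting A"
proof -
  interpret A: topological_action G X R "arr H" A by unfold_locales fact
  let ?B = "\<Phi> (arr H) A"
  have B: "groupoid_action M (arr H) ?B" using act by (simp add: actors_def)
  have anB: "anchor ?B (mult H y h) = anchor ?B y" if "y \<in> harrs" "h \<in> harrs" "src H y = rng H h" for y h
    using act that by (simp add: actors_def)
  have srcB: "src H (act ?B m y) = src H y"
    if "m \<in> topspace (arr M)" "y \<in> harrs" "src M m = anchor ?B y" for m y
    using act that by (simp add: actors_def)
  have mulB: "mult H (act ?B m y) h = act ?B m (mult H y h)"
    if "m \<in> topspace (arr M)" "y \<in> harrs" "h \<in> harrs" "src M m = anchor ?B y" "src H y = rng H h" for m y h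
    using act that by (simp add: actors_def)
  define Z where "Z U = subtopology (arr H) (H.saturated U)" for U
  define C where "C U = restrict_action ?B (H.saturated U)" for U
  have ts: "topspace (Z U) = H.saturated U" for U
    by (auto simp: Z_def H.saturated_def)
  have C: "groupoid_action M (Z U) (C U)" for U
    unfolding Z_def C_def
    by (rule groupoid_action_restrict[OF B])
      (use srcB groupoid_action_closed[OF B] in \<open>auto simp: H.saturated_def\<close>)
  have "\<exists>D. correspondence_action G X R (Z U) D \<and> \<Phi> (Z U) D = C U" for U
    using \<Phi>_surj[OF C] by metis
  then obtain D where D: "\<And>U. correspondence_action G X R (Z U) (D U)" "\<And>U. \<Phi> (Z U) (D U) = C U" by metis
  have inc: "corr_equivariant G X (Z U) (arr H) (D U) A (\<lambda>y. y)" for U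
  proof -
    have "equivariant M (Z U) (C U) ?B (\<lambda>y. y)" unfolding equivariant_def ts by (simp add: C_def)
    then show ?thesis using \<Phi>_natural[OF D(1) A, of U "\<lambda>y. y"] D(2)
      by (simp add: Z_def continuous_map_from_subtopology)
  qed
  have tr: "corr_equivariant G X (Z (rng H ` V)) (arr H) (D (rng H ` V)) A (H.translate V)"
    if V: "V \<in> bisections H" for V
  proof -
    let ?U = "rng H ` V"
    have c: "continuous_map (Z ?U) (arr H) (H.translate V)"
      unfolding Z_def using H.continuous_translate[OF V] .
    have "anchor ?B (H.translate V y) = anchor ?B y" if "y \<in> H.saturated ?U" for y
      unfolding H.translate_def using that H.translate(1-3)[OF V that] anB by (simp add: H.saturated_def)
    moreover have "H.translate V (act ?B g y) = act ?B g (H.translate V y)"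
      if "g \<in> topspace (arr M)" "y \<in> H.saturated ?U" "src M g = anchor ?B y" for g y
      unfolding H.translate_def using that H.translate(1-3)[OF V that(2)] mulB srcB
      by (simp add: H.saturated_def)
    ultimately have "equivariant M (Z ?U) (C ?U) ?B (H.translate V)"
      unfolding equivariant_def ts by (simp add: C_def)
    then show ?thesis using \<Phi>_natural[OF D(1) A c] D(2) by simp
  qed
  have anD: "anchor (D U) y = anchor A y" if "y \<in> H.saturated U" for U y
    using inc that ts unfolding corr_equivariant_def equivariant_def by simp
  \<comment> \<open>Equivariance of the inclusion identifies D with A on the saturated set. As D
    maps this set to itself, so does A.\<close>
  have actD: "act A g y \<in> H.saturated U" "act A g y = act (D U) g y"
    if y: "g \<in> arrs" "y \<in> H.saturated U" "src G g = anchor A y" for U g y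
  proof -
    interpret D: topological_action G X R "Z U" "D U" by unfold_locales (rule D(1))
    have "\<forall>g\<in>arrs. \<forall>y\<in>H.saturated U. src G g = anchor (D U) y \<longrightarrow> act (D U) g y = act A g y"
      using inc[of U] unfolding corr_equivariant_def equivariant_def ts by blast
    then show e: "act A g y = act (D U) g y" using y anD[OF y(2)] by metis
    show "act A g y \<in> H.saturated U" using D.act_closed[of g y] y anD[OF y(2)] ts e by simp
  qed
  have xactD: "xact A x y \<in> H.saturated U" "xact A x y = xact (D U) x y"
    if y: "x \<in> pts" "y \<in> H.saturated U" "ranchor X x = anchor A y" for U x y
  proof -
    interpret D: topological_action G X R "Z U" "D U" by unfold_locales (rule D(1))
    have "\<forall>x\<in>pts. \<forall>y\<in>H.saturated U. ranchor X x = anchor (D U) y \<longrightarrow> xact (D U) x y = xact A x y"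
      using inc[of U] unfolding corr_equivariant_def ts by blast
    then show e: "xact A x y = xact (D U) x y" using y anD[OF y(2)] by metis
    show "xact A x y \<in> H.saturated U" using D.xact_closed[of x y] y anD[OF y(2)] ts e by simp
  qed
  have srcA: "src H (act A g y) = src H y" if y: "g \<in> arrs" "y \<in> harrs" "src G g = anchor A y" for g y
  proof (rule H.obj_eqI[symmetric])
    show "src H y \<in> units H" "src H (act A g y) \<in> units H" using A.act_closed[OF y] H.src_units y by auto
    fix N assume "openin (obj H) N" "src H y \<in> N"
    then show "src H (act A g y) \<in> N" using actD(1)[of g y N] y by (auto simp: H.saturated_def)
  qed
  have srcX: "src H (xact A x y) = src H y" if y: "x \<in> pts" "y \<in> harrs" "ranchor X x = anchor A y" for x y
  proof (rule H.obj_eqI[symmetric])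
    show "src H y \<in> units H" "src H (xact A x y) \<in> units H" using A.xact_closed[OF y] H.src_units y by auto
    fix N assume "openin (obj H) N" "src H y \<in> N"
    then show "src H (xact A x y) \<in> N" using xactD(1)[of x y N] y by (auto simp: H.saturated_def)
  qed
  have main: "anchor A (mult H x h) = anchor A x \<and>
     (\<forall>g\<in>arrs. src G g = anchor A x \<longrightarrow> mult H (act A g x) h = act A g (mult H x h)) \<and>
     (\<forall>u\<in>pts. ranchor X u = anchor A x \<longrightarrow> mult H (xact A u x) h = xact A u (mult H x h))"
    if x: "x \<in> harrs" "h \<in> harrs" "src H x = rng H h" for x h
  proof -
    obtain V where V: "V \<in> bisections H" "h \<in> V" using H.bisection_exists[OF openin_topspace x(2)] .
    let ?U = "rng H ` V"
    have xs: "x \<in> H.saturated ?U" using x V by (simp add: H.saturated_def)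
    have f: "H.translate V y = mult H y h" if "src H y = src H x" for y
      using that H.rsec_eq[OF V, of "src H x"] x by (simp add: H.translate_def)
    note e = tr[OF V(1), unfolded corr_equivariant_def equivariant_def ts]
    have 1: "anchor A (mult H x h) = anchor A x" using e xs f[OF refl] anD[OF xs] by auto
    have 2: "mult H (act A g x) h = act A g (mult H x h)" if g: "g \<in> arrs" "src G g = anchor A x" for g
    proof -
      have "H.translate V (act (D ?U) g x) = act A g (H.translate V x)"
        using e g xs anD[OF xs] by simp
      then show ?thesis using actD(2)[OF g(1) xs g(2)] f[OF refl] f[OF srcA[OF g(1) x(1) g(2)]] by simp
    qed
    have 3: "mult H (xact A g x) h = xact A g (mult H x h)" if g: "g \<in> pts" "ranchor X g = anchor A x" for g
    proof -
      have "H.translate V (xact (D ?U) g x) = xact A g (H.translate V x)"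
        using e g xs anD[OF xs] by simp
      then show ?thesis using xactD(2)[OF g(1) xs g(2)] f[OF refl] f[OF srcX[OF g(1) x(1) g(2)]] by simp
    qed
    show ?thesis using 1 2 3 by blast
  qed
  show ?thesis unfolding commuting_def using main srcA srcX by blast
qed

lemma corr_action_of:
  assumes B: "groupoid_action M Y B"
  shows "correspondence_action G X R Y (corr_action_of G X R \<Phi> Y B)" "\<Phi> Y (corr_action_of G X R \<Phi> Y B) = B"
proof -
  have b: "bij_betw (\<Phi> Y) {A. correspondence_action G X R Y A} {B. groupoid_action M Y B}"
    using bij unfolding model_bijection_def by blast
  show "\<Phi> Y (corr_action_of G X R \<Phi> Y B) = B"
    unfolding corr_action_of_def using f_the_inv_into_f_bij_betw[OF b] B by blast
  show "correspondence_action G X R Y (corr_action_of G X R \<Phi> Y B)"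
    unfolding corr_action_of_def using bij_betwE[OF bij_betw_the_inv_into[OF b]] B by blast
qed

lemma corr_action_of_\<Phi>: "correspondence_action G X R Y A \<Longrightarrow> corr_action_of G X R \<Phi> Y (\<Phi> Y A) = A"
  unfolding corr_action_of_def using bij the_inv_into_f_f unfolding model_bijection_def bij_betw_def
  by (metis (no_types, lifting) mem_Collect_eq)

lemma actor_commuting_action:
  assumes "B \<in> actors M H"
  shows "commuting_action G X H R (corr_action_of G X R \<Phi> (arr H) B)"
proof -
  have B: "groupoid_action M (arr H) B" using assms by (simp add: actors_def)
  have "commuting (corr_action_of G X R \<Phi> (arr H) B)"
    by (rule actor_imp_commuting) (use corr_action_of[OF B] assms in simp_all)
  then show ?thesis using corr_action_of(1)[OF B] by unfold_locales
qed

lemma bij_betw_actors: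
  assumes R: "openin (obj G) R"
  shows "bij_betw (\<lambda>B. bisection_map_of G X H (corr_action_of G X R \<Phi> (arr H) B)) (actors M H)
           {\<theta> \<in> bisection_maps G X R H. closure_condition G X H \<theta>}"
proof (rule bij_betwI')
  fix B B' assume B: "B \<in> actors M H" and B': "B' \<in> actors M H"
  have "B = B'" if "bisection_map_of G X H (corr_action_of G X R \<Phi> (arr H) B) =
      bisection_map_of G X H (corr_action_of G X R \<Phi> (arr H) B')"
    using commuting_action_eqI[OF actor_commuting_action[OF B] actor_commuting_action[OF B'] that]
      corr_action_of(2) B B' unfolding actors_def by (metis (no_types, lifting) mem_Collect_eq)
  then show "(bisection_map_of G X H (corr_action_of G X R \<Phi> (arr H) B) =
      bisection_map_of G X H (corr_action_of G X R \<Phi> (arr H) B')) \<longleftrightarrow> B = B'" by blast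
next
  fix B assume "B \<in> actors M H"
  then interpret A: commuting_action G X H R "corr_action_of G X R \<Phi> (arr H) B" by (rule actor_commuting_action)
  show "bisection_map_of G X H (corr_action_of G X R \<Phi> (arr H) B) \<in>
      {\<theta> \<in> bisection_maps G X R H. closure_condition G X H \<theta>}"
    using A.th_bisection_maps[OF R] A.th_closure_condition by blast
next
  fix \<theta> assume \<theta>: "\<theta> \<in> {\<theta> \<in> bisection_maps G X R H. closure_condition G X H \<theta>}"
  interpret T: bisection_map G X H R \<theta> by unfold_locales (use R \<theta> in auto)
  have a: "correspondence_action G X R (arr H) T.the_action" using T.the_action_action \<theta> by blast
  have "\<Phi> (arr H) T.the_action \<in> actors M H" using commuting_imp_actor[OF a T.commuting_the_action] .
  moreover have "corr_action_of G X R \<Phi> (arr H) (\<Phi> (arr H) T.the_action) = T.the_action"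
    using corr_action_of_\<Phi>[OF a] .
  ultimately show "\<exists>B\<in>actors M H. \<theta> = bisection_map_of G X H (corr_action_of G X R \<Phi> (arr H) B)"
    using T.bisection_map_of_the_action by metis
qed

end

section \<open>Topologising algebraic actions\<close>

context algebraic_action
begin

text \<open>The coarsest family of sets that is forced to be open by continuity of the anchor map,
  closedness of compact cones and openness of the action of X.\<close>

inductive cylinder :: "'y set \<Rightarrow> bool" where
  base: "\<lbrakk>openin (obj G) U; compactin XG K\<rbrakk> \<Longrightarrow> cylinder {y \<in> S. anchor A y \<in> U \<and> y \<notin> orbit_cone K}"
| step: "\<lbrakk>openin (spc X) W; cylinder B\<rbrakk> \<Longrightarrow> cylinder (sact W B)"

definition cylinder_topology :: "'y topology" where
  "cylinder_topology = topology_generated_by {B. cylinder B}"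

lemma cylinder_subset: "cylinder B \<Longrightarrow> B \<subseteq> S"
proof (induction rule: cylinder.induct)
  case (step W B)
  then show ?case using sact_subset openin_subset by blast
qed auto

lemma cylinder_anchor: "openin (obj G) U \<Longrightarrow> cylinder {y \<in> S. anchor A y \<in> U}"
  using cylinder.base[of U "{}"] by (simp add: orbit_cone_def)

lemma cylinder_all: "cylinder S"
proof -
  have "{y \<in> S. anchor A y \<in> units G} = S" using anchor_units by auto
  then show ?thesis using cylinder_anchor[of "units G"] openin_topspace[of "obj G"] by simp
qed

lemma topspace_cylinder [simp]: "topspace cylinder_topology = S"
  unfolding cylinder_topology_def using cylinder_subset cylinder_all by auto

lemma openin_cylinder: "cylinder B \<Longrightarrow> openin cylinder_topology B"
  unfolding cylinder_topology_def by (rule topology_generated_by_Basis) simp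

lemma continuous_map_cylinder:
  assumes "\<And>z. z \<in> topspace Z \<Longrightarrow> f z \<in> S"
    and "\<And>B. cylinder B \<Longrightarrow> openin Z {z \<in> topspace Z. f z \<in> B}"
  shows "continuous_map Z cylinder_topology f"
  unfolding cylinder_topology_def
proof (rule continuous_on_generated_topo)
  show "openin Z (f -` U \<inter> topspace Z)" if "U \<in> {B. cylinder B}" for U
    using assms(2)[of U] that by (simp add: vimage_def Collect_conj_eq inf_commute)
  show "f ` topspace Z \<subseteq> \<Union>{B. cylinder B}"
    using assms(1) topspace_cylinder unfolding cylinder_topology_def by auto
qed

text \<open>The generators are closed under multiplication by open sets of X, but finite
  intersections of generators need an argument. For a bisection W the assignment B \<mapsto> W B
  commutes with intersections, because factors in W can be cancelled; a general W is a union of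
  bisections.\<close>

lemma openin_sact_cylinder:
  assumes W: "openin (spc X) W" and B: "openin cylinder_topology B"
  shows "openin cylinder_topology (sact W B)"
proof -
  have "\<forall>W\<in>corr_bisections G X. openin cylinder_topology (sact W B)"
    using B[unfolded cylinder_topology_def, THEN openin_topology_generated_by]
  proof (induction rule: generate_topology_on.induct)
    case Empty
    then show ?case by (simp add: sact_def)
  next
    case (Int a b)
    have "openin cylinder_topology a" "openin cylinder_topology b"
      using Int.hyps unfolding cylinder_topology_def by (simp_all add: openin_topology_generated_by_iff)
    then have ab: "a \<subseteq> S" "b \<subseteq> S" using openin_subset topspace_cylinder by blast+
    have "sact W (a \<inter> b) = sact W a \<inter> sact W b" if W: "W \<in> corr_bisections G X" for W
    proof (intro equalityI subsetI)
      fix k assume "k \<in> sact W a \<inter> sact W b"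
      then obtain x y x' y' where *: "x \<in> W" "y \<in> a" "ranchor X x = anchor A y" "k = xact A x y"
        "x' \<in> W" "y' \<in> b" "ranchor X x' = anchor A y'" "k = xact A x' y'"
        unfolding sact_def by blast
      then have "x = x' \<and> y = y'" using ab by (intro xact_bisection_cancel[OF W]) auto
      then show "k \<in> sact W (a \<inter> b)" unfolding sact_def using * by blast
    qed (auto simp: sact_def)
    then show ?case using Int.IH by auto
  next
    case (UN K)
    have "sact W (\<Union>K) = (\<Union>k\<in>K. sact W k)" for W unfolding sact_def by blast
    then show ?case using UN.IH by auto
  next
    case (Basis s)
    then show ?case using openin_cylinder cylinder.step corr_bisectionD(1) by auto
  qed
  moreover have "sact W B = (\<Union>U\<in>{U \<in> corr_bisections G X. U \<subseteq> W}. sact U B)"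
  proof (intro equalityI subsetI)
    fix k assume "k \<in> sact W B"
    then obtain x y where *: "x \<in> W" "y \<in> B" "ranchor X x = anchor A y" "k = xact A x y"
      unfolding sact_def by blast
    obtain U where "U \<in> corr_bisections G X" "x \<in> U" "U \<subseteq> W" using corr_bisection_exists[OF W *(1)] .
    then show "k \<in> (\<Union>U\<in>{U \<in> corr_bisections G X. U \<subseteq> W}. sact U B)"
      using * unfolding sact_def by blast
  qed (auto simp: sact_def)
  ultimately show ?thesis by auto
qed

lemma openin_not_orbit:
  assumes "compactin XG K" shows "openin (spc X) {x \<in> pts. orb x \<notin> K}"
proof -
  have "openin XG (topspace XG - K)" using compactin_imp_closedin[OF Hausdorff_XG assms] by blast
  then have "openin (spc X) {x \<in> pts. orb x \<in> topspace XG - K}"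
    using continuous_orbit openin_continuous_map_preimage by blast
  also have "{x \<in> pts. orb x \<in> topspace XG - K} = {x \<in> pts. orb x \<notin> K}" by auto
  finally show ?thesis .
qed

lemma openin_lact_preimage:
  assumes V: "V \<in> bisections G" and W: "openin (spc X) W"
  shows "openin (spc X) {x \<in> pts. lanchor X x \<in> src G ` V \<and> lact X (ssec V (lanchor X x)) x \<in> W}"
proof -
  define E where "E = {x \<in> pts. lanchor X x \<in> src G ` V}"
  have E: "openin (spc X) E" unfolding E_def
    using openin_lanchor_preimage bisectionD(5)[OF V] by blast
  have *: "continuous_map (subtopology (spc X) E) (spc X) (\<lambda>x. x)"
    by (simp add: continuous_map_from_subtopology)
  have "continuous_map (subtopology (spc X) E) (spc X) (\<lambda>x. lact X (ssec V (lanchor X x)) x)"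
    by (intro cont_lact cont_ssec cont_lanchor * V) (use ssec[OF V] in \<open>auto simp: E_def\<close>)
  from openin_preimage_subtopology[OF this E W] show ?thesis unfolding E_def by (simp add: conj_assoc)
qed

text \<open>Points outside a cone stay outside it under small perturbations of an arrow g applied to
  them: for a point x z by continuity on X, for the others because the translates of K by a compact
  neighbourhood of g are contained in a single compact set.\<close>

lemma translated_compact:
  assumes V: "V \<in> bisections G" and C: "compactin (arr G) C" "C \<subseteq> V" and K: "compactin XG K"
  obtains L where "compactin XG L"
    "\<And>g y. \<lbrakk>g \<in> C; y \<in> S; src G g = anchor A y; act A g y \<in> orbit_cone K\<rbrakk> \<Longrightarrow> y \<in> orbit_cone L"
proof -
  obtain D where D: "compactin (spc X) D" "K \<subseteq> orb ` D" using compactin_XG_lift[OF K] .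
  define E where "E = {x \<in> pts. lanchor X x \<in> rng G ` V}"
  \<comment> \<open>Only representatives with left anchor in the compact, hence closed, set r(C) can
    occur as first factors of g y. Moving them back by the arrows of V gives a compact set of orbits
    that serves all g in C at once.\<close>
  define D' where "D' = D \<inter> {x \<in> pts. lanchor X x \<in> rng G ` C}"
  have "compactin (obj G) (rng G ` C)" using image_compactin[OF C(1) continuous_rng] .
  then have "closedin (obj G) (rng G ` C)" using compactin_imp_closedin[OF Hausdorff_obj] by blast
  then have "closedin (spc X) {x \<in> pts. lanchor X x \<in> rng G ` C}"
    using lanchor_continuous closedin_continuous_map_preimage by blast
  then have "compactin (spc X) D'" unfolding D'_def using D(1) compactin_Int_closedin by blast
  moreover have "D' \<subseteq> E" using C(2) by (auto simp: D'_def E_def)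
  ultimately have D': "compactin (subtopology (spc X) E) D'" by (simp add: compactin_subtopology)
  have *: "continuous_map (subtopology (spc X) E) (spc X) (\<lambda>x. x)"
    by (simp add: continuous_map_from_subtopology)
  have "continuous_map (subtopology (spc X) E) (spc X) (\<lambda>x. lact X (invs G (rsec V (lanchor X x))) x)"
    by (intro cont_lact cont_inv cont_rsec cont_lanchor * V)
      (use rsec[OF V] bisection_in[OF V] in \<open>auto simp: E_def src_inv\<close>)
  then have L: "compactin XG (orb ` (\<lambda>x. lact X (invs G (rsec V (lanchor X x))) x) ` D')"
    using image_compactin[OF D'] compactin_orbit_image by blast
  show thesis
  proof (rule that[OF L])
    fix g y assume g: "g \<in> C" "y \<in> S" "src G g = anchor A y" "act A g y \<in> orbit_cone K"
    then have gt: "g \<in> V" "g \<in> arrs" using C(2) bisection_in[OF V] by auto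
    obtain x z where x: "x \<in> pts" "orb x \<in> K" "z \<in> S" "ranchor X x = anchor A z" "act A g y = xact A x z"
      using g(4) unfolding orbit_cone_def by blast
    obtain d where d: "d \<in> D" "orb x = orb d" using D(2) x(2) by blast
    have dp: "d \<in> pts" using d D(1) compactin_subset_topspace by blast
    obtain h where h: "act A h z \<in> S" "ranchor X d = anchor A (act A h z)" "xact A x z = xact A d (act A h z)"
      using xact_change[OF x(1) dp x(3,4) d(2)] by metis
    define w where "w = act A h z"
    have w: "w \<in> S" "ranchor X d = anchor A w" "act A g y = xact A d w" using h x by (auto simp: w_def)
    have ld: "lanchor X d = rng G g" using anchor_act[OF gt(2) g(2,3)] anchor_xact[OF dp w(1,2)] w(3) by simp
    have "y = act A (invs G g) (xact A d w)" using act_inv_cancel[OF gt(2) g(2,3)] w(3) by simp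
    also have "\<dots> = xact A (lact X (invs G g) d) w"
      using act_xact[of "invs G g" d w] gt dp w ld by (simp add: inv_closed src_inv)
    finally have y: "y = xact A (lact X (invs G g) d) w" .
    have l: "lact X (invs G g) d \<in> pts" "ranchor X (lact X (invs G g) d) = anchor A w"
      using gt dp w ld by (auto simp: lact_closed inv_closed src_inv ranchor_lact)
    have "rsec V (lanchor X d) = g" using rsec_eq[OF V gt(1)] ld by simp
    moreover have "d \<in> D'" using d dp ld g(1) by (simp add: D'_def)
    ultimately have "orb (lact X (invs G g) d) \<in> orb ` (\<lambda>x. lact X (invs G (rsec V (lanchor X x))) x) ` D'"
      by force
    from mem_orbit_coneI[OF l(1) this w(1) l(2)]
    show "y \<in> orbit_cone (orb ` (\<lambda>x. lact X (invs G (rsec V (lanchor X x))) x) ` D')" unfolding y .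
  qed
qed

text \<open>The neighbourhood of y is returned in the explicit form \<open>sact W S\<close>. The
  ultrafilter argument reuses it, because \<open>near\<close> asserts membership of exactly these
  sets.\<close>

lemma act_base_nbhd_inside:
  assumes U: "openin (obj G) U" and K: "compactin XG K"
    and g: "g \<in> arrs" "y \<in> S" "src G g = anchor A y" "rng G g \<in> U" "act A g y \<notin> orbit_cone K"
    and x: "x \<in> pts" "z \<in> S" "ranchor X x = anchor A z" "y = xact A x z"
  shows "\<exists>V W. openin (arr G) V \<and> openin (spc X) W \<and> g \<in> V \<and> x \<in> W \<and>
    (\<forall>h\<in>V. \<forall>z\<in>sact W S. src G h = anchor A z \<longrightarrow> rng G h \<in> U \<and> act A h z \<notin> orbit_cone K)"
proof -
  obtain V where V: "V \<in> bisections G" "g \<in> V" "V \<subseteq> {g \<in> arrs. rng G g \<in> U}"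
    using bisection_exists[OF openin_rng_preimage[OF U], of g] g by blast
  define W where "W = {x \<in> pts. lanchor X x \<in> src G ` V \<and> lact X (ssec V (lanchor X x)) x \<in> {x \<in> pts. orb x \<notin> K}}"
  have W: "openin (spc X) W" unfolding W_def by (rule openin_lact_preimage[OF V(1) openin_not_orbit[OF K]])
  have lx: "lanchor X x = src G g" using x g anchor_xact by simp
  have "ssec V (lanchor X x) = g" using ssec_eq[OF V(1,2)] lx by simp
  moreover have "orb (lact X g x) \<notin> K"
    using g(5) act_xact[of g x z] x g lx xact_mem_orbit_cone_iff[of "lact X g x" z K]
    by (simp add: lact_closed ranchor_lact)
  moreover have "lanchor X x \<in> src G ` V" using lx V(2) by simp
  ultimately have "x \<in> W" using x g lx by (simp add: W_def lact_closed)
  moreover have "rng G h \<in> U \<and> act A h w \<notin> orbit_cone K" if h: "h \<in> V" "w \<in> sact W S" "src G h = anchor A w" for h w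
  proof -
    obtain x' z' where x': "x' \<in> W" "z' \<in> S" "ranchor X x' = anchor A z'" "w = xact A x' z'"
      using h(2) unfolding sact_def by blast
    have t: "x' \<in> pts" "h \<in> arrs" using x' h V bisection_in[OF V(1)] by (auto simp: W_def)
    have l: "src G h = lanchor X x'" using h(3) x' t anchor_xact by simp
    then have "ssec V (lanchor X x') = h" using ssec_eq[OF V(1) h(1)] by simp
    then have "orb (lact X h x') \<notin> K" using x'(1) by (auto simp: W_def)
    then have "act A h w \<notin> orbit_cone K"
      using act_xact[of h x' z'] x' t l xact_mem_orbit_cone_iff[of "lact X h x'" z' K]
      by (simp add: lact_closed ranchor_lact)
    then show ?thesis using V h by auto
  qed
  ultimately show ?thesis using bisectionD(1)[OF V(1)] V(2) W by blast
qed

text \<open>Here the neighbourhood is the complement of a compact cone, the only kind of set that a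
  stopping letter guarantees to lie in an ultrafilter.\<close>

lemma act_base_nbhd_outside:
  assumes U: "openin (obj G) U" and K: "compactin XG K"
    and g: "g \<in> arrs" "y \<in> S" "src G g = anchor A y" "rng G g \<in> U" "act A g y \<notin> orbit_cone K"
    and False: "y \<notin> sact pts S"
  shows "\<exists>V L. openin (arr G) V \<and> compactin XG L \<and> g \<in> V \<and> y \<notin> orbit_cone L \<and>
    (\<forall>h\<in>V. \<forall>z\<in>S - orbit_cone L. src G h = anchor A z \<longrightarrow> rng G h \<in> U \<and> act A h z \<notin> orbit_cone K)"
proof -
  obtain V where V: "V \<in> bisections G" "g \<in> V" "V \<subseteq> {g \<in> arrs. rng G g \<in> U}"
    using bisection_exists[OF openin_rng_preimage[OF U], of g] g by blast
  obtain V' C where C: "V' \<in> bisections G" "g \<in> V'" "V' \<subseteq> C" "C \<subseteq> V" "compactin (arr G) C"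
    using arr_compact_nbhd[OF bisectionD(1)[OF V(1)] V(2)] .
  obtain L where L: "compactin XG L"
    "\<And>g y. \<lbrakk>g \<in> C; y \<in> S; src G g = anchor A y; act A g y \<in> orbit_cone K\<rbrakk> \<Longrightarrow> y \<in> orbit_cone L"
    using translated_compact[OF V(1) C(5,4) K] by metis
  have "y \<notin> orbit_cone L" using False unfolding orbit_cone_def sact_def by blast
  moreover have "rng G h \<in> U \<and> act A h z \<notin> orbit_cone K" if "h \<in> V'" "z \<in> S" "z \<notin> orbit_cone L" "src G h = anchor A z" for h z
    using that L(2)[of h z] C V by auto
  ultimately show ?thesis using bisectionD(1)[OF C(1)] C(2) L(1) by blast
qed

lemma act_base_nbhd:
  assumes U: "openin (obj G) U" and K: "compactin XG K"
    and g: "g \<in> arrs" "y \<in> S" "src G g = anchor A y" "rng G g \<in> U" "act A g y \<notin> orbit_cone K"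
  shows "\<exists>V B. openin (arr G) V \<and> cylinder B \<and> g \<in> V \<and> y \<in> B \<and>
    (\<forall>h\<in>V. \<forall>z\<in>B. src G h = anchor A z \<longrightarrow> rng G h \<in> U \<and> act A h z \<notin> orbit_cone K)"
proof (cases "y \<in> sact pts S")
  case True
  then obtain x z where x: "x \<in> pts" "z \<in> S" "ranchor X x = anchor A z" "y = xact A x z"
    unfolding sact_def by blast
  obtain V W where "openin (arr G) V" "openin (spc X) W" "g \<in> V" "x \<in> W"
    "\<forall>h\<in>V. \<forall>z\<in>sact W S. src G h = anchor A z \<longrightarrow> rng G h \<in> U \<and> act A h z \<notin> orbit_cone K"
    using act_base_nbhd_inside[OF assms x] by blast
  moreover from this have "cylinder (sact W S)" "y \<in> sact W S"
    using cylinder.step[OF _ cylinder_all] x unfolding sact_def by blast+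
  ultimately show ?thesis by blast
next
  case False
  obtain V L where V: "openin (arr G) V" "compactin XG L" "g \<in> V" "y \<notin> orbit_cone L"
    "\<forall>h\<in>V. \<forall>z\<in>S - orbit_cone L. src G h = anchor A z \<longrightarrow> rng G h \<in> U \<and> act A h z \<notin> orbit_cone K"
    using act_base_nbhd_outside[OF assms False] by blast
  define B where "B = {y \<in> S. anchor A y \<in> units G \<and> y \<notin> orbit_cone L}"
  have "cylinder B" unfolding B_def using cylinder.base[OF _ V(2)] openin_topspace[of "obj G"] by simp
  moreover have "y \<in> B" "B \<subseteq> S - orbit_cone L" using g(2) V(4) anchor_units unfolding B_def by blast+
  ultimately show ?thesis using V by blast
qed

text \<open>If g y = w b, then y = (inverse(g) w) b. Arrows near g only change the first factor and
  leave B alone, so continuity of the action of G needs a case distinction on cylinders but no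
  induction.\<close>

lemma act_step_nbhd:
  assumes W: "openin (spc X) W" and g: "g \<in> arrs" "y \<in> S" "src G g = anchor A y" "act A g y \<in> sact W B"
    and B: "B \<subseteq> S"
  shows "\<exists>V W'. openin (arr G) V \<and> openin (spc X) W' \<and> g \<in> V \<and> y \<in> sact W' B \<and>
    (\<forall>h\<in>V. \<forall>z\<in>sact W' B. src G h = anchor A z \<longrightarrow> act A h z \<in> sact W B)"
proof -
  obtain w b where w: "w \<in> W" "b \<in> B" "ranchor X w = anchor A b" "act A g y = xact A w b"
    using g(4) unfolding sact_def by blast
  have t: "w \<in> pts" "b \<in> S" using w B openin_subset[OF W] by auto
  obtain V where V: "V \<in> bisections G" "g \<in> V" using bisection_exists[OF openin_topspace g(1)] .
  define W' where "W' = {x \<in> pts. lanchor X x \<in> src G ` V \<and> lact X (ssec V (lanchor X x)) x \<in> W}"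
  have W': "openin (spc X) W'" unfolding W'_def by (rule openin_lact_preimage[OF V(1) W])
  have lw: "lanchor X w = rng G g" using anchor_act[OF g(1-3)] anchor_xact[OF t w(3)] w(4) by simp
  define x where "x = lact X (invs G g) w"
  have x: "x \<in> pts" "lanchor X x = src G g" "ranchor X x = anchor A b" "lact X g x = w"
    using t g lw w by (auto simp: x_def lact_closed inv_closed src_inv rng_inv lanchor_lact ranchor_lact lact_inv_cancel')
  have "y = act A (invs G g) (xact A w b)" using act_inv_cancel[OF g(1-3)] w(4) by simp
  then have y: "y = xact A x b"
    using act_xact[of "invs G g" w b] t g lw w by (simp add: x_def inv_closed src_inv)
  have "ssec V (lanchor X x) = g" using ssec_eq[OF V] x by simp
  moreover have "lanchor X x \<in> src G ` V" using x(2) V(2) by simp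
  ultimately have "x \<in> W'" using x w by (simp add: W'_def)
  then have "y \<in> sact W' B" unfolding sact_def using y x w by blast
  moreover have "act A h z \<in> sact W B" if h: "h \<in> V" "z \<in> sact W' B" "src G h = anchor A z" for h z
  proof -
    obtain x' z' where x': "x' \<in> W'" "z' \<in> B" "ranchor X x' = anchor A z'" "z = xact A x' z'"
      using h(2) unfolding sact_def by blast
    have t: "x' \<in> pts" "h \<in> arrs" "z' \<in> S" using x' h B bisection_in[OF V(1)] by (auto simp: W'_def)
    have l: "src G h = lanchor X x'" using h(3) x' t anchor_xact by simp
    then have "ssec V (lanchor X x') = h" using ssec_eq[OF V(1) h(1)] by simp
    then have "lact X h x' \<in> W" using x'(1) by (auto simp: W'_def)
    moreover have "act A h z = xact A (lact X h x') z'" "ranchor X (lact X h x') = anchor A z'"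
      using act_xact[of h x' z'] x' t l by (auto simp: ranchor_lact)
    ultimately show ?thesis unfolding sact_def using x'(2) by blast
  qed
  ultimately show ?thesis using bisectionD(1)[OF V(1)] V(2) W' by blast
qed

lemma continuous_act_cylinder:
  "continuous_map (subtopology (prod_topology (arr G) cylinder_topology) {(g, y). src G g = anchor A y})
    cylinder_topology (\<lambda>(g, y). act A g y)" (is "continuous_map ?D _ _")
proof (rule continuous_map_cylinder)
  show "(case z of (g, y) \<Rightarrow> act A g y) \<in> S" if "z \<in> topspace ?D" for z
    using that act_closed by auto
  fix B assume B: "cylinder B"
  have t: "{z \<in> topspace ?D. (case z of (g, y) \<Rightarrow> act A g y) \<in> B} =
    {(g, y). g \<in> arrs \<and> y \<in> S \<and> src G g = anchor A y \<and> act A g y \<in> B}" (is "_ = ?P") by auto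
  have "openin ?D ?P"
  proof (rule openin_subtopology_prodI)
    fix g y assume "(g, y) \<in> ?P"
    then have g: "g \<in> arrs" "y \<in> S" "src G g = anchor A y" "act A g y \<in> B" by auto
    have "\<exists>V B'. openin (arr G) V \<and> cylinder B' \<and> g \<in> V \<and> y \<in> B' \<and>
      (\<forall>h\<in>V. \<forall>z\<in>B'. src G h = anchor A z \<longrightarrow> act A h z \<in> B)"
      using B
    proof cases
      case (base U K)
      obtain V B' where "openin (arr G) V" "cylinder B'" "g \<in> V" "y \<in> B'"
        "\<forall>h\<in>V. \<forall>z\<in>B'. src G h = anchor A z \<longrightarrow> rng G h \<in> U \<and> act A h z \<notin> orbit_cone K"
        using act_base_nbhd[OF base(2,3) g(1-3)] g base(1) anchor_act[OF g(1-3)] by auto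
      moreover from this have "act A h z \<in> B" if "h \<in> V" "z \<in> B'" "src G h = anchor A z" for h z
        using that base(1) anchor_act[of h z] act_closed[of h z] cylinder_subset[of B'] openin_subset[of "arr G" V]
        by (simp add: subset_iff)
      ultimately show ?thesis by blast
    next
      case (step W B0)
      then show ?thesis
        using act_step_nbhd[OF step(2) g(1-3), of B0] g(4) cylinder_subset[OF step(3)] cylinder.step[OF _ step(3)]
        by metis
    qed
    then obtain V B' where V: "openin (arr G) V" "cylinder B'" "g \<in> V" "y \<in> B'"
      "\<forall>h\<in>V. \<forall>z\<in>B'. src G h = anchor A z \<longrightarrow> act A h z \<in> B" by blast
    then have "V \<times> B' \<inter> {(g, y). src G g = anchor A y} \<subseteq> ?P"
      using openin_subset[OF V(1)] cylinder_subset[OF V(2)] by auto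
    then show "\<exists>V B'. openin (arr G) V \<and> openin cylinder_topology B' \<and> g \<in> V \<and> y \<in> B' \<and>
      V \<times> B' \<inter> {(g, y). src G g = anchor A y} \<subseteq> ?P"
      using V openin_cylinder by blast
  qed auto
  then show "openin ?D {z \<in> topspace ?D. (case z of (g, y) \<Rightarrow> act A g y) \<in> B}" unfolding t .
qed

lemma continuous_anchor_cylinder: "continuous_map cylinder_topology (obj G) (anchor A)"
  unfolding continuous_map using anchor_units openin_cylinder[OF cylinder_anchor] by auto

lemma continuous_xact_cylinder:
  "continuous_map (subtopology (prod_topology (spc X) cylinder_topology) {(x, y). ranchor X x = anchor A y})
    cylinder_topology (\<lambda>(x, y). xact A x y)" (is "continuous_map ?D _ _")
proof (rule continuous_map_cylinder)
  show "(case z of (x, y) \<Rightarrow> xact A x y) \<in> S" if "z \<in> topspace ?D" for z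
    using that xact_closed by auto
  fix B assume B: "cylinder B"
  have t: "{z \<in> topspace ?D. (case z of (x, y) \<Rightarrow> xact A x y) \<in> B} =
    {(x, y). x \<in> pts \<and> y \<in> S \<and> ranchor X x = anchor A y \<and> xact A x y \<in> B}" (is "_ = ?P") by auto
  have "openin ?D ?P"
  proof (rule openin_subtopology_prodI)
    fix x y assume "(x, y) \<in> ?P"
    then have x: "x \<in> pts" "y \<in> S" "ranchor X x = anchor A y" "xact A x y \<in> B" by auto
    show "\<exists>V O'. openin (spc X) V \<and> openin cylinder_topology O' \<and> x \<in> V \<and> y \<in> O' \<and>
      V \<times> O' \<inter> {(x, y). ranchor X x = anchor A y} \<subseteq> ?P"
      using B
    proof cases
      case (base U K)
      define V where "V = {x \<in> pts. lanchor X x \<in> U} \<inter> {x \<in> pts. orb x \<notin> K}"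
      have V: "openin (spc X) V" unfolding V_def
        using openin_lanchor_preimage[OF base(2)] openin_not_orbit[OF base(3)] by blast
      \<comment> \<open>Membership of x y in a basic set depends on x alone, through its left anchor
        and its orbit.\<close>
      have iff: "xact A x y \<in> B \<longleftrightarrow> x \<in> V" if "x \<in> pts" "y \<in> S" "ranchor X x = anchor A y" for x y
        using that base(1) by (simp add: V_def anchor_xact xact_closed xact_mem_orbit_cone_iff)
      then have "V \<times> S \<inter> {(x, y). ranchor X x = anchor A y} \<subseteq> ?P" "x \<in> V"
        using x by (auto simp: V_def)
      then show ?thesis using V x openin_topspace[of cylinder_topology] by auto
    next
      case (step W B0)
      have B0: "B0 \<subseteq> S" using cylinder_subset[OF step(3)] .
      obtain w b where w: "w \<in> W" "b \<in> B0" "ranchor X w = anchor A b" "xact A w b = xact A x y"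
        using x(4) step(1) unfolding sact_def by force
      have wt: "w \<in> pts" "b \<in> S" using w B0 openin_subset[OF step(2)] by auto
      \<comment> \<open>The same point is written as x y and as w b, with x = w h and b = h y. For
        nearby x' and y' the arrow h is replaced by the arrow k of a bisection through h with source
        the common anchor; then x' y' = (x' inverse(k)) (k y') stays in the cylinder.\<close>
      obtain h where h: "h \<in> arrs" "ranchor X w = rng G h" "src G h = anchor A y" "x = ract X w h" "b = act A h y"
        using xact_eq_iff[of w x b y] w wt x by auto
      obtain V where V: "V \<in> bisections G" "h \<in> V" using bisection_exists[OF openin_topspace h(1)] .
      define E where "E = {y \<in> S. anchor A y \<in> src G ` V}"
      have E: "openin cylinder_topology E" unfolding E_def
        using openin_cylinder[OF cylinder_anchor[OF bisectionD(5)[OF V(1)]]] .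
      have id: "continuous_map (subtopology cylinder_topology E) cylinder_topology (\<lambda>x. x)"
        by (simp add: continuous_map_from_subtopology)
      have anc: "continuous_map (subtopology cylinder_topology E) (obj G) (anchor A)"
        using continuous_anchor_cylinder continuous_map_from_subtopology by blast
      have "continuous_map (subtopology cylinder_topology E) cylinder_topology (\<lambda>y. act A (ssec V (anchor A y)) y)"
        by (rule continuous_map_pair_compose[OF continuous_act_cylinder cont_ssec[OF V(1) anc] id])
          (use ssec[OF V(1)] in \<open>auto simp: E_def\<close>)
      from openin_preimage_subtopology[OF this E openin_cylinder[OF step(3)]]
      have O': "openin cylinder_topology {y \<in> E. act A (ssec V (anchor A y)) y \<in> B0}" (is "openin _ ?O") .
      define E' where "E' = {x \<in> pts. ranchor X x \<in> src G ` V}"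
      have E': "openin (spc X) E'" unfolding E'_def
        using openin_ranchor_preimage bisectionD(5)[OF V(1)] by blast
      have *: "continuous_map (subtopology (spc X) E') (spc X) (\<lambda>x. x)"
        by (simp add: continuous_map_from_subtopology)
      have "continuous_map (subtopology (spc X) E') (spc X) (\<lambda>x. ract X x (invs G (ssec V (ranchor X x))))"
        by (intro cont_ract cont_inv cont_ssec cont_ranchor * V)
          (use ssec[OF V(1)] bisection_in[OF V(1)] in \<open>auto simp: E'_def rng_inv\<close>)
      from openin_preimage_subtopology[OF this E' step(2)]
      have W': "openin (spc X) {x \<in> E'. ract X x (invs G (ssec V (ranchor X x))) \<in> W}" (is "openin _ ?W") .
      have sh: "ssec V (anchor A y) = h" using ssec_eq[OF V] h by simp
      have im: "anchor A y \<in> src G ` V" using h(3) V(2) by (metis image_eqI)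
      then have "y \<in> ?O" using x h(5) w sh by (simp add: E_def)
      moreover have "x \<in> ?W"
      proof -
        have "ract X x (invs G h) = w" using ract_inv_cancel[OF wt(1) h(1,2)] h(4) by simp
        then show ?thesis using x w sh im by (simp add: E'_def)
      qed
      moreover have "?W \<times> ?O \<inter> {(x, y). ranchor X x = anchor A y} \<subseteq> ?P"
      proof
        fix p assume "p \<in> ?W \<times> ?O \<inter> {(x, y). ranchor X x = anchor A y}"
        then obtain x' y' where p: "p = (x', y')" "x' \<in> ?W" "y' \<in> ?O" "ranchor X x' = anchor A y'" by auto
        define k where "k = ssec V (anchor A y')"
        have k: "k \<in> V" "src G k = anchor A y'" "act A k y' \<in> B0" "ract X x' (invs G k) \<in> W"
          using p ssec[OF V(1), of "anchor A y'"] by (auto simp: E_def k_def)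
        have t: "k \<in> arrs" "x' \<in> pts" "y' \<in> S" using k p bisection_in[OF V(1)] by (auto simp: E_def E'_def)
        have r: "ranchor X (ract X x' (invs G k)) = rng G k" "ract X x' (invs G k) \<in> pts"
          using t k p by (auto simp: ranchor_ract ract_closed inv_closed rng_inv src_inv)
        have "xact A x' y' = xact A (ract X x' (invs G k)) (act A k y')"
          using xact_ract[OF r(2) t(1,3) r(1) k(2)] ract_inv_cancel'[OF t(2,1)] p k by simp
        moreover have "ranchor X (ract X x' (invs G k)) = anchor A (act A k y')"
          using r anchor_act[OF t(1,3) k(2)] by simp
        ultimately have "xact A x' y' \<in> B" unfolding step(1) sact_def using k by blast
        then show "p \<in> ?P" using p t by simp
      qed
      ultimately show ?thesis using W' O' by blast
    qed
  qed auto
  then show "openin ?D {z \<in> topspace ?D. (case z of (x, y) \<Rightarrow> xact A x y) \<in> B}" unfolding t .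
qed

theorem correspondence_action_cylinder: "correspondence_action G X R cylinder_topology A"
proof (rule correspondence_actionI[OF topspace_cylinder continuous_anchor_cylinder
      continuous_act_cylinder continuous_xact_cylinder openin_sact_cylinder])
  fix K assume K: "compactin XG K"
  have "openin cylinder_topology {y \<in> S. anchor A y \<in> units G \<and> y \<notin> orbit_cone K}"
    using openin_cylinder[OF cylinder.base[OF _ K]] openin_topspace[of "obj G"] by simp
  also have "{y \<in> S. anchor A y \<in> units G \<and> y \<notin> orbit_cone K} = topspace cylinder_topology - orbit_cone K"
    using anchor_units by auto
  finally show "closedin cylinder_topology (orbit_cone K)"
    unfolding closedin_def using orbit_cone_subset by simp
qed

end

lemma (in topological_action) openin_if_cylinder: "cylinder B \<Longrightarrow> openin Y B"
proof (induction rule: cylinder.induct)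
  case (base U K)
  have "{y \<in> topspace Y. anchor A y \<in> U \<and> y \<notin> orbit_cone K} = {y \<in> topspace Y. anchor A y \<in> U} - orbit_cone K" by auto
  then show ?case using openin_anchor_preimage[OF base(1)] closedin_orbit_cone[OF base(2)] by (simp add: openin_diff)
qed (rule openin_sact)

section \<open>The action on streams\<close>

text \<open>A point of the universal action is a finite or infinite composable sequence of points of X up to the
  action of G on the inner variables. Choosing a representative in each orbit makes these
  sequences unique; the groupoid then acts on them letter by letter like a Mealy machine. A
  finite sequence is continued by its last object, which lies outside R.\<close>

context correspondence_setting
begin

definition rep where "rep x = (SOME y. y \<in> pts \<and> orb y = orb x)"
text \<open>The arrow by which x differs from the chosen representative; freeness makes it unique.
  It is the part of x that is handed on to the next letter.\<close>

definition off where "off x = (SOME g. g \<in> arrs \<and> ranchor X (rep x) = rng G g \<and> x = ract X (rep x) g)"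

lemma rep: "x \<in> pts \<Longrightarrow> rep x \<in> pts \<and> orb (rep x) = orb x"
  unfolding rep_def by (rule someI_ex) blast

lemma rep_cong: "orb x = orb y \<Longrightarrow> rep x = rep y"
  by (simp add: rep_def)

lemma rep_rep: "x \<in> pts \<Longrightarrow> rep (rep x) = rep x"
  using rep rep_cong by blast

lemma off:
  assumes "x \<in> pts"
  shows "off x \<in> arrs" "rng G (off x) = ranchor X (rep x)" "ract X (rep x) (off x) = x" "src G (off x) = ranchor X x"
proof -
  obtain g where "g \<in> arrs" "ranchor X (rep x) = rng G g" "x = ract X (rep x) g"
    using orbit_eqD[of "rep x" x] rep[OF assms] assms by metis
  then have "off x \<in> arrs \<and> ranchor X (rep x) = rng G (off x) \<and> x = ract X (rep x) (off x)"
    unfolding off_def using someI[of "\<lambda>g. g \<in> arrs \<and> ranchor X (rep x) = rng G g \<and> x = ract X (rep x) g" g] by simp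
  then show *: "off x \<in> arrs" "rng G (off x) = ranchor X (rep x)" "ract X (rep x) (off x) = x" by auto
  show "src G (off x) = ranchor X x" using ranchor_ract[of "rep x" "off x"] * rep[OF assms] by simp
qed

lemma off_eqI:
  assumes "x \<in> pts" "g \<in> arrs" "ranchor X (rep x) = rng G g" "ract X (rep x) g = x"
  shows "off x = g"
  using ract_free_eq[of "rep x" "off x" g] off[OF assms(1)] rep[OF assms(1)] assms by simp

lemma rep_off_ract:
  assumes "x \<in> pts" "g \<in> arrs" "ranchor X x = rng G g"
  shows "rep (ract X x g) = rep x" "off (ract X x g) = mult G (off x) g"
proof -
  show r: "rep (ract X x g) = rep x" using rep_cong orbit_ract[OF assms] by blast
  show "off (ract X x g) = mult G (off x) g"
  proof (rule off_eqI)
    show "ract X (rep (ract X x g)) (mult G (off x) g) = ract X x g"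
      unfolding r using ract_mult[of "rep x" "off x" g] off[OF assms(1)] rep[OF assms(1)] assms by simp
  qed (use assms off[OF assms(1)] r in \<open>auto simp: ract_closed mult_closed rng_mult\<close>)
qed

lemma off_rep: "x \<in> pts \<Longrightarrow> rep x = x \<Longrightarrow> off x = ranchor X x"
  by (rule off_eqI) (auto simp: ranchor_units unit_closed rng_unit ract_unit)

text \<open>From g x = (g \<open>rep x\<close>) \<open>off x\<close>, the new offset is a product.
  This cocycle identity is what makes the letterwise action multiplicative.\<close>

lemma rep_off_lact:
  assumes "g \<in> arrs" "x \<in> pts" "src G g = lanchor X x"
  shows "rep (lact X g x) = rep (lact X g (rep x))"
    "off (lact X g x) = mult G (off (lact X g (rep x))) (off x)"
    "src G g = lanchor X (rep x)"
proof -
  have r: "rep x \<in> pts" using rep assms by blast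
  show l: "src G g = lanchor X (rep x)" using orbit_lanchor[OF r assms(2)] rep assms by simp
  have "lact X g x = ract X (lact X g (rep x)) (off x)"
    using actions_commute[OF assms(1) r _ l, of "off x"] off[OF assms(2)] by simp
  then show "rep (lact X g x) = rep (lact X g (rep x))"
    "off (lact X g x) = mult G (off (lact X g (rep x))) (off x)"
    using rep_off_ract[of "lact X g (rep x)" "off x"] off[OF assms(2)] assms r l
    by (simp_all add: lact_closed ranchor_lact)
qed

text \<open>Letters use the sum type of \<open>universe\<close>: a left summand is an object at
  which a sequence has stopped, the middle summand is a point of X, and the last summand is reserved
  for copies of objects of M and does not occur in \<open>streams\<close>.\<close>

fun letter_anchor :: "'g + 'x + 'm \<Rightarrow> 'g" where
  "letter_anchor (Inl u) = u"
| "letter_anchor (Inr (Inl x)) = lanchor X x"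
| "letter_anchor (Inr (Inr m)) = undefined"

fun out :: "'g \<Rightarrow> 'g + 'x + 'm \<Rightarrow> 'g + 'x + 'm" where
  "out g (Inl u) = Inl (rng G g)"
| "out g (Inr (Inl x)) = Inr (Inl (rep (lact X g x)))"
| "out g (Inr (Inr m)) = Inr (Inr m)"

fun next_state :: "'g \<Rightarrow> 'g + 'x + 'm \<Rightarrow> 'g" where
  "next_state g (Inl u) = g"
| "next_state g (Inr (Inl x)) = off (lact X g x)"
| "next_state g (Inr (Inr m)) = g"

text \<open>The arrow that remains after g has passed the first n letters.\<close>

primrec state :: "'g \<Rightarrow> (nat \<Rightarrow> 'g + 'x + 'm) \<Rightarrow> nat \<Rightarrow> 'g" where
  "state g a 0 = g"
| "state g a (Suc n) = next_state (state g a n) (a n)"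

definition stream_act :: "'g \<Rightarrow> (nat \<Rightarrow> 'g + 'x + 'm) \<Rightarrow> nat \<Rightarrow> 'g + 'x + 'm" where
  "stream_act g a n = out (state g a n) (a n)"

definition stream_xact :: "'x \<Rightarrow> (nat \<Rightarrow> 'g + 'x + 'm) \<Rightarrow> nat \<Rightarrow> 'g + 'x + 'm" where
  "stream_xact x a = case_nat (Inr (Inl (rep x))) (stream_act (off x) a)"

definition streams :: "'g set \<Rightarrow> (nat \<Rightarrow> 'g + 'x + 'm) set" where
  "streams R = {a. \<forall>n.
    (\<exists>x\<in>pts. a n = Inr (Inl x) \<and> rep x = x \<and> ranchor X x = letter_anchor (a (Suc n))) \<or>
    (\<exists>u\<in>units G - R. a n = Inl u \<and> a (Suc n) = Inl u)}"

section \<open>Algebra of the operations on streams\<close>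

lemma streams_cases:
  assumes "a \<in> streams R"
  obtains (pt) x where "x \<in> pts" "a n = Inr (Inl x)" "rep x = x" "ranchor X x = letter_anchor (a (Suc n))"
    | (stop) u where "u \<in> units G" "u \<notin> R" "a n = Inl u" "a (Suc n) = Inl u"
proof -
  have "(\<exists>x\<in>pts. a n = Inr (Inl x) \<and> rep x = x \<and> ranchor X x = letter_anchor (a (Suc n))) \<or>
    (\<exists>u\<in>units G - R. a n = Inl u \<and> a (Suc n) = Inl u)"
    using assms unfolding streams_def by simp
  then show thesis using pt stop by blast
qed

lemma letter_anchor_units: "a \<in> streams R \<Longrightarrow> letter_anchor (a n) \<in> units G"
  by (rule streams_cases[of a R n]) (auto simp: lanchor_units)

lemma state_invariant:
  assumes "a \<in> streams R" "g \<in> arrs" "src G g = letter_anchor (a 0)"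
  shows "state g a n \<in> arrs \<and> src G (state g a n) = letter_anchor (a n)"
proof (induction n)
  case 0
  then show ?case using assms by simp
next
  case (Suc n)
  from assms(1) show ?case
  proof (cases rule: streams_cases[of a R n])
    case (pt x)
    then have "lact X (state g a n) x \<in> pts" "ranchor X (lact X (state g a n) x) = ranchor X x"
      using Suc by (auto simp: lact_closed ranchor_lact)
    then show ?thesis using pt off[of "lact X (state g a n) x"] by simp
  next
    case (stop u)
    then show ?thesis using Suc by simp
  qed
qed

lemma letter_anchor_out:
  assumes "a \<in> streams R" "g \<in> arrs" "src G g = letter_anchor (a n)"
  shows "letter_anchor (out g (a n)) = rng G g"
  using assms(1)
proof (cases rule: streams_cases[of a R n])
  case (pt x)
  then have "lact X g x \<in> pts" "lanchor X (lact X g x) = rng G g"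
    using assms by (auto simp: lact_closed lanchor_lact)
  then show ?thesis using pt orbit_lanchor[of "rep (lact X g x)" "lact X g x"] rep by simp
qed simp

lemma letter_anchor_stream_act:
  assumes "a \<in> streams R" "g \<in> arrs" "src G g = letter_anchor (a 0)"
  shows "letter_anchor (stream_act g a n) = rng G (state g a n)"
  unfolding stream_act_def using letter_anchor_out[OF assms(1)] state_invariant[OF assms] by blast

lemma stream_act_closed:
  assumes inv: "invariant G R" and a: "a \<in> streams R" "g \<in> arrs" "src G g = letter_anchor (a 0)"
  shows "stream_act g a \<in> streams R"
  unfolding streams_def
proof (intro CollectI allI)
  fix n
  note st = state_invariant[OF a, of n]
  from a(1) show "(\<exists>x\<in>pts. stream_act g a n = Inr (Inl x) \<and> rep x = x \<and> ranchor X x = letter_anchor (stream_act g a (Suc n))) \<or>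
    (\<exists>u\<in>units G - R. stream_act g a n = Inl u \<and> stream_act g a (Suc n) = Inl u)"
  proof (cases rule: streams_cases[of a R n])
    case (pt x)
    define y where "y = lact X (state g a n) x"
    have y: "y \<in> pts" using pt st by (simp add: y_def lact_closed)
    have "stream_act g a n = Inr (Inl (rep y))" using pt by (simp add: stream_act_def y_def)
    moreover have "ranchor X (rep y) = letter_anchor (stream_act g a (Suc n))"
      using letter_anchor_stream_act[OF a, of "Suc n"] pt off[OF y] by (simp add: y_def)
    ultimately show ?thesis using rep[OF y] rep_rep[OF y] by blast
  next
    case (stop u)
    \<comment> \<open>Invariance of R is what keeps stopping objects outside R when an arrow
      acts.\<close>
    have "rng G (state g a n) \<in> units G - R"
      using inv st stop rng_units[of "state g a n"] unfolding invariant_def by auto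
    moreover have "stream_act g a n = Inl (rng G (state g a n))" "stream_act g a (Suc n) = Inl (rng G (state g a n))"
      using stop by (simp_all add: stream_act_def)
    ultimately show ?thesis by blast
  qed
qed

lemma stream_act_unit:
  assumes "a \<in> streams R" shows "stream_act (letter_anchor (a 0)) a = a"
proof
  fix n
  have st: "state (letter_anchor (a 0)) a n = letter_anchor (a n)" for n
  proof (induction n)
    case (Suc n)
    from assms show ?case
      by (cases rule: streams_cases[of a R n]) (use Suc in \<open>simp_all add: lact_unit off_rep\<close>)
  qed simp
  from assms show "stream_act (letter_anchor (a 0)) a n = a n"
    by (cases rule: streams_cases[of a R n])
      (simp_all add: stream_act_def st lact_unit rng_unit)
qed

text \<open>By the cocycle identity, the state of gh after n letters of a is the state of g on the
  stream h a times the state of h on a; the equality of letters follows.\<close>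

lemma stream_act_mult:
  assumes inv: "invariant G R" and a: "a \<in> streams R" and g: "g \<in> arrs" "h \<in> arrs" "src G g = rng G h"
    and h: "src G h = letter_anchor (a 0)"
  shows "stream_act (mult G g h) a = stream_act g (stream_act h a)"
proof
  fix n
  let ?b = "stream_act h a"
  have b: "?b \<in> streams R" using stream_act_closed[OF inv a g(2) h] .
  have b0: "src G g = letter_anchor (?b 0)" using letter_anchor_stream_act[OF a g(2) h, of 0] g by simp
  note sh = state_invariant[OF a g(2) h] and sg = state_invariant[OF b g(1) b0]
  have c: "src G (state g ?b n) = rng G (state h a n)" for n
    using sg letter_anchor_stream_act[OF a g(2) h] by metis
  have lx: "lact X (mult G (state g ?b n) (state h a n)) x = lact X (state g ?b n) (lact X (state h a n) x)"
    "lact X (state h a n) x \<in> pts" "src G (state g ?b n) = lanchor X (lact X (state h a n) x)"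
    if "x \<in> pts" "a n = Inr (Inl x)" for n x
    using that sh[of n] sg[of n] c[of n] lact_mult[of "state g ?b n" "state h a n" x]
    by (simp_all add: lact_closed lanchor_lact)
  have o: "?b n = out (state h a n) (a n)" for n by (simp add: stream_act_def)
  have st: "state (mult G g h) a n = mult G (state g ?b n) (state h a n)" for n
  proof (induction n)
    case (Suc n)
    from a show ?case
    proof (cases rule: streams_cases[of a R n])
      case (pt x)
      then show ?thesis
        using Suc rep_off_lact(2)[of "state g ?b n" "lact X (state h a n) x"] sg[of n] lx[of x n] o[of n]
        by simp
    next
      case (stop u)
      then show ?thesis using Suc by (simp add: stream_act_def)
    qed
  qed simp
  from a show "stream_act (mult G g h) a n = stream_act g ?b n"
  proof (cases rule: streams_cases[of a R n])
    case (pt x)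
    then show ?thesis
      using st[of n] lx[of x n] rep_off_lact(1)[of "state g ?b n" "lact X (state h a n) x"] sg[of n]
      by (simp add: stream_act_def)
  next
    case (stop u)
    then show ?thesis
      using st[of n] c[of n] sg[of n] sh[of n] o[of n] stream_act_def[of "mult G g h" a n] stream_act_def[of g ?b n]
      by (simp add: rng_mult)
  qed
qed

lemma stream_act_case_nat:
  "stream_act g (case_nat l b) = case_nat (out g l) (stream_act (next_state g l) b)"
proof
  fix n
  have "state g (case_nat l b) (Suc n) = state (next_state g l) b n" for n
    by (induction n) auto
  then show "stream_act g (case_nat l b) n = case_nat (out g l) (stream_act (next_state g l) b) n"
    by (cases n) (simp_all add: stream_act_def)
qed

lemma stream_xact_closed:
  assumes inv: "invariant G R" and a: "a \<in> streams R" "x \<in> pts" "ranchor X x = letter_anchor (a 0)"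
  shows "stream_xact x a \<in> streams R"
proof -
  note o = off[OF a(2)]
  have b: "stream_act (off x) a \<in> streams R" using stream_act_closed[OF inv a(1) o(1)] o a by simp
  have "ranchor X (rep x) = letter_anchor (stream_act (off x) a 0)"
    using letter_anchor_stream_act[OF a(1) o(1), of 0] o a by simp
  then show ?thesis
    using b rep[OF a(2)] rep_rep[OF a(2)] unfolding streams_def stream_xact_def
    by (auto split: nat.split)
qed

lemma letter_anchor_stream_xact: "x \<in> pts \<Longrightarrow> letter_anchor (stream_xact x a 0) = lanchor X x"
  using orbit_lanchor[of "rep x" x] rep[of x] by (simp add: stream_xact_def)

lemma stream_act_xact:
  assumes inv: "invariant G R" and a: "a \<in> streams R" "x \<in> pts" "ranchor X x = letter_anchor (a 0)"
    and g: "g \<in> arrs" "src G g = lanchor X x"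
  shows "stream_act g (stream_xact x a) = stream_xact (lact X g x) a"
proof -
  note o = off[OF a(2)] and r = rep_off_lact[OF g(1) a(2) g(2)]
  have l: "lact X g (rep x) \<in> pts" using rep[OF a(2)] g(1) r(3) lact_closed by blast
  have "stream_act (off (lact X g (rep x))) (stream_act (off x) a) = stream_act (mult G (off (lact X g (rep x))) (off x)) a"
    using stream_act_mult[OF inv a(1) off(1)[OF l] o(1)] off[OF l] o a g rep[OF a(2)] r(3)
    by (simp add: ranchor_lact)
  then show ?thesis
    unfolding stream_xact_def stream_act_case_nat using r by simp
qed

lemma stream_xact_eq_iff:
  assumes inv: "invariant G R" and a: "a \<in> streams R" "x \<in> pts" "ranchor X x = letter_anchor (a 0)"
    and b: "b \<in> streams R" "y \<in> pts" "ranchor X y = letter_anchor (b 0)"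
  shows "stream_xact x a = stream_xact y b \<longleftrightarrow>
    (\<exists>g\<in>arrs. ranchor X x = rng G g \<and> src G g = letter_anchor (b 0) \<and> y = ract X x g \<and> a = stream_act g b)"
    (is "?L \<longleftrightarrow> ?R")
proof
  note ox = off[OF a(2)] and oy = off[OF b(2)]
  { assume ?L
    then have r: "rep x = rep y" and e: "stream_act (off x) a = stream_act (off y) b"
      unfolding stream_xact_def by (metis (no_types, lifting) nat.case(1) sum.inject, metis ext nat.case(2))
    \<comment> \<open>Equal first letters mean that x and y share a representative, so y = x g
      forces \<open>off y\<close> to be \<open>off x\<close> times g.\<close>
    define g where "g = mult G (invs G (off x)) (off y)"
    have ro: "rng G (off x) = rng G (off y)" using r ox oy by simp
    have g: "g \<in> arrs" "rng G g = ranchor X x" "src G g = letter_anchor (b 0)"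
      using ox oy ro a b by (simp_all add: g_def mult_closed inv_closed rng_mult rng_inv src_mult src_inv)
    have "y = ract X (rep x) (mult G (off x) g)"
      using oy r ox ro by (simp add: g_def mult_inv_cancel_left')
    also have "\<dots> = ract X x g"
      using ract_mult[of "rep x" "off x" g] rep[OF a(2)] ox g by simp
    finally have y: "y = ract X x g" .
    have s: "src G (off x) = letter_anchor (a 0)" "src G (off y) = letter_anchor (b 0)" using ox oy a b by auto
    have "a = stream_act (mult G (invs G (off x)) (off x)) a"
      using stream_act_unit[OF a(1)] ox s by (simp add: inv_left)
    also have "\<dots> = stream_act (invs G (off x)) (stream_act (off y) b)"
      using stream_act_mult[OF inv a(1) inv_closed[OF ox(1)] ox(1) _ s(1)] ox e by (simp add: src_inv)
    also have "\<dots> = stream_act g b"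
      using stream_act_mult[OF inv b(1) inv_closed[OF ox(1)] oy(1) _ s(2)] ox ro by (simp add: g_def src_inv)
    finally have as: "a = stream_act g b" .
    show ?R using g(1) g(2)[symmetric] g(3) y as by blast }
  { assume ?R
    then obtain g where g: "g \<in> arrs" "ranchor X x = rng G g" "src G g = letter_anchor (b 0)" "y = ract X x g" "a = stream_act g b"
      by blast
    have "stream_act (off x) a = stream_act (off y) b"
      using rep_off_ract[OF a(2) g(1,2)] g stream_act_mult[OF inv b(1) ox(1) g(1) _ g(3)] ox by simp
    then show ?L using rep_off_ract[OF a(2) g(1,2)] g(4) by (simp add: stream_xact_def) }
qed

text \<open>A chosen representative has a unit as its offset, so prefixing it leaves the tail
  unchanged. This is the inverse of \<open>stream_xact\<close> on streams that do not stop at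
  once.\<close>

lemma stream_unfold:
  assumes "a \<in> streams R" "a 0 = Inr (Inl x)"
  shows "(\<lambda>n. a (Suc n)) \<in> streams R" "x \<in> pts" "ranchor X x = letter_anchor (a (Suc 0))"
    "a = stream_xact x (\<lambda>n. a (Suc n))"
proof -
  show t: "(\<lambda>n. a (Suc n)) \<in> streams R" using assms(1) unfolding streams_def by blast
  show x: "x \<in> pts" "ranchor X x = letter_anchor (a (Suc 0))"
    using assms by (auto elim: streams_cases[of a R 0])
  have r: "rep x = x" using assms by (auto elim: streams_cases[of a R 0])
  have "stream_act (off x) (\<lambda>n. a (Suc n)) = (\<lambda>n. a (Suc n))"
    using stream_act_unit[OF t] off_rep[OF x(1) r] x(2) by simp
  then show "a = stream_xact x (\<lambda>n. a (Suc n))"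
    unfolding stream_xact_def using r assms(2) by (auto simp: fun_eq_iff split: nat.split)
qed

text \<open>Streams are wrapped as singletons because the points of \<open>universe\<close> are sets
  of sequences.\<close>

definition stream_points :: "'g set \<Rightarrow> (nat \<Rightarrow> 'g + 'x + 'm) set set" where
  "stream_points R = (\<lambda>a. {a}) ` streams R"

definition stream_action :: "'g set \<Rightarrow> ('g, 'x, (nat \<Rightarrow> 'g + 'x + 'm) set) corr_action" where
  "stream_action R =
    \<lparr>anchor = restrict (\<lambda>y. letter_anchor (the_elem y 0)) (stream_points R),
     act = (\<lambda>g y. if g \<in> arrs \<and> y \<in> stream_points R \<and> src G g = letter_anchor (the_elem y 0)
       then {stream_act g (the_elem y)} else undefined),
     xact = (\<lambda>x y. if x \<in> pts \<and> y \<in> stream_points R \<and> ranchor X x = letter_anchor (the_elem y 0)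
       then {stream_xact x (the_elem y)} else undefined)\<rparr>"

lemma stream_action_simps:
  "a \<in> streams R \<Longrightarrow> {a} \<in> stream_points R"
  "a \<in> streams R \<Longrightarrow> anchor (stream_action R) {a} = letter_anchor (a 0)"
  "\<lbrakk>a \<in> streams R; g \<in> arrs; src G g = letter_anchor (a 0)\<rbrakk> \<Longrightarrow> act (stream_action R) g {a} = {stream_act g a}"
  "\<lbrakk>a \<in> streams R; x \<in> pts; ranchor X x = letter_anchor (a 0)\<rbrakk> \<Longrightarrow> xact (stream_action R) x {a} = {stream_xact x a}"
  by (simp_all add: stream_action_def stream_points_def)

lemma algebraic_stream_action:
  assumes inv: "invariant G R"
  shows "algebraic_action G X R (stream_points R :: (nat \<Rightarrow> 'g + 'x + 'm) set set) (stream_action R)"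
proof -
  let ?P = "stream_points R :: (nat \<Rightarrow> 'g + 'x + 'm) set set"
  have P: "\<exists>a\<in>streams R. y = {a}" if "y \<in> ?P" for y using that by (auto simp: stream_points_def)
  note simps = stream_action_simps
  show ?thesis
  proof (unfold_locales, goal_cases)
    case 1 then show ?case by (simp add: stream_action_def)
  next
    case 2 then show ?case by (auto simp: stream_action_def extensional_def)
  next
    case 3 then show ?case by (auto simp: stream_action_def extensional_def)
  next
    case (4 y)
    with P obtain a where "a \<in> streams R" "y = {a}" by blast
    then show ?case using simps letter_anchor_units by metis
  next
    case (5 g y)
    with P obtain a where "a \<in> streams R" "y = {a}" by blast
    then show ?case using 5 simps stream_act_closed[OF inv] by metis
  next
    case (6 y)
    with P obtain a where a: "a \<in> streams R" "y = {a}" by blast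
    then show ?case
      using simps(2)[OF a(1)] simps(3)[OF a(1), of "letter_anchor (a 0)"] stream_act_unit[OF a(1)]
        letter_anchor_units[OF a(1), of 0] unit_closed src_unit by simp
  next
    case (7 g y)
    with P obtain a where a: "a \<in> streams R" "y = {a}" by blast
    then show ?case
      using 7 stream_act_closed[OF inv, of a g] letter_anchor_stream_act[of a R g 0] by (simp add: simps)
  next
    case (8 g h y)
    with P obtain a where a: "a \<in> streams R" "y = {a}" by blast
    then have h: "src G h = letter_anchor (a 0)" using 8 by (simp add: simps)
    have "stream_act h a \<in> streams R" "letter_anchor (stream_act h a 0) = rng G h"
      using stream_act_closed[OF inv a(1) 8(2) h] letter_anchor_stream_act[OF a(1) 8(2) h, of 0] by simp_all
    then show ?case
      using 8 a h stream_act_mult[OF inv a(1) 8(1,2) 8(4) h] by (simp add: simps mult_closed src_mult)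
  next
    case (9 x y)
    with P obtain a where "a \<in> streams R" "y = {a}" by blast
    then show ?case using 9 simps stream_xact_closed[OF inv] by metis
  next
    case (10 x y)
    with P obtain a where a: "a \<in> streams R" "y = {a}" by blast
    then show ?case
      using 10 stream_xact_closed[OF inv, of a x] letter_anchor_stream_xact[of x a] by (simp add: simps)
  next
    case (11 g x y)
    with P obtain a where a: "a \<in> streams R" "y = {a}" by blast
    then have x: "ranchor X x = letter_anchor (a 0)" using 11 by (simp add: simps)
    have "stream_xact x a \<in> streams R" "letter_anchor (stream_xact x a 0) = lanchor X x"
      using stream_xact_closed[OF inv a(1) 11(2) x] letter_anchor_stream_xact[OF 11(2)] by simp_all
    then show ?case
      using 11 a x stream_act_xact[OF inv a(1) 11(2) x 11(1)] by (simp add: simps lact_closed ranchor_lact)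
  next
    case (12 x x' y y')
    obtain a b where a: "a \<in> streams R" "y = {a}" "b \<in> streams R" "y' = {b}"
      using P[OF 12(3)] P[OF 12(4)] by blast
    then have x: "ranchor X x = letter_anchor (a 0)" "ranchor X x' = letter_anchor (b 0)" using 12 by (auto simp: simps)
    show ?case
      using 12 a x stream_xact_eq_iff[OF inv a(1) 12(1) x(1) a(3) 12(2) x(2)]
      by (auto simp: simps)
  next
    case (13 y)
    with P obtain a where a: "a \<in> streams R" "y = {a}" by blast
    \<comment> \<open>Stopping objects lie outside R, so a stream over R starts with a point of
      X.\<close>
    then have "letter_anchor (a 0) \<in> R" using 13 by (simp add: simps)
    then obtain x where x: "a 0 = Inr (Inl x)" using a(1) by (auto elim: streams_cases[of a R 0])
    note u = stream_unfold[OF a(1) x]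
    have "xact (stream_action R) x {\<lambda>n. a (Suc n)} = {stream_xact x (\<lambda>n. a (Suc n))}"
      by (rule simps(4)[OF u(1,2)]) (use u(3) in simp)
    then have "y = xact (stream_action R) x {\<lambda>n. a (Suc n)}" using a(2) u(4) by metis
    moreover have "ranchor X x = anchor (stream_action R) {\<lambda>n. a (Suc n)}" using simps(2)[OF u(1)] u(3) by simp
    ultimately show ?case using u(2) simps(1)[OF u(1)] by blast
  qed
qed

end

section \<open>Ultrafilters\<close>

definition ultra :: "'a set \<Rightarrow> 'a set set \<Rightarrow> bool" where
  "ultra S L \<longleftrightarrow> L \<subseteq> Pow S \<and> {} \<notin> L \<and> (\<forall>A\<in>L. \<forall>B\<in>L. A \<inter> B \<in> L) \<and>
    (\<forall>A\<in>L. \<forall>B. A \<subseteq> B \<longrightarrow> B \<subseteq> S \<longrightarrow> B \<in> L) \<and> (\<forall>A. A \<subseteq> S \<longrightarrow> A \<in> L \<or> S - A \<in> L)"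

lemma ultraD:
  assumes "ultra S L"
  shows "A \<in> L \<Longrightarrow> A \<subseteq> S" "{} \<notin> L" "\<lbrakk>A \<in> L; B \<in> L\<rbrakk> \<Longrightarrow> A \<inter> B \<in> L"
    "\<lbrakk>A \<in> L; A \<subseteq> B; B \<subseteq> S\<rbrakk> \<Longrightarrow> B \<in> L" "A \<subseteq> S \<Longrightarrow> A \<notin> L \<Longrightarrow> S - A \<in> L" "S \<in> L"
proof -
  show "A \<in> L \<Longrightarrow> A \<subseteq> S" "{} \<notin> L" "\<lbrakk>A \<in> L; B \<in> L\<rbrakk> \<Longrightarrow> A \<inter> B \<in> L"
    "\<lbrakk>A \<in> L; A \<subseteq> B; B \<subseteq> S\<rbrakk> \<Longrightarrow> B \<in> L" "A \<subseteq> S \<Longrightarrow> A \<notin> L \<Longrightarrow> S - A \<in> L"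
    using assms unfolding ultra_def by blast+
  have "{} \<in> L \<or> S - {} \<in> L" "{} \<notin> L" using assms unfolding ultra_def by blast+
  then show "S \<in> L" by simp
qed

lemma ultra_disjoint: "\<lbrakk>ultra S L; A \<in> L; B \<in> L; A \<inter> B = {}\<rbrakk> \<Longrightarrow> False"
  using ultraD(2,3) by metis

lemma ultra_Un:
  assumes "ultra S L" "A \<union> B \<in> L" shows "A \<in> L \<or> B \<in> L"
proof (rule ccontr)
  assume n: "\<not> (A \<in> L \<or> B \<in> L)"
  have "A \<subseteq> S" "B \<subseteq> S" using ultraD(1)[OF assms] by auto
  then have "(S - A) \<inter> (S - B) \<in> L" using n ultraD(3,5)[OF assms(1)] by blast
  moreover have "(S - A) \<inter> (S - B) \<inter> (A \<union> B) = {}" by blast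
  ultimately show False using ultra_disjoint[OF assms(1) _ assms(2)] by blast
qed

lemma ultra_Union:
  assumes "ultra S L" "finite F" "\<Union>F \<in> L" shows "\<exists>A\<in>F. A \<in> L"
  using assms(2,3)
proof (induction rule: finite_induct)
  case empty
  then show ?case using ultraD(2)[OF assms(1)] by simp
next
  case (insert A F)
  then show ?case using ultra_Un[OF assms(1), of A "\<Union>F"] by auto
qed

text \<open>Zorn gives a family that is maximal among those containing the given one without a
  finite subfamily covering S. Maximality makes it a maximal ideal of sets, and the sets outside it
  form the ultrafilter. It turns the failure of finite subcovers into an ultrafilter.\<close>

lemma ultra_avoiding_exists:
  assumes B: "\<B> \<subseteq> Pow S" and nc: "\<And>F. \<lbrakk>finite F; F \<subseteq> \<B>\<rbrakk> \<Longrightarrow> \<Union>F \<noteq> S"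
  obtains L where "ultra S L" "\<And>A. A \<in> \<B> \<Longrightarrow> S - A \<in> L"
proof -
  define P where "P = {I. \<B> \<subseteq> I \<and> I \<subseteq> Pow S \<and> (\<forall>F. finite F \<longrightarrow> F \<subseteq> I \<longrightarrow> \<Union>F \<noteq> S)}"
  have "\<exists>I\<in>P. \<forall>J\<in>P. I \<subseteq> J \<longrightarrow> J = I"
  proof (rule subset_Zorn_nonempty)
    show "P \<noteq> {}" using assms unfolding P_def by blast
    fix \<C> assume c: "\<C> \<noteq> {}" "subset.chain P \<C>"
    then have sub: "\<C> \<subseteq> P" by (simp add: subset_chain_def)
    have "\<Union>F \<noteq> S" if F: "finite F" "F \<subseteq> \<Union>\<C>" for F
    proof -
      obtain I where "I \<in> \<C>" "F \<subseteq> I" using finite_subset_Union_chain[OF F c] by blast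
      then show ?thesis using sub F(1) unfolding P_def by blast
    qed
    moreover obtain I where "I \<in> \<C>" using c(1) by blast
    then have "\<B> \<subseteq> I" using sub by (auto simp: P_def)
    then have "\<B> \<subseteq> \<Union>\<C>" using \<open>I \<in> \<C>\<close> by blast
    moreover have "\<Union>\<C> \<subseteq> Pow S" using sub by (auto simp: P_def)
    ultimately show "\<Union>\<C> \<in> P" unfolding P_def by blast
  qed
  then obtain I where I: "I \<in> P" "\<And>J. J \<in> P \<Longrightarrow> I \<subseteq> J \<Longrightarrow> J = I" by blast
  have IP: "\<B> \<subseteq> I" "I \<subseteq> Pow S" "\<And>F. finite F \<Longrightarrow> F \<subseteq> I \<Longrightarrow> \<Union>F \<noteq> S" using I(1) by (simp_all add: P_def)
  have max: "\<exists>F. finite F \<and> F \<subseteq> I \<and> A \<union> \<Union>F = S" if "A \<subseteq> S" "A \<notin> I" for A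
  proof -
    have "insert A I \<notin> P" using I(2)[of "insert A I"] that by blast
    moreover have "\<B> \<subseteq> insert A I" "insert A I \<subseteq> Pow S" using IP(1,2) that(1) by auto
    ultimately have "\<not> (\<forall>F. finite F \<longrightarrow> F \<subseteq> insert A I \<longrightarrow> \<Union>F \<noteq> S)" unfolding P_def by simp
    then obtain F where F: "finite F" "F \<subseteq> insert A I" "\<Union>F = S" by blast
    then have "A \<union> \<Union>(F - {A}) = S" using that by blast
    moreover have "F - {A} \<subseteq> I" "finite (F - {A})" using F by auto
    ultimately show ?thesis by blast
  qed
  define L where "L = {A. A \<subseteq> S \<and> A \<notin> I}"
  have "ultra S L"
    unfolding ultra_def
  proof (intro conjI ballI allI impI)
    show "L \<subseteq> Pow S" by (auto simp: L_def)
    have S: "S \<notin> I" using IP(3)[of "{S}"] by auto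
    have dn: "A \<in> I" if AB: "A \<subseteq> B" "B \<in> I" for A B
    proof (rule ccontr)
      assume "A \<notin> I"
      then obtain F where "finite F" "F \<subseteq> I" "A \<union> \<Union>F = S" using max[of A] AB IP(2) by blast
      then have "\<Union>(insert B F) = S" "insert B F \<subseteq> I" "finite (insert B F)" using AB IP(2) by auto
      then show False using IP(3) by blast
    qed
    show "{} \<notin> L"
    proof
      assume "{} \<in> L"
      then obtain F where "finite F" "F \<subseteq> I" "\<Union>F = S" using max[of "{}"] by (auto simp: L_def)
      then show False using IP(3) by blast
    qed
    fix A
    { fix B assume AB: "A \<in> L" "B \<in> L"
      show "A \<inter> B \<in> L"
      proof (rule ccontr)
        assume "A \<inter> B \<notin> L"
        then have i: "A \<inter> B \<in> I" using AB by (auto simp: L_def)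
        obtain F F' where F: "finite F" "F \<subseteq> I" "A \<union> \<Union>F = S" "finite F'" "F' \<subseteq> I" "B \<union> \<Union>F' = S"
          using max[of A] max[of B] AB by (auto simp: L_def)
        then have "\<Union>(insert (A \<inter> B) (F \<union> F')) = S" by blast
        then show False using IP(3)[of "insert (A \<inter> B) (F \<union> F')"] F i by auto
      qed }
    { fix B assume "A \<in> L" "A \<subseteq> B" "B \<subseteq> S"
      then show "B \<in> L" using dn by (auto simp: L_def) }
    { assume A: "A \<subseteq> S"
      show "A \<in> L \<or> S - A \<in> L"
      proof (rule ccontr)
        assume "\<not> (A \<in> L \<or> S - A \<in> L)"
        then have "{A, S - A} \<subseteq> I" using A by (auto simp: L_def)
        then show False using IP(3)[of "{A, S - A}"] A by auto
      qed }
  qed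
  moreover have "S - A \<in> L" if "A \<in> \<B>" for A
    using ultraD(5)[OF calculation, of A] that IP(1) B by (auto simp: L_def)
  ultimately show thesis using that by blast
qed

section \<open>Compactness of complete actions\<close>

context algebraic_action
begin

text \<open>The image of L under the anchor map converges to u.\<close>

definition over where "over L u \<longleftrightarrow> (\<forall>N. openin (obj G) N \<longrightarrow> u \<in> N \<longrightarrow> {y \<in> S. anchor A y \<in> N} \<in> L)"

text \<open>The first factors of the points in L converge to x, up to the action of G between the
  two factors.\<close>

definition near where "near L x \<longleftrightarrow> (\<forall>W. openin (spc X) W \<longrightarrow> x \<in> W \<longrightarrow> sact W S \<in> L)"

text \<open>The image of L under the partial map x y \<mapsto> y. This map is well defined only for
  first factors in a bisection, and the quantification over all neighbourhoods of x makes the result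
  independent of such a choice.\<close>

definition shift where
  "shift L x = {B. B \<subseteq> S \<and> (\<forall>W. openin (spc X) W \<longrightarrow> x \<in> W \<longrightarrow> sact W B \<in> L)}"

lemma sact_open_subset: "openin (spc X) W \<Longrightarrow> B \<subseteq> S \<Longrightarrow> sact W B \<subseteq> S"
  using sact_subset openin_subset by blast

text \<open>Intersections are handled inside a small bisection, where factors can be cancelled. For
  complements, W S lies in L by nearness and is the union of W A and W (S - A), so L chooses one of
  them.\<close>

lemma ultra_shift:
  assumes L: "ultra S L" and x: "x \<in> pts" "near L x"
  shows "ultra S (shift L x)"
  unfolding ultra_def
proof (intro conjI ballI allI impI)
  show "shift L x \<subseteq> Pow S" by (auto simp: shift_def)
  show "{} \<notin> shift L x"
    using x(1) ultraD(2)[OF L] openin_topspace[of "spc X"] unfolding shift_def by (force simp: sact_def)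
  have small: "\<exists>U. U \<in> corr_bisections G X \<and> x \<in> U \<and> U \<subseteq> W" if "openin (spc X) W" "x \<in> W" for W
    using corr_bisection_exists[OF that] by metis
  fix A'
  { fix B assume AB: "A' \<in> shift L x" "B \<in> shift L x"
    have "sact W (A' \<inter> B) \<in> L" if W: "openin (spc X) W" "x \<in> W" for W
    proof -
      obtain U where U: "U \<in> corr_bisections G X" "x \<in> U" "U \<subseteq> W" using small[OF W] by blast
      have o: "openin (spc X) U" using corr_bisectionD(1)[OF U(1)] .
      have S: "A' \<subseteq> S" "B \<subseteq> S" using AB by (auto simp: shift_def)
      have "sact U A' \<inter> sact U B \<in> L" using ultraD(3)[OF L] AB o U(2) unfolding shift_def by blast
      moreover have "sact U A' \<inter> sact U B \<subseteq> sact W (A' \<inter> B)"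
      proof
        fix k assume "k \<in> sact U A' \<inter> sact U B"
        then obtain v y v' y' where *: "v \<in> U" "y \<in> A'" "ranchor X v = anchor A y" "k = xact A v y"
          "v' \<in> U" "y' \<in> B" "ranchor X v' = anchor A y'" "k = xact A v' y'"
          unfolding sact_def by blast
        then have "v = v' \<and> y = y'" using S by (intro xact_bisection_cancel[OF U(1)]) auto
        then show "k \<in> sact W (A' \<inter> B)" unfolding sact_def using * U(3) by blast
      qed
      moreover have "sact W (A' \<inter> B) \<subseteq> S" by (rule sact_open_subset[OF W(1)]) (use S in blast)
      ultimately show ?thesis by (rule ultraD(4)[OF L])
    qed
    then show "A' \<inter> B \<in> shift L x" using AB by (auto simp: shift_def) }
  { fix B assume AB: "A' \<in> shift L x" "A' \<subseteq> B" "B \<subseteq> S"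
    have "sact W B \<in> L" if "openin (spc X) W" "x \<in> W" for W
      using ultraD(4)[OF L, of "sact W A'" "sact W B"] AB that sact_mono[OF order_refl AB(2)]
        sact_open_subset[OF that(1) AB(3)] by (simp add: shift_def)
    then show "B \<in> shift L x" using AB by (simp add: shift_def) }
  { assume A': "A' \<subseteq> S"
    show "A' \<in> shift L x \<or> S - A' \<in> shift L x"
    proof (rule ccontr)
      assume "\<not> (A' \<in> shift L x \<or> S - A' \<in> shift L x)"
      then obtain W W' where W: "openin (spc X) W" "x \<in> W" "sact W A' \<notin> L"
        "openin (spc X) W'" "x \<in> W'" "sact W' (S - A') \<notin> L" using A' unfolding shift_def by blast
      have o: "openin (spc X) (W \<inter> W')" "x \<in> W \<inter> W'" using W by auto
      then have "sact (W \<inter> W') S \<in> L" using x(2) by (simp add: near_def)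
      moreover have "sact (W \<inter> W') S = sact (W \<inter> W') A' \<union> sact (W \<inter> W') (S - A')"
        using A' unfolding sact_def by blast
      ultimately have "sact (W \<inter> W') A' \<in> L \<or> sact (W \<inter> W') (S - A') \<in> L" using ultra_Un[OF L] by metis
      moreover have "sact (W \<inter> W') A' \<subseteq> sact W A'" "sact (W \<inter> W') (S - A') \<subseteq> sact W' (S - A')"
        by (rule sact_mono; blast)+
      moreover have "sact W A' \<subseteq> S" "sact W' (S - A') \<subseteq> S"
        using sact_open_subset W A' by blast+
      ultimately show False using W(3,6) ultraD(4)[OF L] by blast
    qed }
qed

lemma over_shift:
  assumes L: "ultra S L" and x: "x \<in> pts" "near L x"
  shows "over (shift L x) (ranchor X x)"
  unfolding over_def
proof (intro allI impI)
  fix N assume N: "openin (obj G) N" "ranchor X x \<in> N"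
  have "sact W {y \<in> S. anchor A y \<in> N} \<in> L" if W: "openin (spc X) W" "x \<in> W" for W
  proof -
    have "openin (spc X) (W \<inter> {x \<in> pts. ranchor X x \<in> N})" "x \<in> W \<inter> {x \<in> pts. ranchor X x \<in> N}"
      using openin_ranchor_preimage[OF N(1)] W N x by auto
    then have "sact (W \<inter> {x \<in> pts. ranchor X x \<in> N}) S \<in> L" using x(2) unfolding near_def by blast
    moreover have "sact (W \<inter> {x \<in> pts. ranchor X x \<in> N}) S \<subseteq> sact W {y \<in> S. anchor A y \<in> N}"
    proof
      fix k assume "k \<in> sact (W \<inter> {x \<in> pts. ranchor X x \<in> N}) S"
      then obtain v y where "v \<in> W" "ranchor X v \<in> N" "y \<in> S" "ranchor X v = anchor A y" "k = xact A v y"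
        unfolding sact_def by blast
      moreover from this have "y \<in> {y \<in> S. anchor A y \<in> N}" by simp
      ultimately show "k \<in> sact W {y \<in> S. anchor A y \<in> N}" unfolding sact_def by blast
    qed
    ultimately show ?thesis using ultraD(4)[OF L] sact_open_subset[OF W(1), of "{y \<in> S. anchor A y \<in> N}"] by blast
  qed
  then show "{y \<in> S. anchor A y \<in> N} \<in> shift L x" by (auto simp: shift_def)
qed

text \<open>The admissible first letters of L: a chosen representative to which the first factors
  converge, or a stop outside R when L leaves every compact cone.\<close>

definition good where
  "good L l \<longleftrightarrow>
    (\<exists>x\<in>pts. l = Inr (Inl x) \<and> rep x = x \<and> over L (lanchor X x) \<and> near L x) \<or>
    (\<exists>u\<in>units G - R. l = Inl u \<and> over L u \<and> (\<forall>K. compactin XG K \<longrightarrow> orbit_cone K \<notin> L))"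

text \<open>If L contains the cone of a compact K but is near no representative, each representative
  has a neighbourhood W with W S outside L; finitely many of these cover the cone, a contradiction.
  If L contains no compact cone, then u lies outside R: for u in R, regularity makes the preimage in
  the orbit space of a compact neighbourhood of u compact, and by axiom (iii) its cone contains all
  points with anchor near u.\<close>

lemma good_exists:
  assumes reg: "regular_on G X R" and R: "openin (obj G) R"
    and L: "ultra S L" and u: "u \<in> units G" "over L u"
  shows "\<exists>l. good L l \<and> letter_anchor l = u"
proof (cases "\<exists>K. compactin XG K \<and> orbit_cone K \<in> L")
  case True
  then obtain K where K: "compactin XG K" "orbit_cone K \<in> L" by blast
  have "\<exists>x\<in>pts. rep x = x \<and> near L x"
  proof (rule ccontr)
    assume n: "\<not> (\<exists>x\<in>pts. rep x = x \<and> near L x)"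
    then have "\<forall>x\<in>pts. rep x = x \<longrightarrow> (\<exists>W. openin (spc X) W \<and> x \<in> W \<and> sact W S \<notin> L)"
      unfolding near_def by blast
    then obtain w where w: "\<And>x. x \<in> pts \<Longrightarrow> rep x = x \<Longrightarrow> openin (spc X) (w x) \<and> x \<in> w x \<and> sact (w x) S \<notin> L"
      by metis
    let ?P = "{x \<in> pts. rep x = x}"
    have "\<forall>U\<in>(\<lambda>x. orb ` w x) ` ?P. openin XG U" using w open_orbit unfolding open_map_def by auto
    moreover have "K \<subseteq> \<Union>((\<lambda>x. orb ` w x) ` ?P)"
    proof
      fix k assume "k \<in> K"
      then obtain x where x: "x \<in> pts" "k = orb x" using compactin_subset_topspace[OF K(1)] by auto
      then have "rep x \<in> ?P" "k = orb (rep x)" using rep rep_rep by auto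
      then show "k \<in> \<Union>((\<lambda>x. orb ` w x) ` ?P)" using w[of "rep x"] by blast
    qed
    ultimately obtain FF where FF: "finite FF" "FF \<subseteq> (\<lambda>x. orb ` w x) ` ?P" "K \<subseteq> \<Union>FF"
      using compactinD[OF K(1)] by meson
    obtain F where F: "F \<subseteq> ?P" "finite F" "FF = (\<lambda>x. orb ` w x) ` F"
      using finite_subset_image[OF FF(1,2)] by blast
    have "orbit_cone K \<subseteq> \<Union>((\<lambda>x. sact (w x) S) ` F)"
    proof
      fix k assume "k \<in> orbit_cone K"
      then obtain x y where x: "x \<in> pts" "orb x \<in> K" "y \<in> S" "ranchor X x = anchor A y" "k = xact A x y"
        unfolding orbit_cone_def by blast
      then obtain f v where f: "f \<in> F" "v \<in> w f" "orb x = orb v" using FF(3) F(3) by blast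
      have "v \<in> pts" using f F(1) w[of f] openin_subset by blast
      then obtain h where "act A h y \<in> S" "ranchor X v = anchor A (act A h y)" "xact A x y = xact A v (act A h y)"
        using xact_change[OF x(1) _ x(3,4) f(3)] by metis
      then have "k \<in> sact (w f) S" unfolding sact_def using f(2) x(5) by blast
      then show "k \<in> \<Union>((\<lambda>x. sact (w x) S) ` F)" using f(1) by blast
    qed
    moreover have "\<Union>((\<lambda>x. sact (w x) S) ` F) \<subseteq> S"
      using sact_open_subset w F(1) by blast
    ultimately have "\<Union>((\<lambda>x. sact (w x) S) ` F) \<in> L" using ultraD(4)[OF L K(2)] by blast
    then obtain x where "x \<in> F" "sact (w x) S \<in> L"
      using ultra_Union[OF L, of "(\<lambda>x. sact (w x) S) ` F"] F(2) by auto
    then show False using w F(1) by blast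
  qed
  then obtain x where x: "x \<in> pts" "rep x = x" "near L x" by blast
  have "lanchor X x = u"
  proof (rule ccontr)
    assume "lanchor X x \<noteq> u"
    then obtain N N' where N: "openin (obj G) N" "openin (obj G) N'" "lanchor X x \<in> N" "u \<in> N'" "N \<inter> N' = {}"
      using obj_separate[OF lanchor_units[OF x(1)] u(1)] by metis
    have "sact {x \<in> pts. lanchor X x \<in> N} S \<in> L"
      using x openin_lanchor_preimage[OF N(1)] N(3) unfolding near_def by blast
    moreover have "{y \<in> S. anchor A y \<in> N'} \<in> L" using u N unfolding over_def by blast
    moreover have "sact {x \<in> pts. lanchor X x \<in> N} S \<inter> {y \<in> S. anchor A y \<in> N'} = {}"
      using N(5) anchor_xact unfolding sact_def by fastforce
    ultimately show False using ultra_disjoint[OF L] by blast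
  qed
  then have "good L (Inr (Inl x)) \<and> letter_anchor (Inr (Inl x)) = u"
    using x u unfolding good_def by auto
  then show ?thesis by blast
next
  case False
  have "u \<notin> R"
  proof
    assume uR: "u \<in> R"
    have "neighbourhood_base_of (compactin (obj G)) (obj G)"
      using locally_compact_obj Hausdorff_obj locally_compact_space_neighbourhood_base by blast
    then obtain N C where NC: "openin (obj G) N" "compactin (obj G) C" "u \<in> N" "N \<subseteq> C" "C \<subseteq> R"
      using R uR unfolding neighbourhood_base_of by metis
    define P where "P = {C \<in> topspace XG. orbit_anchor X C \<in> R}"
    have p: "proper_map (subtopology XG P) (subtopology (obj G) R) (orbit_anchor X)"
      using reg unfolding regular_on_def P_def Let_def by blast
    have "compactin (subtopology (obj G) R) C" using NC by (simp add: compactin_subtopology)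
    from compactin_proper_map_preimage[OF p this]
    have K: "compactin XG {k \<in> topspace (subtopology XG P). orbit_anchor X k \<in> C}" (is "compactin XG ?K")
      by (simp add: compactin_subtopology)
    have "{y \<in> S. anchor A y \<in> N} \<subseteq> orbit_cone ?K"
    proof
      fix y assume y: "y \<in> {y \<in> S. anchor A y \<in> N}"
      then have "anchor A y \<in> R" using NC by blast
      then obtain x z where x: "x \<in> pts" "z \<in> S" "ranchor X x = anchor A z" "y = xact A x z"
        using covered[of y] y by blast
      then have "orbit_anchor X (orb x) \<in> C" "orbit_anchor X (orb x) \<in> R"
        using orbit_anchor_orb[OF x(1)] anchor_xact[OF x(1-3)] y NC by auto
      then have "orb x \<in> ?K" using x(1) by (simp add: P_def)
      from mem_orbit_coneI[OF x(1) this x(2,3)] show "y \<in> orbit_cone ?K" using x(4) by simp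
    qed
    moreover have "{y \<in> S. anchor A y \<in> N} \<in> L" using u(2) NC unfolding over_def by blast
    ultimately have "orbit_cone ?K \<in> L" using ultraD(4)[OF L] orbit_cone_subset by blast
    then show False using False K by blast
  qed
  then have "good L (Inl u) \<and> letter_anchor (Inl u) = u" using u False unfolding good_def by auto
  then show ?thesis by blast
qed

text \<open>The point \<open>w n\<close> is the intended limit of \<open>L n\<close>: unfolding
  \<open>w 0\<close> along the letters gives the successive \<open>w n\<close>. At a stop it must
  avoid the image of X, so that it lies outside every cone, as L does.\<close>

definition follows where
  "follows L a w \<longleftrightarrow> (\<forall>n. w n \<in> S \<and> anchor A (w n) = letter_anchor (a n) \<and>
    (case a n of Inr (Inl x) \<Rightarrow> ranchor X x = anchor A (w (Suc n)) \<and> w n = xact A x (w (Suc n))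
       \<and> L (Suc n) = shift (L n) x
     | _ \<Rightarrow> w n \<notin> sact pts S))"

lemma followsD:
  assumes "follows L a w"
  shows "w n \<in> S" "anchor A (w n) = letter_anchor (a n)"
    "a n = Inr (Inl x) \<Longrightarrow> ranchor X x = anchor A (w (Suc n)) \<and> w n = xact A x (w (Suc n)) \<and> L (Suc n) = shift (L n) x"
    "a n = Inl u \<Longrightarrow> w n \<notin> sact pts S"
  using assms[unfolded follows_def, THEN spec[of _ n]] by auto

lemma openin_lact_ract_preimage:
  assumes V: "V \<in> bisections G" and V': "V' \<in> bisections G" and W: "openin (spc X) W"
  shows "openin (spc X) {x \<in> pts. lanchor X x \<in> src G ` V \<and> ranchor X x \<in> src G ` V' \<and>
    ract X (lact X (ssec V (lanchor X x)) x) (invs G (ssec V' (ranchor X x))) \<in> W}"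
proof -
  define E where "E = {x \<in> pts. lanchor X x \<in> src G ` V} \<inter> {x \<in> pts. ranchor X x \<in> src G ` V'}"
  have E: "openin (spc X) E" unfolding E_def
    using openin_lanchor_preimage openin_ranchor_preimage bisectionD(5)[OF V] bisectionD(5)[OF V'] by blast
  have *: "continuous_map (subtopology (spc X) E) (spc X) (\<lambda>x. x)"
    by (simp add: continuous_map_from_subtopology)
  have s: "ssec V (lanchor X x) \<in> arrs \<and> src G (ssec V (lanchor X x)) = lanchor X x \<and>
    ssec V' (ranchor X x) \<in> arrs \<and> src G (ssec V' (ranchor X x)) = ranchor X x" if "x \<in> E" for x
    using that ssec[OF V, of "lanchor X x"] ssec[OF V', of "ranchor X x"] bisection_in[OF V] bisection_in[OF V']
    unfolding E_def by blast
  have Ep: "E \<subseteq> pts" by (auto simp: E_def)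
  have "continuous_map (subtopology (spc X) E) (spc X)
    (\<lambda>x. ract X (lact X (ssec V (lanchor X x)) x) (invs G (ssec V' (ranchor X x))))"
    by (intro cont_ract cont_lact cont_inv cont_ssec cont_lanchor cont_ranchor * V V')
      (use s Ep in \<open>auto simp: E_def rng_inv ranchor_lact\<close>)
  from openin_preimage_subtopology[OF this E W] show ?thesis
    unfolding E_def by (rule back_subst[of "openin (spc X)"]) auto
qed

text \<open>The translates by arrows g make the claim strong enough for the induction over cylinders.\<close>

lemma cylinder_in_ultra:
  assumes L: "\<And>n. ultra S (L n)" and gd: "\<And>n. good (L n) (a n)" and fo: "follows L a w"
    and B: "cylinder B"
  shows "\<lbrakk>openin (arr G) V; g \<in> V; src G g = anchor A (w n); act A g (w n) \<in> B\<rbrakk>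
    \<Longrightarrow> {z \<in> S. \<exists>v\<in>V. src G v = anchor A z \<and> act A v z \<in> B} \<in> L n"
  using B
proof (induction arbitrary: n g V rule: cylinder.induct)
  case (base U K)
  have g: "g \<in> arrs" using base.prems openin_subset by blast
  have w: "w n \<in> S" using fo unfolding follows_def by blast
  have r: "rng G g \<in> U" "act A g (w n) \<notin> orbit_cone K" using base.prems anchor_act[OF g w] by auto
  have over: "over (L n) (anchor A (w n))"
    using gd[of n] followsD(2)[OF fo, of n] unfolding good_def by auto
  \<comment> \<open>The claim asks for an arrow of V at each z. Convergence of the anchors under
    \<open>L n\<close> supplies one in the intersection of V and V'.\<close>
  have fin: "{z \<in> S. \<exists>v\<in>V. src G v = anchor A z \<and> act A v z \<in> {y \<in> S. anchor A y \<in> U \<and> y \<notin> orbit_cone K}} \<in> L n"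
    if V': "openin (arr G) V'" "g \<in> V'" and T: "T \<in> L n"
      and h: "\<forall>h\<in>V'. \<forall>z\<in>T. src G h = anchor A z \<longrightarrow> rng G h \<in> U \<and> act A h z \<notin> orbit_cone K" for V' T
  proof -
    have o: "openin (arr G) (V \<inter> V')" "g \<in> V \<inter> V'" using V' base.prems by auto
    then have "openin (obj G) (src G ` (V \<inter> V'))" using open_src unfolding open_map_def by blast
    moreover have "anchor A (w n) \<in> src G ` (V \<inter> V')" using o base.prems(3) by (metis image_eqI)
    ultimately have "{z \<in> S. anchor A z \<in> src G ` (V \<inter> V')} \<in> L n" using over unfolding over_def by blast
    then have m: "T \<inter> {z \<in> S. anchor A z \<in> src G ` (V \<inter> V')} \<in> L n" using ultraD(3)[OF L T] by blast
    show ?thesis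
    proof (rule ultraD(4)[OF L m])
      show "T \<inter> {z \<in> S. anchor A z \<in> src G ` (V \<inter> V')} \<subseteq>
        {z \<in> S. \<exists>v\<in>V. src G v = anchor A z \<and> act A v z \<in> {y \<in> S. anchor A y \<in> U \<and> y \<notin> orbit_cone K}}"
      proof
        fix z assume "z \<in> T \<inter> {z \<in> S. anchor A z \<in> src G ` (V \<inter> V')}"
        then obtain v where v: "z \<in> T" "z \<in> S" "v \<in> V" "v \<in> V'" "src G v = anchor A z" by auto
        have "v \<in> arrs" using v V' openin_subset by blast
        then have "act A v z \<in> S" "anchor A (act A v z) = rng G v" using v act_closed anchor_act by auto
        then show "z \<in> {z \<in> S. \<exists>v\<in>V. src G v = anchor A z \<and> act A v z \<in> {y \<in> S. anchor A y \<in> U \<and> y \<notin> orbit_cone K}}"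
          using h v by auto
      qed
    qed blast
  qed
  from gd[of n] show ?case unfolding good_def
  proof (elim disjE bexE conjE)
    fix x assume x: "x \<in> pts" "a n = Inr (Inl x)" "near (L n) x"
    then have "ranchor X x = anchor A (w (Suc n))" "w n = xact A x (w (Suc n))" "w (Suc n) \<in> S"
      using followsD(3)[OF fo x(2)] followsD(1)[OF fo] by auto
    then obtain V' W where "openin (arr G) V'" "openin (spc X) W" "g \<in> V'" "x \<in> W"
      "\<forall>h\<in>V'. \<forall>z\<in>sact W S. src G h = anchor A z \<longrightarrow> rng G h \<in> U \<and> act A h z \<notin> orbit_cone K"
      using act_base_nbhd_inside[OF base.hyps g w base.prems(3) r x(1), of "w (Suc n)"] by blast
    moreover from this have "sact W S \<in> L n" using x(3) unfolding near_def by blast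
    ultimately show ?thesis using fin by blast
  next
    fix u assume u: "a n = Inl u" "\<forall>K. compactin XG K \<longrightarrow> orbit_cone K \<notin> L n"
    then have "w n \<notin> sact pts S" using followsD(4)[OF fo] by blast
    then obtain V' C where "openin (arr G) V'" "compactin XG C" "g \<in> V'"
      "\<forall>h\<in>V'. \<forall>z\<in>S - orbit_cone C. src G h = anchor A z \<longrightarrow> rng G h \<in> U \<and> act A h z \<notin> orbit_cone K"
      using act_base_nbhd_outside[OF base.hyps g w base.prems(3) r] by blast
    moreover from this have "S - orbit_cone C \<in> L n" using u(2) ultraD(5)[OF L orbit_cone_subset] by blast
    ultimately show ?thesis using fin by blast
  qed
next
  case (step W B)
  have g: "g \<in> arrs" using step.prems openin_subset by blast
  have wn: "w n \<in> S" "w (Suc n) \<in> S" using fo unfolding follows_def by blast+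
  have BS: "B \<subseteq> S" using cylinder_subset step.hyps by blast
  obtain v b where v: "v \<in> W" "b \<in> B" "ranchor X v = anchor A b" "act A g (w n) = xact A v b"
    using step.prems(4) unfolding sact_def by blast
  have vt: "v \<in> pts" "b \<in> S" using v BS openin_subset[OF step.hyps(1)] by auto
  have lv: "lanchor X v = rng G g" using anchor_act[OF g wn(1) step.prems(3)] anchor_xact[OF vt v(3)] v(4) by simp
  have "w n = act A (invs G g) (xact A v b)" using act_inv_cancel[OF g wn(1) step.prems(3)] v(4) by simp
  also have "\<dots> = xact A (lact X (invs G g) v) b"
    using act_xact[of "invs G g" v b] g vt v lv by (simp add: inv_closed src_inv)
  finally have "w n \<in> sact pts S"
    unfolding sact_def using g vt v lv by (auto intro!: exI[of _ "lact X (invs G g) v"] exI[of _ b] simp: lact_closed inv_closed src_inv ranchor_lact)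
  \<comment> \<open>At a stop \<open>w n\<close> would lie outside the image of X, so the letter is
    a point x and the next ultrafilter is a shift.\<close>
  then obtain x where x: "x \<in> pts" "a n = Inr (Inl x)" "near (L n) x"
    using gd[of n] followsD(4)[OF fo, of n] unfolding good_def by blast
  then have f: "ranchor X x = anchor A (w (Suc n))" "w n = xact A x (w (Suc n))" "L (Suc n) = shift (L n) x"
    using followsD(3)[OF fo x(2)] by auto
  have lx: "src G g = lanchor X x" using step.prems(3) f anchor_xact[OF x(1) wn(2)] by simp
  have gx: "lact X g x \<in> pts" "ranchor X (lact X g x) = anchor A (w (Suc n))"
    using g x lx f by (auto simp: lact_closed ranchor_lact)
  have "xact A v b = xact A (lact X g x) (w (Suc n))"
    using v(4) f(2) act_xact[OF g x(1) wn(2) lx f(1)] by simp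
  then obtain h where h: "h \<in> arrs" "ranchor X v = rng G h" "src G h = anchor A (w (Suc n))"
    "lact X g x = ract X v h" "b = act A h (w (Suc n))"
    using xact_eq_iff[OF vt(1) gx(1) vt(2) wn(2) v(3) gx(2)] by blast
  obtain V1 where V1: "V1 \<in> bisections G" "g \<in> V1" "V1 \<subseteq> V" using bisection_exists[OF step.prems(1,2)] .
  obtain V2 where V2: "V2 \<in> bisections G" "h \<in> V2" using bisection_exists[OF openin_topspace h(1)] .
  \<comment> \<open>The induction hypothesis is applied one letter further, at the arrow h with b =
    h \<open>w (Suc n)\<close>. This is why the claim has to admit translates.\<close>
  define T where "T = {z \<in> S. \<exists>v\<in>V2. src G v = anchor A z \<and> act A v z \<in> B}"
  have "T \<in> L (Suc n)" unfolding T_def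
    using step.IH[OF bisectionD(1)[OF V2(1)] V2(2) h(3)] h(5) v(2) by simp
  \<comment> \<open>The points x' for which v1 x' inverse(v2) lies in W, with v1 and v2 chosen by
    the sections. For such x' and z' in T one has v1 (x' z') = (v1 x' inverse(v2)) (v2 z'), which
    lies in W B.\<close>
  define W1 where "W1 = {x \<in> pts. lanchor X x \<in> src G ` V1 \<and> ranchor X x \<in> src G ` V2 \<and>
    ract X (lact X (ssec V1 (lanchor X x)) x) (invs G (ssec V2 (ranchor X x))) \<in> W}"
  have W1: "openin (spc X) W1" unfolding W1_def by (rule openin_lact_ract_preimage[OF V1(1) V2(1) step.hyps(1)])
  have "ssec V1 (lanchor X x) = g" "ssec V2 (ranchor X x) = h"
    using ssec_eq[OF V1(1,2)] ssec_eq[OF V2] lx h f by auto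
  moreover have "ract X (lact X g x) (invs G h) = v" using ract_inv_cancel[OF vt(1) h(1,2)] h(4) by simp
  moreover have "lanchor X x \<in> src G ` V1" "ranchor X x \<in> src G ` V2"
    using lx V1(2) h(3) f(1) V2(2) by (metis image_eqI)+
  ultimately have "x \<in> W1" using x v by (simp add: W1_def)
  then have m: "sact W1 T \<in> L n" using \<open>T \<in> L (Suc n)\<close> f(3) W1 unfolding shift_def by blast
  show ?case
  proof (rule ultraD(4)[OF L m])
    show "sact W1 T \<subseteq> {z \<in> S. \<exists>v\<in>V. src G v = anchor A z \<and> act A v z \<in> sact W B}"
    proof
      fix z assume "z \<in> sact W1 T"
      then obtain x' z' where *: "x' \<in> W1" "z' \<in> T" "ranchor X x' = anchor A z'" "z = xact A x' z'"
        unfolding sact_def by blast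
      obtain v2 where v2: "v2 \<in> V2" "src G v2 = anchor A z'" "act A v2 z' \<in> B" "z' \<in> S"
        using *(2) unfolding T_def by blast
      define v1 where "v1 = ssec V1 (lanchor X x')"
      have v1: "v1 \<in> V1" "src G v1 = lanchor X x'" "x' \<in> pts"
        using *(1) ssec[OF V1(1), of "lanchor X x'"] by (auto simp: W1_def v1_def)
      have t: "v1 \<in> arrs" "v2 \<in> arrs" using v1 v2 bisection_in V1 V2 by blast+
      have "ssec V2 (ranchor X x') = v2" using ssec_eq[OF V2(1) v2(1)] v2(2) *(3) by simp
      then have k: "ract X (lact X v1 x') (invs G v2) \<in> W" using *(1) by (simp add: W1_def v1_def)
      define p where "p = ract X (lact X v1 x') (invs G v2)"
      have l: "lact X v1 x' \<in> pts" "ranchor X (lact X v1 x') = src G v2"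
        using t v1 v2 * by (auto simp: lact_closed ranchor_lact)
      have p: "p \<in> pts" "ranchor X p = rng G v2" "ract X p v2 = lact X v1 x'"
        using t l by (auto simp: p_def ract_closed inv_closed rng_inv ranchor_ract src_inv ract_inv_cancel')
      have "act A v1 z = xact A (lact X v1 x') z'" using act_xact[of v1 x' z'] t v1 v2 * by simp
      also have "\<dots> = xact A p (act A v2 z')" using xact_ract[OF p(1) t(2) v2(4) p(2) v2(2)] p(3) by simp
      finally have "act A v1 z = xact A p (act A v2 z')" .
      moreover have "ranchor X p = anchor A (act A v2 z')" using p anchor_act t v2 by simp
      ultimately have "act A v1 z \<in> sact W B" unfolding sact_def using k v2 by (auto simp: p_def)
      moreover have "z \<in> S" "src G v1 = anchor A z"
        using xact_closed[of x' z'] anchor_xact[of x' z'] v1 v2 * by auto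
      ultimately show "z \<in> {z \<in> S. \<exists>v\<in>V. src G v = anchor A z \<and> act A v z \<in> sact W B}"
        using v1 V1 by blast
    qed
  qed blast
qed

lemma openin_in_ultra:
  assumes L: "\<And>n. ultra S (L n)" and gd: "\<And>n. good (L n) (a n)" and fo: "follows L a w"
    and O: "openin cylinder_topology C" "w 0 \<in> C"
  shows "C \<in> L 0"
proof -
  have w: "w 0 \<in> S" using fo unfolding follows_def by blast
  have "generate_topology_on {B. cylinder B} C"
    using O(1) unfolding cylinder_topology_def by (rule openin_topology_generated_by)
  then have "C \<subseteq> S \<and> (w 0 \<in> C \<longrightarrow> C \<in> L 0)"
  proof (induction rule: generate_topology_on.induct)
    case (Int a b)
    then show ?case using ultraD(3)[OF L] by blast
  next
    case (UN K)
    then have "\<Union>K \<subseteq> S" by blast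
    moreover have "\<Union>K \<in> L 0" if "w 0 \<in> \<Union>K"
    proof -
      from that obtain k where "k \<in> K" "w 0 \<in> k" by blast
      then show ?thesis using UN.IH ultraD(4)[OF L _ _ \<open>\<Union>K \<subseteq> S\<close>] by blast
    qed
    ultimately show ?case by blast
  next
    case (Basis B)
    then have B: "cylinder B" by simp
    have "B \<in> L 0" if "w 0 \<in> B"
    proof -
      \<comment> \<open>With V the open set of units the translates disappear, and the set is
        contained in B itself.\<close>
      have "{z \<in> S. \<exists>v\<in>units G. src G v = anchor A z \<and> act A v z \<in> B} \<in> L 0"
        by (rule cylinder_in_ultra[OF L gd fo B openin_units])
          (use anchor_units[OF w] src_unit act_unit[OF w] that in auto)
      moreover have "{z \<in> S. \<exists>v\<in>units G. src G v = anchor A z \<and> act A v z \<in> B} \<subseteq> B"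
        using src_unit act_unit by auto
      ultimately show ?thesis using ultraD(4)[OF L] cylinder_subset[OF B] by blast
    qed
    then show ?case using cylinder_subset[OF B] by blast
  qed simp
  then show ?thesis using O by blast
qed

text \<open>Every stream is realised by a point together with its successive tails. The type
  argument names \<open>'m\<close>, which occurs in streams but not in the types of the
  locale.\<close>

definition complete :: "(nat \<Rightarrow> 'g + 'x + 'm) itself \<Rightarrow> bool" where
  "complete _ \<longleftrightarrow> (\<forall>a::nat \<Rightarrow> 'g + 'x + 'm. a \<in> streams R \<longrightarrow>
    (\<exists>w. \<forall>n. w n \<in> S \<and> anchor A (w n) = letter_anchor (a n) \<and>
      (case a n of Inr (Inl x) \<Rightarrow> ranchor X x = anchor A (w (Suc n)) \<and> w n = xact A x (w (Suc n))
       | _ \<Rightarrow> w n \<notin> sact pts S)))"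

text \<open>Dependent choice of pairs of an ultrafilter and a good letter for it. After a stop the
  pair is repeated forever, which matches the constant continuation of finite streams.\<close>

lemma run_exists:
  assumes reg: "regular_on G X R" and R: "openin (obj G) R"
    and L: "ultra S L0" "u \<in> units G" "over L0 u"
  obtains L a where "L 0 = L0" "\<And>n. ultra S (L n)" "\<And>n. good (L n) (a n)" "letter_anchor (a 0) = u"
    "(a :: nat \<Rightarrow> 'g + 'x + 'm) \<in> streams R" "\<And>n x. a n = Inr (Inl x) \<Longrightarrow> L (Suc n) = shift (L n) x"
proof -
  define P where "P n s \<longleftrightarrow> ultra S (fst s) \<and> good (fst s) (snd s) \<and>
    (n = 0 \<longrightarrow> fst s = L0 \<and> letter_anchor (snd s) = u)" for n :: nat and s :: "'y set set \<times> ('g + 'x + 'm)"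
  define Q where "Q n s s' \<longleftrightarrow> (case snd s of
      Inr (Inl x) \<Rightarrow> fst s' = shift (fst s) x \<and> letter_anchor (snd s') = ranchor X x
    | _ \<Rightarrow> s' = s)" for n :: nat and s s' :: "'y set set \<times> ('g + 'x + 'm)"
  obtain l0 :: "'g + 'x + 'm" where l0: "good L0 l0" "letter_anchor l0 = u"
    using good_exists[OF reg R L] by blast
  have "\<exists>f. \<forall>n. P n (f n) \<and> Q n (f n) (f (Suc n))"
  proof (rule dependent_nat_choice)
    show "\<exists>s. P 0 s" using L l0 by (intro exI[of _ "(L0, l0)"]) (simp add: P_def)
    fix s n assume s: "P n s"
    then have us: "ultra S (fst s)" by (simp add: P_def)
    from s have "good (fst s) (snd s)" by (simp add: P_def)
    then show "\<exists>s'. P (Suc n) s' \<and> Q n s s'"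
      unfolding good_def
    proof (elim disjE bexE conjE)
      fix x assume x: "x \<in> pts" "snd s = Inr (Inl x)" "near (fst s) x"
      obtain l :: "'g + 'x + 'm" where "good (shift (fst s) x) l" "letter_anchor l = ranchor X x"
        using good_exists[OF reg R ultra_shift[OF us x(1,3)] ranchor_units[OF x(1)] over_shift[OF us x(1,3)]] by blast
      then have "P (Suc n) (shift (fst s) x, l) \<and> Q n s (shift (fst s) x, l)"
        using ultra_shift[OF us x(1,3)] x(2) by (simp add: P_def Q_def)
      then show ?thesis by blast
    next
      fix u assume "snd s = Inl u"
      then have "P (Suc n) s \<and> Q n s s" using s by (simp add: P_def Q_def)
      then show ?thesis by blast
    qed
  qed
  then obtain f where f: "\<And>n. P n (f n)" "\<And>n. Q n (f n) (f (Suc n))" by blast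
  define L where "L n = fst (f n)" for n
  define a where "a n = snd (f n)" for n
  have g: "good (L n) (a n)" for n using f(1)[of n] by (simp add: P_def L_def a_def)
  have "a \<in> streams R"
    unfolding streams_def
  proof (intro CollectI allI)
    fix n
    from g[of n] show "(\<exists>x\<in>pts. a n = Inr (Inl x) \<and> rep x = x \<and> ranchor X x = letter_anchor (a (Suc n))) \<or>
      (\<exists>u\<in>units G - R. a n = Inl u \<and> a (Suc n) = Inl u)"
      unfolding good_def
    proof (elim disjE bexE conjE)
      fix x assume "x \<in> pts" "a n = Inr (Inl x)" "rep x = x"
      then show ?thesis using f(2)[of n] by (simp add: Q_def a_def)
    next
      fix u assume "u \<in> units G - R" "a n = Inl u"
      then show ?thesis using f(2)[of n] by (simp add: Q_def a_def)
    qed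
  qed
  moreover have "L (Suc n) = shift (L n) x" if "a n = Inr (Inl x)" for n x
    using f(2)[of n] that by (simp add: Q_def a_def L_def)
  moreover have "L 0 = L0" "letter_anchor (a 0) = u" "ultra S (L n)" for n
    using f(1)[of 0] f(1)[of n] by (simp_all add: P_def L_def a_def)
  ultimately show thesis using that g by blast
qed

text \<open>Closedness of the anchor map and compactness of its fibres are two instances of this one
  statement. If it fails, some ultrafilter over u contains the complement of every member of the
  cover, but completeness provides a limit in the fibre of u and hence in some member.\<close>

lemma fibre_nbhd_cover:
  assumes reg: "regular_on G X R" and R: "openin (obj G) R"
    and co: "complete TYPE(nat \<Rightarrow> 'g + 'x + 'm)"
    and u: "u \<in> units G" and \<C>: "\<And>C. C \<in> \<C> \<Longrightarrow> openin cylinder_topology C" "{y \<in> S. anchor A y = u} \<subseteq> \<Union>\<C>"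
  obtains N F where "openin (obj G) N" "u \<in> N" "finite F" "F \<subseteq> \<C>" "{y \<in> S. anchor A y \<in> N} \<subseteq> \<Union>F"
proof (rule ccontr)
  assume "\<not> thesis"
  then have neg: "\<not> (\<exists>N F. openin (obj G) N \<and> u \<in> N \<and> finite F \<and> F \<subseteq> \<C> \<and> {y \<in> S. anchor A y \<in> N} \<subseteq> \<Union>F)"
    using that by blast
  \<comment> \<open>Adding the points with anchor outside a neighbourhood of u forces the
    ultrafilter that avoids this family to lie over u.\<close>
  define \<B> where "\<B> = \<C> \<union> {{y \<in> S. anchor A y \<notin> N} | N. openin (obj G) N \<and> u \<in> N}"
  have CS: "C \<subseteq> S" if "C \<in> \<C>" for C using openin_subset[OF \<C>(1)[OF that]] by simp
  obtain L0 where L0: "ultra S L0" "\<And>A. A \<in> \<B> \<Longrightarrow> S - A \<in> L0"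
  proof (rule ultra_avoiding_exists)
    show "\<B> \<subseteq> Pow S" using CS by (auto simp: \<B>_def)
    fix F assume F: "finite F" "F \<subseteq> \<B>"
    show "\<Union>F \<noteq> S"
    proof
      assume FS: "\<Union>F = S"
      define n where "n B = (SOME N. openin (obj G) N \<and> u \<in> N \<and> B = {y \<in> S. anchor A y \<notin> N})" for B
      have n: "openin (obj G) (n B) \<and> u \<in> n B \<and> B = {y \<in> S. anchor A y \<notin> n B}" if "B \<in> F - \<C>" for B
        unfolding n_def by (rule someI_ex) (use that F(2) in \<open>auto simp: \<B>_def\<close>)
      \<comment> \<open>The factor \<open>units G\<close> makes N the whole object space, not the
        universe of the type, when F contains only members of the cover.\<close>
      define N where "N = units G \<inter> \<Inter>(n ` (F - \<C>))"
      have N: "openin (obj G) N"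
      proof (cases "F - \<C> = {}")
        case True
        then show ?thesis unfolding N_def True using openin_topspace[of "obj G"] by simp
      next
        case False
        then show ?thesis using F(1) n openin_topspace[of "obj G"]
          unfolding N_def by (intro openin_Int openin_Inter) auto
      qed
      moreover have "u \<in> N" using u n by (auto simp: N_def)
      moreover have "{y \<in> S. anchor A y \<in> N} \<subseteq> \<Union>(F \<inter> \<C>)"
      proof
        fix y assume y: "y \<in> {y \<in> S. anchor A y \<in> N}"
        then obtain B where B: "B \<in> F" "y \<in> B" using FS by blast
        have "B \<in> \<C>"
        proof (rule ccontr)
          assume "B \<notin> \<C>"
          then have "B \<in> F - \<C>" using B by blast
          then show False using n[of B] B y unfolding N_def by blast
        qed
        then show "y \<in> \<Union>(F \<inter> \<C>)" using B by blast
      qed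
      moreover have "finite (F \<inter> \<C>)" "F \<inter> \<C> \<subseteq> \<C>" using F(1) by auto
      ultimately show False using neg by blast
    qed
  qed blast
  have over: "over L0 u"
    unfolding over_def
  proof (intro allI impI)
    fix N assume "openin (obj G) N" "u \<in> N"
    then have "S - {y \<in> S. anchor A y \<notin> N} \<in> L0" using L0(2) by (auto simp: \<B>_def)
    moreover have "S - {y \<in> S. anchor A y \<notin> N} = {y \<in> S. anchor A y \<in> N}" by blast
    ultimately show "{y \<in> S. anchor A y \<in> N} \<in> L0" by simp
  qed
  obtain L and a :: "nat \<Rightarrow> 'g + 'x + 'm" where La: "L 0 = L0" "\<And>n. ultra S (L n)" "\<And>n. good (L n) (a n)"
    "letter_anchor (a 0) = u" "a \<in> streams R" "\<And>n x. a n = Inr (Inl x) \<Longrightarrow> L (Suc n) = shift (L n) x"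
    using run_exists[OF reg R L0(1) u over] by blast
  obtain w where w: "\<And>n. w n \<in> S \<and> anchor A (w n) = letter_anchor (a n) \<and>
      (case a n of Inr (Inl x) \<Rightarrow> ranchor X x = anchor A (w (Suc n)) \<and> w n = xact A x (w (Suc n))
       | _ \<Rightarrow> w n \<notin> sact pts S)"
    using co La(5) unfolding complete_def by blast
  have fo: "follows L a w"
    unfolding follows_def
  proof (intro allI)
    fix n
    show "w n \<in> S \<and> anchor A (w n) = letter_anchor (a n) \<and>
      (case a n of Inr (Inl x) \<Rightarrow> ranchor X x = anchor A (w (Suc n)) \<and> w n = xact A x (w (Suc n)) \<and> L (Suc n) = shift (L n) x
       | _ \<Rightarrow> w n \<notin> sact pts S)"
      using w[of n] La(6)[of n] by (auto split: sum.splits)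
  qed
  have "w 0 \<in> {y \<in> S. anchor A y = u}" using w[of 0] La(4) by simp
  then obtain C where C: "C \<in> \<C>" "w 0 \<in> C" using \<C>(2) by blast
  have "C \<in> L0" using openin_in_ultra[OF La(2,3) fo \<C>(1)[OF C(1)] C(2)] La(1) by simp
  moreover have "S - C \<in> L0" using L0(2) C(1) by (simp add: \<B>_def)
  moreover have "C \<inter> (S - C) = {}" by blast
  ultimately show False using ultra_disjoint[OF L0(1)] by blast
qed

theorem proper_anchor:
  assumes reg: "regular_on G X R" and R: "openin (obj G) R"
    and co: "complete TYPE(nat \<Rightarrow> 'g + 'x + 'm)"
  shows "proper_map cylinder_topology (obj G) (anchor A)"
  unfolding proper_map_def
proof (intro conjI ballI)
  show "closed_map cylinder_topology (obj G) (anchor A)"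
    unfolding closed_map_def
  proof (intro allI impI)
    fix C assume C: "closedin cylinder_topology C"
    then have CS: "C \<subseteq> S" using closedin_subset by fastforce
    have o: "openin cylinder_topology (S - C)" using C unfolding closedin_def by simp
    have "openin (obj G) (units G - anchor A ` C)"
    proof (subst openin_subopen, intro ballI)
      fix u assume u: "u \<in> units G - anchor A ` C"
      \<comment> \<open>If u is not an anchor of a point of C, the single open set S - C covers the
        fibre of u, so it contains all points with anchor near u.\<close>
      obtain N F where N: "openin (obj G) N" "u \<in> N" "F \<subseteq> {S - C}" "{y \<in> S. anchor A y \<in> N} \<subseteq> \<Union>F"
        by (rule fibre_nbhd_cover[OF reg R co, of u "{S - C}"]) (use u o in auto)
      then have "N \<inter> anchor A ` C = {}" using CS by blast
      then show "\<exists>T. openin (obj G) T \<and> u \<in> T \<and> T \<subseteq> units G - anchor A ` C"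
        using N openin_subset[OF N(1)] by (intro exI[of _ N]) auto
    qed
    moreover have "anchor A ` C \<subseteq> units G" using CS anchor_units by blast
    ultimately show "closedin (obj G) (anchor A ` C)" unfolding closedin_def by simp
  qed
  fix u assume u: "u \<in> topspace (obj G)"
  show "compactin cylinder_topology {x \<in> topspace cylinder_topology. anchor A x = u}"
    unfolding compactin_def
  proof (intro conjI allI impI)
    fix \<U> assume \<U>: "Ball \<U> (openin cylinder_topology) \<and> {x \<in> topspace cylinder_topology. anchor A x = u} \<subseteq> \<Union>\<U>"
    obtain N F where "u \<in> N" "finite F" "F \<subseteq> \<U>" "{y \<in> S. anchor A y \<in> N} \<subseteq> \<Union>F"
      by (rule fibre_nbhd_cover[OF reg R co, of u \<U>]) (use u \<U> in auto)
    then show "\<exists>\<F>. finite \<F> \<and> \<F> \<subseteq> \<U> \<and> {x \<in> topspace cylinder_topology. anchor A x = u} \<subseteq> \<Union>\<F>"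
      by (intro exI[of _ F]) auto
  qed auto
qed

end

section \<open>The object space of the groupoid model\<close>

lemma proper_map_cong:
  assumes "proper_map X Y f" "\<And>x. x \<in> topspace X \<Longrightarrow> f x = g x"
  shows "proper_map X Y g"
proof -
  have "{x \<in> topspace X. f x = y} = {x \<in> topspace X. g x = y}" for y using assms(2) by auto
  moreover have "f ` U = g ` U" if "U \<subseteq> topspace X" for U using that assms(2) by (intro image_cong) auto
  ultimately show ?thesis
    using assms(1) closedin_subset unfolding proper_map_def closed_map_def by metis
qed

locale universal_model = correspondence_setting G X + M: etale_groupoid M
  for G :: "'g groupoid" and X :: "('g, 'x) correspondence" and M :: "'m groupoid" +
  fixes R :: "'g set"
    and \<Psi> :: "('g, 'x, 'm) universe topology \<Rightarrow>
      ('g, 'x, ('g, 'x, 'm) universe) corr_action \<Rightarrow> ('m, ('g, 'x, 'm) universe) action"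
  assumes bij: "model_bijection G X R M \<Psi>" and nat: "model_natural G X R M \<Psi> \<Psi>"
    and R: "openin (obj G) R" and inv: "invariant G R" and reg: "regular_on G X R"
begin

text \<open>Moves objects of M into the point type at which \<open>\<Psi>\<close> is available, as
  constant sequences in the summand reserved for them.\<close>

definition embed :: "'m \<Rightarrow> ('g, 'x, 'm) universe" where
  "embed m = {\<lambda>n. Inr (Inr m)}"

text \<open>As \<open>embed\<close> is injective, this quotient topology is a homeomorphic copy of
  the object space of M.\<close>

definition Omega where "Omega = quotient_topology (obj M) embed"

definition proj where "proj = inv_into (units M) embed"

text \<open>The canonical action of M on its objects, in which m moves its source to its
  range.\<close>

definition unit_action :: "('m, ('g, 'x, 'm) universe) action" where
  "unit_action = \<lparr>anchor = restrict proj (topspace Omega),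
    act = (\<lambda>m y. if m \<in> topspace (arr M) \<and> y \<in> topspace Omega \<and> src M m = proj y
      then embed (rng M m) else undefined)\<rparr>"

lemma inj_embed: "inj embed"
  by (auto simp: inj_def embed_def fun_eq_iff)

lemma topspace_Omega: "topspace Omega = embed ` units M"
  by (simp add: Omega_def)

lemma proj_embed: "u \<in> units M \<Longrightarrow> proj (embed u) = u"
  unfolding proj_def by (rule inv_into_f_f) (use inj_embed in \<open>auto intro: inj_on_subset\<close>)

lemma embed_proj: "y \<in> topspace Omega \<Longrightarrow> embed (proj y) = y \<and> proj y \<in> units M"
  using proj_embed by (auto simp: topspace_Omega)

lemma continuous_embed: "continuous_map (obj M) Omega embed"
  unfolding Omega_def using quotient_map_quotient_topology quotient_imp_continuous_map by blast

lemma openin_Omega_image: "openin (obj M) U \<Longrightarrow> openin Omega (embed ` U)"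
proof -
  assume U: "openin (obj M) U"
  then have Us: "U \<subseteq> units M" using openin_subset by fastforce
  have "{x \<in> topspace (obj M). embed x \<in> embed ` U} = U"
    using Us inj_embed by (auto dest: injD)
  then show ?thesis unfolding Omega_def openin_quotient_topology using U Us by auto
qed

lemma homeomorphic_embed: "homeomorphic_map (obj M) Omega embed"
proof (rule bijective_open_imp_homeomorphic_map[OF continuous_embed])
  show "open_map (obj M) Omega embed" unfolding open_map_def using openin_Omega_image by blast
qed (use inj_embed in \<open>auto simp: topspace_Omega intro: inj_on_subset\<close>)

lemma continuous_proj: "continuous_map Omega (obj M) proj"
  unfolding continuous_map
proof (intro conjI allI impI)
  show "proj ` topspace Omega \<subseteq> topspace (obj M)" using embed_proj by auto
  fix U assume U: "openin (obj M) U"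
  then have "U \<subseteq> units M" using openin_subset by fastforce
  then have "{y \<in> topspace Omega. proj y \<in> U} = embed ` U"
    using proj_embed by (auto simp: topspace_Omega subset_iff)
  then show "openin Omega {y \<in> topspace Omega. proj y \<in> U}" using openin_Omega_image[OF U] by simp
qed

lemma unit_action_simps:
  "y \<in> topspace Omega \<Longrightarrow> anchor unit_action y = proj y"
  "\<lbrakk>m \<in> topspace (arr M); y \<in> topspace Omega; src M m = proj y\<rbrakk> \<Longrightarrow> act unit_action m y = embed (rng M m)"
  by (simp_all add: unit_action_def)

lemma embed_Omega: "u \<in> units M \<Longrightarrow> embed u \<in> topspace Omega"
  by (simp add: topspace_Omega)

lemma groupoid_action_unit_action: "groupoid_action M Omega unit_action"
proof -
  let ?D = "subtopology (prod_topology (arr M) Omega) {(g, y). src M g = anchor unit_action y}"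
  have a: "continuous_map Omega (obj M) (anchor unit_action)"
    by (rule continuous_map_eq[OF continuous_proj]) (simp add: unit_action_simps)
  have "continuous_map ?D (obj M) (\<lambda>z. rng M (fst z))"
    by (rule M.cont_rng) (simp add: continuous_map_from_subtopology continuous_map_fst)
  from continuous_map_compose[OF this continuous_embed]
  have "continuous_map ?D Omega (\<lambda>(g, y). act unit_action g y)"
    by (rule continuous_map_eq) (auto simp: unit_action_simps)
  with a show ?thesis
    unfolding groupoid_action_def
  proof (intro conjI ballI impI)
    show "anchor unit_action \<in> extensional (topspace Omega)" by (simp add: unit_action_def)
    show "(\<lambda>(g, y). act unit_action g y) \<in> extensional
      {(g, y). g \<in> topspace (arr M) \<and> y \<in> topspace Omega \<and> src M g = anchor unit_action y}"
      by (auto simp: unit_action_def extensional_def)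
  next
    fix y assume y: "y \<in> topspace Omega"
    then show "act unit_action (anchor unit_action y) y = y"
      using embed_proj[OF y] M.unit_closed M.src_unit M.rng_unit by (simp add: unit_action_simps)
  next
    fix g y assume *: "g \<in> topspace (arr M)" "y \<in> topspace Omega" "src M g = anchor unit_action y"
    then show "anchor unit_action (act unit_action g y) = rng M g"
      by (simp add: unit_action_simps proj_embed embed_Omega M.rng_units)
  next
    fix g h y assume "g \<in> topspace (arr M)" "h \<in> topspace (arr M)" "y \<in> topspace Omega"
      "src M g = rng M h" "src M h = anchor unit_action y"
    then show "act unit_action (mult M g h) y = act unit_action g (act unit_action h y)"
      by (simp add: unit_action_simps proj_embed embed_Omega M.rng_units M.mult_closed M.src_mult M.rng_mult)
  qed
qed

definition universal_action where "universal_action = corr_action_of G X R \<Psi> Omega unit_action"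

lemma universal_action:
  "correspondence_action G X R Omega universal_action" "\<Psi> Omega universal_action = unit_action"
proof -
  have b: "bij_betw (\<Psi> Omega) {A. correspondence_action G X R Omega A} {B. groupoid_action M Omega B}"
    using bij unfolding model_bijection_def by blast
  show "\<Psi> Omega universal_action = unit_action"
    unfolding universal_action_def corr_action_of_def
    using f_the_inv_into_f_bij_betw[OF b] groupoid_action_unit_action by blast
  show "correspondence_action G X R Omega universal_action"
    unfolding universal_action_def corr_action_of_def
    using bij_betwE[OF bij_betw_the_inv_into[OF b]] groupoid_action_unit_action by blast
qed

text \<open>The object space of M is the terminal space with an action of M.\<close>

lemma equivariant_to_Omega:
  assumes B: "groupoid_action M Y B"
  shows "continuous_map Y Omega (\<lambda>y. embed (anchor B y))"
    "equivariant M Y B unit_action (\<lambda>y. embed (anchor B y))"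
proof -
  have c: "continuous_map Y (obj M) (anchor B)" using B unfolding groupoid_action_def by blast
  show "continuous_map Y Omega (\<lambda>y. embed (anchor B y))"
    using continuous_map_compose[OF c continuous_embed] by (simp add: o_def)
  have u: "anchor B y \<in> units M" if "y \<in> topspace Y" for y
    using continuous_map_image_subset_topspace[OF c] that by auto
  show "equivariant M Y B unit_action (\<lambda>y. embed (anchor B y))"
    unfolding equivariant_def
    using u B by (auto simp: unit_action_simps proj_embed embed_Omega groupoid_action_def)
qed

section \<open>Classifying maps and the topology of the object space\<close>

sublocale U: topological_action G X R Omega universal_action
  by unfold_locales (rule universal_action)

definition classify where "classify Y A y = embed (anchor (\<Psi> Y A) y)"

lemma classify:
  assumes A: "correspondence_action G X R Y A"
  shows "continuous_map Y Omega (classify Y A)" "corr_equivariant G X Y Omega A universal_action (classify Y A)"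
proof -
  have B: "groupoid_action M Y (\<Psi> Y A)" using bij A unfolding model_bijection_def by (meson bij_betwE mem_Collect_eq)
  show c: "continuous_map Y Omega (classify Y A)"
    using equivariant_to_Omega(1)[OF B] unfolding classify_def[abs_def] .
  show "corr_equivariant G X Y Omega A universal_action (classify Y A)"
    using nat[unfolded model_natural_def, rule_format, OF A universal_action(1) c]
      equivariant_to_Omega(2)[OF B] universal_action(2) unfolding classify_def[abs_def] by simp
qed

text \<open>Equivariance for M preserves anchors, and on the object space the anchor map is
  injective. This is the uniqueness half of terminality.\<close>

lemma self_map_id:
  assumes "continuous_map Omega Omega f" "corr_equivariant G X Omega Omega universal_action universal_action f"
    and y: "y \<in> topspace Omega"
  shows "f y = y"
proof -
  have "equivariant M Omega unit_action unit_action f"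
    using nat[unfolded model_natural_def, rule_format, OF universal_action(1) universal_action(1) assms(1)]
      assms(2) universal_action(2) by simp
  then have "anchor unit_action (f y) = anchor unit_action y" using y unfolding equivariant_def by blast
  moreover have "f y \<in> topspace Omega" using continuous_map_image_subset_topspace[OF assms(1)] y by blast
  ultimately have "proj (f y) = proj y" using y by (simp add: unit_action_simps)
  then show ?thesis using embed_proj y \<open>f y \<in> topspace Omega\<close> by metis
qed

text \<open>Terminality forces the topology to be the cylinder topology: the identity from the
  cylinder topology must be the classifying map, which is continuous.\<close>

lemma openin_Omega_cylinder:
  assumes "openin Omega V" shows "openin U.cylinder_topology V"
proof -
  let ?f = "classify U.cylinder_topology universal_action"
  note A = U.correspondence_action_cylinder
  have "continuous_map Omega U.cylinder_topology (\<lambda>y. y)"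
    by (rule U.continuous_map_cylinder)
      (use U.openin_if_cylinder U.cylinder_subset in \<open>auto simp: Collect_conj_eq Int_absorb1\<close>)
  from continuous_map_compose[OF this classify(1)[OF A]]
  have c: "continuous_map Omega Omega ?f" by (simp add: o_def)
  have "corr_equivariant G X Omega Omega universal_action universal_action ?f"
    using classify(2)[OF A] unfolding corr_equivariant_def equivariant_def xact_image_def by simp
  then have id: "?f y = y" if "y \<in> topspace Omega" for y using self_map_id[OF c _ that] by blast
  have "openin U.cylinder_topology {y \<in> topspace U.cylinder_topology. ?f y \<in> V}"
    using openin_continuous_map_preimage[OF classify(1)[OF A] assms] .
  also have "{y \<in> topspace U.cylinder_topology. ?f y \<in> V} = V"
    using id openin_subset[OF assms] by auto
  finally show ?thesis .
qed

text \<open>The classifying map of the stream action sends the tails of a stream to the required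
  points. That a stopped tail avoids the image of X is the preimage clause of equivariance.\<close>

lemma universal_complete: "U.complete TYPE(nat \<Rightarrow> 'g + 'x + 'm)"
  unfolding U.complete_def
proof (intro allI impI)
  fix a :: "nat \<Rightarrow> 'g + 'x + 'm" assume a: "a \<in> streams R"
  interpret S: algebraic_action G X R "stream_points R :: ('g, 'x, 'm) universe set" "stream_action R"
    by (rule algebraic_stream_action[OF inv])
  let ?f = "classify S.cylinder_topology (stream_action R)"
  note A = S.correspondence_action_cylinder
  note c = classify(1)[OF A] and e = classify(2)[OF A]
  define t where "t n = (\<lambda>k. a (n + k))" for n
  have t: "t n \<in> streams R" for n using a unfolding t_def streams_def by simp
  have tS: "{t n} \<in> stream_points R" for n using stream_action_simps(1)[OF t] .
  have ts: "(\<lambda>k. t n (Suc k)) = t (Suc n)" for n by (simp add: t_def)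
  have t0: "t n 0 = a n" for n by (simp add: t_def)
  define w where "w n = ?f {t n}" for n
  have w1: "w n \<in> topspace Omega" for n
    using continuous_map_image_subset_topspace[OF c] tS[of n] by (auto simp: w_def)
  have anc: "anchor universal_action (w n) = letter_anchor (a n)" for n
    using e tS[of n] stream_action_simps(2)[OF t, of n] t0
    unfolding corr_equivariant_def equivariant_def w_def by simp
  have pt: "ranchor X x = anchor universal_action (w (Suc n)) \<and> w n = xact universal_action x (w (Suc n))"
    if x: "a n = Inr (Inl x)" for n x
  proof -
    have "t n 0 = Inr (Inl x)" using x t0 by simp
    note u = stream_unfold[OF t[of n] this, unfolded ts]
    have r: "ranchor X x = letter_anchor (t (Suc n) 0)" using u(3) by (simp add: t_def)
    have "xact (stream_action R) x {t (Suc n)} = {t n}"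
      using stream_action_simps(4)[OF t u(2) r] u(4) by simp
    moreover have "ranchor X x = anchor (stream_action R) {t (Suc n)}"
      using r stream_action_simps(2)[OF t] by simp
    moreover have "\<forall>x\<in>pts. \<forall>y\<in>stream_points R. ranchor X x = anchor (stream_action R) y \<longrightarrow>
        ?f (xact (stream_action R) x y) = xact universal_action x (?f y)"
      using e unfolding corr_equivariant_def S.topspace_cylinder by blast
    ultimately have "w n = xact universal_action x (w (Suc n))"
      using u(2) tS[of "Suc n"] unfolding w_def by metis
    then show ?thesis using r anc[of "Suc n"] t0 by simp
  qed
  have stop: "w n \<notin> U.sact pts (topspace Omega)" if u: "a n = Inl u" for n u
  proof
    assume "w n \<in> U.sact pts (topspace Omega)"
    then have "{t n} \<in> {y \<in> topspace S.cylinder_topology. ?f y \<in> xact_image X Omega universal_action}"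
      using tS[of n] by (simp add: U.xact_image_eq w_def)
    then have "{t n} \<in> xact_image X S.cylinder_topology (stream_action R)"
      using e unfolding corr_equivariant_def by blast
    then obtain x y where x: "x \<in> pts" "y \<in> stream_points R" "ranchor X x = anchor (stream_action R) y"
      "{t n} = xact (stream_action R) x y"
      unfolding xact_image_def by auto
    then obtain b where b: "b \<in> streams R" "y = {b}" unfolding stream_points_def by blast
    then have "ranchor X x = letter_anchor (b 0)" using x(3) stream_action_simps(2) by metis
    then have "{t n} = {stream_xact x b}" using x(4) b stream_action_simps(4)[OF b(1) x(1)] by simp
    then have "t n 0 = Inr (Inl (rep x))" by (simp add: stream_xact_def)
    then show False using u t0 by simp
  qed
  show "\<exists>w. \<forall>n. w n \<in> topspace Omega \<and> anchor universal_action (w n) = letter_anchor (a n) \<and>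
      (case a n of Inr (Inl x) \<Rightarrow> ranchor X x = anchor universal_action (w (Suc n)) \<and>
           w n = xact universal_action x (w (Suc n))
       | _ \<Rightarrow> w n \<notin> U.sact pts (topspace Omega))"
  proof (intro exI allI conjI)
    fix n
    show "w n \<in> topspace Omega" "anchor universal_action (w n) = letter_anchor (a n)" using w1 anc by auto
    from a show "case a n of Inr (Inl x) \<Rightarrow> ranchor X x = anchor universal_action (w (Suc n)) \<and>
           w n = xact universal_action x (w (Suc n))
       | _ \<Rightarrow> w n \<notin> U.sact pts (topspace Omega)"
      by (cases rule: streams_cases[of a R n]) (use pt[of n] stop[of n] in auto)
  qed
qed

lemma proper_universal_anchor: "proper_map Omega (obj G) (anchor universal_action)"
proof -
  have p: "proper_map U.cylinder_topology (obj G) (anchor universal_action)"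
    using U.proper_anchor[OF reg R universal_complete] .
  have id: "continuous_map U.cylinder_topology Omega (\<lambda>y. y)"
    unfolding continuous_map
  proof (intro conjI allI impI)
    fix V assume "openin Omega V"
    moreover from this have "{y \<in> topspace U.cylinder_topology. y \<in> V} = V"
      using openin_subset by fastforce
    ultimately show "openin U.cylinder_topology {y \<in> topspace U.cylinder_topology. y \<in> V}"
      using openin_Omega_cylinder by simp
  qed simp
  have "closedin U.cylinder_topology C" if "closedin Omega C" for C
    using that openin_Omega_cylinder unfolding closedin_def by simp
  then have "closed_map Omega (obj G) (anchor universal_action)"
    using p unfolding proper_map_def closed_map_def by blast
  moreover have "compactin Omega {y \<in> topspace Omega. anchor universal_action y = u}" if "u \<in> topspace (obj G)" for u
    using image_compactin[OF _ id, of "{y \<in> topspace Omega. anchor universal_action y = u}"] p that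
    unfolding proper_map_def by simp
  ultimately show ?thesis unfolding proper_map_def by blast
qed

text \<open>The map q from the objects of M to those of G is proper and continuous, and r is q after
  b. Composition with q preserves properness, and since the object space of M is Hausdorff,
  properness of the composite passes back to b.\<close>

lemma proper_map_iff:
  assumes AY: "continuous_map Z (obj M) b" "\<And>z. z \<in> topspace Z \<Longrightarrow> anchor universal_action (embed (b z)) = r z"
  shows "proper_map Z (obj M) b \<longleftrightarrow> proper_map Z (obj G) r"
proof -
  define q where "q = anchor universal_action \<circ> embed"
  have q: "proper_map (obj M) (obj G) q"
    unfolding q_def
    by (rule proper_map_compose[OF homeomorphic_imp_proper_map[OF homeomorphic_embed] proper_universal_anchor])
  have cq: "continuous_map (obj M) (obj G) q"
    unfolding q_def by (rule continuous_map_compose[OF continuous_embed U.action_parts(4)])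
  have e: "(q \<circ> b) z = r z" if "z \<in> topspace Z" for z using AY(2)[OF that] by (simp add: q_def)
  show ?thesis
  proof
    assume "proper_map Z (obj M) b"
    from proper_map_compose[OF this q] show "proper_map Z (obj G) r"
      by (rule proper_map_cong) (rule e)
  next
    assume "proper_map Z (obj G) r"
    then have "proper_map Z (obj G) (q \<circ> b)" by (rule proper_map_cong) (use e in \<open>simp add: o_def\<close>)
    then show "proper_map Z (obj M) b"
      using proper_map_from_composition_right[OF M.Hausdorff_obj _ AY(1) cq] by blast
  qed
qed

end

theorem theorem4p3:
  fixes G :: "'g groupoid" and H :: "'h groupoid" and M :: "'m groupoid"
    and X :: "('g, 'x) correspondence" and R :: "'g set"
    and \<Phi> :: "'h topology \<Rightarrow> ('g, 'x, 'h) corr_action \<Rightarrow> ('m, 'h) action"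
    and \<Psi> :: "('g, 'x, 'm) universe topology \<Rightarrow>
      ('g, 'x, ('g, 'x, 'm) universe) corr_action \<Rightarrow> ('m, ('g, 'x, 'm) universe) action"
  assumes "etale_groupoid G" and "etale_groupoid H"
    and "groupoid_correspondence G X"
    and "openin (obj G) R" and "invariant G R"
    and "regular_on G X R"
    and "groupoid_model G X R M \<Phi> \<Psi>"
  shows "bij_betw (\<lambda>B. bisection_map_of G X H (corr_action_of G X R \<Phi> (arr H) B)) (actors M H)
           {\<theta> \<in> bisection_maps G X R H. closure_condition G X H \<theta>} \<and>
         (\<forall>B\<in>actors M H.
            let A = corr_action_of G X R \<Phi> (arr H) B in
            \<exists>\<rho>. (\<forall>h\<in>topspace (arr H). anchor A h = \<rho> (rng H h)) \<and>
                induces_anchor G H (bisection_map_of G X H A) \<rho> \<and>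
                (proper_actor M H B \<longleftrightarrow> proper_map (obj H) (obj G) \<rho>)) \<and>
         (\<forall>\<theta>\<in>bisection_maps G X R H.
            (\<exists>\<rho>. induces_anchor G H \<theta> \<rho>) \<and>
            (\<forall>\<rho>. induces_anchor G H \<theta> \<rho> \<longrightarrow> proper_map (obj H) (obj G) \<rho> \<longrightarrow>
               closure_condition G X H \<theta>))"
proof -
  have model: "etale_groupoid M" "model_bijection G X R M \<Phi>" "model_bijection G X R M \<Psi>"
    "model_natural G X R M \<Phi> \<Phi>" "model_natural G X R M \<Phi> \<Psi>" "model_natural G X R M \<Psi> \<Psi>"
    using assms(7) unfolding groupoid_model_def by auto
  interpret S: model_setting G X H R M \<Phi>
    by (intro model_setting.intro bisection_setting.intro correspondence_setting.intro
        model_setting_axioms.intro assms model)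
  interpret U: universal_model G X M R \<Psi>
    by (intro universal_model.intro correspondence_setting.intro universal_model_axioms.intro assms model)
  have actor: "\<exists>\<rho>. (\<forall>h\<in>topspace (arr H). anchor (corr_action_of G X R \<Phi> (arr H) B) h = \<rho> (rng H h)) \<and>
      induces_anchor G H (bisection_map_of G X H (corr_action_of G X R \<Phi> (arr H) B)) \<rho> \<and>
      (proper_actor M H B \<longleftrightarrow> proper_map (obj H) (obj G) \<rho>)"
    if B: "B \<in> actors M H" for B
  proof (intro exI conjI ballI)
    let ?A = "corr_action_of G X R \<Phi> (arr H) B"
    interpret A: commuting_action G X H R ?A by (rule S.actor_commuting_action[OF B])
    have gB: "groupoid_action M (arr H) B" using B by (simp add: actors_def)
    have \<Phi>A: "\<Phi> (arr H) ?A = B" by (rule S.corr_action_of(2)[OF gB])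
    show "anchor ?A h = anchor ?A (rng H h)" if "h \<in> topspace (arr H)" for h
      using A.anchor_rng[OF that] by simp
    show "induces_anchor G H (bisection_map_of G X H ?A) (anchor ?A)" by (rule A.induces_anchor_th)
    note f = U.equivariant_to_Omega[OF gB]
    \<comment> \<open>This is where naturality between the two point types is used: it identifies
      the anchor map of the action on H with q after the anchor map of the actor.\<close>
    have "corr_equivariant G X (arr H) U.Omega ?A U.universal_action (\<lambda>y. U.embed (anchor B y))"
      using model(5)[unfolded model_natural_def, rule_format, OF A.action U.universal_action(1) f(1)] f(2)
      by (simp add: \<Phi>A U.universal_action(2))
    then have e: "anchor U.universal_action (U.embed (anchor B h)) = anchor ?A h" if "h \<in> topspace (arr H)" for h
      using that unfolding corr_equivariant_def equivariant_def by blast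
    have "continuous_map (arr H) (obj M) (anchor B)" using gB unfolding groupoid_action_def by blast
    then have "continuous_map (obj H) (obj M) (anchor B)"
      unfolding obj_def[of H] by (rule continuous_map_from_subtopology)
    then show "proper_actor M H B \<longleftrightarrow> proper_map (obj H) (obj G) (anchor ?A)"
      unfolding proper_actor_def by (rule U.proper_map_iff) (use e S.H.unit_closed in simp)
  qed
  have maps: "(\<exists>\<rho>. induces_anchor G H \<theta> \<rho>) \<and>
      (\<forall>\<rho>. induces_anchor G H \<theta> \<rho> \<longrightarrow> proper_map (obj H) (obj G) \<rho> \<longrightarrow> closure_condition G X H \<theta>)"
    if \<theta>: "\<theta> \<in> bisection_maps G X R H" for \<theta>
  proof -
    interpret T: bisection_map G X H R \<theta> by unfold_locales fact+
    show ?thesis using T.induces_anchor_rho T.closure_condition_if_proper by blast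
  qed
  show ?thesis
    unfolding Let_def using S.bij_betw_actors[OF assms(4)] actor maps by blast
qed

end
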